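(* Let $\xi_0,\xi_1,\ldots$ be i.i.d. real-valued random variables with $\mathbb{E}\,\xi_0=0$ and $\mathbb{E}[\xi_0^2]=1$, let $P_n(z)=\sum_{k=0}^\infty f_{n,k}\xi_k z^k$, $n\in\mathbb N$, where the coefficients $f_{n,k}$ are those of one of the four ensembles SP, FAF, HAF, WP listed in the context, and let $N_n[a,b]$ be the number of real zeroes of $P_n$ in $[a,b]$. For $[a,b]\subseteq\mathbb{R}\setminus\{0\}$ we have $$\lim_{n\to\infty}\frac{\mathbb{E}\,N_n[a,b]}{\sqrt n}=\begin{cases}\dfrac1\pi\displaystyle\int_a^b\frac{1}{1+t^2}\,dt & \text{in the SP case},\\[2mm] \dfrac{b-a}{\pi} & \text{in the FAF case}.\end{cases}$$ Furthermore, for $[a,b]\subset(-1,1)\setminus\{0\}$ we have $$\lim_{n\to\infty}\frac{\mathbb{E}\,N_n[a,b]}{\sqrt n}=\begin{cases}\dfrac1\pi\displaystyle\int_a^b\frac{1}{1-t^2}\,dt & \text{in the HAF case},\\[2mm] \dfrac{b-a}{\pi} & \text{in the WP case}.\end{cases}$$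
   Context: The four ensembles are given by the following coefficients ($n\in\mathbb{N}$, $k\in\mathbb{N}_0$): - SP (spherical polynomials): $f_{n,k}=\sqrt{\binom nk}$ for $k\le n$ and $f_{n,k}=0$ for $k>n$. - FAF (flat random analytic function): $f_{n,k}=\sqrt{n^k/k!}$. - HAF (hyperbolic random analytic function): $f_{n,k}=\sqrt{\binom{n+k-1}{k}}$. - WP (Weyl polynomials): $f_{n,k}=\sqrt{n^k/k!}$ for $k\le n$ and $f_{n,k}=0$ for $k>n$. In the SP and WP cases $P_n$ is a polynomial; with probability one $P_n$ is an entire function in the FAF case and is analytic on the open unit disk in the HAF case. $N_n[a,b]$ denotes the number of points $x\in[a,b]$ with $P_n(x)=0$; on the event that $P_n$ vanishes identically, set $N_n[a,b]=0$. *)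

theory Defs
  imports "HOL-Probability.Probability"
begin

datatype ensemble =
    SP   (* spherical polynomials *)
  | FAF  (* flat random analytic function *)
  | HAF  (* hyperbolic random analytic function *)
  | WP   (* Weyl polynomials *)

fun ens_coeff :: "ensemble \<Rightarrow> nat \<Rightarrow> nat \<Rightarrow> real" where
  "ens_coeff SP n k = (if k \<le> n then sqrt (real (n choose k)) else 0)"
| "ens_coeff FAF n k = sqrt (real n ^ k / fact k)"
| "ens_coeff HAF n k = sqrt (real ((n + k - 1) choose k))"
| "ens_coeff WP n k = (if k \<le> n then sqrt (real n ^ k / fact k) else 0)"

text \<open>
  The region on which the random series almost surely defines an analytic function.
\<close>

fun ens_domain :: "ensemble \<Rightarrow> complex set" where
  "ens_domain HAF = ball 0 1"
| "ens_domain SP = UNIV"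
| "ens_domain FAF = UNIV"
| "ens_domain WP = UNIV"

text \<open>
  On the null event where the series diverges at some point of the region, the values of
  \<open>suminf\<close> there are junk. This has no effect on expectations, which are taken with
  \<open>nn_integral\<close> and depend on the integrand only up to null sets.
\<close>

definition random_fun ::
  "ensemble \<Rightarrow> (nat \<Rightarrow> 'w \<Rightarrow> real) \<Rightarrow> nat \<Rightarrow> 'w \<Rightarrow> complex \<Rightarrow> complex" where
  "random_fun E \<xi> n \<omega> z = (\<Sum>k. complex_of_real (ens_coeff E n k * \<xi> k \<omega>) * z ^ k)"

text \<open>
  Zeros are counted without multiplicity. Counting measure is used instead of \<open>card\<close>, which
  would send an infinite zero set to 0.
\<close>

definition num_real_zeros ::
  "ensemble \<Rightarrow> (nat \<Rightarrow> 'w \<Rightarrow> real) \<Rightarrow> nat \<Rightarrow> real \<Rightarrow> real \<Rightarrow> 'w \<Rightarrow> ennreal" where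
  "num_real_zeros E \<xi> n a b \<omega> =
     (if \<forall>z\<in>ens_domain E. random_fun E \<xi> n \<omega> z = 0 then 0
      else emeasure (count_space UNIV)
             {x \<in> {a..b}. random_fun E \<xi> n \<omega> (complex_of_real x) = 0})"

definition expected_real_zeros ::
  "'w measure \<Rightarrow> ensemble \<Rightarrow> (nat \<Rightarrow> 'w \<Rightarrow> real) \<Rightarrow> nat \<Rightarrow> real \<Rightarrow> real \<Rightarrow> ennreal" where
  "expected_real_zeros M E \<xi> n a b = (\<integral>\<^sup>+ \<omega>. num_real_zeros E \<xi> n a b \<omega> \<partial>M)"

end

theory Submission
  imports Defs "HOL-Complex_Analysis.Complex_Analysis" "HOL-Real_Asymp.Real_Asymp"
begin

text \<open>
  Substitute \<open>x = \<plusminus> exp \<tau>\<close>. The normalised process in \<open>\<tau>\<close> has correlation about \<open>exp (- (s * D \<tau>)\<^sup>2 / 2)\<close>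
  at lag \<open>s / sqrt n\<close>, where \<open>D \<tau> = exp \<tau> / (1 - \<sigma> * exp (2 * \<tau>))\<close>. The squared coefficients are unimodal and
  flat near their mode, so pairs of values satisfy a central limit theorem, uniformly in \<open>\<tau>\<close>, and the
  probability of a sign change between neighbours of a grid of mesh \<open>s / sqrt n\<close> is close to \<open>s * D \<tau> / pi\<close>.
  Summing over the grid gives a Riemann sum for \<open>sqrt n / pi\<close> times the integral of \<open>D\<close>, and this bounds the number
  of zeros from below.

  For the upper bound, a Blaschke factor estimate shows that each further zero in a grid cell makes the value at
  the left endpoint smaller by a factor \<open>s\<close> compared to the local size of the process. Anti-concentration
  makes this contribute \<open>o(s)\<close> per cell. Cells with more than about \<open>n powr (1/4)\<close> zeros are so improbable that a
  linear bound on the number of zeros suffices: the degree for polynomials, and otherwise a Jensen-type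
  bound based on the first coefficient with \<open>\<bar>\<xi> k\<bar> \<ge> 1/2\<close>.
\<close>

section \<open>Linear forms in i.i.d. variables\<close>

text \<open>Only two moments are given and the law of \<open>\<xi> 0\<close> may have atoms, so the
  normal approximation comes without a rate and cannot reach events whose size shrinks with
  \<open>n\<close>. Small values are therefore estimated from the decay of the characteristic
  function, down to the scale \<open>exp (- (n powr (3/10)))\<close>. Three exponents have to fit
  together. Runs of \<open>J = n powr (1/4)\<close> consecutive weights of comparable size must
  exist throughout a window of length about \<open>L = n powr (2/3)\<close> beyond the mode, which
  requires \<open>J * L\<close> to be small against \<open>n\<close>. Across this window the weights
  fall below \<open>exp (- const * n powr (1/3))\<close>. Finally \<open>1/3 > 3/10 > 1/4\<close>,
  so frequencies up to \<open>exp (n powr (3/10))\<close> are controlled and outweigh the factor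
  \<open>v powr (2 * n powr (1/4))\<close> coming from \<open>n powr (1/4)\<close> zeros. The mesh
  is \<open>s = v ^ 3\<close> because \<open>m\<close> zeros bound the square of the value by
  \<open>s ^ (2 * m) = v ^ (6 * m)\<close> times a random constant; allowing
  \<open>v ^ (4 * m)\<close> for the square and \<open>v ^ (- 2 * m)\<close> for the constant gives
  probability of order \<open>v ^ (2 * m)\<close>, which for \<open>m = 2\<close> is
  \<open>v * s = o(s)\<close>.\<close>

locale iid_std = prob_space M for M :: "'w measure" +
  fixes \<xi> :: "nat \<Rightarrow> 'w \<Rightarrow> real"
  assumes indep: "indep_vars (\<lambda>_. borel) \<xi> UNIV"
    and distr_eq: "distr M borel (\<xi> k) = distr M borel (\<xi> 0)"
    and mean_zero: "expectation (\<xi> 0) = 0"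
    and sq_integrable: "integrable M (\<lambda>\<omega>. (\<xi> 0 \<omega>)\<^sup>2)"
    and sq_mean: "expectation (\<lambda>\<omega>. (\<xi> 0 \<omega>)\<^sup>2) = 1"
begin

section \<open>Moments and orthonormality of the variables\<close>

lemma xi_measurable [measurable]: "\<xi> k \<in> borel_measurable M"
  using indep unfolding indep_vars_def2 by simp

lemma xi_integrable_iff:
  fixes g :: "real \<Rightarrow> real"
  assumes [measurable]: "g \<in> borel_measurable borel"
  shows "integrable M (\<lambda>\<omega>. g (\<xi> k \<omega>)) \<longleftrightarrow> integrable M (\<lambda>\<omega>. g (\<xi> 0 \<omega>))"
proof -
  have "integrable M (\<lambda>\<omega>. g (\<xi> k \<omega>)) \<longleftrightarrow> integrable (distr M borel (\<xi> k)) g"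
    by (subst integrable_distr_eq) auto
  also have "\<dots> \<longleftrightarrow> integrable M (\<lambda>\<omega>. g (\<xi> 0 \<omega>))"
    unfolding distr_eq[of k] by (subst integrable_distr_eq) auto
  finally show ?thesis .
qed

lemma xi_expectation:
  fixes g :: "real \<Rightarrow> real"
  assumes [measurable]: "g \<in> borel_measurable borel"
  shows "expectation (\<lambda>\<omega>. g (\<xi> k \<omega>)) = expectation (\<lambda>\<omega>. g (\<xi> 0 \<omega>))"
proof -
  have "expectation (\<lambda>\<omega>. g (\<xi> k \<omega>)) = integral\<^sup>L (distr M borel (\<xi> k)) g"
    by (subst integral_distr) auto
  also have "\<dots> = expectation (\<lambda>\<omega>. g (\<xi> 0 \<omega>))"
    unfolding distr_eq[of k] by (subst integral_distr) auto
  finally show ?thesis .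
qed

lemma xi_sq_integrable [simp]: "integrable M (\<lambda>\<omega>. (\<xi> k \<omega>)\<^sup>2)"
  using xi_integrable_iff[of "\<lambda>x. x\<^sup>2" k] sq_integrable by simp

lemma xi_integrable [simp]: "integrable M (\<xi> k)"
  by (rule square_integrable_imp_integrable[OF _ xi_sq_integrable]) simp_all

lemma xi_mean [simp]: "expectation (\<xi> k) = 0"
  using xi_expectation[of "\<lambda>x. x" k] mean_zero by simp

lemma xi_sq_mean [simp]: "expectation (\<lambda>\<omega>. (\<xi> k \<omega>)\<^sup>2) = 1"
  using xi_expectation[of "\<lambda>x. x\<^sup>2" k] sq_mean by simp

lemma xi_abs_mean_le: "(\<integral>\<^sup>+\<omega>. ennreal \<bar>\<xi> k \<omega>\<bar> \<partial>M) \<le> 1"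
proof -
  have "(\<integral>\<^sup>+\<omega>. ennreal \<bar>\<xi> k \<omega>\<bar> \<partial>M) \<le> (\<integral>\<^sup>+\<omega>. ennreal ((1 + (\<xi> k \<omega>)\<^sup>2) / 2) \<partial>M)"
  proof (intro nn_integral_mono ennreal_leI)
    fix \<omega>
    show "\<bar>\<xi> k \<omega>\<bar> \<le> (1 + (\<xi> k \<omega>)\<^sup>2) / 2"
      using zero_le_power2[of "\<bar>\<xi> k \<omega>\<bar> - 1"] by (simp add: power2_diff)
  qed
  also have "\<dots> = ennreal (expectation (\<lambda>\<omega>. (1 + (\<xi> k \<omega>)\<^sup>2) / 2))"
    by (intro nn_integral_eq_integral) auto
  also have "\<dots> = 1" by (simp add: prob_space)
  finally show ?thesis .
qed

lemma xi_prod_integrable: "integrable M (\<lambda>\<omega>. \<xi> j \<omega> * \<xi> k \<omega>)"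
proof (rule Bochner_Integration.integrable_bound[of M "\<lambda>\<omega>. (\<xi> j \<omega>)\<^sup>2 + (\<xi> k \<omega>)\<^sup>2"])
  show "AE \<omega> in M. norm (\<xi> j \<omega> * \<xi> k \<omega>) \<le> norm ((\<xi> j \<omega>)\<^sup>2 + (\<xi> k \<omega>)\<^sup>2)"
  proof (rule AE_I2)
    fix \<omega>
    have "2 * (\<bar>\<xi> j \<omega>\<bar> * \<bar>\<xi> k \<omega>\<bar>) \<le> (\<xi> j \<omega>)\<^sup>2 + (\<xi> k \<omega>)\<^sup>2"
      using zero_le_power2[of "\<bar>\<xi> j \<omega>\<bar> - \<bar>\<xi> k \<omega>\<bar>"] by (simp add: power2_diff)
    moreover have "0 \<le> \<bar>\<xi> j \<omega>\<bar> * \<bar>\<xi> k \<omega>\<bar>" by simp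
    ultimately have "\<bar>\<xi> j \<omega>\<bar> * \<bar>\<xi> k \<omega>\<bar> \<le> (\<xi> j \<omega>)\<^sup>2 + (\<xi> k \<omega>)\<^sup>2"
      by linarith
    then show "norm (\<xi> j \<omega> * \<xi> k \<omega>) \<le> norm ((\<xi> j \<omega>)\<^sup>2 + (\<xi> k \<omega>)\<^sup>2)"
      by (simp add: abs_mult)
  qed
qed auto

lemma xi_orthonormal: "expectation (\<lambda>\<omega>. \<xi> j \<omega> * \<xi> k \<omega>) = (if j = k then 1 else 0)"
proof (cases "j = k")
  case True
  then show ?thesis using xi_sq_mean[of k] by (simp add: power2_eq_square)
next
  case False
  have "expectation (\<lambda>\<omega>. \<Prod>i\<in>{j, k}. \<xi> i \<omega>) = (\<Prod>i\<in>{j, k}. expectation (\<xi> i))"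
    by (rule indep_vars_lebesgue_integral[OF _ indep_vars_subset[OF indep]]) auto
  then show ?thesis
    using False by simp
qed

section \<open>Random series with absolutely summable coefficients\<close>

definition rs :: "(nat \<Rightarrow> real) \<Rightarrow> 'w \<Rightarrow> real" where
  "rs a \<omega> = (\<Sum>k. a k * \<xi> k \<omega>)"

lemma rs_measurable [measurable]: "rs a \<in> borel_measurable M"
  unfolding rs_def by measurable

text \<open>First absolute moments are at most 1, so the expected sum of absolute values is finite.
  Absolute summability of the coefficients thus replaces a convergence theorem for independent sums;
  where the series diverges, \<open>rs\<close> is an arbitrary value of
  \<open>suminf\<close>.\<close>

lemma AE_summable:
  assumes "summable (\<lambda>k. \<bar>a k\<bar>)"
  shows "AE \<omega> in M. summable (\<lambda>k. \<bar>a k * \<xi> k \<omega>\<bar>)"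
proof -
  have "(\<integral>\<^sup>+\<omega>. (\<Sum>k. ennreal \<bar>a k * \<xi> k \<omega>\<bar>) \<partial>M) = (\<Sum>k. \<integral>\<^sup>+\<omega>. ennreal \<bar>a k * \<xi> k \<omega>\<bar> \<partial>M)"
    by (intro nn_integral_suminf) measurable
  also have "\<dots> \<le> (\<Sum>k. ennreal \<bar>a k\<bar>)"
  proof (intro suminf_le)
    fix k
    have "(\<integral>\<^sup>+\<omega>. ennreal \<bar>a k * \<xi> k \<omega>\<bar> \<partial>M) = ennreal \<bar>a k\<bar> * (\<integral>\<^sup>+\<omega>. ennreal \<bar>\<xi> k \<omega>\<bar> \<partial>M)"
      by (subst nn_integral_cmult[symmetric]) (auto simp: abs_mult ennreal_mult)
    also have "\<dots> \<le> ennreal \<bar>a k\<bar> * 1"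
      by (intro mult_left_mono xi_abs_mean_le) auto
    finally show "(\<integral>\<^sup>+\<omega>. ennreal \<bar>a k * \<xi> k \<omega>\<bar> \<partial>M) \<le> ennreal \<bar>a k\<bar>" by simp
  qed auto
  also have "\<dots> = ennreal (\<Sum>k. \<bar>a k\<bar>)"
    by (intro suminf_ennreal2 assms) auto
  finally have "(\<integral>\<^sup>+\<omega>. (\<Sum>k. ennreal \<bar>a k * \<xi> k \<omega>\<bar>) \<partial>M) \<noteq> \<infinity>"
    by (metis ennreal_less_top infinity_ennreal_def leD)
  then have "AE \<omega> in M. (\<Sum>k. ennreal \<bar>a k * \<xi> k \<omega>\<bar>) \<noteq> \<infinity>"
    by (intro nn_integral_PInf_AE) measurable
  then show ?thesis
    by eventually_elim (rule summable_suminf_not_top, auto)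
qed

lemma rs_sums:
  assumes "summable (\<lambda>k. \<bar>a k\<bar>)"
  shows "AE \<omega> in M. (\<lambda>k. a k * \<xi> k \<omega>) sums rs a \<omega>"
  using AE_summable[OF assms]
proof eventually_elim
  case (elim \<omega>)
  then have "summable (\<lambda>k. a k * \<xi> k \<omega>)" by (rule summable_rabs_cancel)
  then show ?case unfolding rs_def by (rule summable_sums)
qed

lemma expectation_partial_sq:
  "expectation (\<lambda>\<omega>. (\<Sum>k<K. a k * \<xi> k \<omega>)\<^sup>2) = (\<Sum>k<K. (a k)\<^sup>2)"
  "integrable M (\<lambda>\<omega>. (\<Sum>k<K. a k * \<xi> k \<omega>)\<^sup>2)"
proof -
  have eq: "(\<Sum>k<K. a k * \<xi> k \<omega>)\<^sup>2 = (\<Sum>j<K. \<Sum>k<K. a j * a k * (\<xi> j \<omega> * \<xi> k \<omega>))" for \<omega>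
    by (simp add: power2_eq_square sum_product mult_ac)
  show "integrable M (\<lambda>\<omega>. (\<Sum>k<K. a k * \<xi> k \<omega>)\<^sup>2)"
    unfolding eq by (intro Bochner_Integration.integrable_sum integrable_mult_right xi_prod_integrable)
  have "expectation (\<lambda>\<omega>. (\<Sum>k<K. a k * \<xi> k \<omega>)\<^sup>2) =
      (\<Sum>j<K. \<Sum>k<K. a j * a k * expectation (\<lambda>\<omega>. \<xi> j \<omega> * \<xi> k \<omega>))"
    unfolding eq
    by (simp add: Bochner_Integration.integral_sum Bochner_Integration.integrable_sum xi_prod_integrable)
  also have "\<dots> = (\<Sum>k<K. (a k)\<^sup>2)"
    by (simp add: xi_orthonormal power2_eq_square if_distrib cong: if_cong)
  finally show "expectation (\<lambda>\<omega>. (\<Sum>k<K. a k * \<xi> k \<omega>)\<^sup>2) = (\<Sum>k<K. (a k)\<^sup>2)" .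
qed

lemma summable_sq:
  fixes a :: "nat \<Rightarrow> real"
  assumes "summable (\<lambda>k. \<bar>a k\<bar>)"
  shows "summable (\<lambda>k. (a k)\<^sup>2)"
proof (rule summable_comparison_test_ev[OF _ assms])
  have "(\<lambda>k. \<bar>a k\<bar>) \<longlonglongrightarrow> 0" using assms by (rule summable_LIMSEQ_zero)
  then have "eventually (\<lambda>k. \<bar>a k\<bar> < 1) sequentially"
    by (rule order_tendstoD) simp
  then show "eventually (\<lambda>k. norm ((a k)\<^sup>2) \<le> \<bar>a k\<bar>) sequentially"
  proof eventually_elim
    case (elim k)
    then have "\<bar>a k\<bar> * \<bar>a k\<bar> \<le> \<bar>a k\<bar> * 1" by (intro mult_left_mono) auto
    then show ?case by (simp add: power2_eq_square abs_mult)
  qed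
qed

text \<open>Fatou's lemma along the partial sums, whose second moments are explicit by
  orthonormality.\<close>

lemma rs_sq_le:
  assumes "summable (\<lambda>k. \<bar>a k\<bar>)"
  shows "(\<integral>\<^sup>+\<omega>. ennreal ((rs a \<omega>)\<^sup>2) \<partial>M) \<le> ennreal (\<Sum>k. (a k)\<^sup>2)"
proof -
  have "(\<integral>\<^sup>+\<omega>. ennreal ((rs a \<omega>)\<^sup>2) \<partial>M)
      = (\<integral>\<^sup>+\<omega>. liminf (\<lambda>K. ennreal ((\<Sum>k<K. a k * \<xi> k \<omega>)\<^sup>2)) \<partial>M)"
  proof (rule nn_integral_cong_AE)
    show "AE \<omega> in M. ennreal ((rs a \<omega>)\<^sup>2) = liminf (\<lambda>K. ennreal ((\<Sum>k<K. a k * \<xi> k \<omega>)\<^sup>2))"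
      using rs_sums[OF assms]
    proof eventually_elim
      case (elim \<omega>)
      then have "(\<lambda>K. ennreal ((\<Sum>k<K. a k * \<xi> k \<omega>)\<^sup>2)) \<longlonglongrightarrow> ennreal ((rs a \<omega>)\<^sup>2)"
        unfolding sums_def by (intro tendsto_ennrealI tendsto_power)
      then show ?case by (rule lim_imp_Liminf[OF sequentially_bot, symmetric])
    qed
  qed
  also have "\<dots> \<le> liminf (\<lambda>K. \<integral>\<^sup>+\<omega>. ennreal ((\<Sum>k<K. a k * \<xi> k \<omega>)\<^sup>2) \<partial>M)"
    by (intro nn_integral_liminf) measurable
  also have "\<dots> = liminf (\<lambda>K. ennreal (\<Sum>k<K. (a k)\<^sup>2))"
    by (subst nn_integral_eq_integral) (auto simp: expectation_partial_sq)
  also have "(\<lambda>K. ennreal (\<Sum>k<K. (a k)\<^sup>2)) \<longlonglongrightarrow> ennreal (\<Sum>k. (a k)\<^sup>2)"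
    using summable_sq[OF assms] by (intro tendsto_ennrealI) (simp add: summable_LIMSEQ)
  then have "liminf (\<lambda>K. ennreal (\<Sum>k<K. (a k)\<^sup>2)) = ennreal (\<Sum>k. (a k)\<^sup>2)"
    by (rule lim_imp_Liminf[OF sequentially_bot])
  finally show ?thesis .
qed

section \<open>Characteristic functions of linear forms\<close>

definition \<phi> :: "real \<Rightarrow> complex" where "\<phi> = char (distr M borel (\<xi> 0))"

definition cf :: "(nat \<Rightarrow> real) \<Rightarrow> complex" where
  "cf a = (CLINT \<omega>|M. iexp (rs a \<omega>))"

lemma char_scaled: "char (distr M borel (\<lambda>\<omega>. c * \<xi> k \<omega>)) 1 = \<phi> c"
proof -
  have "char (distr M borel (\<lambda>\<omega>. c * \<xi> k \<omega>)) 1 = (CLINT \<omega>|M. iexp (c * \<xi> k \<omega>))"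
    unfolding char_def by (subst integral_distr) auto
  also have "\<dots> = char (distr M borel (\<xi> k)) c"
    unfolding char_def by (subst integral_distr) auto
  finally show ?thesis unfolding \<phi>_def distr_eq[of k] .
qed

text \<open>Independence factorises the partial sums, and dominated convergence with bound 1 passes
  to the series.\<close>

lemma cf_prod:
  assumes "summable (\<lambda>k. \<bar>a k\<bar>)"
  shows "(\<lambda>K. \<Prod>k<K. \<phi> (a k)) \<longlonglongrightarrow> cf a"
proof -
  have "(CLINT \<omega>|M. iexp (\<Sum>k<K. a k * \<xi> k \<omega>)) = (\<Prod>k<K. \<phi> (a k))" for K
  proof -
    have "(CLINT \<omega>|M. iexp (\<Sum>k<K. a k * \<xi> k \<omega>)) = char (distr M borel (\<lambda>\<omega>. \<Sum>k\<in>{..<K}. a k * \<xi> k \<omega>)) 1"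
      unfolding char_def by (subst integral_distr) auto
    also have "\<dots> = (\<Prod>k<K. char (distr M borel (\<lambda>\<omega>. a k * \<xi> k \<omega>)) 1)"
    proof (rule char_distr_sum)
      show "indep_vars (\<lambda>i. borel) (\<lambda>k \<omega>. a k * \<xi> k \<omega>) {..<K}"
        by (rule indep_vars_compose2[where X=\<xi>], rule indep_vars_subset[OF indep]) auto
    qed
    finally show ?thesis by (simp add: char_scaled)
  qed
  moreover have "(\<lambda>K. CLINT \<omega>|M. iexp (\<Sum>k<K. a k * \<xi> k \<omega>)) \<longlonglongrightarrow> cf a"
    unfolding cf_def
  proof (rule integral_dominated_convergence[where w="\<lambda>_. 1"])
    show "AE \<omega> in M. (\<lambda>K. iexp (\<Sum>k<K. a k * \<xi> k \<omega>)) \<longlonglongrightarrow> iexp (rs a \<omega>)"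
      using rs_sums[OF assms] unfolding sums_def
      by eventually_elim (intro tendsto_intros)
  qed auto
  ultimately show ?thesis by simp
qed

lemma norm_phi_le_1: "norm (\<phi> t) \<le> 1"
  unfolding \<phi>_def by (rule real_distribution.cmod_char_le_1[OF real_distribution_distr]) simp

text \<open>Taylor expansion to second order with remainder \<open>o(u\<^sup>2)\<close>. The usual
  cubic remainder is truncated at \<open>6 * x\<^sup>2\<close>, which is integrable, and its mean
  tends to 0 by dominated convergence.\<close>

lemma phi_approx:
  assumes "\<epsilon> > 0"
  shows "\<exists>\<eta>>0. \<forall>u. \<bar>u\<bar> \<le> \<eta> \<longrightarrow> norm (\<phi> u - (1 - u\<^sup>2 / 2)) \<le> \<epsilon> * u\<^sup>2"
proof -
  interpret \<mu>: real_distribution "distr M borel (\<xi> 0)" by (rule real_distribution_distr) simp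
  have int: "integrable (distr M borel (\<xi> 0)) (\<lambda>x. x)"
    using xi_integrable[of 0] by (subst integrable_distr_eq) auto
  have int2: "integrable (distr M borel (\<xi> 0)) (\<lambda>x. x\<^sup>2)"
    using xi_sq_integrable[of 0] by (subst integrable_distr_eq) auto
  have ev: "\<mu>.expectation (\<lambda>x. x) = 0"
    using xi_mean[of 0] by (subst integral_distr) auto
  have ev2: "\<mu>.expectation (\<lambda>x. x\<^sup>2) = 1"
    using xi_sq_mean[of 0] by (subst integral_distr) auto
  define h where "h t = (LINT x|distr M borel (\<xi> 0). min (6 * x\<^sup>2) (\<bar>t\<bar> * \<bar>x\<bar> ^ 3))" for t :: real
  have bound: "norm (\<phi> t - (1 - t\<^sup>2 * 1 / 2)) \<le> (t\<^sup>2 / 6) * h t" for t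
    unfolding \<phi>_def h_def using \<mu>.char_approx3[OF int ev int2, of 1 t] by (simp add: ev ev2)
  have hlim: "(\<lambda>n. h (1 / Suc n)) \<longlonglongrightarrow> (LINT x|distr M borel (\<xi> 0). 0)"
    unfolding h_def
  proof (rule integral_dominated_convergence[where w="\<lambda>x. 6 * x^2"])
    show "AE x in distr M borel (\<xi> 0). (\<lambda>n. min (6 * x\<^sup>2) (\<bar>1 / real (Suc n)\<bar> * \<bar>x\<bar> ^ 3)) \<longlonglongrightarrow> 0"
    proof (rule AE_I2)
      fix x :: real
      have "(\<lambda>n. 1 / real (Suc n) * \<bar>x\<bar> ^ 3) \<longlonglongrightarrow> 0 * \<bar>x\<bar> ^ 3"
        by (intro tendsto_intros) (rule LIMSEQ_Suc[OF lim_1_over_n])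
      then have "(\<lambda>n. min (6 * x\<^sup>2) (1 / real (Suc n) * \<bar>x\<bar> ^ 3)) \<longlonglongrightarrow> min (6 * x\<^sup>2) (0 * \<bar>x\<bar> ^ 3)"
        by (intro tendsto_min tendsto_const)
      then show "(\<lambda>n. min (6 * x\<^sup>2) (\<bar>1 / real (Suc n)\<bar> * \<bar>x\<bar> ^ 3)) \<longlonglongrightarrow> 0" by simp
    qed
  qed (use int2 in auto)
  have "eventually (\<lambda>n. h (1 / Suc n) < 6 * \<epsilon>) sequentially"
    using order_tendstoD(2)[OF hlim] assms by simp
  then obtain n where n: "h (1 / Suc n) < 6 * \<epsilon>" by (auto simp: eventually_sequentially)
  \<comment> \<open>\<open>h\<close> is monotone in \<open>\<bar>t\<bar>\<close>, so its smallness
    along the sequence \<open>1 / Suc n\<close> extends to a whole neighbourhood of 0.\<close>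
  have mono: "h u \<le> h (1 / Suc n)" if "\<bar>u\<bar> \<le> 1 / Suc n" for u
    unfolding h_def
  proof (rule integral_mono)
    have i: "integrable (distr M borel (\<xi> 0)) (\<lambda>x. min (6 * x\<^sup>2) (\<bar>t\<bar> * \<bar>x\<bar> ^ 3))" for t
      by (rule Bochner_Integration.integrable_bound[of _ "\<lambda>x. 6 * x\<^sup>2"]) (use int2 in auto)
    show "integrable (distr M borel (\<xi> 0)) (\<lambda>x. min (6 * x\<^sup>2) (\<bar>u\<bar> * \<bar>x\<bar> ^ 3))"
      "integrable (distr M borel (\<xi> 0)) (\<lambda>x. min (6 * x\<^sup>2) (\<bar>1 / real (Suc n)\<bar> * \<bar>x\<bar> ^ 3))"
      by (rule i)+
    fix x :: real
    show "min (6 * x\<^sup>2) (\<bar>u\<bar> * \<bar>x\<bar> ^ 3) \<le> min (6 * x\<^sup>2) (\<bar>1 / real (Suc n)\<bar> * \<bar>x\<bar> ^ 3)"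
      using that by (intro min.mono mult_right_mono) auto
  qed
  show ?thesis
  proof (intro exI[of _ "1 / Suc n"] conjI allI impI)
    fix u :: real assume u: "\<bar>u\<bar> \<le> 1 / Suc n"
    have "norm (\<phi> u - (1 - u\<^sup>2 / 2)) \<le> (u\<^sup>2 / 6) * h u" using bound[of u] by simp
    also have "\<dots> \<le> (u\<^sup>2 / 6) * (6 * \<epsilon>)" using mono[OF u] n by (intro mult_left_mono) auto
    finally show "norm (\<phi> u - (1 - u\<^sup>2 / 2)) \<le> \<epsilon> * u\<^sup>2" by (simp add: mult.commute)
  qed simp
qed

end

context iid_std
begin

text \<open>With error at most \<open>u\<^sup>2 / 4\<close>, \<open>norm (\<phi> u)\<close> is at
  most \<open>1 - u\<^sup>2 / 4\<close>; the cap at 1 on the radius keeps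
  \<open>1 - u\<^sup>2 / 2\<close> nonnegative.\<close>

lemma phi_decay: "\<exists>c>0. \<forall>u. \<bar>u\<bar> \<le> c \<longrightarrow> norm (\<phi> u) \<le> exp (- u\<^sup>2 / 4)"
proof -
  obtain \<eta> where \<eta>: "\<eta> > 0" "\<And>u. \<bar>u\<bar> \<le> \<eta> \<Longrightarrow> norm (\<phi> u - (1 - u\<^sup>2 / 2)) \<le> 1/4 * u\<^sup>2"
    using phi_approx[of "1/4"] by auto
  show ?thesis
  proof (intro exI[of _ "min \<eta> 1"] conjI allI impI)
    fix u assume u: "\<bar>u\<bar> \<le> min \<eta> 1"
    then have u1: "u\<^sup>2 \<le> 1" by (simp add: abs_square_le_1)
    have "norm (\<phi> u) \<le> norm (\<phi> u - (1 - u\<^sup>2 / 2)) + norm (complex_of_real (1 - u\<^sup>2 / 2))"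
      using norm_triangle_ineq[of "\<phi> u - (1 - u\<^sup>2 / 2)" "complex_of_real (1 - u\<^sup>2 / 2)"] by simp
    also have "norm (complex_of_real (1 - u\<^sup>2 / 2)) = 1 - u\<^sup>2 / 2"
      unfolding norm_of_real using u1 by simp
    also have "norm (\<phi> u - (1 - u\<^sup>2 / 2)) + (1 - u\<^sup>2 / 2) \<le> 1 + (- u\<^sup>2 / 4)"
      using \<eta>(2)[of u] u by simp
    also have "\<dots> \<le> exp (- u\<^sup>2 / 4)" by (rule exp_ge_add_one_self)
    finally show "norm (\<phi> u) \<le> exp (- u\<^sup>2 / 4)" .
  qed (use \<eta> in auto)
qed

text \<open>Factors with index in \<open>F\<close> get the Gaussian bound and all others the trivial
  bound 1. A set \<open>F\<close> of moderately small coefficients therefore suffices; large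
  coefficients elsewhere do no harm.\<close>

lemma cf_norm_le:
  assumes a: "summable (\<lambda>k. \<bar>a k\<bar>)" and c: "\<And>u. \<bar>u\<bar> \<le> c \<Longrightarrow> norm (\<phi> u) \<le> exp (- u\<^sup>2 / 4)"
    and F: "finite F" "\<And>k. k \<in> F \<Longrightarrow> \<bar>a k\<bar> \<le> c"
  shows "norm (cf a) \<le> exp (- (\<Sum>k\<in>F. (a k)\<^sup>2) / 4)"
proof (rule tendsto_upperbound[OF tendsto_norm[OF cf_prod[OF a]]])
  obtain K0 where K0: "F \<subseteq> {..<K0}"
    using F(1) finite_nat_iff_bounded by blast
  show "eventually (\<lambda>K. norm (\<Prod>k<K. \<phi> (a k)) \<le> exp (- (\<Sum>k\<in>F. (a k)\<^sup>2) / 4)) sequentially"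
  proof (rule eventually_sequentiallyI)
    fix K assume "K0 \<le> K"
    then have FK: "F \<subseteq> {..<K}" using K0 by auto
    have "norm (\<Prod>k<K. \<phi> (a k)) = (\<Prod>k<K. norm (\<phi> (a k)))"
      by (rule prod_norm[symmetric])
    also have "\<dots> \<le> (\<Prod>k<K. if k \<in> F then exp (- (a k)\<^sup>2 / 4) else 1)"
      using c[OF F(2)] norm_phi_le_1 by (intro prod_mono) auto
    also have "\<dots> = (\<Prod>k\<in>F. exp (- (a k)\<^sup>2 / 4))"
      using FK by (subst prod.If_cases) (auto simp: Int_absorb1)
    also have "\<dots> = exp (- (\<Sum>k\<in>F. (a k)\<^sup>2) / 4)"
      using F(1) by (simp add: exp_sum[symmetric] sum_divide_distrib sum_negf[symmetric])
    finally show "norm (\<Prod>k<K. \<phi> (a k)) \<le> exp (- (\<Sum>k\<in>F. (a k)\<^sup>2) / 4)" .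
  qed
qed simp

lemma cf_scaled:
  assumes "summable (\<lambda>k. \<bar>a k\<bar>)"
  shows "cf (\<lambda>k. t * a k) = (CLINT \<omega>|M. iexp (t * rs a \<omega>))"
  unfolding cf_def
proof (rule integral_cong_AE)
  show "AE \<omega> in M. iexp (rs (\<lambda>k. t * a k) \<omega>) = iexp (t * rs a \<omega>)"
    using rs_sums[OF assms]
  proof eventually_elim
    case (elim \<omega>)
    have "rs (\<lambda>k. t * a k) \<omega> = t * rs a \<omega>"
      using sums_unique[OF sums_mult[OF elim, of t]] by (simp add: rs_def mult_ac)
    then show ?case by simp
  qed
qed measurable

section \<open>Anti-concentration from decay of characteristic functions\<close>

lemma prob_space_std_normal: "prob_space std_normal_distribution"
  by (rule prob_space_normal_density) simp

text \<open>A Gaussian function of \<open>rs a\<close> is the average of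
  \<open>iexp (g / l * rs a)\<close> over a standard normal frequency \<open>g\<close>. Fubini then
  expresses the smoothed small-ball probability through \<open>cf\<close> without any inversion
  formula.\<close>

lemma expectation_gauss_eq:
  assumes a: "summable (\<lambda>k. \<bar>a k\<bar>)"
  shows "complex_of_real (expectation (\<lambda>\<omega>. exp (- (rs a \<omega>)\<^sup>2 / (2 * l\<^sup>2))))
     = (CLINT g|std_normal_distribution. cf (\<lambda>k. (g / l) * a k))"
proof -
  interpret N: prob_space std_normal_distribution by (rule prob_space_std_normal)
  interpret P: pair_prob_space M std_normal_distribution ..
  have "complex_of_real (expectation (\<lambda>\<omega>. exp (- (rs a \<omega>)\<^sup>2 / (2 * l\<^sup>2))))
      = (CLINT \<omega>|M. complex_of_real (exp (- (rs a \<omega>)\<^sup>2 / (2 * l\<^sup>2))))"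
    by (rule integral_complex_of_real[symmetric])
  also have "\<dots> = (CLINT \<omega>|M. char std_normal_distribution (rs a \<omega> / l))"
    by (simp add: char_std_normal_distribution power_divide mult.commute)
  also have "\<dots> = (CLINT \<omega>|M. CLINT g|std_normal_distribution. iexp (rs a \<omega> / l * g))"
    unfolding char_def ..
  also have "\<dots> = (CLINT g|std_normal_distribution. CLINT \<omega>|M. iexp (rs a \<omega> / l * g))"
    by (rule P.Fubini_integral[symmetric]) (auto intro!: P.integrable_const_bound[where B=1])
  also have "\<dots> = (CLINT g|std_normal_distribution. cf (\<lambda>k. (g / l) * a k))"
    by (subst cf_scaled[OF a]) (simp add: mult_ac)
  finally show ?thesis .
qed

lemma small_ball_le_gauss:
  assumes l: "l > 0"
  shows "prob {\<omega> \<in> space M. \<bar>rs a \<omega>\<bar> \<le> l} \<le> 2 * expectation (\<lambda>\<omega>. exp (- (rs a \<omega>)\<^sup>2 / (2 * l\<^sup>2)))"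
proof -
  \<comment> \<open>On the interval the Gaussian is at least \<open>exp (- 1/2)\<close>, whence the
    factor 2.\<close>
  have e: "exp (1/2 :: real) \<le> 2"
    using exp_bound[of "1/2"] by (simp add: power2_eq_square)
  have "prob {\<omega> \<in> space M. \<bar>rs a \<omega>\<bar> \<le> l} = expectation (indicator {\<omega> \<in> space M. \<bar>rs a \<omega>\<bar> \<le> l})"
    by simp
  also have "\<dots> \<le> expectation (\<lambda>\<omega>. 2 * exp (- (rs a \<omega>)\<^sup>2 / (2 * l\<^sup>2)))"
  proof (rule integral_mono)
    show "integrable M (\<lambda>\<omega>. 2 * exp (- (rs a \<omega>)\<^sup>2 / (2 * l\<^sup>2)))"
      by (rule integrable_const_bound[where B=2]) auto
    fix \<omega>
    show "indicator {\<omega> \<in> space M. \<bar>rs a \<omega>\<bar> \<le> l} \<omega> \<le> 2 * exp (- (rs a \<omega>)\<^sup>2 / (2 * l\<^sup>2))"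
    proof (cases "\<bar>rs a \<omega>\<bar> \<le> l")
      case True
      then have "(rs a \<omega>)\<^sup>2 \<le> l\<^sup>2" using l by (simp add: abs_le_square_iff[symmetric])
      then have "- (1/2) \<le> - (rs a \<omega>)\<^sup>2 / (2 * l\<^sup>2)" using l by (simp add: field_simps)
      then have "exp (- (1/2)) \<le> exp (- (rs a \<omega>)\<^sup>2 / (2 * l\<^sup>2))" by simp
      moreover have "1 \<le> 2 * exp (- (1/2) :: real)" using e by (simp add: exp_minus field_simps)
      ultimately have "1 \<le> 2 * exp (- (rs a \<omega>)\<^sup>2 / (2 * l\<^sup>2))" by linarith
      then show ?thesis by (simp add: indicator_def)
    qed (auto simp: indicator_def)
  qed (auto intro: integrable_const_bound[where B=1])
  finally show ?thesis by simp
qed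

text \<open>The frequency is \<open>t = g / l\<close>. Up to \<open>T\<close> the chosen
  coefficients give \<open>exp (- min (t\<^sup>2 / 2) J / 4)\<close>; beyond \<open>T\<close> the
  trivial bound 1 is at most \<open>(t / T)\<^sup>2\<close>, whose normal mean is
  \<open>1 / (l * T)\<^sup>2\<close>. The set \<open>F\<close> may depend on \<open>t\<close>, since
  which coefficients are small enough changes with the frequency.\<close>

lemma anti_concentration:
  assumes a: "summable (\<lambda>k. \<bar>a k\<bar>)" and c: "\<And>u. \<bar>u\<bar> \<le> c \<Longrightarrow> norm (\<phi> u) \<le> exp (- u\<^sup>2 / 4)"
    and l: "l > 0" and T: "T > 0"
    and F: "\<And>t. \<bar>t\<bar> \<le> T \<Longrightarrow> \<exists>F. finite F \<and> (\<forall>k\<in>F. \<bar>t * a k\<bar> \<le> c) \<and> min (t\<^sup>2 / 2) J \<le> (\<Sum>k\<in>F. (t * a k)\<^sup>2)"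
  shows "prob {\<omega> \<in> space M. \<bar>rs a \<omega>\<bar> \<le> l} \<le> 4 * l + 2 * exp (- J / 4) + 2 / (l * T)\<^sup>2"
proof -
  interpret N: prob_space std_normal_distribution by (rule prob_space_std_normal)
  have cf1: "norm (cf b) \<le> 1" for b
    unfolding cf_def by (intro order_trans[OF integral_norm_bound]) (simp add: prob_space)
  have bound: "norm (cf (\<lambda>k. t * a k)) \<le> exp (- t\<^sup>2 / 8) + exp (- J / 4) + (t / T)\<^sup>2" for t
  proof (cases "\<bar>t\<bar> \<le> T")
    case True
    then obtain F' where F': "finite F'" "\<And>k. k \<in> F' \<Longrightarrow> \<bar>t * a k\<bar> \<le> c"
      "min (t\<^sup>2 / 2) J \<le> (\<Sum>k\<in>F'. (t * a k)\<^sup>2)" using F[OF True] by auto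
    have "summable (\<lambda>k. \<bar>t * a k\<bar>)" using a by (simp add: abs_mult summable_mult)
    then have "norm (cf (\<lambda>k. t * a k)) \<le> exp (- (\<Sum>k\<in>F'. (t * a k)\<^sup>2) / 4)"
      using c F' by (intro cf_norm_le) auto
    also have "\<dots> \<le> exp (- min (t\<^sup>2 / 2) J / 4)" using F'(3) by simp
    also have "\<dots> \<le> exp (- t\<^sup>2 / 8) + exp (- J / 4)" by (simp add: min_def)
    finally show ?thesis by (simp add: add.commute add_increasing)
  next
    case False
    then have "T \<le> \<bar>t\<bar>" by simp
    then have "T\<^sup>2 \<le> t\<^sup>2" using T by (simp add: abs_le_square_iff[symmetric])
    then have "1 \<le> (t / T)\<^sup>2" using T by (simp add: power_divide)
    then show ?thesis using cf1[of "\<lambda>k. t * a k"] by (smt (verit) exp_gt_zero)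
  qed
  have i1: "integrable std_normal_distribution (\<lambda>g. exp (- (g / l)\<^sup>2 / 8))"
    by (rule N.integrable_const_bound[where B=1]) auto
  have i2: "integrable std_normal_distribution (\<lambda>g. (g / l / T)\<^sup>2)"
    using integrable_std_normal_distribution_moment[of 2] by (simp add: power_divide)
  have m2: "(LINT g|std_normal_distribution. (g / l / T)\<^sup>2) = 1 / (l * T)\<^sup>2"
    using std_normal_distribution_even_moments[of 1] by (simp add: power_divide power_mult_distrib)
  \<comment> \<open>Dropping the exponential of the standard normal density leaves
    \<open>exp (- (g / l)\<^sup>2 / 8)\<close>, a multiple of the normal density of standard
    deviation \<open>2 * l\<close>; this makes the bound linear in \<open>l\<close>.\<close>
  have m1: "(LINT g|std_normal_distribution. exp (- (g / l)\<^sup>2 / 8)) \<le> 2 * l"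
  proof -
    have "(LINT g|std_normal_distribution. exp (- (g / l)\<^sup>2 / 8))
        = (LINT g|lborel. std_normal_density g * exp (- (g / l)\<^sup>2 / 8))"
      by (subst integral_density) auto
    also have "\<dots> \<le> (LINT g|lborel. 2 * l * normal_density 0 (2 * l) g)"
    proof (rule integral_mono)
      show "integrable lborel (\<lambda>g. std_normal_density g * exp (- (g / l)\<^sup>2 / 8))"
        using i1 by (subst (asm) integrable_density) auto
      show "integrable lborel (\<lambda>g. 2 * l * normal_density 0 (2 * l) g)"
        using l by (intro integrable_mult_right integrable_normal_density) auto
      fix g :: real
      have "std_normal_density g * exp (- (g / l)\<^sup>2 / 8) = 1 / sqrt (2 * pi) * exp (- g\<^sup>2 / 2) * exp (- (g / l)\<^sup>2 / 8)"
        by (simp add: std_normal_density_def)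
      also have "\<dots> \<le> 1 / sqrt (2 * pi) * 1 * exp (- (g / l)\<^sup>2 / 8)"
        by (intro mult_right_mono mult_left_mono) auto
      also have "\<dots> = 2 * l * normal_density 0 (2 * l) g"
      proof -
        have "sqrt (2 * pi * (2 * l)\<^sup>2) = 2 * l * sqrt (2 * pi)"
          using l by (simp only: real_sqrt_mult real_sqrt_abs) simp
        then show ?thesis
          using l unfolding normal_density_def by (simp add: power_divide power_mult_distrib mult.commute)
      qed
      finally show "std_normal_density g * exp (- (g / l)\<^sup>2 / 8) \<le> 2 * l * normal_density 0 (2 * l) g" .
    qed
    also have "\<dots> = 2 * l" using l by simp
    finally show ?thesis .
  qed
  have "expectation (\<lambda>\<omega>. exp (- (rs a \<omega>)\<^sup>2 / (2 * l\<^sup>2)))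
      = norm (complex_of_real (expectation (\<lambda>\<omega>. exp (- (rs a \<omega>)\<^sup>2 / (2 * l\<^sup>2)))))"
    by (subst norm_of_real) (simp add: integral_nonneg_AE)
  also have "\<dots> \<le> (LINT g|std_normal_distribution. norm (cf (\<lambda>k. (g / l) * a k)))"
    unfolding expectation_gauss_eq[OF a] by (rule integral_norm_bound)
  also have "\<dots> \<le> (LINT g|std_normal_distribution. exp (- (g / l)\<^sup>2 / 8) + exp (- J / 4) + (g / l / T)\<^sup>2)"
  proof (rule integral_mono)
    show "integrable std_normal_distribution (\<lambda>g. exp (- (g / l)\<^sup>2 / 8) + exp (- J / 4) + (g / l / T)\<^sup>2)"
      using i1 i2 by (intro Bochner_Integration.integrable_add) auto
    have "(\<lambda>g. cf (\<lambda>k. (g / l) * a k)) \<in> borel_measurable borel"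
      unfolding cf_scaled[OF a] by measurable
    then have "(\<lambda>g. norm (cf (\<lambda>k. (g / l) * a k))) \<in> borel_measurable std_normal_distribution"
      by simp
    then show "integrable std_normal_distribution (\<lambda>g. norm (cf (\<lambda>k. (g / l) * a k)))"
      using cf1 by (intro N.integrable_const_bound[where B=1]) auto
  qed (rule bound)
  also have "\<dots> = (LINT g|std_normal_distribution. exp (- (g / l)\<^sup>2 / 8)) + exp (- J / 4) + 1 / (l * T)\<^sup>2"
    using i1 i2 m2 N.prob_space by (simp add: Bochner_Integration.integral_add)
  finally have "expectation (\<lambda>\<omega>. exp (- (rs a \<omega>)\<^sup>2 / (2 * l\<^sup>2))) \<le> 2 * l + exp (- J / 4) + 1 / (l * T)\<^sup>2"
    using m1 by linarith
  then show ?thesis using small_ball_le_gauss[OF l, of a] by simp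
qed

end

section \<open>Blaschke bounds for zeros\<close>

text \<open>Division by a Blaschke factor keeps the supremum bound: the Schwarz lemma applies once a
  disc automorphism has moved the zero \<open>t\<close> to the centre. The value of \<open>h\<close>
  at \<open>t\<close> is recorded because it vanishes at a double zero.\<close>

lemma Moebius_divide:
  fixes f :: "complex \<Rightarrow> complex"
  assumes f: "f holomorphic_on ball 0 1" and M: "\<And>z. norm z < 1 \<Longrightarrow> norm (f z) \<le> M"
    and t: "norm t < 1" "f t = 0"
  shows "\<exists>h. h holomorphic_on ball 0 1 \<and> (\<forall>z. norm z < 1 \<longrightarrow> norm (h z) \<le> M) \<and>
    (\<forall>z. norm z < 1 \<longrightarrow> f z = Moebius_function 0 t z * h z) \<and> h t = deriv f t * (1 - cnj t * t)"
proof -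
  have M0: "M \<ge> 0" using order_trans[OF norm_ge_zero M[of 0]] by simp
  have nz: "1 - cnj t * z \<noteq> 0" if "norm z < 1" for z
  proof -
    have "norm (cnj t * z) < 1" using t(1) that norm_mult_less[of "cnj t" 1 z 1] by simp
    then show ?thesis by auto
  qed
  have sch: "norm (f z) \<le> M * norm (Moebius_function 0 t z)" if z: "norm z < 1" for z
  proof -
    \<comment> \<open>The slack \<open>e\<close> makes the normalised function strictly smaller than
      1 and avoids division by 0 when \<open>M = 0\<close>.\<close>
    have "norm (f z) \<le> (M + e) * norm (Moebius_function 0 t z)" if e: "e > 0" for e
    proof -
      define F where "F w = f (Moebius_function 0 (-t) w) / (M + e)" for w
      have sub: "Moebius_function 0 (-t) ` ball 0 1 \<subseteq> ball 0 1"
        using t Moebius_function_norm_lt_1[of "-t"] by auto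
      have "(\<lambda>w. f (Moebius_function 0 (-t) w)) holomorphic_on ball 0 1"
        using holomorphic_on_compose_gen[OF Moebius_function_holomorphic f sub] t by (simp add: o_def)
      then have F: "F holomorphic_on ball 0 1"
        unfolding F_def using M0 e by (intro holomorphic_intros) (auto simp: complex_eq_iff)
      have F0: "F 0 = 0" unfolding F_def using t by (simp add: Moebius_function_of_zero)
      have F1: "norm (F w) < 1" if "norm w < 1" for w
      proof -
        have "norm (f (Moebius_function 0 (-t) w)) \<le> M"
          using t that by (intro M Moebius_function_norm_lt_1) auto
        moreover have "norm (complex_of_real M + complex_of_real e) = M + e"
          using M0 e by (simp flip: of_real_add)
        ultimately show ?thesis unfolding F_def using M0 e by (simp add: norm_divide)
      qed
      have "norm (F (Moebius_function 0 t z)) \<le> norm (Moebius_function 0 t z)"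
        using F F0 F1 Moebius_function_norm_lt_1[OF t(1) z] by (rule Schwarz_Lemma(1))
      moreover have "Moebius_function 0 (-t) (Moebius_function 0 t z) = z"
        using t z by (intro Moebius_function_compose) auto
      moreover have "norm (complex_of_real M + complex_of_real e) = M + e"
        using M0 e by (simp flip: of_real_add)
      ultimately show ?thesis using M0 e by (simp add: F_def norm_divide field_simps)
    qed
    then have *: "norm (f z) \<le> M * norm (Moebius_function 0 t z) + e * norm (Moebius_function 0 t z)" if "e > 0" for e
      using that by (simp add: distrib_right)
    show ?thesis
    proof (rule field_le_epsilon)
      fix e :: real assume e: "0 < e"
      have "e * norm (Moebius_function 0 t z) \<le> e * 1"
        using Moebius_function_norm_lt_1[OF t(1) z, of 0] e by (intro mult_left_mono) auto
      then show "norm (f z) \<le> M * norm (Moebius_function 0 t z) + e" using *[OF e] by simp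
    qed
  qed
  define q where "q z = (if z = t then deriv f t else f z / (z - t))" for z
  define h where "h z = q z * (1 - cnj t * z)" for z
  have q: "q holomorphic_on ball 0 1"
    by (rule pole_theorem_open_0[OF f, of t]) (use t in \<open>auto simp: q_def\<close>)
  then have h: "h holomorphic_on ball 0 1"
    unfolding h_def by (intro holomorphic_intros)
  have eq: "f z = Moebius_function 0 t z * h z" if "norm z < 1" for z
    using nz[OF that] t by (auto simp: h_def q_def Moebius_function_simple)
  have le: "norm (h z) \<le> M" if z: "norm z < 1" "z \<noteq> t" for z
  proof -
    have "Moebius_function 0 t z \<noteq> 0" using nz[OF z(1)] z(2) by (simp add: Moebius_function_simple)
    moreover have "norm (Moebius_function 0 t z) * norm (h z) \<le> norm (Moebius_function 0 t z) * M"
      using sch[OF z(1)] eq[OF z(1)] by (simp add: norm_mult mult.commute)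
    ultimately show ?thesis by simp
  qed
  \<comment> \<open>At \<open>t\<close> itself the factor is 0 and cannot be cancelled, so the bound
    is taken over by continuity.\<close>
  have "norm (h t) \<le> M"
  proof (rule tendsto_upperbound)
    have "isCont h t"
      using holomorphic_on_imp_continuous_on[OF h] t by (simp add: continuous_on_eq_continuous_at)
    then show "((\<lambda>z. norm (h z)) \<longlongrightarrow> norm (h t)) (at t)"
      unfolding isCont_def by (rule tendsto_norm)
    have "eventually (\<lambda>z. z \<in> ball 0 1) (at t)"
      using t by (intro eventually_at_in_open') auto
    then show "eventually (\<lambda>z. norm (h z) \<le> M) (at t)"
      using eventually_neq_at_within[of t t] by eventually_elim (use le in auto)
  qed simp
  then have le': "norm (h z) \<le> M" if "norm z < 1" for z
    using le[of z] that by (cases "z = t") auto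
  have ht: "h t = deriv f t * (1 - cnj t * t)" by (simp add: h_def q_def)
  show ?thesis by (intro exI[of _ h] conjI allI impI h le' eq ht)
qed

text \<open>Dividing off one zero preserves the bound and the remaining zeros, because the factor of
  \<open>t\<close> vanishes nowhere else in the disc.\<close>

lemma Moebius_zeros_bound:
  fixes f :: "complex \<Rightarrow> complex"
  assumes "finite T" "T \<subseteq> ball 0 1" "f holomorphic_on ball 0 1" "\<And>z. norm z < 1 \<Longrightarrow> norm (f z) \<le> M"
    and "\<And>t. t \<in> T \<Longrightarrow> f t = 0" and z: "norm z < 1"
  shows "norm (f z) \<le> M * (\<Prod>t\<in>T. norm (Moebius_function 0 t z))"
  using assms(1-5)
proof (induction T arbitrary: f rule: finite_induct)
  case empty
  then show ?case using z by simp
next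
  case (insert t T)
  have t: "norm t < 1" using insert.prems by auto
  obtain h where h: "h holomorphic_on ball 0 1" "\<And>z. norm z < 1 \<Longrightarrow> norm (h z) \<le> M"
    "\<And>z. norm z < 1 \<Longrightarrow> f z = Moebius_function 0 t z * h z"
    using Moebius_divide[OF insert.prems(2,3) t insert.prems(4)[OF insertI1]] by auto
  have "norm (h z) \<le> M * (\<Prod>t\<in>T. norm (Moebius_function 0 t z))"
  proof (rule insert.IH)
    show "T \<subseteq> ball 0 1" "h holomorphic_on ball 0 1" using insert.prems h by auto
    show "norm (h z) \<le> M" if "norm z < 1" for z using h that by auto
    fix u assume u: "u \<in> T"
    then have u1: "norm u < 1" using insert.prems by auto
    have "norm (cnj t * u) < 1" using t u1 norm_mult_less[of "cnj t" 1 u 1] by simp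
    then have "Moebius_function 0 t u \<noteq> 0" using u insert.hyps by (auto simp: Moebius_function_simple)
    then show "h u = 0" using h(3)[OF u1] insert.prems(4)[of u] u by simp
  qed
  then have "norm (Moebius_function 0 t z) * norm (h z)
      \<le> norm (Moebius_function 0 t z) * (M * (\<Prod>t\<in>T. norm (Moebius_function 0 t z)))"
    by (intro mult_left_mono) auto
  then show ?case using insert.hyps h(3)[OF z] by (simp add: norm_mult mult_ac)
qed

text \<open>A vanishing derivative makes the quotient vanish at \<open>t\<close> again, so the same
  factor can be divided off twice.\<close>

lemma Moebius_double_zero_bound:
  fixes f :: "complex \<Rightarrow> complex"
  assumes f: "f holomorphic_on ball 0 1" "\<And>z. norm z < 1 \<Longrightarrow> norm (f z) \<le> M"
    and t: "norm t < 1" "f t = 0" "deriv f t = 0"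
  shows "norm (f 0) \<le> M * (norm t)\<^sup>2"
proof -
  obtain h where h: "h holomorphic_on ball 0 1" "\<And>z. norm z < 1 \<Longrightarrow> norm (h z) \<le> M"
    "\<And>z. norm z < 1 \<Longrightarrow> f z = Moebius_function 0 t z * h z" "h t = deriv f t * (1 - cnj t * t)"
    using Moebius_divide[OF f t(1,2)] by auto
  have "norm (h 0) \<le> M * (\<Prod>t\<in>{t}. norm (Moebius_function 0 t 0))"
    using h t by (intro Moebius_zeros_bound) auto
  then have "norm t * norm (h 0) \<le> norm t * (M * norm t)"
    by (intro mult_left_mono) (auto simp: Moebius_function_of_zero)
  then show ?thesis
    using h(3)[of 0] by (simp add: norm_mult Moebius_function_of_zero power2_eq_square mult_ac)
qed

section \<open>Power series with real coefficients and their zeros in the unit interval\<close>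

locale real_power_series =
  fixes c :: "nat \<Rightarrow> real" and g :: "real \<Rightarrow> real"
  assumes c: "summable (\<lambda>i. \<bar>c i\<bar>)" and g: "\<And>x. \<bar>x\<bar> \<le> 1 \<Longrightarrow> (\<lambda>i. c i * x ^ i) sums g x"
begin

definition G :: "complex \<Rightarrow> complex" where "G z = (\<Sum>i. of_real (c i) * z ^ i)"

lemma G_summable: "norm z \<le> 1 \<Longrightarrow> summable (\<lambda>i. norm (of_real (c i) * z ^ i :: complex))"
  by (rule summable_comparison_test'[OF c])
     (auto simp: norm_mult norm_power intro!: mult_left_le power_le_one)

lemma G_holomorphic: "G holomorphic_on ball 0 1"
proof (rule power_series_holomorphic)
  fix w :: complex assume "w \<in> ball 0 1"
  then show "(\<lambda>n. complex_of_real (c n) * (w - 0) ^ n) sums G w"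
    unfolding G_def using summable_sums[OF summable_norm_cancel[OF G_summable[of w]]] by simp
qed

lemma G_bound:
  assumes "norm z \<le> 1"
  shows "norm (G z) \<le> (\<Sum>i. \<bar>c i\<bar>)"
proof -
  have "norm (G z) \<le> (\<Sum>i. norm (of_real (c i) * z ^ i :: complex))"
    unfolding G_def using G_summable[OF assms] by (rule summable_norm)
  also have "\<dots> \<le> (\<Sum>i. \<bar>c i\<bar>)"
    using assms by (intro suminf_le c G_summable)
      (auto simp: norm_mult norm_power intro!: mult_left_le power_le_one)
  finally show ?thesis .
qed

lemma G_of_real:
  assumes "\<bar>x\<bar> \<le> 1"
  shows "G (of_real x) = of_real (g x)"
proof -
  have "(\<lambda>i. of_real (c i * x ^ i) :: complex) sums of_real (g x)"
    using g[OF assms] by (rule sums_of_real)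
  then show ?thesis unfolding G_def by (simp add: sums_iff)
qed

text \<open>At the centre each Blaschke factor has modulus equal to that of its zero, hence at most
  \<open>s\<close>.\<close>

lemma card_zeros_bound:
  assumes s: "0 < s" "s < 1" and T: "finite T" "T \<subseteq> {0..s}" "\<And>t. t \<in> T \<Longrightarrow> g t = 0"
  shows "\<bar>g 0\<bar> \<le> (\<Sum>i. \<bar>c i\<bar>) * s ^ card T"
proof -
  have "norm (G 0) \<le> (\<Sum>i. \<bar>c i\<bar>) * (\<Prod>t\<in>complex_of_real ` T. norm (Moebius_function 0 t 0))"
  proof (rule Moebius_zeros_bound)
    show "complex_of_real ` T \<subseteq> ball 0 1" using T s by force
    show "norm (G z) \<le> (\<Sum>i. \<bar>c i\<bar>)" if "norm z < 1" for z using G_bound that by simp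
    show "G t = 0" if "t \<in> complex_of_real ` T" for t
      using that T s by (auto simp: G_of_real subset_eq)
  qed (use T G_holomorphic in auto)
  also have "(\<Prod>t\<in>complex_of_real ` T. norm (Moebius_function 0 t 0)) = (\<Prod>t\<in>T. \<bar>t\<bar>)"
    by (subst prod.reindex) (auto simp: inj_on_def Moebius_function_of_zero)
  also have "(\<Sum>i. \<bar>c i\<bar>) * (\<Prod>t\<in>T. \<bar>t\<bar>) \<le> (\<Sum>i. \<bar>c i\<bar>) * (\<Prod>t\<in>T. s)"
    using T by (intro mult_left_mono prod_mono suminf_nonneg c) (auto simp: subset_eq)
  finally show ?thesis using G_of_real[of 0] by simp
qed

lemma G_vector_deriv:
  assumes "\<bar>x\<bar> < 1"
  shows "((\<lambda>y. G (of_real y)) has_vector_derivative deriv G (of_real x)) (at x)"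
proof -
  have "(G has_field_derivative deriv G (of_real x)) (at (of_real x))"
    using assms by (intro holomorphic_derivI[OF G_holomorphic]) auto
  then show ?thesis by (rule has_vector_derivative_real_field)
qed

lemma eventually_G_of_real:
  assumes "\<bar>x\<bar> < 1"
  shows "eventually (\<lambda>y. G (of_real y) = of_real (g y)) (nhds x)"
proof -
  have "eventually (\<lambda>y. y \<in> {-1<..<1}) (nhds x)"
    using assms by (intro eventually_nhds_in_open) auto
  then show ?thesis by eventually_elim (simp add: G_of_real abs_le_iff)
qed

lemma g_deriv:
  assumes "\<bar>x\<bar> < 1"
  shows "(g has_real_derivative Re (deriv G (of_real x))) (at x)"
proof -
  have "((\<lambda>y. Re (G (of_real y))) has_real_derivative Re (deriv G (of_real x))) (at x)"
    using G_vector_deriv[OF assms] by (rule has_field_derivative_Re)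
  moreover have ev: "eventually (\<lambda>y. Re (G (of_real y)) = g y) (nhds x)"
    using eventually_G_of_real[OF assms] by eventually_elim simp
  ultimately show ?thesis by (simp add: DERIV_cong_ev[OF refl ev refl])
qed

lemma g_cont: "continuous_on {-1<..<1} g"
proof (intro continuous_at_imp_continuous_on ballI)
  fix x :: real assume "x \<in> {-1<..<1}"
  then have "\<bar>x\<bar> < 1" by auto
  then show "isCont g x" using g_deriv DERIV_isCont by blast
qed

text \<open>\<open>G\<close> is real on the real axis, so its imaginary part is constant there.
  Hence the complex derivative at a real point vanishes as soon as the real one does.\<close>

lemma deriv_G_real:
  assumes "\<bar>x\<bar> < 1"
  shows "Im (deriv G (of_real x)) = 0"
proof -
  have "((\<lambda>y. Im (G (of_real y))) has_real_derivative Im (deriv G (of_real x))) (at x)"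
    using G_vector_deriv[OF assms] by (rule has_field_derivative_Im)
  moreover have ev: "eventually (\<lambda>y. Im (G (of_real y)) = 0) (nhds x)"
    using eventually_G_of_real[OF assms] by eventually_elim simp
  ultimately have "((\<lambda>y. 0) has_real_derivative Im (deriv G (of_real x))) (at x)"
    by (simp add: DERIV_cong_ev[OF refl ev refl])
  then show ?thesis by (intro DERIV_unique[OF _ DERIV_const])
qed

text \<open>A zero without a sign change between the endpoints is either accompanied by another zero
  or is a double zero. Both cases supply two Blaschke factors, so the bound is the one for two
  zeros.\<close>

lemma touching_zero_bound:
  assumes s: "0 < s" "s < 1" and t: "t \<in> {0..s}" "g t = 0" and pos: "g 0 * g s > 0"
  shows "\<bar>g 0\<bar> \<le> (\<Sum>i. \<bar>c i\<bar>) * s ^ 2"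
proof (cases "\<exists>t'\<in>{0..s}. t' \<noteq> t \<and> g t' = 0")
  case True
  then obtain t' where t': "t' \<in> {0..s}" "t' \<noteq> t" "g t' = 0" by auto
  have "\<bar>g 0\<bar> \<le> (\<Sum>i. \<bar>c i\<bar>) * s ^ card {t, t'}"
    using t t' by (intro card_zeros_bound s) auto
  then show ?thesis using t'(2) by (simp add: card_insert_if power2_eq_square)
next
  case False
  then have uniq: "t' = t" if "t' \<in> {0..s}" "g t' = 0" for t' using that by auto
  have ts: "0 < t" "t < s"
    using t pos by (auto simp: less_le)
  define l where "l = Re (deriv G (of_real t))"
  have d: "(g has_real_derivative l) (at t)"
    unfolding l_def using ts s by (intro g_deriv) auto
  have cont: "continuous_on {x..y} g" if "-1 < x" "y < 1" for x y
    using that by (intro continuous_on_subset[OF g_cont]) auto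
  \<comment> \<open>Away from the only zero \<open>t\<close> the intermediate value theorem excludes
    sign changes.\<close>
  have sign: False if "0 \<le> x" "x < y" "y \<le> s" "t \<notin> {x..y}" "g x * g y < 0" for x y
  proof -
    have "\<exists>z\<in>{x..y}. g z = 0"
    proof (cases "g x < 0")
      case True
      then show ?thesis using that s IVT'[of g x 0 y] cont[of x y] by (auto simp: mult_less_0_iff)
    next
      case False
      then show ?thesis using that s IVT2'[of g y 0 x] cont[of x y] by (auto simp: mult_less_0_iff)
    qed
    then obtain z where z: "z \<in> {x..y}" "g z = 0" by auto
    then have "z = t" using that by (intro uniq) auto
    then show False using z that by simp
  qed
  \<comment> \<open>A nonzero derivative would give opposite signs on the two sides of
    \<open>t\<close>, and these would persist to 0 and \<open>s\<close>, against
    \<open>pos\<close>.\<close>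
  have "l = 0"
  proof (rule ccontr)
    assume "l \<noteq> 0"
    then consider "l > 0" | "l < 0" by linarith
    then obtain x y where xy: "0 \<le> x" "x < t" "t < y" "y \<le> s" "g x * g y < 0"
    proof cases
      case 1
      obtain e1 where e1: "e1 > 0" "\<And>h. 0 < h \<Longrightarrow> h < e1 \<Longrightarrow> g t < g (t + h)"
        using DERIV_pos_inc_right[OF d 1] by auto
      obtain e2 where e2: "e2 > 0" "\<And>h. 0 < h \<Longrightarrow> h < e2 \<Longrightarrow> g (t - h) < g t"
        using DERIV_pos_inc_left[OF d 1] by auto
      define h where "h = min (min e1 e2) (min t (s - t)) / 2"
      have "0 < h" "h < e1" "h < e2" "h < t" "h < s - t"
        using e1(1) e2(1) ts by (auto simp: h_def)
      then show ?thesis using that[of "t - h" "t + h"] e1(2)[of h] e2(2)[of h] t(2)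
        by (auto simp: mult_less_0_iff)
    next
      case 2
      obtain e1 where e1: "e1 > 0" "\<And>h. 0 < h \<Longrightarrow> h < e1 \<Longrightarrow> g t > g (t + h)"
        using DERIV_neg_dec_right[OF d 2] by auto
      obtain e2 where e2: "e2 > 0" "\<And>h. 0 < h \<Longrightarrow> h < e2 \<Longrightarrow> g (t - h) > g t"
        using DERIV_neg_dec_left[OF d 2] by auto
      define h where "h = min (min e1 e2) (min t (s - t)) / 2"
      have "0 < h" "h < e1" "h < e2" "h < t" "h < s - t"
        using e1(1) e2(1) ts by (auto simp: h_def)
      then show ?thesis using that[of "t - h" "t + h"] e1(2)[of h] e2(2)[of h] t(2)
        by (auto simp: mult_less_0_iff)
    qed
    have "g 0 * g x \<ge> 0" using sign[of 0 x] xy by (cases "x = 0") (auto simp: not_less[symmetric])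
    moreover have "g y * g s \<ge> 0" using sign[of y s] xy ts by (cases "y = s") (auto simp: not_less[symmetric])
    ultimately show False using xy(5) pos
      by (auto simp: mult_less_0_iff zero_less_mult_iff zero_le_mult_iff)
  qed
  then have "deriv G (of_real t) = 0"
    using deriv_G_real[of t] ts s by (simp add: complex_eq_iff l_def)
  then have "norm (G 0) \<le> (\<Sum>i. \<bar>c i\<bar>) * (norm (complex_of_real t))\<^sup>2"
    using ts s t G_of_real[of t] G_bound by (intro Moebius_double_zero_bound G_holomorphic) auto
  also have "\<dots> \<le> (\<Sum>i. \<bar>c i\<bar>) * s ^ 2"
    using ts by (intro mult_left_mono power_mono suminf_nonneg c) auto
  finally show ?thesis using G_of_real[of 0] by simp
qed

end

section \<open>Random exponential sums as power series\<close>

lemma suminf_swap_real: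
  fixes F :: "nat \<Rightarrow> nat \<Rightarrow> real"
  assumes 1: "\<And>k. summable (\<lambda>i. \<bar>F k i\<bar>)" and 2: "summable (\<lambda>k. \<Sum>i. \<bar>F k i\<bar>)"
  shows "summable (\<lambda>k. \<bar>F k i\<bar>)" "summable (\<lambda>i. \<bar>\<Sum>k. F k i\<bar>)"
    "(\<lambda>i. \<Sum>k. F k i) sums (\<Sum>k. \<Sum>i. F k i)"
proof -
  have inf: "infsum f UNIV = suminf f" if "summable (\<lambda>n. \<bar>f n\<bar>)" for f :: "nat \<Rightarrow> real"
    using norm_summable_imp_has_sum[of f] that summable_sums[OF summable_rabs_cancel[OF that]]
    by (intro infsumI) auto
  have on: "f summable_on UNIV" if "summable (\<lambda>n. \<bar>f n\<bar>)" for f :: "nat \<Rightarrow> real"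
    using that by (intro norm_summable_imp_summable_on) simp
  have inf': "infsum (\<lambda>i. \<bar>F k i\<bar>) UNIV = (\<Sum>i. \<bar>F k i\<bar>)" for k
    using 1[of k] by (intro inf) simp
  have nn: "0 \<le> (\<Sum>i. \<bar>F k i\<bar>)" for k using 1 by (intro suminf_nonneg) auto
  have "(\<lambda>p. norm (case p of (k, i) \<Rightarrow> F k i)) summable_on (UNIV \<times> UNIV)"
    unfolding Infinite_Sum.abs_summable_on_Sigma_iff
    using 1 2 nn by (auto simp: inf' intro!: on)
  then have abs: "(\<lambda>(k, i). \<bar>F k i\<bar>) summable_on (UNIV \<times> UNIV)"
    by (simp add: case_prod_unfold)
  then have abs': "(\<lambda>(i, k). \<bar>F k i\<bar>) summable_on (UNIV \<times> UNIV)"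
    by (subst summable_on_swap) (simp add: case_prod_unfold)
  have sF: "(\<lambda>(k, i). F k i) summable_on (UNIV \<times> UNIV)"
    by (rule abs_summable_summable) (use abs in \<open>simp add: case_prod_unfold\<close>)
  have s1: "summable (\<lambda>k. \<bar>F k i\<bar>)" for i
  proof -
    have "(\<lambda>k. \<bar>F k i\<bar>) summable_on UNIV"
      using summable_on_SigmaD1[OF abs', of i] by simp
    then show ?thesis by (rule summable_on_imp_summable)
  qed
  show "summable (\<lambda>k. \<bar>F k i\<bar>)" by (rule s1)
  have "(\<lambda>i. infsum (\<lambda>k. \<bar>F k i\<bar>) UNIV) summable_on UNIV"
    using summable_on_Sigma_banach[OF abs'] by simp
  then have "(\<lambda>i. \<Sum>k. \<bar>F k i\<bar>) summable_on UNIV"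
    using inf[of "\<lambda>k. \<bar>F k _\<bar>"] s1 by simp
  then have s2: "summable (\<lambda>i. \<Sum>k. \<bar>F k i\<bar>)" by (rule summable_on_imp_summable)
  show s3: "summable (\<lambda>i. \<bar>\<Sum>k. F k i\<bar>)"
    by (rule summable_comparison_test'[OF s2]) (use summable_rabs[OF s1] in auto)
  have "infsum (\<lambda>k. infsum (\<lambda>i. F k i) UNIV) UNIV = infsum (\<lambda>i. infsum (\<lambda>k. F k i) UNIV) UNIV"
    by (rule infsum_swap_banach[OF sF])
  moreover have "summable (\<lambda>k. \<bar>\<Sum>i. F k i\<bar>)"
    by (rule summable_comparison_test'[OF 2]) (use summable_rabs[OF 1] in auto)
  ultimately have "(\<Sum>k. \<Sum>i. F k i) = (\<Sum>i. \<Sum>k. F k i)"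
    using inf[OF 1] inf[OF s1] s3 by (simp add: inf)
  then show "(\<lambda>i. \<Sum>k. F k i) sums (\<Sum>k. \<Sum>i. F k i)"
    using summable_sums[OF summable_rabs_cancel[OF s3]] by simp
qed

text \<open>The quotient \<open>fact (2 * i) / (fact i)\<^sup>2\<close> is a central binomial
  coefficient, at most \<open>2 ^ (2 * i)\<close>.\<close>

lemma fact_double_le: "fact (2 * i) \<le> (4 ^ i * (fact i)\<^sup>2 :: real)"
proof -
  have "real (fact i * fact (2 * i - i) * (2 * i choose i)) = fact (2 * i)"
    by (subst binomial_fact_lemma) auto
  then have "fact (2 * i) = (fact i)\<^sup>2 * real (2 * i choose i)"
    by (simp add: power2_eq_square)
  also have "real (2 * i choose i) \<le> 2 ^ (2 * i)"
    using binomial_le_pow2[of "2 * i" i] by (metis of_nat_le_iff of_nat_numeral of_nat_power)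
  finally have "fact (2 * i) \<le> (fact i)\<^sup>2 * (2 ^ (2 * i) :: real)" by simp
  moreover have "(2::real) ^ (2 * i) = 4 ^ i" by (simp add: power_mult)
  ultimately show ?thesis by (simp add: mult.commute)
qed

lemma power_le_fact_exp:
  assumes "x \<ge> (0::real)"
  shows "x ^ n \<le> fact n * exp x"
proof -
  have "(\<Sum>i\<in>{n}. x ^ i / fact i) \<le> (\<Sum>i. x ^ i / fact i)"
    using summable_exp[of x] assms by (intro sum_le_suminf) (auto simp: field_simps)
  also have "\<dots> = exp x" by (simp add: exp_def field_simps)
  finally show ?thesis by (simp add: field_simps)
qed

text \<open>Cauchy--Schwarz against the weights \<open>2 ^ (- i)\<close>, whose sum is 2. It
  replaces the absolute sum of the coefficients by a quadratic quantity with computable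
  mean.\<close>

lemma sq_suminf_abs_le:
  fixes c :: "nat \<Rightarrow> real"
  assumes c: "summable (\<lambda>i. \<bar>c i\<bar>)" and Q: "summable (\<lambda>i. 2 ^ i * (c i)\<^sup>2)"
  shows "(\<Sum>i. \<bar>c i\<bar>)\<^sup>2 \<le> 2 * (\<Sum>i. 2 ^ i * (c i)\<^sup>2)"
proof (rule LIMSEQ_le_const2)
  show "(\<lambda>n. (\<Sum>i<n. \<bar>c i\<bar>)\<^sup>2) \<longlonglongrightarrow> (\<Sum>i. \<bar>c i\<bar>)\<^sup>2"
    by (intro tendsto_power summable_LIMSEQ c)
  have "(\<Sum>i<n. \<bar>c i\<bar>)\<^sup>2 \<le> 2 * (\<Sum>i. 2 ^ i * (c i)\<^sup>2)" for n
  proof -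
    have "(\<Sum>i<n. \<bar>c i\<bar>)\<^sup>2 = (\<Sum>i<n. (1 / sqrt 2 ^ i) * (sqrt 2 ^ i * \<bar>c i\<bar>))\<^sup>2"
      by simp
    also have "\<dots> \<le> (\<Sum>i<n. (1 / sqrt 2 ^ i)\<^sup>2) * (\<Sum>i<n. (sqrt 2 ^ i * \<bar>c i\<bar>)\<^sup>2)"
      by (rule Cauchy_Schwarz_ineq_sum)
    also have "(\<Sum>i<n. (sqrt 2 ^ i * \<bar>c i\<bar>)\<^sup>2) = (\<Sum>i<n. 2 ^ i * (c i)\<^sup>2)"
      by (simp add: power_mult_distrib power_mult[symmetric] mult.commute[of _ 2]) (simp add: power_mult)
    also have "(\<Sum>i<n. (1 / sqrt 2 ^ i)\<^sup>2) = (\<Sum>i<n. (1 / 2) ^ i)"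
      by (simp add: power_divide power_mult[symmetric] mult.commute[of _ 2]) (simp add: power_mult)
    also have "(\<Sum>i<n. (1 / 2 :: real) ^ i) * (\<Sum>i<n. 2 ^ i * (c i)\<^sup>2) \<le> 2 * (\<Sum>i. 2 ^ i * (c i)\<^sup>2)"
    proof (rule mult_mono)
      show "(\<Sum>i<n. (1 / 2 :: real) ^ i) \<le> 2"
        using sum_le_suminf[of "\<lambda>i. (1/2::real) ^ i" "{..<n}"] by (simp add: suminf_geometric summable_geometric)
      show "(\<Sum>i<n. 2 ^ i * (c i)\<^sup>2) \<le> (\<Sum>i. 2 ^ i * (c i)\<^sup>2)"
        by (rule sum_le_suminf[OF Q]) auto
    qed (auto intro: sum_nonneg)
    finally show ?thesis .
  qed
  then show "\<exists>N. \<forall>n\<ge>N. (\<Sum>i<n. \<bar>c i\<bar>)\<^sup>2 \<le> 2 * (\<Sum>i. 2 ^ i * (c i)\<^sup>2)" by blast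
qed

context iid_std
begin

text \<open>Each exponential is expanded in \<open>u\<close> and the two sums are exchanged.
  Absolute convergence for \<open>\<bar>u\<bar> \<le> 1\<close> reduces to the series with
  \<open>exp \<bar>d k\<bar>\<close>, which converges almost surely, so one null set serves all
  \<open>u\<close>.\<close>

lemma exp_sum_power_series:
  assumes sm: "summable (\<lambda>k. \<bar>a k\<bar> * exp \<bar>d k\<bar>)"
  shows "AE \<omega> in M. real_power_series (\<lambda>i. rs (\<lambda>k. a k * d k ^ i / fact i) \<omega>)
           (\<lambda>u. rs (\<lambda>k. a k * exp (d k * u)) \<omega>)"
proof -
  have "AE \<omega> in M. summable (\<lambda>k. \<bar>a k * exp \<bar>d k\<bar> * \<xi> k \<omega>\<bar>)"
    by (rule AE_summable) (use sm in \<open>simp add: abs_mult\<close>)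
  then show ?thesis
  proof eventually_elim
    case (elim \<omega>)
    define x where "x k = a k * \<xi> k \<omega>" for k
    have sx: "summable (\<lambda>k. \<bar>x k\<bar> * exp \<bar>d k\<bar>)"
      using elim by (simp add: x_def abs_mult mult_ac)
    define F where "F u k i = x k * d k ^ i / fact i * u ^ i" for u :: real and k i
    have F_sums: "(\<lambda>i. F u k i) sums (x k * exp (d k * u))" for u k
    proof -
      have "(\<lambda>i. x k * ((d k * u) ^ i /\<^sub>R fact i)) sums (x k * exp (d k * u))"
        by (intro sums_mult exp_converges)
      then show ?thesis by (simp add: F_def power_mult_distrib field_simps)
    qed
    have Fabs_sums: "(\<lambda>i. \<bar>F u k i\<bar>) sums (\<bar>x k\<bar> * exp \<bar>d k * u\<bar>)" for u k
    proof -
      have "(\<lambda>i. \<bar>x k\<bar> * (\<bar>d k * u\<bar> ^ i /\<^sub>R fact i)) sums (\<bar>x k\<bar> * exp \<bar>d k * u\<bar>)"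
        by (intro sums_mult exp_converges)
      then show ?thesis by (simp add: F_def power_mult_distrib field_simps abs_mult power_abs)
    qed
    have s1: "summable (\<lambda>i. \<bar>F u k i\<bar>)" for u k
      using Fabs_sums by (rule sums_summable)
    have s2: "summable (\<lambda>k. \<Sum>i. \<bar>F u k i\<bar>)" if "\<bar>u\<bar> \<le> 1" for u
    proof (rule summable_comparison_test'[OF sx])
      fix k
      have "\<bar>d k * u\<bar> \<le> \<bar>d k\<bar>" using that by (simp add: abs_mult mult_left_le)
      then show "norm (\<Sum>i. \<bar>F u k i\<bar>) \<le> \<bar>x k\<bar> * exp \<bar>d k\<bar>"
        by (subst sums_unique[OF Fabs_sums[of u k], symmetric]) (simp add: mult_left_mono)
    qed
    have col: "(\<Sum>k. F u k i) = rs (\<lambda>k. a k * d k ^ i / fact i) \<omega> * u ^ i" if "\<bar>u\<bar> \<le> 1" for u i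
    proof -
      have "summable (\<lambda>k. F 1 k i)"
        using suminf_swap_real(1)[OF s1 s2, of 1 i] by (simp add: summable_rabs_cancel)
      then have "(\<Sum>k. F 1 k i * u ^ i) = (\<Sum>k. F 1 k i) * u ^ i"
        by (rule suminf_mult2[symmetric])
      then show ?thesis by (simp add: F_def rs_def x_def mult_ac)
    qed
    show ?case
    proof
      show "summable (\<lambda>i. \<bar>rs (\<lambda>k. a k * d k ^ i / fact i) \<omega>\<bar>)"
        using suminf_swap_real(2)[OF s1 s2, of 1] col[of 1] by simp
    next
      fix u :: real assume u: "\<bar>u\<bar> \<le> 1"
      have "(\<Sum>k. \<Sum>i. F u k i) = rs (\<lambda>k. a k * exp (d k * u)) \<omega>"
        using sums_unique[OF F_sums[of u]] by (simp add: rs_def x_def mult_ac)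
      then show "(\<lambda>i. rs (\<lambda>k. a k * d k ^ i / fact i) \<omega> * u ^ i) sums rs (\<lambda>k. a k * exp (d k * u)) \<omega>"
        using suminf_swap_real(3)[OF s1 s2[OF u]] col[OF u] by simp
    qed
  qed
qed

text \<open>A Cauchy--Schwarz bound for the squared \<open>\<ell>\<^sup>1\<close> norm of the Taylor
  coefficients of \<open>u \<mapsto> rs (\<lambda>k. a k * exp (d k * u)) \<omega>\<close>, hence for its squared supremum on the unit disc.\<close>

definition Vsum :: "(nat \<Rightarrow> real) \<Rightarrow> (nat \<Rightarrow> real) \<Rightarrow> 'w \<Rightarrow> ennreal" where
  "Vsum a d \<omega> = 2 * (\<Sum>i. ennreal (2 ^ i * (rs (\<lambda>k. a k * d k ^ i / fact i) \<omega>)\<^sup>2))"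

lemma Vsum_measurable [measurable]: "Vsum a d \<in> borel_measurable M"
  unfolding Vsum_def by measurable

text \<open>The \<open>i\<close>-th Taylor coefficient has second moment at most
  \<open>C / 4 ^ i\<close>: the exponential moment of order 4 supplies \<open>16 ^ i\<close>, of
  which \<open>fact_double_le\<close> loses \<open>4 ^ i\<close>. The weights \<open>2 ^ i\<close>
  then still leave a geometric series with sum 2.\<close>

lemma Vsum_le:
  assumes sm: "summable (\<lambda>k. \<bar>a k\<bar> * exp \<bar>d k\<bar>)"
    and sC: "summable (\<lambda>k. (a k)\<^sup>2 * exp (4 * \<bar>d k\<bar>))" "(\<Sum>k. (a k)\<^sup>2 * exp (4 * \<bar>d k\<bar>)) \<le> C"
  shows "(\<integral>\<^sup>+\<omega>. Vsum a d \<omega> \<partial>M) \<le> ennreal (4 * C)"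
proof -
  have C0: "C \<ge> 0" using order_trans[OF suminf_nonneg[OF sC(1)] sC(2)] by simp
  have ci: "(\<integral>\<^sup>+\<omega>. ennreal ((rs (\<lambda>k. a k * d k ^ i / fact i) \<omega>)\<^sup>2) \<partial>M) \<le> ennreal (C / 4 ^ i)" for i
  proof -
    have s: "summable (\<lambda>k. \<bar>a k * d k ^ i / fact i\<bar>)"
    proof (rule summable_comparison_test'[OF sm])
      fix k
      have "\<bar>d k\<bar> ^ i / fact i \<le> exp \<bar>d k\<bar>"
        using power_le_fact_exp[of "\<bar>d k\<bar>" i] by (simp add: field_simps)
      then have "\<bar>a k\<bar> * (\<bar>d k\<bar> ^ i / fact i) \<le> \<bar>a k\<bar> * exp \<bar>d k\<bar>" by (rule mult_left_mono) simp
      then show "norm \<bar>a k * d k ^ i / fact i\<bar> \<le> \<bar>a k\<bar> * exp \<bar>d k\<bar>"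
        by (simp add: abs_mult power_abs)
    qed
    have le: "(a k * d k ^ i / fact i)\<^sup>2 \<le> (a k)\<^sup>2 * exp (4 * \<bar>d k\<bar>) / 4 ^ i" for k
    proof -
      have "(4 * \<bar>d k\<bar>) ^ (2 * i) \<le> fact (2 * i) * exp (4 * \<bar>d k\<bar>)"
        by (rule power_le_fact_exp) simp
      also have "\<dots> \<le> (4 ^ i * (fact i)\<^sup>2) * exp (4 * \<bar>d k\<bar>)"
        by (intro mult_right_mono fact_double_le) auto
      finally have "(4 * \<bar>d k\<bar>) ^ (2 * i) \<le> 4 ^ i * ((fact i)\<^sup>2 * exp (4 * \<bar>d k\<bar>))"
        by (simp add: mult_ac)
      moreover have "(4 * \<bar>d k\<bar>) ^ (2 * i) = 4 ^ i * (4 ^ i * (d k ^ i)\<^sup>2)"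
      proof -
        have "(4 * \<bar>d k\<bar>) ^ (2 * i) = (16 * (d k)\<^sup>2) ^ i"
          unfolding power_mult by (simp add: power_mult_distrib)
        also have "\<dots> = (4 * 4) ^ i * (d k ^ i)\<^sup>2"
          by (simp add: power_mult_distrib power_mult[symmetric] mult.commute)
        finally show ?thesis unfolding power_mult_distrib by (simp add: mult_ac)
      qed
      ultimately have "4 ^ i * (4 ^ i * (d k ^ i)\<^sup>2) \<le> 4 ^ i * ((fact i)\<^sup>2 * exp (4 * \<bar>d k\<bar>))"
        by simp
      then have "4 ^ i * (d k ^ i)\<^sup>2 \<le> (fact i)\<^sup>2 * exp (4 * \<bar>d k\<bar>)" by simp
      then have "(d k ^ i)\<^sup>2 / (fact i)\<^sup>2 \<le> exp (4 * \<bar>d k\<bar>) / 4 ^ i" by (simp add: field_simps)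
      then have "(a k)\<^sup>2 * ((d k ^ i)\<^sup>2 / (fact i)\<^sup>2) \<le> (a k)\<^sup>2 * (exp (4 * \<bar>d k\<bar>) / 4 ^ i)"
        by (rule mult_left_mono) simp
      then show ?thesis by (simp add: power_mult_distrib power_divide)
    qed
    have "(\<integral>\<^sup>+\<omega>. ennreal ((rs (\<lambda>k. a k * d k ^ i / fact i) \<omega>)\<^sup>2) \<partial>M) \<le> ennreal (\<Sum>k. (a k * d k ^ i / fact i)\<^sup>2)"
      by (rule rs_sq_le[OF s])
    also have "(\<Sum>k. (a k * d k ^ i / fact i)\<^sup>2) \<le> (\<Sum>k. (a k)\<^sup>2 * exp (4 * \<bar>d k\<bar>) / 4 ^ i)"
      by (intro suminf_le le summable_sq[OF s] summable_divide sC)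
    also have "\<dots> \<le> C / 4 ^ i"
      using sC by (simp add: suminf_divide divide_right_mono)
    finally show ?thesis by (simp add: ennreal_leI)
  qed
  have "(\<integral>\<^sup>+\<omega>. Vsum a d \<omega> \<partial>M) = 2 * (\<Sum>i. \<integral>\<^sup>+\<omega>. ennreal (2 ^ i * (rs (\<lambda>k. a k * d k ^ i / fact i) \<omega>)\<^sup>2) \<partial>M)"
    unfolding Vsum_def by (simp add: nn_integral_cmult nn_integral_suminf)
  also have "\<dots> \<le> 2 * (\<Sum>i. ennreal (C * (1 / 2) ^ i))"
  proof (intro mult_left_mono suminf_le)
    fix i
    have "(\<integral>\<^sup>+\<omega>. ennreal (2 ^ i * (rs (\<lambda>k. a k * d k ^ i / fact i) \<omega>)\<^sup>2) \<partial>M)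
        = ennreal (2 ^ i) * (\<integral>\<^sup>+\<omega>. ennreal ((rs (\<lambda>k. a k * d k ^ i / fact i) \<omega>)\<^sup>2) \<partial>M)"
      by (simp add: ennreal_mult nn_integral_cmult)
    also have "\<dots> \<le> ennreal (2 ^ i) * ennreal (C / 4 ^ i)"
      by (intro mult_left_mono ci) simp
    also have "\<dots> = ennreal (2 ^ i * (C / 4 ^ i))"
      using C0 by (intro ennreal_mult[symmetric]) auto
    also have "2 ^ i * (C / 4 ^ i) = C * (1 / 2) ^ i"
    proof -
      have "(4::real) ^ i = 2 ^ i * 2 ^ i" by (simp flip: power_mult_distrib)
      then show ?thesis by (simp add: field_simps)
    qed
    finally show "(\<integral>\<^sup>+\<omega>. ennreal (2 ^ i * (rs (\<lambda>k. a k * d k ^ i / fact i) \<omega>)\<^sup>2) \<partial>M) \<le> ennreal (C * (1 / 2) ^ i)" .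
  qed auto
  also have "(\<Sum>i. ennreal (C * (1 / 2) ^ i)) = ennreal (\<Sum>i. C * (1 / 2) ^ i)"
    using C0 by (intro suminf_ennreal2 summable_mult summable_geometric) auto
  also have "(\<Sum>i. C * (1 / 2 :: real) ^ i) = C * 2"
    by (subst suminf_mult) (auto simp: suminf_geometric summable_geometric)
  also have "2 * ennreal (C * 2) = ennreal (4 * C)"
    using C0 by (subst ennreal_numeral[symmetric], subst ennreal_mult[symmetric]) auto
  finally show ?thesis .
qed

text \<open>The power series expansion holds off a single null set, and everything else is
  deterministic. The quantifiers over \<open>s\<close>, \<open>T\<close> and \<open>t\<close> stay
  inside the almost sure event because the zeros are random.\<close>

lemma local_zeros_bound:
  assumes sm: "summable (\<lambda>k. \<bar>a k\<bar> * exp \<bar>d k\<bar>)"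
  shows "AE \<omega> in M. continuous_on {-1<..<1} (\<lambda>u. rs (\<lambda>k. a k * exp (d k * u)) \<omega>) \<and>
    (\<forall>s T. 0 < s \<longrightarrow> s < 1 \<longrightarrow> finite T \<longrightarrow> T \<subseteq> {t\<in>{0..s}. rs (\<lambda>k. a k * exp (d k * t)) \<omega> = 0} \<longrightarrow>
       ennreal ((rs a \<omega>)\<^sup>2) \<le> Vsum a d \<omega> * ennreal (s ^ (2 * card T))) \<and>
    (\<forall>s t. 0 < s \<longrightarrow> s < 1 \<longrightarrow> t \<in> {0..s} \<longrightarrow> rs (\<lambda>k. a k * exp (d k * t)) \<omega> = 0 \<longrightarrow>
       rs a \<omega> * rs (\<lambda>k. a k * exp (d k * s)) \<omega> > 0 \<longrightarrow>
       ennreal ((rs a \<omega>)\<^sup>2) \<le> Vsum a d \<omega> * ennreal (s ^ 4))"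
  using exp_sum_power_series[OF sm]
proof eventually_elim
  case (elim \<omega>)
  define c where "c i = rs (\<lambda>k. a k * d k ^ i / fact i) \<omega>" for i
  define g where "g u = rs (\<lambda>k. a k * exp (d k * u)) \<omega>" for u
  interpret real_power_series c g using elim unfolding c_def[abs_def] g_def[abs_def] .
  have g0: "rs a \<omega> = g 0" by (simp add: g_def)
  have V: "Vsum a d \<omega> = 2 * (\<Sum>i. ennreal (2 ^ i * (c i)\<^sup>2))" by (simp add: Vsum_def c_def)
  \<comment> \<open>If the weighted sum diverges the right-hand side is infinite, as
    \<open>r > 0\<close>; otherwise \<open>sq_suminf_abs_le\<close> applies.\<close>
  have key: "ennreal ((g 0)\<^sup>2) \<le> Vsum a d \<omega> * ennreal (r\<^sup>2)" if "\<bar>g 0\<bar> \<le> (\<Sum>i. \<bar>c i\<bar>) * r" "r > 0" for r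
  proof (cases "(\<Sum>i. ennreal (2 ^ i * (c i)\<^sup>2)) = \<top>")
    case True
    then show ?thesis using that(2) by (simp add: V ennreal_top_mult ennreal_mult_top)
  next
    case False
    then have sQ: "summable (\<lambda>i. 2 ^ i * (c i)\<^sup>2)"
      by (intro summable_suminf_not_top) auto
    have "(g 0)\<^sup>2 \<le> ((\<Sum>i. \<bar>c i\<bar>) * r)\<^sup>2"
      using that(1) by (metis abs_ge_zero power2_abs power_mono)
    also have "\<dots> \<le> (2 * (\<Sum>i. 2 ^ i * (c i)\<^sup>2)) * r\<^sup>2"
      unfolding power_mult_distrib by (intro mult_right_mono sq_suminf_abs_le c sQ) auto
    finally have "ennreal ((g 0)\<^sup>2) \<le> ennreal ((2 * (\<Sum>i. 2 ^ i * (c i)\<^sup>2)) * r\<^sup>2)"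
      by (rule ennreal_leI)
    also have "\<dots> = ennreal 2 * ennreal (\<Sum>i. 2 ^ i * (c i)\<^sup>2) * ennreal (r\<^sup>2)"
      using suminf_nonneg[OF sQ] by (simp add: ennreal_mult)
    also have "ennreal (\<Sum>i. 2 ^ i * (c i)\<^sup>2) = (\<Sum>i. ennreal (2 ^ i * (c i)\<^sup>2))"
      by (rule suminf_ennreal2[symmetric, OF _ sQ]) auto
    finally show ?thesis by (simp add: V)
  qed
  have "ennreal ((g 0)\<^sup>2) \<le> Vsum a d \<omega> * ennreal (s ^ (2 * card T))"
    if "0 < s" "s < 1" "finite T" "T \<subseteq> {t\<in>{0..s}. g t = 0}" for s T
  proof -
    have "\<bar>g 0\<bar> \<le> (\<Sum>i. \<bar>c i\<bar>) * s ^ card T"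
      using that by (intro card_zeros_bound) auto
    then have "ennreal ((g 0)\<^sup>2) \<le> Vsum a d \<omega> * ennreal ((s ^ card T)\<^sup>2)"
      by (rule key) (use that in simp)
    then show ?thesis by (simp add: power_mult[symmetric] mult.commute)
  qed
  moreover have "ennreal ((g 0)\<^sup>2) \<le> Vsum a d \<omega> * ennreal (s ^ 4)"
    if "0 < s" "s < 1" "t \<in> {0..s}" "g t = 0" "g 0 * g s > 0" for s t
    using key[OF touching_zero_bound[OF that]] that by simp
  ultimately show ?case using g_cont unfolding g0 by (auto simp: g_def)
qed

end

section \<open>Gaussian measure of sectors\<close>

lemma nn_integral_even:
  assumes [measurable]: "f \<in> borel_measurable borel" and even: "\<And>x::real. f (- x) = f x"
  shows "(\<integral>\<^sup>+x. f x \<partial>lborel) = 2 * (\<integral>\<^sup>+x. f x * indicator {0..} x \<partial>lborel)"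
proof -
  have "(\<integral>\<^sup>+x. f x \<partial>lborel) = (\<integral>\<^sup>+x. f x * indicator {0..} x + f x * indicator {..<0} x \<partial>lborel)"
    by (intro nn_integral_cong) (auto simp: indicator_def)
  also have "\<dots> = (\<integral>\<^sup>+x. f x * indicator {0..} x \<partial>lborel) + (\<integral>\<^sup>+x. f x * indicator {..<0} x \<partial>lborel)"
    by (intro nn_integral_add) auto
  also have "(\<integral>\<^sup>+x. f x * indicator {..<0} x \<partial>lborel) = (\<integral>\<^sup>+x. f x * indicator {0<..} x \<partial>lborel)"
    by (subst nn_integral_real_affine[where c="-1" and t=0]) (auto simp: even indicator_def intro!: nn_integral_cong)
  also have "\<dots> = (\<integral>\<^sup>+x. f x * indicator {0..} x \<partial>lborel)"
    by (intro nn_integral_cong_AE) (use AE_lborel_singleton[of 0] in eventually_elim, auto simp: indicator_def)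
  finally show ?thesis by (simp add: mult_2)
qed

lemma nn_integral_abs_gauss:
  assumes q: "q > 0"
  shows "(\<integral>\<^sup>+u. ennreal (\<bar>u\<bar> * exp (- q * u\<^sup>2)) \<partial>lborel) = ennreal (1 / q)"
proof -
  have "(\<integral>\<^sup>+u. ennreal (u * exp (- q * u\<^sup>2)) * indicator {0..} u \<partial>lborel) = ennreal (0 - (- exp (- q * 0\<^sup>2) / (2 * q)))"
  proof (rule nn_integral_FTC_atLeast)
    show "((\<lambda>u. - exp (- q * u\<^sup>2) / (2 * q)) has_real_derivative u * exp (- q * u\<^sup>2)) (at u)" for u
      using q by (auto intro!: derivative_eq_intros simp: field_simps)
    show "((\<lambda>u. - exp (- q * u\<^sup>2) / (2 * q)) \<longlongrightarrow> 0) at_top"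
      using q by real_asymp
  qed auto
  moreover have "(\<integral>\<^sup>+u. ennreal (u * exp (- q * u\<^sup>2)) * indicator {0..} u \<partial>lborel)
      = (\<integral>\<^sup>+u. ennreal (\<bar>u\<bar> * exp (- q * u\<^sup>2)) * indicator {0..} u \<partial>lborel)"
    by (intro nn_integral_cong) (auto simp: indicator_def)
  ultimately have h: "(\<integral>\<^sup>+u. ennreal (\<bar>u\<bar> * exp (- q * u\<^sup>2)) * indicator {0..} u \<partial>lborel) = ennreal (1 / (2 * q))"
    by simp
  have "(\<integral>\<^sup>+u. ennreal (\<bar>u\<bar> * exp (- q * u\<^sup>2)) \<partial>lborel) = 2 * ennreal (1 / (2 * q))"
    unfolding h[symmetric] by (rule nn_integral_even) auto
  also have "\<dots> = ennreal (1 / q)"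
    using q by (subst ennreal_numeral[symmetric], subst ennreal_mult[symmetric]) auto
  finally show ?thesis .
qed

lemma nn_integral_Cauchy_tail:
  "(\<integral>\<^sup>+z. ennreal (1 / (pi * (1 + z\<^sup>2))) * indicator {m..} z \<partial>lborel) = ennreal (1 / 2 - arctan m / pi)"
proof (rule nn_integral_FTC_atLeast)
  show "((\<lambda>z. arctan z / pi) has_real_derivative 1 / (pi * (1 + z\<^sup>2))) (at z)" for z
    using DERIV_cdivide[OF DERIV_arctan[of z], of pi] by (simp add: divide_simps mult.commute)
  have "((\<lambda>z. arctan z / pi) \<longlongrightarrow> (pi / 2) / pi) at_top"
    by (intro tendsto_divide tendsto_arctan_at_top tendsto_const) auto
  then show "((\<lambda>z. arctan z / pi) \<longlongrightarrow> 1 / 2) at_top" by simp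
  show "0 \<le> 1 / (pi * (1 + z\<^sup>2))" for z :: real by simp
qed measurable

text \<open>Both forms of the sign comparison are carried along: the strict one produces a zero
  inside a cell and serves the lower bound, the weak one covers every cell with a possible sign
  change and serves the upper bound.\<close>

definition sgnrel :: "(real \<Rightarrow> bool) \<Rightarrow> bool" where
  "sgnrel R \<longleftrightarrow> R = (\<lambda>x. x < 0) \<or> R = (\<lambda>x. x \<le> 0)"

lemma sgnrel_measurable [measurable (raw)]:
  assumes "sgnrel R" and [measurable]: "f \<in> borel_measurable N"
  shows "Measurable.pred N (\<lambda>x. R (f x))"
  using assms(1) unfolding sgnrel_def by auto

text \<open>The ratio \<open>z = v / u\<close> of two independent centred normal variables of equal
  variance is Cauchy distributed, and the sign condition depends on the ratio alone.\<close>

lemma gauss_sector: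
  assumes \<sigma>: "\<sigma> > 0" and d: "d > 0" and R: "sgnrel R"
  shows "(\<integral>\<^sup>+u. \<integral>\<^sup>+v. ennreal (normal_density 0 \<sigma> u * normal_density 0 \<sigma> v) *
      indicator {v. R (u * (c * u + d * v))} v \<partial>lborel \<partial>lborel) = ennreal (1 / 2 - arctan (c / d) / pi)"
proof -
  note [measurable] = sgnrel_measurable[OF R]
  have "(\<integral>\<^sup>+u. \<integral>\<^sup>+v. ennreal (normal_density 0 \<sigma> u * normal_density 0 \<sigma> v) *
      indicator {v. R (u * (c * u + d * v))} v \<partial>lborel \<partial>lborel)
    = (\<integral>\<^sup>+u. \<integral>\<^sup>+z. ennreal (\<bar>u\<bar> * normal_density 0 \<sigma> u * normal_density 0 \<sigma> (u * z)) *
      indicator {z. R (c + d * z)} z \<partial>lborel \<partial>lborel)"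
  proof (rule nn_integral_cong_AE)
    have "AE u in lborel. u \<noteq> (0::real)" by (rule AE_lborel_singleton)
    then show "AE u in lborel. (\<integral>\<^sup>+v. ennreal (normal_density 0 \<sigma> u * normal_density 0 \<sigma> v) *
      indicator {v. R (u * (c * u + d * v))} v \<partial>lborel) = (\<integral>\<^sup>+z. ennreal (\<bar>u\<bar> * normal_density 0 \<sigma> u * normal_density 0 \<sigma> (u * z)) *
      indicator {z. R (c + d * z)} z \<partial>lborel)"
    proof eventually_elim
      case (elim u)
      have eq: "R (u * (c * u + d * (u * z))) \<longleftrightarrow> R (c + d * z)" for z
      proof -
        have "u * (c * u + d * (u * z)) = u\<^sup>2 * (c + d * z)" by (simp add: power2_eq_square algebra_simps)
        then show ?thesis using R elim unfolding sgnrel_def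
          by (auto simp: mult_less_0_iff mult_le_0_iff)
      qed
      have "(\<integral>\<^sup>+v. ennreal (normal_density 0 \<sigma> u * normal_density 0 \<sigma> v) * indicator {v. R (u * (c * u + d * v))} v \<partial>lborel)
        = ennreal \<bar>u\<bar> * (\<integral>\<^sup>+z. ennreal (normal_density 0 \<sigma> u * normal_density 0 \<sigma> (0 + u * z)) * indicator {v. R (u * (c * u + d * v))} (0 + u * z) \<partial>lborel)"
        by (rule nn_integral_real_affine[OF _ elim]) measurable
      also have "\<dots> = (\<integral>\<^sup>+z. ennreal \<bar>u\<bar> * (ennreal (normal_density 0 \<sigma> u * normal_density 0 \<sigma> (0 + u * z)) * indicator {v. R (u * (c * u + d * v))} (0 + u * z)) \<partial>lborel)"
        by (rule nn_integral_cmult[symmetric]) measurable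
      also have "\<dots> = (\<integral>\<^sup>+z. ennreal (\<bar>u\<bar> * normal_density 0 \<sigma> u * normal_density 0 \<sigma> (u * z)) * indicator {z. R (c + d * z)} z \<partial>lborel)"
        by (intro nn_integral_cong) (auto simp: indicator_def eq ennreal_mult[symmetric] mult.assoc)
      finally show ?case .
    qed
  qed
  also have "\<dots> = (\<integral>\<^sup>+z. \<integral>\<^sup>+u. ennreal (\<bar>u\<bar> * normal_density 0 \<sigma> u * normal_density 0 \<sigma> (u * z)) *
      indicator {z. R (c + d * z)} z \<partial>lborel \<partial>lborel)"
    by (rule lborel_pair.Fubini'[symmetric]) (measurable)
  also have "\<dots> = (\<integral>\<^sup>+z. ennreal (1 / (pi * (1 + z\<^sup>2))) * indicator {z. R (c + d * z)} z \<partial>lborel)"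
  proof (rule nn_integral_cong)
    fix z :: real
    define q where "q = (1 + z\<^sup>2) / (2 * \<sigma>\<^sup>2)"
    have z1: "1 + z\<^sup>2 > 0" by (smt (verit) zero_le_power2)
    have q: "q > 0" using \<sigma> z1 by (simp add: q_def)
    have e: "\<bar>u\<bar> * normal_density 0 \<sigma> u * normal_density 0 \<sigma> (u * z) = 1 / (2 * pi * \<sigma>\<^sup>2) * (\<bar>u\<bar> * exp (- q * u\<^sup>2))" for u
    proof -
      have "exp (- q * u\<^sup>2) = exp (- u\<^sup>2 / (2 * \<sigma>\<^sup>2)) * exp (- (u * z)\<^sup>2 / (2 * \<sigma>\<^sup>2))"
        unfolding exp_add[symmetric] using \<sigma> by (simp add: q_def power_mult_distrib field_simps)
      moreover have "sqrt (2 * pi * \<sigma>\<^sup>2) * sqrt (2 * pi * \<sigma>\<^sup>2) = 2 * pi * \<sigma>\<^sup>2" by simp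
      ultimately show ?thesis by (simp add: normal_density_def field_simps)
    qed
    have "(\<integral>\<^sup>+u. ennreal (\<bar>u\<bar> * normal_density 0 \<sigma> u * normal_density 0 \<sigma> (u * z)) * indicator {z. R (c + d * z)} z \<partial>lborel)
        = (\<integral>\<^sup>+u. ennreal (1 / (2 * pi * \<sigma>\<^sup>2)) * ennreal (\<bar>u\<bar> * exp (- q * u\<^sup>2)) \<partial>lborel) * indicator {z. R (c + d * z)} z"
      unfolding e by (subst nn_integral_multc) (measurable, simp add: ennreal_mult'[symmetric])
    also have "(\<integral>\<^sup>+u. ennreal (1 / (2 * pi * \<sigma>\<^sup>2)) * ennreal (\<bar>u\<bar> * exp (- q * u\<^sup>2)) \<partial>lborel) = ennreal (1 / (2 * pi * \<sigma>\<^sup>2)) * ennreal (1 / q)"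
      by (subst nn_integral_cmult) (auto simp: nn_integral_abs_gauss[OF q, simplified])
    also have "\<dots> = ennreal (1 / (2 * pi * \<sigma>\<^sup>2) * (1 / q))" using q by (intro ennreal_mult[symmetric]) auto
    also have "1 / (2 * pi * \<sigma>\<^sup>2) * (1 / q) = 1 / (pi * (1 + z\<^sup>2))" using \<sigma> z1 by (simp add: q_def field_simps)
    finally show "(\<integral>\<^sup>+u. ennreal (\<bar>u\<bar> * normal_density 0 \<sigma> u * normal_density 0 \<sigma> (u * z)) * indicator {z. R (c + d * z)} z \<partial>lborel)
      = ennreal (1 / (pi * (1 + z\<^sup>2))) * indicator {z. R (c + d * z)} z" .
  qed
  \<comment> \<open>Reflection turns the condition into \<open>z \<ge> c / d\<close>, up to the
    single point where \<open>c = d * z\<close>.\<close>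
  also have "\<dots> = (\<integral>\<^sup>+z. ennreal (1 / (pi * (1 + z\<^sup>2))) * indicator {z. R (c - d * z)} z \<partial>lborel)"
    by (subst nn_integral_real_affine[where c="-1" and t=0]) (auto simp: indicator_def intro!: nn_integral_cong)
  also have "\<dots> = (\<integral>\<^sup>+z. ennreal (1 / (pi * (1 + z\<^sup>2))) * indicator {c / d..} z \<partial>lborel)"
  proof (rule nn_integral_cong_AE)
    show "AE z in lborel. ennreal (1 / (pi * (1 + z\<^sup>2))) * indicator {z. R (c - d * z)} z = ennreal (1 / (pi * (1 + z\<^sup>2))) * indicator {c / d..} z"
      using AE_lborel_singleton[of "c / d"]
    proof eventually_elim
      case (elim z)
      then have "c \<noteq> d * z" using d by (auto simp: field_simps)
      then show ?case using d R unfolding sgnrel_def by (auto simp: indicator_def field_simps)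
    qed
  qed
  also have "\<dots> = ennreal (1 / 2 - arctan (c / d) / pi)" by (rule nn_integral_Cauchy_tail)
  finally show ?thesis .
qed

section \<open>Central limit theorem for pairs of linear forms\<close>

abbreviation std_normal :: "real measure" where "std_normal \<equiv> std_normal_distribution"

text \<open>The Gaussian is its own Fourier transform, so its density is an average of characters
  over a standard normal frequency.\<close>

lemma normal_density_fourier:
  assumes e: "e > 0"
  shows "complex_of_real (normal_density x e u) =
    complex_of_real (1 / (sqrt (2 * pi) * e)) * (CLINT g|std_normal. iexp ((u - x) / e * g))"
proof -
  have "(CLINT g|std_normal. iexp ((u - x) / e * g)) = char std_normal ((u - x) / e)"
    unfolding char_def ..
  also have "\<dots> = complex_of_real (exp (- ((u - x) / e)\<^sup>2 / 2))"
    by (simp add: char_std_normal_distribution)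
  finally have *: "(CLINT g|std_normal. iexp ((u - x) / e * g)) = complex_of_real (exp (- ((u - x) / e)\<^sup>2 / 2))" .
  have "sqrt (2 * pi * e\<^sup>2) = sqrt (2 * pi) * e" using e by (simp add: real_sqrt_mult)
  then have nd: "normal_density x e u = 1 / (sqrt (2 * pi) * e) * exp (- ((u - x) / e)\<^sup>2 / 2)"
    unfolding normal_density_def by (simp add: power_divide mult.commute)
  show ?thesis unfolding * nd by (rule of_real_mult)
qed

text \<open>The density at \<open>u\<close> of a standard normal variable plus independent noise of
  width \<open>e\<close>: as a convolution on the left, by averaging the Fourier form of the noise
  on the right. It identifies the limit in \<open>pd_tendsto\<close>.\<close>

lemma gauss_conv_fourier:
  assumes e: "e > 0"
  shows "complex_of_real (normal_density 0 (sqrt (1 + e\<^sup>2)) u) =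
    complex_of_real (1 / (sqrt (2 * pi) * e)) *
      (CLINT g|std_normal. iexp (u / e * g) * complex_of_real (exp (- (g / e)\<^sup>2 / 2)))"
proof -
  interpret N: prob_space std_normal by (rule prob_space_normal_density) simp
  interpret NN: pair_prob_space std_normal std_normal ..
  define K where "K = 1 / (sqrt (2 * pi) * e)"
  have nd: "0 \<le> normal_density x e u \<and> normal_density x e u \<le> K" for x
  proof -
    have "sqrt (2 * pi * e\<^sup>2) = sqrt (2 * pi) * e" using e by (simp add: real_sqrt_mult)
    then have "normal_density x e u = K * exp (- (u - x)\<^sup>2 / (2 * e\<^sup>2))" by (simp add: normal_density_def K_def)
    moreover have "K * exp (- (u - x)\<^sup>2 / (2 * e\<^sup>2)) \<le> K * 1"
      using e by (intro mult_left_mono) (auto simp: K_def)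
    moreover have "K \<ge> 0" using e by (simp add: K_def)
    ultimately show ?thesis by simp
  qed
  have m [measurable]: "(\<lambda>x. normal_density x e u) \<in> borel_measurable borel"
    unfolding normal_density_def by measurable
  have "ennreal (LINT x|std_normal. normal_density x e u) = (\<integral>\<^sup>+x. ennreal (normal_density x e u) \<partial>std_normal)"
    by (rule nn_integral_eq_integral[symmetric]) (auto intro!: N.integrable_const_bound[where B=K] simp: nd)
  also have "\<dots> = (\<integral>\<^sup>+x. ennreal (normal_density 0 e (u - x) * normal_density 0 1 x) \<partial>lborel)"
    by (subst nn_integral_density)
       (auto simp: ennreal_mult'[symmetric] mult.commute normal_density_def intro!: nn_integral_cong)
  also have "\<dots> = ennreal (normal_density 0 (sqrt (e\<^sup>2 + 1\<^sup>2)) u)"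
    using fun_cong[OF conv_normal_density_zero_mean[OF e zero_less_one], of u] by simp
  finally have "(LINT x|std_normal. normal_density x e u) = normal_density 0 (sqrt (1 + e\<^sup>2)) u"
    by (subst (asm) ennreal_inj) (auto intro!: integral_nonneg_AE simp: nd add.commute)
  then have "complex_of_real (normal_density 0 (sqrt (1 + e\<^sup>2)) u) = (CLINT x|std_normal. complex_of_real (normal_density x e u))"
    by (metis integral_complex_of_real)
  also have "\<dots> = K * (CLINT x|std_normal. CLINT g|std_normal. iexp ((u - x) / e * g))"
    by (simp add: normal_density_fourier[OF e] K_def)
  also have "(CLINT x|std_normal. CLINT g|std_normal. iexp ((u - x) / e * g)) = (CLINT g|std_normal. CLINT x|std_normal. iexp ((u - x) / e * g))"
    by (rule NN.Fubini_integral[symmetric]) (auto intro!: NN.integrable_const_bound[where B=1])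
  also have "\<dots> = (CLINT g|std_normal. iexp (u / e * g) * complex_of_real (exp (- (g / e)\<^sup>2 / 2)))"
  proof (rule Bochner_Integration.integral_cong[OF refl])
    fix g
    have "(CLINT x|std_normal. iexp ((u - x) / e * g)) = (CLINT x|std_normal. iexp (u / e * g) * iexp ((- g / e) * x))"
      unfolding exp_add[symmetric] by (intro Bochner_Integration.integral_cong[OF refl]) (simp add: field_simps diff_divide_distrib)
    also have "\<dots> = iexp (u / e * g) * char std_normal (- g / e)"
      unfolding char_def by simp
    also have "\<dots> = iexp (u / e * g) * complex_of_real (exp (- (g / e)\<^sup>2 / 2))"
      by (simp add: char_std_normal_distribution power_divide)
    finally show "(CLINT x|std_normal. iexp ((u - x) / e * g)) = iexp (u / e * g) * complex_of_real (exp (- (g / e)\<^sup>2 / 2))" .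
  qed
  finally show ?thesis by (simp add: K_def)
qed

text \<open>Gaussian smoothing of width \<open>e\<close> centred at \<open>(x, w)\<close>.\<close>

definition gk :: "real \<Rightarrow> real \<Rightarrow> real \<Rightarrow> real \<times> real \<Rightarrow> real" where
  "gk e x w z = normal_density x e (fst z) * normal_density w e (snd z)"

lemma gk_measurable [measurable]:
  assumes [measurable]: "f \<in> borel_measurable N" "g \<in> borel_measurable N" "h \<in> N \<rightarrow>\<^sub>M (lborel \<Otimes>\<^sub>M lborel)"
  shows "(\<lambda>x. gk e (f x) (g x) (h x)) \<in> borel_measurable N"
proof -
  have [measurable]: "(\<lambda>x. fst (h x)) \<in> borel_measurable N" "(\<lambda>x. snd (h x)) \<in> borel_measurable N"
    using measurable_comp[OF assms(3) measurable_fst] measurable_comp[OF assms(3) measurable_snd] by (auto simp: o_def)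
  show ?thesis unfolding gk_def normal_density_def by measurable
qed

lemma gk_nonneg [simp]: "0 \<le> gk e x w z"
  by (simp add: gk_def)

lemma gk_le:
  assumes e: "e > 0"
  shows "gk e x w z \<le> 1 / (2 * pi * e\<^sup>2)"
proof -
  have "gk e x w z = 1 / (sqrt (2 * pi * e\<^sup>2) * sqrt (2 * pi * e\<^sup>2)) *
      exp (- (fst z - x)\<^sup>2 / (2 * e\<^sup>2)) * exp (- (snd z - w)\<^sup>2 / (2 * e\<^sup>2))"
    unfolding gk_def normal_density_def by simp
  also have "sqrt (2 * pi * e\<^sup>2) * sqrt (2 * pi * e\<^sup>2) = 2 * pi * e\<^sup>2" by simp
  also have "1 / (2 * pi * e\<^sup>2) * exp (- (fst z - x)\<^sup>2 / (2 * e\<^sup>2)) * exp (- (snd z - w)\<^sup>2 / (2 * e\<^sup>2))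
      \<le> 1 / (2 * pi * e\<^sup>2) * 1 * 1"
    using e by (intro mult_mono) auto
  finally show ?thesis by simp
qed

lemma normal_nn_total: "e > 0 \<Longrightarrow> (\<integral>\<^sup>+u. ennreal (normal_density x e u) \<partial>lborel) = 1"
  by (subst nn_integral_eq_integral) auto

lemma gk_total:
  assumes e: "e > 0"
  shows "(\<integral>\<^sup>+z. ennreal (gk e x w z) \<partial>(lborel \<Otimes>\<^sub>M lborel)) = 1"
proof -
  have "(\<integral>\<^sup>+z. ennreal (gk e x w z) \<partial>(lborel \<Otimes>\<^sub>M lborel)) =
      (\<integral>\<^sup>+u. \<integral>\<^sup>+v. ennreal (gk e x w (u, v)) \<partial>lborel \<partial>lborel)"
    by (rule lborel.nn_integral_fst[symmetric]) measurable
  also have "\<dots> = (\<integral>\<^sup>+u. ennreal (normal_density x e u) * (\<integral>\<^sup>+v. ennreal (normal_density w e v) \<partial>lborel) \<partial>lborel)"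
    by (subst nn_integral_cmult[symmetric]) (auto simp: gk_def ennreal_mult)
  also have "\<dots> = 1" using normal_nn_total[OF e] by simp
  finally show ?thesis .
qed

lemma normal_tail:
  assumes e: "e > 0" and \<eta>: "\<eta> > 0"
  shows "(\<integral>\<^sup>+u. ennreal (normal_density x e u) * indicator {u. \<bar>u - x\<bar> \<ge> \<eta>} u \<partial>lborel) \<le> ennreal (e\<^sup>2 / \<eta>\<^sup>2)"
proof -
  have "(\<integral>\<^sup>+u. ennreal (normal_density x e u) * indicator {u. \<bar>u - x\<bar> \<ge> \<eta>} u \<partial>lborel)
      \<le> (\<integral>\<^sup>+u. ennreal (normal_density x e u * (u - x)\<^sup>2 / \<eta>\<^sup>2) \<partial>lborel)"
  proof (rule nn_integral_mono)
    fix u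
    show "ennreal (normal_density x e u) * indicator {u. \<bar>u - x\<bar> \<ge> \<eta>} u \<le> ennreal (normal_density x e u * (u - x)\<^sup>2 / \<eta>\<^sup>2)"
    proof (cases "\<bar>u - x\<bar> \<ge> \<eta>")
      case True
      then have "\<eta>\<^sup>2 \<le> (u - x)\<^sup>2" using \<eta> by (simp add: abs_le_square_iff[symmetric])
      then have "normal_density x e u * 1 \<le> normal_density x e u * ((u - x)\<^sup>2 / \<eta>\<^sup>2)"
        using \<eta> by (intro mult_left_mono) auto
      then show ?thesis using True by (auto intro!: ennreal_leI)
    qed simp
  qed
  also have "\<dots> = ennreal (LINT u|lborel. normal_density x e u * (u - x)\<^sup>2 / \<eta>\<^sup>2)"
    using integrable_normal_moment[OF e, of x 2] by (intro nn_integral_eq_integral) auto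
  also have "(LINT u|lborel. normal_density x e u * (u - x)\<^sup>2 / \<eta>\<^sup>2) = e\<^sup>2 / \<eta>\<^sup>2"
    using integral_normal_moment_even[OF e, of x 1] by (simp add: fact_numeral)
  finally show ?thesis .
qed

text \<open>If the noise is smaller than \<open>\<eta>\<close> in both coordinates and both linear
  forms exceed \<open>2 * \<eta>\<close> in absolute value, no sign changes; the bounds on
  \<open>c\<close> and \<open>d\<close> make the second form move by less than
  \<open>2 * \<eta>\<close>. The remaining cases are the two strips and Chebyshev's bound for the
  noise. The hypothesis \<open>stable\<close> fits sectors and their complements alike.\<close>

lemma gk_sector_le:
  assumes e: "e > 0" and \<eta>: "\<eta> > 0" and cd: "\<bar>c\<bar> \<le> 1" "\<bar>d\<bar> \<le> 1"
    and A [measurable]: "A \<in> sets (lborel \<Otimes>\<^sub>M lborel)"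
    and stable: "\<And>u v. \<bar>u - x\<bar> < \<bar>x\<bar> \<Longrightarrow> \<bar>(c * u + d * v) - (c * x + d * w)\<bar> < \<bar>c * x + d * w\<bar> \<Longrightarrow>
        (u, v) \<in> A \<Longrightarrow> (x, w) \<in> A"
  shows "(\<integral>\<^sup>+z. ennreal (gk e x w z) * indicator A z \<partial>(lborel \<Otimes>\<^sub>M lborel)) \<le>
     indicator A (x, w) + indicator {x. \<bar>x\<bar> \<le> 2 * \<eta>} x + indicator {y. \<bar>y\<bar> \<le> 2 * \<eta>} (c * x + d * w)
     + ennreal (2 * e\<^sup>2 / \<eta>\<^sup>2)" (is "?L \<le> _")
proof (cases "(x, w) \<in> A \<or> \<bar>x\<bar> \<le> 2 * \<eta> \<or> \<bar>c * x + d * w\<bar> \<le> 2 * \<eta>")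
  case True
  have "?L \<le> (\<integral>\<^sup>+z. ennreal (gk e x w z) \<partial>(lborel \<Otimes>\<^sub>M lborel))"
    by (intro nn_integral_mono) (auto simp: indicator_def)
  also have "\<dots> = 1" by (rule gk_total[OF e])
  also have "1 \<le> indicator A (x, w) + indicator {x. \<bar>x\<bar> \<le> 2 * \<eta>} x + indicator {y. \<bar>y\<bar> \<le> 2 * \<eta>} (c * x + d * w)
     + ennreal (2 * e\<^sup>2 / \<eta>\<^sup>2)"
    using True by (auto simp: indicator_def add_increasing add_increasing2)
  finally show ?thesis .
next
  case False
  have far: "\<bar>u - x\<bar> \<ge> \<eta> \<or> \<bar>v - w\<bar> \<ge> \<eta>" if "(u, v) \<in> A" for u v
  proof (rule ccontr)
    assume "\<not> ?thesis"
    then have uv: "\<bar>u - x\<bar> < \<eta>" "\<bar>v - w\<bar> < \<eta>" by auto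
    have "\<bar>(c * u + d * v) - (c * x + d * w)\<bar> = \<bar>c * (u - x) + d * (v - w)\<bar>" by (simp add: algebra_simps)
    also have "\<dots> \<le> \<bar>c\<bar> * \<bar>u - x\<bar> + \<bar>d\<bar> * \<bar>v - w\<bar>" by (metis abs_mult abs_triangle_ineq)
    also have "\<dots> \<le> 1 * \<bar>u - x\<bar> + 1 * \<bar>v - w\<bar>" using cd by (intro add_mono mult_right_mono) auto
    also have "\<dots> < 2 * \<eta>" using uv by simp
    finally have "\<bar>(c * u + d * v) - (c * x + d * w)\<bar> < \<bar>c * x + d * w\<bar>" using False by linarith
    moreover have "\<bar>u - x\<bar> < \<bar>x\<bar>" using uv False \<eta> by linarith
    ultimately show False using stable[of u v] that False by blast
  qed
  have "?L \<le> (\<integral>\<^sup>+z. ennreal (gk e x w z) * indicator {z. \<bar>fst z - x\<bar> \<ge> \<eta>} z + ennreal (gk e x w z) * indicator {z. \<bar>snd z - w\<bar> \<ge> \<eta>} z \<partial>(lborel \<Otimes>\<^sub>M lborel))"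
  proof (rule nn_integral_mono)
    fix z :: "real \<times> real"
    show "ennreal (gk e x w z) * indicator A z \<le> ennreal (gk e x w z) * indicator {z. \<bar>fst z - x\<bar> \<ge> \<eta>} z + ennreal (gk e x w z) * indicator {z. \<bar>snd z - w\<bar> \<ge> \<eta>} z"
      using far[of "fst z" "snd z"] by (auto simp: indicator_def)
  qed
  also have "\<dots> = (\<integral>\<^sup>+z. ennreal (gk e x w z) * indicator {z. \<bar>fst z - x\<bar> \<ge> \<eta>} z \<partial>(lborel \<Otimes>\<^sub>M lborel)) + (\<integral>\<^sup>+z. ennreal (gk e x w z) * indicator {z. \<bar>snd z - w\<bar> \<ge> \<eta>} z \<partial>(lborel \<Otimes>\<^sub>M lborel))"
    by (rule nn_integral_add) measurable
  also have "(\<integral>\<^sup>+z. ennreal (gk e x w z) * indicator {z. \<bar>fst z - x\<bar> \<ge> \<eta>} z \<partial>(lborel \<Otimes>\<^sub>M lborel))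
      = (\<integral>\<^sup>+u. \<integral>\<^sup>+v. ennreal (gk e x w (u, v)) * indicator {z. \<bar>fst z - x\<bar> \<ge> \<eta>} (u, v) \<partial>lborel \<partial>lborel)"
    by (rule lborel.nn_integral_fst[symmetric]) measurable
  also have "\<dots> = (\<integral>\<^sup>+u. (ennreal (normal_density x e u) * indicator {u. \<bar>u - x\<bar> \<ge> \<eta>} u) * (\<integral>\<^sup>+v. ennreal (normal_density w e v) \<partial>lborel) \<partial>lborel)"
    by (subst nn_integral_cmult[symmetric]) (auto simp: gk_def ennreal_mult indicator_def intro!: nn_integral_cong)
  also have "\<dots> \<le> ennreal (e\<^sup>2 / \<eta>\<^sup>2)" using normal_nn_total[OF e] normal_tail[OF e \<eta>] by simp
  also have "(\<integral>\<^sup>+z. ennreal (gk e x w z) * indicator {z. \<bar>snd z - w\<bar> \<ge> \<eta>} z \<partial>(lborel \<Otimes>\<^sub>M lborel))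
      = (\<integral>\<^sup>+u. \<integral>\<^sup>+v. ennreal (gk e x w (u, v)) * indicator {z. \<bar>snd z - w\<bar> \<ge> \<eta>} (u, v) \<partial>lborel \<partial>lborel)"
    by (rule lborel.nn_integral_fst[symmetric]) measurable
  also have "\<dots> = (\<integral>\<^sup>+u. ennreal (normal_density x e u) * (\<integral>\<^sup>+v. ennreal (normal_density w e v) * indicator {v. \<bar>v - w\<bar> \<ge> \<eta>} v \<partial>lborel) \<partial>lborel)"
    by (subst nn_integral_cmult[symmetric]) (auto simp: gk_def ennreal_mult indicator_def intro!: nn_integral_cong)
  also have "\<dots> \<le> (\<integral>\<^sup>+u. ennreal (normal_density x e u) * ennreal (e\<^sup>2 / \<eta>\<^sup>2) \<partial>lborel)"
    by (intro nn_integral_mono mult_left_mono normal_tail[OF e \<eta>]) auto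
  also have "\<dots> = ennreal (e\<^sup>2 / \<eta>\<^sup>2)"
    using normal_nn_total[OF e] by (simp add: nn_integral_multc)
  also have "ennreal (e\<^sup>2 / \<eta>\<^sup>2) + ennreal (e\<^sup>2 / \<eta>\<^sup>2) = ennreal (2 * e\<^sup>2 / \<eta>\<^sup>2)"
    by (subst ennreal_plus[symmetric]) auto
  finally show ?thesis by (simp add: add_increasing)
qed

section \<open>Limits of characteristic functions and of smoothed densities\<close>

context iid_std
begin

lemma exp_quadratic_approx:
  assumes "y \<ge> (0::real)"
  shows "\<bar>exp (- y) - (1 - y)\<bar> \<le> y\<^sup>2"
proof -
  have "1 - y \<le> exp (- y)" using exp_ge_add_one_self[of "- y"] by simp
  moreover have "exp (- y) \<le> 1 / (1 + y)"
    using exp_ge_add_one_self[of y] assms by (simp add: exp_minus field_simps)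
  moreover have "1 / (1 + y) \<le> 1 - y + y\<^sup>2"
  proof -
    have "(1 - y + y\<^sup>2) * (1 + y) = 1 + y ^ 3" by (simp add: algebra_simps power2_eq_square power3_eq_cube)
    then show ?thesis using assms by (simp add: divide_le_eq)
  qed
  ultimately show ?thesis by simp
qed

text \<open>Factor by factor replacement of \<open>\<phi>\<close> by the Gaussian: the errors are
  \<open>2 * e' * (a k)\<^sup>2\<close> and add up, since all factors have modulus at most 1. The
  threshold \<open>\<eta>\<close> is common to all coefficient sequences, which is what arrays
  require.\<close>

lemma cf_gauss_approx:
  assumes T: "T \<ge> 0" and \<epsilon>: "\<epsilon> > 0"
  shows "\<exists>\<eta>>0. \<forall>a. summable (\<lambda>k. \<bar>a k\<bar>) \<longrightarrow> (\<Sum>k. (a k)\<^sup>2) \<le> T \<longrightarrow> (\<forall>k. \<bar>a k\<bar> \<le> \<eta>) \<longrightarrow>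
    norm (cf a - exp (- (\<Sum>k. (a k)\<^sup>2) / 2)) \<le> \<epsilon>"
proof -
  \<comment> \<open>The total error \<open>2 * e' * T\<close> then stays below
    \<open>\<epsilon>\<close>; \<open>T + 1\<close> covers \<open>T = 0\<close>.\<close>
  define e' where "e' = \<epsilon> / (2 * (T + 1))"
  have e': "e' > 0" using T \<epsilon> by (simp add: e'_def)
  obtain \<eta>0 where \<eta>0: "\<eta>0 > 0" "\<And>u. \<bar>u\<bar> \<le> \<eta>0 \<Longrightarrow> norm (\<phi> u - (1 - u\<^sup>2 / 2)) \<le> e' * u\<^sup>2"
    using phi_approx[OF e'] by auto
  define \<eta> where "\<eta> = min \<eta>0 (sqrt e')"
  have \<eta>: "\<eta> > 0" using \<eta>0 e' by (simp add: \<eta>_def)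
  have point: "norm (\<phi> u - of_real (exp (- u\<^sup>2 / 2))) \<le> 2 * e' * u\<^sup>2" if u: "\<bar>u\<bar> \<le> \<eta>" for u
  proof -
    have "u\<^sup>2 \<le> (sqrt e')\<^sup>2" using u by (intro abs_le_square_iff[THEN iffD1]) (auto simp: \<eta>_def)
    then have ue: "u\<^sup>2 \<le> e'" using e' by simp
    have "\<bar>exp (- (u\<^sup>2 / 2)) - (1 - u\<^sup>2 / 2)\<bar> \<le> (u\<^sup>2 / 2)\<^sup>2" by (rule exp_quadratic_approx) simp
    also have "\<dots> = u\<^sup>2 * u\<^sup>2 / 4" by (simp add: power2_eq_square)
    also have "\<dots> \<le> e' * u\<^sup>2"
    proof -
      have "u\<^sup>2 * u\<^sup>2 \<le> e' * u\<^sup>2" using ue by (intro mult_right_mono) auto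
      moreover have "0 \<le> u\<^sup>2 * u\<^sup>2" by simp
      ultimately show ?thesis by linarith
    qed
    finally have "norm (complex_of_real (1 - u\<^sup>2 / 2) - of_real (exp (- u\<^sup>2 / 2))) \<le> e' * u\<^sup>2"
      unfolding of_real_diff[symmetric] norm_of_real by (simp add: abs_minus_commute)
    moreover have "norm (\<phi> u - complex_of_real (1 - u\<^sup>2 / 2)) \<le> e' * u\<^sup>2"
      using \<eta>0(2)[of u] u by (simp add: \<eta>_def)
    ultimately show ?thesis
      using norm_diff_triangle_ineq[of "\<phi> u" "complex_of_real (1 - u\<^sup>2 / 2)" "complex_of_real (1 - u\<^sup>2 / 2)" "of_real (exp (- u\<^sup>2 / 2))"]
      by simp
  qed
  show ?thesis
  proof (intro exI[of _ \<eta>] conjI allI impI \<eta>)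
    fix a assume a: "summable (\<lambda>k. \<bar>a k\<bar>)" "(\<Sum>k. (a k)\<^sup>2) \<le> T" "\<forall>k. \<bar>a k\<bar> \<le> \<eta>"
    note sq = summable_sq[OF a(1)]
    have lim: "(\<lambda>K. norm ((\<Prod>k<K. \<phi> (a k)) - (\<Prod>k<K. complex_of_real (exp (- (a k)\<^sup>2 / 2)))))
        \<longlonglongrightarrow> norm (cf a - exp (- (\<Sum>k. (a k)\<^sup>2) / 2))"
    proof (intro tendsto_norm tendsto_diff cf_prod[OF a(1)])
      have "(\<lambda>K. complex_of_real (exp (- (\<Sum>k<K. (a k)\<^sup>2) / 2))) \<longlonglongrightarrow> complex_of_real (exp (- (\<Sum>k. (a k)\<^sup>2) / 2))"
        by (intro tendsto_intros summable_LIMSEQ sq) simp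
      moreover have "(\<Prod>k<K. complex_of_real (exp (- (a k)\<^sup>2 / 2))) = complex_of_real (exp (- (\<Sum>k<K. (a k)\<^sup>2) / 2))" for K
        unfolding of_real_prod[symmetric] exp_sum[OF finite_lessThan, symmetric]
        by (simp add: sum_negf sum_divide_distrib)
      ultimately show "(\<lambda>K. \<Prod>k<K. complex_of_real (exp (- (a k)\<^sup>2 / 2))) \<longlonglongrightarrow> exp (- (\<Sum>k. (a k)\<^sup>2) / 2)"
        by (simp flip: exp_of_real)
    qed
    show "norm (cf a - exp (- (\<Sum>k. (a k)\<^sup>2) / 2)) \<le> \<epsilon>"
    proof (rule tendsto_upperbound[OF lim])
      have "norm ((\<Prod>k<K. \<phi> (a k)) - (\<Prod>k<K. complex_of_real (exp (- (a k)\<^sup>2 / 2)))) \<le> \<epsilon>" for K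
      proof -
        have "norm ((\<Prod>k<K. \<phi> (a k)) - (\<Prod>k<K. complex_of_real (exp (- (a k)\<^sup>2 / 2))))
            \<le> (\<Sum>k<K. norm (\<phi> (a k) - complex_of_real (exp (- (a k)\<^sup>2 / 2))))"
          by (rule norm_prod_diff) (auto simp: norm_phi_le_1)
        also have "\<dots> \<le> (\<Sum>k<K. 2 * e' * (a k)\<^sup>2)"
          using a(3) by (intro sum_mono point) auto
        also have "\<dots> = 2 * e' * (\<Sum>k<K. (a k)\<^sup>2)" by (simp add: sum_distrib_left)
        also have "\<dots> \<le> 2 * e' * T"
          using e' a(2) sum_le_suminf[OF sq, of "{..<K}"] by (intro mult_left_mono) auto
        also have "\<dots> \<le> \<epsilon>" using T \<epsilon> by (simp add: e'_def field_simps)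
        finally show ?thesis .
      qed
      then show "\<forall>\<^sub>F K in sequentially. norm ((\<Prod>k<K. \<phi> (a k)) - (\<Prod>k<K. complex_of_real (exp (- (a k)\<^sup>2 / 2)))) \<le> \<epsilon>"
        by simp
    qed simp
  qed
qed

text \<open>The density of \<open>(rs a, rs b)\<close> plus independent Gaussian noise of width \<open>e\<close>.\<close>

definition pd :: "(nat \<Rightarrow> real) \<Rightarrow> (nat \<Rightarrow> real) \<Rightarrow> real \<Rightarrow> real \<times> real \<Rightarrow> real" where
  "pd a b e z = expectation (\<lambda>\<omega>. gk e (rs a \<omega>) (rs b \<omega>) z)"

lemma gk_integrable:
  assumes "e > 0"
  shows "integrable M (\<lambda>\<omega>. gk e (rs a \<omega>) (rs b \<omega>) z)"
proof (rule integrable_const_bound[where B="1 / (2 * pi * e\<^sup>2)"])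
  show "(\<lambda>\<omega>. gk e (rs a \<omega>) (rs b \<omega>) z) \<in> borel_measurable M"
    unfolding gk_def normal_density_def by measurable
qed (use gk_le[OF assms] in auto)

lemma rs_lincomb:
  assumes "summable (\<lambda>k. \<bar>a k\<bar>)" "summable (\<lambda>k. \<bar>b k\<bar>)"
  shows "AE \<omega> in M. rs (\<lambda>k. s * a k + t * b k) \<omega> = s * rs a \<omega> + t * rs b \<omega>"
  using rs_sums[OF assms(1)] rs_sums[OF assms(2)]
proof eventually_elim
  case (elim \<omega>)
  have "(\<lambda>k. s * (a k * \<xi> k \<omega>) + t * (b k * \<xi> k \<omega>)) sums (s * rs a \<omega> + t * rs b \<omega>)"
    by (intro sums_add sums_mult elim)
  then show ?case unfolding rs_def[of "\<lambda>k. s * a k + t * b k"]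
    by (simp add: sums_iff algebra_simps)
qed

lemma cf_lincomb:
  assumes "summable (\<lambda>k. \<bar>a k\<bar>)" "summable (\<lambda>k. \<bar>b k\<bar>)"
  shows "cf (\<lambda>k. s * a k + t * b k) = (CLINT \<omega>|M. iexp (s * rs a \<omega> + t * rs b \<omega>))"
  unfolding cf_def
  by (rule integral_cong_AE) (measurable, use rs_lincomb[OF assms, of s t] in eventually_elim, simp)

text \<open>Both coordinates of the noise are written as normal averages of characters, and Fubini
  moves the expectation inside. Thus the smoothed density depends on the pair only through
  \<open>cf\<close> of its linear combinations.\<close>

lemma pd_fourier:
  assumes a: "summable (\<lambda>k. \<bar>a k\<bar>)" and b: "summable (\<lambda>k. \<bar>b k\<bar>)" and e: "e > 0"
  shows "complex_of_real (pd a b e (u, v)) = complex_of_real ((1 / (sqrt (2 * pi) * e))\<^sup>2) *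
    (CLINT g|std_normal. CLINT h|std_normal. iexp (u / e * g) * iexp (v / e * h) *
       cf (\<lambda>k. (- g / e) * a k + (- h / e) * b k))"
proof -
  interpret N: prob_space std_normal by (rule prob_space_normal_density) simp
  interpret MN: pair_prob_space M std_normal ..
  define K where "K = 1 / (sqrt (2 * pi) * e)"
  define X where "X = rs a" define W where "W = rs b"
  have [measurable]: "X \<in> borel_measurable M" "W \<in> borel_measurable M" by (auto simp: X_def W_def)
  let ?f = "\<lambda>\<omega> g h. iexp ((u - X \<omega>) / e * g) * iexp ((v - W \<omega>) / e * h)"
  have in1: "norm (CLINT h|std_normal. ?f \<omega> g h) \<le> 1" for \<omega> g
    by (rule order_trans[OF integral_norm_bound]) (simp add: norm_mult N.prob_space)
  have "complex_of_real (pd a b e (u, v)) = (CLINT \<omega>|M. complex_of_real (gk e (X \<omega>) (W \<omega>) (u, v)))"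
    unfolding pd_def X_def W_def by (rule integral_complex_of_real[symmetric])
  also have "\<dots> = (CLINT \<omega>|M. complex_of_real (K\<^sup>2) * (CLINT g|std_normal. CLINT h|std_normal. ?f \<omega> g h))"
  proof (intro Bochner_Integration.integral_cong[OF refl])
    fix \<omega>
    have F: "complex_of_real (normal_density x e u) = complex_of_real K * (CLINT g|std_normal. iexp ((u - x) / e * g))" for x u
      unfolding K_def by (rule normal_density_fourier[OF e])
    have "complex_of_real (gk e (X \<omega>) (W \<omega>) (u, v)) = complex_of_real (K\<^sup>2) *
        ((CLINT g|std_normal. iexp ((u - X \<omega>) / e * g)) * (CLINT h|std_normal. iexp ((v - W \<omega>) / e * h)))"
      unfolding gk_def fst_conv snd_conv of_real_mult[of "normal_density _ _ _"] F power2_eq_square of_real_mult[of K]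
      by (simp only: mult_ac)
    then show "complex_of_real (gk e (X \<omega>) (W \<omega>) (u, v)) = complex_of_real (K\<^sup>2) * (CLINT g|std_normal. CLINT h|std_normal. ?f \<omega> g h)"
      by (simp only: integral_mult_right_zero integral_mult_left_zero)
  qed
  also have "\<dots> = complex_of_real (K\<^sup>2) * (CLINT \<omega>|M. CLINT g|std_normal. CLINT h|std_normal. ?f \<omega> g h)"
    by simp
  also have "(CLINT \<omega>|M. CLINT g|std_normal. CLINT h|std_normal. ?f \<omega> g h)
      = (CLINT g|std_normal. CLINT \<omega>|M. CLINT h|std_normal. ?f \<omega> g h)"
    by (rule MN.Fubini_integral[symmetric], rule MN.integrable_const_bound[where B=1])
       (use in1 in auto)
  also have "\<dots> = (CLINT g|std_normal. CLINT h|std_normal. CLINT \<omega>|M. ?f \<omega> g h)"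
    by (intro Bochner_Integration.integral_cong[OF refl] MN.Fubini_integral[symmetric] MN.integrable_const_bound[where B=1])
       (auto simp: norm_mult)
  also have "\<dots> = (CLINT g|std_normal. CLINT h|std_normal. iexp (u / e * g) * iexp (v / e * h) *
       cf (\<lambda>k. (- g / e) * a k + (- h / e) * b k))"
  proof (intro Bochner_Integration.integral_cong[OF refl])
    fix g h
    have "?f \<omega> g h = (iexp (u / e * g) * iexp (v / e * h)) * iexp ((- g / e) * X \<omega> + (- h / e) * W \<omega>)" for \<omega>
      unfolding exp_add[symmetric] by (rule arg_cong[of _ _ exp]) (use e in \<open>simp add: field_simps\<close>)
    then show "(CLINT \<omega>|M. ?f \<omega> g h) = iexp (u / e * g) * iexp (v / e * h) * cf (\<lambda>k. (- g / e) * a k + (- h / e) * b k)"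
      unfolding cf_lincomb[OF a b] X_def[symmetric] W_def[symmetric] by simp
  qed
  finally show ?thesis by (simp add: K_def)
qed

text \<open>The limit of \<open>pd\<close> for asymptotically normal orthonormal pairs.\<close>

definition qd :: "real \<Rightarrow> real \<times> real \<Rightarrow> real" where
  "qd e z = normal_density 0 (sqrt (1 + e\<^sup>2)) (fst z) * normal_density 0 (sqrt (1 + e\<^sup>2)) (snd z)"

lemma qd_eq: "qd e = gk (sqrt (1 + e\<^sup>2)) 0 0"
  by (simp add: qd_def gk_def fun_eq_iff)

end

abbreviation plane :: "(real \<times> real) measure" where "plane \<equiv> lborel \<Otimes>\<^sub>M lborel"

context iid_std
begin

lemma cf_le_1: "norm (cf a) \<le> 1"
  unfolding cf_def by (rule order_trans[OF integral_norm_bound]) (simp add: prob_space)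

lemma summable_abs_lincomb:
  fixes a b :: "nat \<Rightarrow> real"
  assumes "summable (\<lambda>k. \<bar>a k\<bar>)" "summable (\<lambda>k. \<bar>b k\<bar>)"
  shows "summable (\<lambda>k. \<bar>s * a k + t * b k\<bar>)"
proof (rule summable_comparison_test')
  show "summable (\<lambda>k. \<bar>s\<bar> * \<bar>a k\<bar> + \<bar>t\<bar> * \<bar>b k\<bar>)"
    by (intro summable_add summable_mult assms)
  show "norm \<bar>s * a k + t * b k\<bar> \<le> \<bar>s\<bar> * \<bar>a k\<bar> + \<bar>t\<bar> * \<bar>b k\<bar>" for k
    by (simp add: abs_mult[symmetric] abs_triangle_ineq)
qed

lemma summable_prod:
  fixes a b :: "nat \<Rightarrow> real"
  assumes "summable (\<lambda>k. \<bar>a k\<bar>)" "summable (\<lambda>k. \<bar>b k\<bar>)"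
  shows "summable (\<lambda>k. a k * b k)"
proof (rule summable_comparison_test')
  show "summable (\<lambda>k. (a k)\<^sup>2 + (b k)\<^sup>2)"
    by (intro summable_add summable_sq assms)
  fix k
  have "2 * (\<bar>a k\<bar> * \<bar>b k\<bar>) \<le> (a k)\<^sup>2 + (b k)\<^sup>2"
    using zero_le_power2[of "\<bar>a k\<bar> - \<bar>b k\<bar>"] by (simp add: power2_diff)
  moreover have "0 \<le> \<bar>a k\<bar> * \<bar>b k\<bar>" by simp
  ultimately have "\<bar>a k\<bar> * \<bar>b k\<bar> \<le> (a k)\<^sup>2 + (b k)\<^sup>2" by linarith
  then show "norm (a k * b k) \<le> (a k)\<^sup>2 + (b k)\<^sup>2" by (simp add: abs_mult)
qed

lemma sq_sum_lincomb:
  fixes a b :: "nat \<Rightarrow> real"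
  assumes "summable (\<lambda>k. \<bar>a k\<bar>)" "summable (\<lambda>k. \<bar>b k\<bar>)"
  shows "(\<Sum>k. (s * a k + t * b k)\<^sup>2) = s\<^sup>2 * (\<Sum>k. (a k)\<^sup>2) + 2 * s * t * (\<Sum>k. a k * b k) + t\<^sup>2 * (\<Sum>k. (b k)\<^sup>2)"
proof -
  have "(\<lambda>k. s\<^sup>2 * (a k)\<^sup>2 + 2 * s * t * (a k * b k) + t\<^sup>2 * (b k)\<^sup>2) sums
      (s\<^sup>2 * (\<Sum>k. (a k)\<^sup>2) + 2 * s * t * (\<Sum>k. a k * b k) + t\<^sup>2 * (\<Sum>k. (b k)\<^sup>2))"
    by (intro sums_add sums_mult summable_sums summable_sq summable_prod assms)
  moreover have "(s * a k + t * b k)\<^sup>2 = s\<^sup>2 * (a k)\<^sup>2 + 2 * s * t * (a k * b k) + t\<^sup>2 * (b k)\<^sup>2" for k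
    by (simp add: power2_eq_square algebra_simps)
  ultimately show ?thesis by (simp add: sums_iff)
qed

end

text \<open>A sequence of pairs with vanishing coefficients, without any rate. Such a sequence
  arises from the contradiction argument in \<open>sector_clt\<close>.\<close>

locale orthonormal_arrays = iid_std M \<xi> for M :: "'w measure" and \<xi> +
  fixes A B :: "nat \<Rightarrow> nat \<Rightarrow> real" and \<eta> :: "nat \<Rightarrow> real"
  assumes A: "\<And>n. summable (\<lambda>k. \<bar>A n k\<bar>)" and B: "\<And>n. summable (\<lambda>k. \<bar>B n k\<bar>)"
    and A1: "\<And>n. (\<Sum>k. (A n k)\<^sup>2) = 1" and B1: "\<And>n. (\<Sum>k. (B n k)\<^sup>2) = 1"
    and AB: "\<And>n. (\<Sum>k. A n k * B n k) = 0"
    and small: "\<And>n k. \<bar>A n k\<bar> \<le> \<eta> n" "\<And>n k. \<bar>B n k\<bar> \<le> \<eta> n" and \<eta>: "\<eta> \<longlonglongrightarrow> 0"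
begin

text \<open>Orthonormality makes the variance of the combination equal to \<open>S\<close> for every
  \<open>n\<close>, so the coefficients may rotate with \<open>n\<close> without affecting the
  limit.\<close>

lemma cf_tendsto:
  assumes S: "\<And>n. s n ^ 2 + t n ^ 2 = S"
  shows "(\<lambda>n. cf (\<lambda>k. s n * A n k + t n * B n k)) \<longlonglongrightarrow> complex_of_real (exp (- S / 2))"
proof (rule tendstoI)
  fix \<epsilon> :: real assume \<epsilon>: "\<epsilon> > 0"
  have S0: "S \<ge> 0" using S[of 0] by (metis sum_power2_ge_zero)
  obtain e where e: "e > 0" "\<And>a. summable (\<lambda>k. \<bar>a k\<bar>) \<Longrightarrow> (\<Sum>k. (a k)\<^sup>2) \<le> S \<Longrightarrow> (\<forall>k. \<bar>a k\<bar> \<le> e) \<Longrightarrow>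
    norm (cf a - exp (- (\<Sum>k. (a k)\<^sup>2) / 2)) \<le> \<epsilon> / 2"
    using cf_gauss_approx[OF S0, of "\<epsilon> / 2"] \<epsilon> by auto
  have "(\<lambda>n. 2 * sqrt S * \<eta> n) \<longlonglongrightarrow> 2 * sqrt S * 0" by (intro tendsto_intros \<eta>)
  then have "eventually (\<lambda>n. 2 * sqrt S * \<eta> n < e) sequentially"
    using e(1) by (intro order_tendstoD) auto
  then show "eventually (\<lambda>n. dist (cf (\<lambda>k. s n * A n k + t n * B n k)) (complex_of_real (exp (- S / 2))) < \<epsilon>) sequentially"
  proof eventually_elim
    case (elim n)
    have sum: "(\<Sum>k. (s n * A n k + t n * B n k)\<^sup>2) = S"
      unfolding sq_sum_lincomb[OF A B] using A1 B1 AB S[of n] by simp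
    have st: "\<bar>s n\<bar> \<le> sqrt S" "\<bar>t n\<bar> \<le> sqrt S"
      using S[of n] by (auto intro!: real_le_rsqrt simp: power2_abs)
    have "\<bar>s n * A n k + t n * B n k\<bar> \<le> e" for k
    proof -
      have "\<bar>s n * A n k + t n * B n k\<bar> \<le> \<bar>s n\<bar> * \<bar>A n k\<bar> + \<bar>t n\<bar> * \<bar>B n k\<bar>"
        by (metis abs_mult abs_triangle_ineq)
      also have "\<dots> \<le> sqrt S * \<eta> n + sqrt S * \<eta> n"
        using S0 by (intro add_mono mult_mono st small) auto
      finally show ?thesis using elim by simp
    qed
    then have "norm (cf (\<lambda>k. s n * A n k + t n * B n k) - exp (- (\<Sum>k. (s n * A n k + t n * B n k)\<^sup>2) / 2)) \<le> \<epsilon> / 2"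
      by (intro e summable_abs_lincomb A B) (auto simp: sum)
    then show ?case using \<epsilon> by (simp add: dist_norm sum flip: exp_of_real)
  qed
qed

text \<open>Dominated convergence, first in \<open>h\<close> and then in \<open>g\<close>; the limit
  integral factorises and each factor is given by \<open>gauss_conv_fourier\<close>.\<close>

lemma pd_tendsto:
  assumes e: "e > 0"
  shows "(\<lambda>n. pd (A n) (B n) e z) \<longlonglongrightarrow> qd e z"
proof -
  interpret N: prob_space std_normal by (rule prob_space_normal_density) simp
  obtain u v where z: "z = (u, v)" by (cases z)
  define K where "K = complex_of_real (1 / (sqrt (2 * pi) * e))"
  let ?E = "\<lambda>g. complex_of_real (exp (- (g / e)\<^sup>2 / 2))"
  have meas: "(\<lambda>h. cf (\<lambda>k. (- g / e) * A n k + (- h / e) * B n k)) \<in> borel_measurable borel" for g n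
    unfolding cf_lincomb[OF A B] by measurable
  have meas2: "(\<lambda>g. CLINT h|std_normal. iexp (u / e * g) * iexp (v / e * h) * cf (\<lambda>k. (- g / e) * A n k + (- h / e) * B n k)) \<in> borel_measurable borel" for n
    unfolding cf_lincomb[OF A B] by measurable
  have in1: "norm (CLINT h|std_normal. iexp (u / e * g) * iexp (v / e * h) * cf (\<lambda>k. (- g / e) * A n k + (- h / e) * B n k)) \<le> 1" for g n
  proof (rule order_trans[OF integral_norm_bound])
    have "(LINT h|std_normal. norm (iexp (u / e * g) * iexp (v / e * h) * cf (\<lambda>k. (- g / e) * A n k + (- h / e) * B n k))) \<le> (LINT h|std_normal. 1)"
      using cf_le_1 meas[of g n]
      by (intro integral_mono N.integrable_const_bound[where B=1]) (auto simp: norm_mult)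
    then show "(LINT h|std_normal. norm (iexp (u / e * g) * iexp (v / e * h) * cf (\<lambda>k. (- g / e) * A n k + (- h / e) * B n k))) \<le> 1"
      using N.prob_space by simp
  qed
  have inner: "(\<lambda>n. CLINT h|std_normal. iexp (u / e * g) * iexp (v / e * h) * cf (\<lambda>k. (- g / e) * A n k + (- h / e) * B n k))
      \<longlonglongrightarrow> (CLINT h|std_normal. (iexp (u / e * g) * ?E g) * (iexp (v / e * h) * ?E h))" for g
  proof (rule integral_dominated_convergence[where w="\<lambda>_. 1"])
    show "AE h in std_normal. (\<lambda>n. iexp (u / e * g) * iexp (v / e * h) * cf (\<lambda>k. (- g / e) * A n k + (- h / e) * B n k))
        \<longlonglongrightarrow> (iexp (u / e * g) * ?E g) * (iexp (v / e * h) * ?E h)"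
    proof (rule AE_I2)
      fix h
      have "(\<lambda>n. cf (\<lambda>k. (- g / e) * A n k + (- h / e) * B n k)) \<longlonglongrightarrow> complex_of_real (exp (- ((g / e)\<^sup>2 + (h / e)\<^sup>2) / 2))"
        by (rule cf_tendsto) (simp add: power_divide)
      also have "complex_of_real (exp (- ((g / e)\<^sup>2 + (h / e)\<^sup>2) / 2)) = ?E g * ?E h"
        unfolding of_real_mult[symmetric] exp_add[symmetric] by (simp add: add_divide_distrib)
      finally have "(\<lambda>n. iexp (u / e * g) * iexp (v / e * h) * cf (\<lambda>k. (- g / e) * A n k + (- h / e) * B n k))
        \<longlonglongrightarrow> iexp (u / e * g) * iexp (v / e * h) * (?E g * ?E h)"
        by (intro tendsto_mult tendsto_const)
      then show "(\<lambda>n. iexp (u / e * g) * iexp (v / e * h) * cf (\<lambda>k. (- g / e) * A n k + (- h / e) * B n k))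
        \<longlonglongrightarrow> (iexp (u / e * g) * ?E g) * (iexp (v / e * h) * ?E h)"
        by (simp only: mult_ac)
    qed
    show "AE h in std_normal. norm (iexp (u / e * g) * iexp (v / e * h) * cf (\<lambda>k. (- g / e) * A n k + (- h / e) * B n k)) \<le> 1" for n
      using cf_le_1 by (simp add: norm_mult)
  qed (use meas[of g] in auto)
  have "(\<lambda>n. CLINT g|std_normal. CLINT h|std_normal. iexp (u / e * g) * iexp (v / e * h) * cf (\<lambda>k. (- g / e) * A n k + (- h / e) * B n k))
      \<longlonglongrightarrow> (CLINT g|std_normal. CLINT h|std_normal. (iexp (u / e * g) * ?E g) * (iexp (v / e * h) * ?E h))"
  proof (rule integral_dominated_convergence[where w="\<lambda>_. 1"])
    show "AE g in std_normal. (\<lambda>n. CLINT h|std_normal. iexp (u / e * g) * iexp (v / e * h) * cf (\<lambda>k. (- g / e) * A n k + (- h / e) * B n k))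
      \<longlonglongrightarrow> (CLINT h|std_normal. (iexp (u / e * g) * ?E g) * (iexp (v / e * h) * ?E h))"
      using inner by simp
    show "AE g in std_normal. norm (CLINT h|std_normal. iexp (u / e * g) * iexp (v / e * h) * cf (\<lambda>k. (- g / e) * A n k + (- h / e) * B n k)) \<le> 1" for n
      using in1 by simp
  qed (use meas2 in auto)
  also have "(CLINT g|std_normal. CLINT h|std_normal. (iexp (u / e * g) * ?E g) * (iexp (v / e * h) * ?E h))
      = (CLINT g|std_normal. iexp (u / e * g) * ?E g) * (CLINT h|std_normal. iexp (v / e * h) * ?E h)"
    by (simp only: integral_mult_right_zero integral_mult_left_zero)
  finally have lim: "(\<lambda>n. complex_of_real (pd (A n) (B n) e (u, v))) \<longlonglongrightarrow>
      K\<^sup>2 * ((CLINT g|std_normal. iexp (u / e * g) * ?E g) * (CLINT h|std_normal. iexp (v / e * h) * ?E h))"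
    unfolding pd_fourier[OF A B e] K_def of_real_power by (intro tendsto_mult tendsto_const)
  have "K\<^sup>2 * ((CLINT g|std_normal. iexp (u / e * g) * ?E g) * (CLINT h|std_normal. iexp (v / e * h) * ?E h))
      = (K * (CLINT g|std_normal. iexp (u / e * g) * ?E g)) * (K * (CLINT h|std_normal. iexp (v / e * h) * ?E h))"
    by (simp only: power2_eq_square mult_ac)
  also have "\<dots> = complex_of_real (qd e (u, v))"
    unfolding K_def gauss_conv_fourier[OF e, symmetric] by (simp add: qd_def)
  finally show ?thesis using lim unfolding z by (simp only: tendsto_of_real_iff)
qed

end

context iid_std
begin

lemma pd_measurable [measurable]: "pd a b e \<in> borel_measurable plane"
  unfolding pd_def by measurable

lemma pd_nonneg: "0 \<le> pd a b e z"
  unfolding pd_def by (rule integral_nonneg_AE) simp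

lemma pd_nn:
  assumes e: "e > 0"
  shows "ennreal (pd a b e z) = (\<integral>\<^sup>+\<omega>. ennreal (gk e (rs a \<omega>) (rs b \<omega>) z) \<partial>M)"
  unfolding pd_def by (rule nn_integral_eq_integral[symmetric]) (auto intro: gk_integrable[OF e])

lemma pd_set:
  assumes e: "e > 0" and S [measurable]: "S \<in> sets plane"
  shows "(\<integral>\<^sup>+z. ennreal (pd a b e z) * indicator S z \<partial>plane) =
    (\<integral>\<^sup>+\<omega>. \<integral>\<^sup>+z. ennreal (gk e (rs a \<omega>) (rs b \<omega>) z) * indicator S z \<partial>plane \<partial>M)"
proof -
  interpret pair_sigma_finite plane M
    by (intro pair_sigma_finite.intro sigma_finite_measure_axioms lborel_pair.sigma_finite_measure_axioms)
  have m: "(\<lambda>\<omega>. ennreal (gk e (rs a \<omega>) (rs b \<omega>) z)) \<in> borel_measurable M" for z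
    using gk_integrable[OF e] by auto
  have "(\<integral>\<^sup>+z. ennreal (pd a b e z) * indicator S z \<partial>plane)
      = (\<integral>\<^sup>+z. \<integral>\<^sup>+\<omega>. ennreal (gk e (rs a \<omega>) (rs b \<omega>) z) * indicator S z \<partial>M \<partial>plane)"
    unfolding pd_nn[OF e] by (intro nn_integral_cong nn_integral_multc[symmetric] m)
  also have "\<dots> = (\<integral>\<^sup>+\<omega>. \<integral>\<^sup>+z. ennreal (gk e (rs a \<omega>) (rs b \<omega>) z) * indicator S z \<partial>plane \<partial>M)"
    by (rule Fubini'[symmetric]) measurable
  finally show ?thesis .
qed

lemma pd_total:
  assumes e: "e > 0"
  shows "(\<integral>\<^sup>+z. ennreal (pd a b e z) \<partial>plane) = 1"
proof -
  have "UNIV \<in> sets plane" using sets.top[of plane] unfolding space_pair_measure by simp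
  from pd_set[OF e this, of a b] show ?thesis by (simp add: gk_total[OF e] emeasure_space_1)
qed

lemma qd_total: "(\<integral>\<^sup>+z. ennreal (qd e z) \<partial>plane) = 1"
  unfolding qd_eq by (rule gk_total) (simp add: add_pos_nonneg)

lemma qd_measurable [measurable]: "qd e \<in> borel_measurable plane"
  unfolding qd_eq by measurable

lemma qd_nonneg: "0 \<le> qd e z" by (simp add: qd_eq)

end

text \<open>Scheffe: pointwise convergence of probability densities gives convergence in mean, hence
  uniformly over all sets. So the test sector may vary with \<open>n\<close>.\<close>

lemma (in orthonormal_arrays) pd_L1:
  assumes e: "e > 0"
  shows "(\<lambda>n. \<integral>\<^sup>+z. ennreal \<bar>pd (A n) (B n) e z - qd e z\<bar> \<partial>plane) \<longlonglongrightarrow> 0"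
proof -
  have "(\<lambda>n. \<integral>\<^sup>+z. norm (pd (A n) (B n) e z - qd e z) \<partial>plane) \<longlonglongrightarrow> 0"
  proof (rule Scheffe_lemma1)
    show "integrable plane (pd (A n) (B n) e)" for n
      using pd_total[OF e] by (intro integrableI_nonneg) (auto simp: pd_nonneg)
    show "integrable plane (qd e)"
      using qd_total by (intro integrableI_nonneg) (auto simp: qd_nonneg)
    show "AE z in plane. (\<lambda>n. pd (A n) (B n) e z) \<longlonglongrightarrow> qd e z"
      using pd_tendsto[OF e] by simp
    show "limsup (\<lambda>n. \<integral>\<^sup>+z. norm (pd (A n) (B n) e z) \<partial>plane) \<le> (\<integral>\<^sup>+z. norm (qd e z) \<partial>plane)"
      using pd_total[OF e] qd_total by (simp add: pd_nonneg qd_nonneg Limsup_const)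
  qed
  then show ?thesis by simp
qed

section \<open>Sign sectors and removal of the smoothing\<close>

definition sector :: "(real \<Rightarrow> bool) \<Rightarrow> real \<Rightarrow> real \<Rightarrow> (real \<times> real) set" where
  "sector R c d = {z. R (fst z * (c * fst z + d * snd z))}"

lemma sector_sets [measurable]:
  assumes "sgnrel R"
  shows "sector R c d \<in> sets plane"
proof -
  note [measurable] = sgnrel_measurable[OF assms]
  have "{z \<in> space plane. R (fst z * (c * fst z + d * snd z))} \<in> sets plane" by measurable
  then show ?thesis by (simp add: sector_def space_pair_measure)
qed

lemma (in iid_std) qd_sector:
  assumes d: "d > 0" and R: "sgnrel R"
  shows "(\<integral>\<^sup>+z. ennreal (qd e z) * indicator (sector R c d) z \<partial>plane) = ennreal (1 / 2 - arctan (c / d) / pi)"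
proof -
  note [measurable] = sector_sets[OF R]
  have "(\<integral>\<^sup>+z. ennreal (qd e z) * indicator (sector R c d) z \<partial>plane)
      = (\<integral>\<^sup>+u. \<integral>\<^sup>+v. ennreal (qd e (u, v)) * indicator (sector R c d) (u, v) \<partial>lborel \<partial>lborel)"
    by (rule lborel.nn_integral_fst[symmetric]) measurable
  also have "\<dots> = (\<integral>\<^sup>+u. \<integral>\<^sup>+v. ennreal (normal_density 0 (sqrt (1 + e\<^sup>2)) u * normal_density 0 (sqrt (1 + e\<^sup>2)) v) *
      indicator {v. R (u * (c * u + d * v))} v \<partial>lborel \<partial>lborel)"
    by (intro nn_integral_cong) (simp add: qd_def sector_def indicator_def)
  also have "\<dots> = ennreal (1 / 2 - arctan (c / d) / pi)"
    by (rule gauss_sector[OF _ d R]) (simp add: add_pos_nonneg)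
  finally show ?thesis .
qed

lemma sector_stable:
  assumes R: "sgnrel R" and "\<bar>u - x\<bar> < \<bar>x\<bar>" "\<bar>(c * u + d * v) - (c * x + d * w)\<bar> < \<bar>c * x + d * w\<bar>"
  shows "(u, v) \<in> sector R c d \<longleftrightarrow> (x, w) \<in> sector R c d"
proof -
  define y y' where "y = c * x + d * w" and "y' = c * u + d * v"
  have "x \<noteq> 0" "y \<noteq> 0" "u > 0 \<longleftrightarrow> x > 0" "y' > 0 \<longleftrightarrow> y > 0" "u \<noteq> 0" "y' \<noteq> 0"
    using assms(2,3) unfolding y_def[symmetric] y'_def[symmetric] by auto
  then have "R (u * y') \<longleftrightarrow> R (x * y)"
    using R unfolding sgnrel_def by (auto simp: mult_less_0_iff mult_le_0_iff)
  then show ?thesis by (simp add: sector_def y_def y'_def)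
qed

context orthonormal_arrays
begin

text \<open>At a fixed scale \<open>l\<close> the Gaussian limit of \<open>cf\<close> suffices. The
  limiting mean is at most \<open>l\<close>, \<open>3 / 2 * l\<close> leaves room for the
  convergence, and \<open>small_ball_le_gauss\<close> doubles it.\<close>

lemma small_ball_eventually:
  assumes st: "\<And>n. s n ^ 2 + t n ^ 2 = 1" and l: "l > 0"
  shows "eventually (\<lambda>n. prob {\<omega> \<in> space M. \<bar>rs (\<lambda>k. s n * A n k + t n * B n k) \<omega>\<bar> \<le> l} \<le> 3 * l) sequentially"
proof -
  interpret N: prob_space std_normal by (rule prob_space_normal_density) simp
  define Y where "Y n k = s n * A n k + t n * B n k" for n k
  have Y: "summable (\<lambda>k. \<bar>Y n k\<bar>)" for n unfolding Y_def by (intro summable_abs_lincomb A B)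
  have meas: "(\<lambda>g. cf (\<lambda>k. (g / l) * Y n k)) \<in> borel_measurable borel" for n
    unfolding cf_scaled[OF Y] by measurable
  have "(\<lambda>n. CLINT g|std_normal. cf (\<lambda>k. (g / l) * Y n k)) \<longlonglongrightarrow> (CLINT g|std_normal. complex_of_real (exp (- (g / l)\<^sup>2 / 2)))"
  proof (rule integral_dominated_convergence[where w="\<lambda>_. 1"])
    show "AE g in std_normal. (\<lambda>n. cf (\<lambda>k. (g / l) * Y n k)) \<longlonglongrightarrow> complex_of_real (exp (- (g / l)\<^sup>2 / 2))"
    proof (rule AE_I2)
      fix g
      have "(\<lambda>n. cf (\<lambda>k. (g / l * s n) * A n k + (g / l * t n) * B n k)) \<longlonglongrightarrow> complex_of_real (exp (- (g / l)\<^sup>2 / 2))"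
      proof (rule cf_tendsto)
        fix n
        have "(g / l * s n)\<^sup>2 + (g / l * t n)\<^sup>2 = (g / l)\<^sup>2 * (s n ^ 2 + t n ^ 2)"
          unfolding power_mult_distrib by (simp only: distrib_left)
        then show "(g / l * s n)\<^sup>2 + (g / l * t n)\<^sup>2 = (g / l)\<^sup>2" using st[of n] by simp
      qed
      then show "(\<lambda>n. cf (\<lambda>k. (g / l) * Y n k)) \<longlonglongrightarrow> complex_of_real (exp (- (g / l)\<^sup>2 / 2))"
        by (simp add: Y_def distrib_left mult.assoc)
    qed
    show "AE g in std_normal. norm (cf (\<lambda>k. (g / l) * Y n k)) \<le> 1" for n using cf_le_1 by simp
  qed (use meas in auto)
  then have "(\<lambda>n. complex_of_real (expectation (\<lambda>\<omega>. exp (- (rs (Y n) \<omega>)\<^sup>2 / (2 * l\<^sup>2)))))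
      \<longlonglongrightarrow> complex_of_real (LINT g|std_normal. exp (- (g / l)\<^sup>2 / 2))"
    unfolding expectation_gauss_eq[OF Y] integral_complex_of_real .
  then have lim: "(\<lambda>n. expectation (\<lambda>\<omega>. exp (- (rs (Y n) \<omega>)\<^sup>2 / (2 * l\<^sup>2)))) \<longlonglongrightarrow> (LINT g|std_normal. exp (- (g / l)\<^sup>2 / 2))"
    by (simp only: tendsto_of_real_iff)
  have "(LINT g|std_normal. exp (- (g / l)\<^sup>2 / 2)) = (LINT g|lborel. std_normal_density g * exp (- (g / l)\<^sup>2 / 2))"
    by (subst integral_density) auto
  also have "\<dots> \<le> (LINT g|lborel. l * normal_density 0 l g)"
  proof (rule integral_mono)
    have "integrable std_normal (\<lambda>g. exp (- (g / l)\<^sup>2 / 2))"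
      by (rule N.integrable_const_bound[where B=1]) auto
    then show "integrable lborel (\<lambda>g. std_normal_density g * exp (- (g / l)\<^sup>2 / 2))"
      by (subst (asm) integrable_density) auto
    show "integrable lborel (\<lambda>g. l * normal_density 0 l g)" using l by simp
    fix g
    have "std_normal_density g * exp (- (g / l)\<^sup>2 / 2) = 1 / sqrt (2 * pi) * exp (- g\<^sup>2 / 2) * exp (- (g / l)\<^sup>2 / 2)"
      by (simp add: std_normal_density_def)
    also have "\<dots> \<le> 1 / sqrt (2 * pi) * 1 * exp (- (g / l)\<^sup>2 / 2)"
      by (intro mult_right_mono mult_left_mono) auto
    also have "\<dots> = l * normal_density 0 l g"
    proof -
      have "sqrt (2 * pi * l\<^sup>2) = l * sqrt (2 * pi)"
        using l by (simp only: real_sqrt_mult real_sqrt_abs) simp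
      then show ?thesis
        using l unfolding normal_density_def by (simp add: power_divide mult.commute)
    qed
    finally show "std_normal_density g * exp (- (g / l)\<^sup>2 / 2) \<le> l * normal_density 0 l g" .
  qed
  also have "\<dots> = l" using l by simp
  finally have "(LINT g|std_normal. exp (- (g / l)\<^sup>2 / 2)) < 3 / 2 * l" using l by simp
  then have "eventually (\<lambda>n. expectation (\<lambda>\<omega>. exp (- (rs (Y n) \<omega>)\<^sup>2 / (2 * l\<^sup>2))) < 3 / 2 * l) sequentially"
    by (rule order_tendstoD(2)[OF lim])
  then show ?thesis
  proof eventually_elim
    case (elim n)
    then show ?case using small_ball_le_gauss[OF l, of "Y n"] unfolding Y_def by simp
  qed
qed

lemma sector_limit:
  assumes cd: "\<And>n. c n ^ 2 + d n ^ 2 = 1" "\<And>n. d n > 0" and \<epsilon>: "\<epsilon> > 0"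
  shows "eventually (\<lambda>n. \<forall>R. sgnrel R \<longrightarrow>
    \<bar>prob {\<omega> \<in> space M. R (rs (A n) \<omega> * (c n * rs (A n) \<omega> + d n * rs (B n) \<omega>))} - (1 / 2 - arctan (c n / d n) / pi)\<bar> \<le> \<epsilon>) sequentially"
proof -
  define h where "h = min 1 (\<epsilon> / 20)"
  have h: "h > 0" "h \<le> 1" "20 * h \<le> \<epsilon>" using \<epsilon> by (auto simp: h_def)
  \<comment> \<open>The noise is much narrower than the margin \<open>h\<close>, so its Chebyshev
    error \<open>2 * e\<^sup>2 / h\<^sup>2\<close> is only \<open>2 * h\<^sup>2\<close>. The other
    errors are \<open>h\<close> from the smoothed densities and \<open>6 * h\<close> from each
    strip, well within \<open>20 * h\<close>.\<close>
  define e where "e = h\<^sup>2"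
  have e: "e > 0" using h by (simp add: e_def)
  have eh: "2 * e\<^sup>2 / h\<^sup>2 \<le> 2 * h"
  proof -
    have "2 * e\<^sup>2 / h\<^sup>2 = 2 * (h * h)" using h(1) by (simp add: e_def power2_eq_square)
    also have "\<dots> \<le> 2 * (h * 1)" using h by (intro mult_left_mono) auto
    finally show ?thesis by simp
  qed
  have "eventually (\<lambda>n. (\<integral>\<^sup>+z. ennreal \<bar>pd (A n) (B n) e z - qd e z\<bar> \<partial>plane) < ennreal h) sequentially"
    using h by (intro order_tendstoD[OF pd_L1[OF e]]) auto
  moreover have "eventually (\<lambda>n. prob {\<omega> \<in> space M. \<bar>rs (\<lambda>k. 1 * A n k + 0 * B n k) \<omega>\<bar> \<le> 2 * h} \<le> 3 * (2 * h)) sequentially"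
    using h by (intro small_ball_eventually) auto
  moreover have "eventually (\<lambda>n. prob {\<omega> \<in> space M. \<bar>rs (\<lambda>k. c n * A n k + d n * B n k) \<omega>\<bar> \<le> 2 * h} \<le> 3 * (2 * h)) sequentially"
    using h cd by (intro small_ball_eventually) auto
  ultimately show ?thesis
  proof eventually_elim
    case (elim n)
    define X where "X = rs (A n)" define W where "W = rs (B n)"
    have [measurable]: "X \<in> borel_measurable M" "W \<in> borel_measurable M" by (auto simp: X_def W_def)
    have pX: "prob {\<omega> \<in> space M. \<bar>X \<omega>\<bar> \<le> 2 * h} \<le> 6 * h"
      using elim(2) by (simp add: X_def)
    have "prob {\<omega> \<in> space M. \<bar>c n * X \<omega> + d n * W \<omega>\<bar> \<le> 2 * h}
        = prob {\<omega> \<in> space M. \<bar>rs (\<lambda>k. c n * A n k + d n * B n k) \<omega>\<bar> \<le> 2 * h}"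
      by (rule measure_eq_AE) (use rs_lincomb[OF A B, of "c n" n "d n" n] in \<open>eventually_elim, simp add: X_def W_def\<close>, auto)
    then have pY: "prob {\<omega> \<in> space M. \<bar>c n * X \<omega> + d n * W \<omega>\<bar> \<le> 2 * h} \<le> 6 * h" using elim(3) by simp
    have cd1: "\<bar>c n\<bar> \<le> 1" "\<bar>d n\<bar> \<le> 1"
      using cd(1)[of n] by (auto simp: abs_square_le_1[symmetric]) (smt (verit) zero_le_power2)+
    \<comment> \<open>Only an upper bound for the Gaussian mass is shown, but for every sign-stable
      set; using it for the sector and for its complement yields both directions.\<close>
    have key: "(\<integral>\<^sup>+z. ennreal (qd e z) * indicator S z \<partial>plane) \<le> ennreal (prob {\<omega> \<in> space M. (X \<omega>, W \<omega>) \<in> S} + \<epsilon>)"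
      if S [measurable]: "S \<in> sets plane" and stable: "\<And>u v x w. \<bar>u - x\<bar> < \<bar>x\<bar> \<Longrightarrow>
        \<bar>(c n * u + d n * v) - (c n * x + d n * w)\<bar> < \<bar>c n * x + d n * w\<bar> \<Longrightarrow> (u, v) \<in> S \<Longrightarrow> (x, w) \<in> S" for S
    proof -
      have Sb [measurable]: "S \<in> sets (borel \<Otimes>\<^sub>M borel)" using S by simp
      have "(\<integral>\<^sup>+z. ennreal (qd e z) * indicator S z \<partial>plane) \<le>
          (\<integral>\<^sup>+z. ennreal (pd (A n) (B n) e z) * indicator S z + ennreal \<bar>pd (A n) (B n) e z - qd e z\<bar> \<partial>plane)"
        by (intro nn_integral_mono)
           (auto simp: indicator_def pd_nonneg ennreal_plus[symmetric] simp del: ennreal_plus intro!: ennreal_leI)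
      also have "\<dots> = (\<integral>\<^sup>+z. ennreal (pd (A n) (B n) e z) * indicator S z \<partial>plane) + (\<integral>\<^sup>+z. ennreal \<bar>pd (A n) (B n) e z - qd e z\<bar> \<partial>plane)"
        by (rule nn_integral_add) measurable
      also have "\<dots> \<le> (\<integral>\<^sup>+z. ennreal (pd (A n) (B n) e z) * indicator S z \<partial>plane) + ennreal h"
        using elim(1) by (intro add_left_mono) auto
      also have "(\<integral>\<^sup>+z. ennreal (pd (A n) (B n) e z) * indicator S z \<partial>plane) =
          (\<integral>\<^sup>+\<omega>. \<integral>\<^sup>+z. ennreal (gk e (X \<omega>) (W \<omega>) z) * indicator S z \<partial>plane \<partial>M)"
        unfolding X_def W_def by (rule pd_set[OF e S])
      also have "\<dots> \<le> (\<integral>\<^sup>+\<omega>. (indicator S (X \<omega>, W \<omega>) + indicator {x. \<bar>x\<bar> \<le> 2 * h} (X \<omega>)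
          + indicator {y. \<bar>y\<bar> \<le> 2 * h} (c n * X \<omega> + d n * W \<omega>)) + ennreal (2 * e\<^sup>2 / h\<^sup>2) \<partial>M)"
      proof (rule nn_integral_mono)
        fix \<omega>
        have "\<And>u v. \<bar>u - X \<omega>\<bar> < \<bar>X \<omega>\<bar> \<Longrightarrow> \<bar>(c n * u + d n * v) - (c n * X \<omega> + d n * W \<omega>)\<bar> < \<bar>c n * X \<omega> + d n * W \<omega>\<bar>
            \<Longrightarrow> (u, v) \<in> S \<Longrightarrow> (X \<omega>, W \<omega>) \<in> S"
          by (rule stable)
        then show "(\<integral>\<^sup>+z. ennreal (gk e (X \<omega>) (W \<omega>) z) * indicator S z \<partial>plane) \<le> indicator S (X \<omega>, W \<omega>) + indicator {x. \<bar>x\<bar> \<le> 2 * h} (X \<omega>)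
          + indicator {y. \<bar>y\<bar> \<le> 2 * h} (c n * X \<omega> + d n * W \<omega>) + ennreal (2 * e\<^sup>2 / h\<^sup>2)"
          by (rule gk_sector_le[OF e h(1) cd1 S])
      qed
      also have "\<dots> = (\<integral>\<^sup>+\<omega>. indicator {\<omega> \<in> space M. (X \<omega>, W \<omega>) \<in> S} \<omega> + indicator {\<omega> \<in> space M. \<bar>X \<omega>\<bar> \<le> 2 * h} \<omega>
          + indicator {\<omega> \<in> space M. \<bar>c n * X \<omega> + d n * W \<omega>\<bar> \<le> 2 * h} \<omega> + ennreal (2 * e\<^sup>2 / h\<^sup>2) \<partial>M)"
        by (intro nn_integral_cong) (auto simp: indicator_def)
      also have "\<dots> = emeasure M {\<omega> \<in> space M. (X \<omega>, W \<omega>) \<in> S} + emeasure M {\<omega> \<in> space M. \<bar>X \<omega>\<bar> \<le> 2 * h}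
          + emeasure M {\<omega> \<in> space M. \<bar>c n * X \<omega> + d n * W \<omega>\<bar> \<le> 2 * h} + ennreal (2 * e\<^sup>2 / h\<^sup>2)"
        by (simp add: nn_integral_add emeasure_space_1)
      also have "\<dots> = ennreal (prob {\<omega> \<in> space M. (X \<omega>, W \<omega>) \<in> S} + prob {\<omega> \<in> space M. \<bar>X \<omega>\<bar> \<le> 2 * h}
          + prob {\<omega> \<in> space M. \<bar>c n * X \<omega> + d n * W \<omega>\<bar> \<le> 2 * h} + 2 * e\<^sup>2 / h\<^sup>2)"
        by (simp add: emeasure_eq_measure)
      also have "\<dots> + ennreal h = ennreal (prob {\<omega> \<in> space M. (X \<omega>, W \<omega>) \<in> S} + prob {\<omega> \<in> space M. \<bar>X \<omega>\<bar> \<le> 2 * h}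
          + prob {\<omega> \<in> space M. \<bar>c n * X \<omega> + d n * W \<omega>\<bar> \<le> 2 * h} + 2 * e\<^sup>2 / h\<^sup>2 + h)"
        using h by (intro ennreal_plus[symmetric]) (auto intro!: add_nonneg_nonneg)
      also have "\<dots> \<le> ennreal (prob {\<omega> \<in> space M. (X \<omega>, W \<omega>) \<in> S} + \<epsilon>)"
        using pX pY eh h by (intro ennreal_leI) linarith
      finally show ?thesis by simp
    qed
    show ?case
    proof (intro allI impI)
      fix R assume R: "sgnrel R"
      note [measurable] = sector_sets[OF R] sgnrel_measurable[OF R]
      define \<theta> where "\<theta> = 1 / 2 - arctan (c n / d n) / pi"
      have \<theta>0: "\<theta> \<ge> 0" using arctan_ubound[of "c n / d n"] by (simp add: \<theta>_def field_simps)
      have \<theta>1: "\<theta> \<le> 1" using arctan_lbound[of "c n / d n"] by (simp add: \<theta>_def field_simps)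
      define p where "p = prob {\<omega> \<in> space M. R (X \<omega> * (c n * X \<omega> + d n * W \<omega>))}"
      have p: "p = prob {\<omega> \<in> space M. (X \<omega>, W \<omega>) \<in> sector R (c n) (d n)}"
        by (simp add: p_def sector_def)
      have q: "(\<integral>\<^sup>+z. ennreal (qd e z) * indicator (sector R (c n) (d n)) z \<partial>plane) = ennreal \<theta>"
        unfolding \<theta>_def by (rule qd_sector[OF cd(2) R])
      have qc: "(\<integral>\<^sup>+z. ennreal (qd e z) * indicator (- sector R (c n) (d n)) z \<partial>plane) = ennreal (1 - \<theta>)"
      proof -
        have "1 = (\<integral>\<^sup>+z. ennreal (qd e z) * indicator (sector R (c n) (d n)) z + ennreal (qd e z) * indicator (- sector R (c n) (d n)) z \<partial>plane)"
          unfolding qd_total[of e, symmetric] by (intro nn_integral_cong) (auto simp: indicator_def)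
        also have "\<dots> = ennreal \<theta> + (\<integral>\<^sup>+z. ennreal (qd e z) * indicator (- sector R (c n) (d n)) z \<partial>plane)"
          by (subst nn_integral_add) (measurable, simp add: q)
        finally have "ennreal \<theta> + (\<integral>\<^sup>+z. ennreal (qd e z) * indicator (- sector R (c n) (d n)) z \<partial>plane) = ennreal \<theta> + ennreal (1 - \<theta>)"
          using \<theta>0 \<theta>1 by (simp flip: ennreal_plus)
        then show ?thesis by (subst (asm) ennreal_add_left_cancel) auto
      qed
      have "ennreal \<theta> \<le> ennreal (p + \<epsilon>)"
        using key[OF sector_sets[OF R, of "c n" "d n"]] sector_stable[OF R, of _ _ "c n" "d n"] unfolding q p by blast
      then have 1: "\<theta> \<le> p + \<epsilon>" using \<epsilon> by (subst (asm) ennreal_le_iff) (auto simp: p_def)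
      have cs: "- sector R (c n) (d n) \<in> sets plane"
        using sets.compl_sets[OF sector_sets[OF R, of "c n" "d n"]] by (simp add: space_pair_measure Compl_eq_Diff_UNIV)
      have "ennreal (1 - \<theta>) \<le> ennreal (prob {\<omega> \<in> space M. (X \<omega>, W \<omega>) \<in> - sector R (c n) (d n)} + \<epsilon>)"
        using key[OF cs] sector_stable[OF R, of _ _ "c n" "d n"] unfolding qc by blast
      also have "prob {\<omega> \<in> space M. (X \<omega>, W \<omega>) \<in> - sector R (c n) (d n)} = 1 - p"
        unfolding p by (subst prob_compl[symmetric]) (auto intro!: arg_cong[where f=prob])
      finally have 2: "1 - \<theta> \<le> 1 - p + \<epsilon>" using \<epsilon> by (subst (asm) ennreal_le_iff) (auto simp: p_def)
      show "\<bar>prob {\<omega> \<in> space M. R (rs (A n) \<omega> * (c n * rs (A n) \<omega> + d n * rs (B n) \<omega>))} - (1 / 2 - arctan (c n / d n) / pi)\<bar> \<le> \<epsilon>"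
        using 1 2 unfolding \<theta>_def p_def X_def W_def by linarith
    qed
  qed
qed

end

section \<open>Uniform central limit theorem for sign changes\<close>

context iid_std
begin

text \<open>By contradiction: if \<open>1 / Suc n\<close> fails for every \<open>n\<close>, the
  counterexamples form an array to which \<open>sector_limit\<close> applies, with the relation
  \<open>R\<close> varying along it. This turns a limit theorem into a bound uniform in the
  coefficients.\<close>

lemma sector_clt:
  assumes \<epsilon>: "\<epsilon> > 0"
  shows "\<exists>\<eta>>0. \<forall>a b c d R. summable (\<lambda>k. \<bar>a k\<bar>) \<longrightarrow> summable (\<lambda>k. \<bar>b k\<bar>) \<longrightarrow>
     (\<Sum>k. (a k)\<^sup>2) = 1 \<longrightarrow> (\<Sum>k. (b k)\<^sup>2) = 1 \<longrightarrow> (\<Sum>k. a k * b k) = 0 \<longrightarrow>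
     (\<forall>k. \<bar>a k\<bar> \<le> \<eta>) \<longrightarrow> (\<forall>k. \<bar>b k\<bar> \<le> \<eta>) \<longrightarrow> c\<^sup>2 + d\<^sup>2 = 1 \<longrightarrow> d > 0 \<longrightarrow> sgnrel R \<longrightarrow>
     \<bar>prob {\<omega> \<in> space M. R (rs a \<omega> * (c * rs a \<omega> + d * rs b \<omega>))} - (1 / 2 - arctan (c / d) / pi)\<bar> \<le> \<epsilon>"
proof (rule ccontr)
  define P where "P \<eta> a b c d R \<longleftrightarrow> summable (\<lambda>k. \<bar>a k\<bar>) \<and> summable (\<lambda>k. \<bar>b k\<bar>) \<and>
     (\<Sum>k. (a k)\<^sup>2) = 1 \<and> (\<Sum>k. (b k)\<^sup>2) = 1 \<and> (\<Sum>k. a k * b k) = 0 \<and>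
     (\<forall>k. \<bar>a k\<bar> \<le> \<eta>) \<and> (\<forall>k. \<bar>b k\<bar> \<le> \<eta>) \<and> c\<^sup>2 + d\<^sup>2 = 1 \<and> d > 0 \<and> sgnrel R \<and>
     \<not> \<bar>prob {\<omega> \<in> space M. R (rs a \<omega> * (c * rs a \<omega> + d * rs b \<omega>))} - (1 / 2 - arctan (c / d) / pi)\<bar> \<le> \<epsilon>"
    for \<eta> :: real and a b and c d :: real and R
  assume "\<not> ?thesis"
  then have "\<forall>\<eta>>0. \<exists>a b c d R. P \<eta> a b c d R" unfolding P_def by (simp add: not_le)
  then have "\<forall>n. \<exists>a b c d R. P (1 / Suc n) a b c d R" by simp
  from choice[OF this] obtain A where "\<forall>n. \<exists>b c d R. P (1 / Suc n) (A n) b c d R" ..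
  from choice[OF this] obtain B where "\<forall>n. \<exists>c d R. P (1 / Suc n) (A n) (B n) c d R" ..
  from choice[OF this] obtain c where "\<forall>n. \<exists>d R. P (1 / Suc n) (A n) (B n) (c n) d R" ..
  from choice[OF this] obtain d where "\<forall>n. \<exists>R. P (1 / Suc n) (A n) (B n) (c n) (d n) R" ..
  from choice[OF this] obtain R where P: "\<And>n. P (1 / Suc n) (A n) (B n) (c n) (d n) (R n)" by auto
  interpret orthonormal_arrays M \<xi> A B "\<lambda>n. 1 / Suc n"
  proof
    show "(\<lambda>n. 1 / real (Suc n)) \<longlonglongrightarrow> 0" by (rule LIMSEQ_Suc[OF lim_1_over_n])
  qed (use P in \<open>simp_all add: P_def\<close>)
  have "eventually (\<lambda>n. \<forall>R. sgnrel R \<longrightarrow>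
    \<bar>prob {\<omega> \<in> space M. R (rs (A n) \<omega> * (c n * rs (A n) \<omega> + d n * rs (B n) \<omega>))} - (1 / 2 - arctan (c n / d n) / pi)\<bar> \<le> \<epsilon>) sequentially"
    by (rule sector_limit) (use P \<epsilon> in \<open>simp_all add: P_def\<close>)
  then obtain n where "\<forall>R. sgnrel R \<longrightarrow>
    \<bar>prob {\<omega> \<in> space M. R (rs (A n) \<omega> * (c n * rs (A n) \<omega> + d n * rs (B n) \<omega>))} - (1 / 2 - arctan (c n / d n) / pi)\<bar> \<le> \<epsilon>"
    by (auto simp: eventually_sequentially)
  then show False using P[of n] unfolding P_def by blast
qed

text \<open>Gram--Schmidt reduces a correlated pair to the orthonormal case.\<close>

lemma sign_change_clt:
  assumes \<epsilon>: "\<epsilon> > 0"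
  shows "\<exists>\<eta>>0. \<forall>a y R. summable (\<lambda>k. \<bar>a k\<bar>) \<longrightarrow> summable (\<lambda>k. \<bar>y k\<bar>) \<longrightarrow>
     (\<Sum>k. (a k)\<^sup>2) = 1 \<longrightarrow> (\<Sum>k. (y k)\<^sup>2) = 1 \<longrightarrow> \<bar>\<Sum>k. a k * y k\<bar> < 1 \<longrightarrow>
     (\<forall>k. \<bar>a k\<bar> \<le> \<eta> * sqrt (1 - (\<Sum>k. a k * y k)\<^sup>2)) \<longrightarrow> (\<forall>k. \<bar>y k\<bar> \<le> \<eta> * sqrt (1 - (\<Sum>k. a k * y k)\<^sup>2)) \<longrightarrow> sgnrel R \<longrightarrow>
     \<bar>prob {\<omega> \<in> space M. R (rs a \<omega> * rs y \<omega>)} - (1 / 2 - arctan ((\<Sum>k. a k * y k) / sqrt (1 - (\<Sum>k. a k * y k)\<^sup>2)) / pi)\<bar> \<le> \<epsilon>"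
proof -
  obtain \<eta> where \<eta>: "\<eta> > 0" and clt0: "\<forall>a b c d R. summable (\<lambda>k. \<bar>a k\<bar>) \<longrightarrow> summable (\<lambda>k. \<bar>b k\<bar>) \<longrightarrow>
     (\<Sum>k. (a k)\<^sup>2) = 1 \<longrightarrow> (\<Sum>k. (b k)\<^sup>2) = 1 \<longrightarrow> (\<Sum>k. a k * b k) = 0 \<longrightarrow>
     (\<forall>k. \<bar>a k\<bar> \<le> \<eta>) \<longrightarrow> (\<forall>k. \<bar>b k\<bar> \<le> \<eta>) \<longrightarrow> c\<^sup>2 + d\<^sup>2 = 1 \<longrightarrow> d > 0 \<longrightarrow> sgnrel R \<longrightarrow>
     \<bar>prob {\<omega> \<in> space M. R (rs a \<omega> * (c * rs a \<omega> + d * rs b \<omega>))} - (1 / 2 - arctan (c / d) / pi)\<bar> \<le> \<epsilon>"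
    using sector_clt[OF \<epsilon>] by (elim exE conjE) (rule that)
  note clt = clt0[rule_format]
  show ?thesis
  \<comment> \<open>The orthogonal part of \<open>y\<close> is divided by
    \<open>d = sqrt (1 - r\<^sup>2)\<close>, so smallness is required relative to \<open>d\<close>;
    the two terms of \<open>y k - r * a k\<close> share \<open>\<eta>\<close> equally.\<close>
  proof (intro exI[of _ "\<eta> / 2"] conjI allI impI)
    show "\<eta> / 2 > 0" using \<eta> by simp
  next
    fix a y :: "nat \<Rightarrow> real" and R
    define r where "r = (\<Sum>k. a k * y k)"
    define d where "d = sqrt (1 - r\<^sup>2)"
    assume a: "summable (\<lambda>k. \<bar>a k\<bar>)" and y: "summable (\<lambda>k. \<bar>y k\<bar>)" and a1: "(\<Sum>k. (a k)\<^sup>2) = 1" and y1: "(\<Sum>k. (y k)\<^sup>2) = 1"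
      and "\<bar>\<Sum>k. a k * y k\<bar> < 1" and "\<forall>k. \<bar>a k\<bar> \<le> \<eta> / 2 * sqrt (1 - (\<Sum>k. a k * y k)\<^sup>2)"
      and "\<forall>k. \<bar>y k\<bar> \<le> \<eta> / 2 * sqrt (1 - (\<Sum>k. a k * y k)\<^sup>2)" and R: "sgnrel R"
    then have r: "\<bar>r\<bar> < 1" and sa: "\<And>k. \<bar>a k\<bar> \<le> \<eta> / 2 * d" and sy: "\<And>k. \<bar>y k\<bar> \<le> \<eta> / 2 * d"
      by (simp_all add: r_def d_def)
    have r2: "r\<^sup>2 < 1" using r by (simp add: abs_square_less_1)
    have d: "d > 0" "d\<^sup>2 = 1 - r\<^sup>2" "d \<le> 1" using r2 by (simp_all add: d_def)
    define b where "b k = (1 / d) * y k + (- r / d) * a k" for k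
    have b: "summable (\<lambda>k. \<bar>b k\<bar>)" unfolding b_def by (intro summable_abs_lincomb a y)
    have b1: "(\<Sum>k. (b k)\<^sup>2) = 1"
    proof -
      have "(\<Sum>k. (b k)\<^sup>2) = (1 / d)\<^sup>2 * 1 + 2 * (1 / d) * (- r / d) * r + (- r / d)\<^sup>2 * 1"
        unfolding b_def sq_sum_lincomb[OF y a] a1 y1 by (simp add: r_def mult.commute)
      also have "\<dots> = (1 - r\<^sup>2) / d\<^sup>2" by (simp add: power_divide power2_eq_square diff_divide_distrib)
      also have "\<dots> = 1" using d r2 by simp
      finally show ?thesis .
    qed
    have ab: "(\<Sum>k. a k * b k) = 0"
    proof -
      have "(\<lambda>k. (1 / d) * (a k * y k) + (- r / d) * (a k)\<^sup>2) sums ((1 / d) * r + (- r / d) * 1)"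
        unfolding r_def a1[symmetric] by (intro sums_add sums_mult summable_sums summable_prod summable_sq a y)
      moreover have "a k * b k = (1 / d) * (a k * y k) + (- r / d) * (a k)\<^sup>2" for k
        by (simp add: b_def power2_eq_square algebra_simps)
      ultimately show ?thesis by (simp add: sums_iff)
    qed
    have as: "\<bar>a k\<bar> \<le> \<eta>" for k
    proof -
      have "\<eta> / 2 * d \<le> \<eta> / 2 * 1" using d \<eta> by (intro mult_left_mono) auto
      then show ?thesis using sa[of k] \<eta> by linarith
    qed
    have bs: "\<bar>b k\<bar> \<le> \<eta>" for k
    proof -
      have "d * b k = y k - r * a k" using d(1) by (simp add: b_def right_diff_distrib)
      then have "\<bar>d * b k\<bar> = \<bar>y k - r * a k\<bar>" by simp
      then have "d * \<bar>b k\<bar> = \<bar>y k - r * a k\<bar>" using d(1) by (simp add: abs_mult)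
      also have "\<dots> \<le> \<bar>y k\<bar> + \<bar>r\<bar> * \<bar>a k\<bar>" by (metis abs_mult abs_triangle_ineq4)
      also have "\<dots> \<le> \<eta> / 2 * d + 1 * (\<eta> / 2 * d)"
        using r d \<eta> by (intro add_mono mult_mono sa sy) auto
      finally have "d * \<bar>b k\<bar> \<le> d * \<eta>" by (simp add: mult.commute)
      then show ?thesis using d by simp
    qed
    have "\<bar>prob {\<omega> \<in> space M. R (rs a \<omega> * (r * rs a \<omega> + d * rs b \<omega>))} - (1 / 2 - arctan (r / d) / pi)\<bar> \<le> \<epsilon>"
      by (rule clt[OF a b a1 b1 ab as bs _ d(1) R]) (simp add: d(2))
    moreover have "prob {\<omega> \<in> space M. R (rs a \<omega> * (r * rs a \<omega> + d * rs b \<omega>))} = prob {\<omega> \<in> space M. R (rs a \<omega> * rs y \<omega>)}"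
    proof -
      note [measurable] = sgnrel_measurable[OF R]
      have "d * b k = y k - r * a k" for k using d(1) by (simp add: b_def right_diff_distrib)
      then have "(\<lambda>k. r * a k + d * b k) = y" by simp
      then have "AE \<omega> in M. rs y \<omega> = r * rs a \<omega> + d * rs b \<omega>" using rs_lincomb[OF a b, of r d] by simp
      then have "AE \<omega> in M. (\<omega> \<in> {\<omega> \<in> space M. R (rs a \<omega> * (r * rs a \<omega> + d * rs b \<omega>))}) = (\<omega> \<in> {\<omega> \<in> space M. R (rs a \<omega> * rs y \<omega>)})"
        by eventually_elim simp
      then show ?thesis by (rule measure_eq_AE) measurable
    qed
    ultimately show "\<bar>prob {\<omega> \<in> space M. R (rs a \<omega> * rs y \<omega>)} - (1 / 2 - arctan ((\<Sum>k. a k * y k) / sqrt (1 - (\<Sum>k. a k * y k)\<^sup>2)) / pi)\<bar> \<le> \<epsilon>"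
      by (simp add: r_def d_def)
  qed
qed

text \<open>By the Blaschke bound, \<open>m\<close> zeros in \<open>[0, s]\<close> force this event.\<close>

definition near_event :: "(nat \<Rightarrow> real) \<Rightarrow> (nat \<Rightarrow> real) \<Rightarrow> real \<Rightarrow> nat \<Rightarrow> 'w set" where
  "near_event a d s m = {\<omega> \<in> space M. ennreal ((rs a \<omega>)\<^sup>2) \<le> Vsum a d \<omega> * ennreal (s ^ (2 * m))}"

lemma near_event_sets [measurable]: "near_event a d s m \<in> sets M"
  unfolding near_event_def by measurable

text \<open>\<open>near_event\<close> forces
  \<open>\<bar>rs a \<omega>\<bar> \<le> v ^ (2 * m)\<close> or
  \<open>Vsum a d \<omega> \<ge> v ^ (- (2 * m))\<close>, because \<open>(v ^ 3) ^ (2 * m)\<close>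
  is the product of \<open>v ^ (2 * m)\<close> and its square. Anti-concentration bounds the first
  event and Markov's inequality the second.\<close>

lemma near_event_prob:
  assumes sm: "summable (\<lambda>k. \<bar>a k\<bar> * exp \<bar>d k\<bar>)"
    and sC: "summable (\<lambda>k. (a k)\<^sup>2 * exp (4 * \<bar>d k\<bar>))" "(\<Sum>k. (a k)\<^sup>2 * exp (4 * \<bar>d k\<bar>)) \<le> C"
    and c: "\<And>u. \<bar>u\<bar> \<le> c \<Longrightarrow> norm (\<phi> u) \<le> exp (- u\<^sup>2 / 4)" and v: "0 < v" and T: "T > 0"
    and F: "\<And>t. \<bar>t\<bar> \<le> T \<Longrightarrow> \<exists>F. finite F \<and> (\<forall>k\<in>F. \<bar>t * a k\<bar> \<le> c) \<and> min (t\<^sup>2 / 2) J \<le> (\<Sum>k\<in>F. (t * a k)\<^sup>2)"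
  shows "prob (near_event a d (v ^ 3) m) \<le> (4 + 4 * C) * v ^ (2 * m) + 2 * exp (- J / 4) + 2 / (v ^ (2 * m) * T)\<^sup>2"
proof -
  have C0: "C \<ge> 0" using order_trans[OF suminf_nonneg[OF sC(1)] sC(2)] by simp
  have a: "summable (\<lambda>k. \<bar>a k\<bar>)"
  proof (rule summable_comparison_test'[OF sm])
    show "norm \<bar>a k\<bar> \<le> \<bar>a k\<bar> * exp \<bar>d k\<bar>" for k
      using mult_left_mono[of 1 "exp \<bar>d k\<bar>" "\<bar>a k\<bar>"] by simp
  qed
  define B1 where "B1 = {\<omega> \<in> space M. \<bar>rs a \<omega>\<bar> \<le> v ^ (2 * m)}"
  define B2 where "B2 = {\<omega> \<in> space M. 1 \<le> ennreal (v ^ (2 * m)) * Vsum a d \<omega>}"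
  have [measurable]: "B1 \<in> sets M" "B2 \<in> sets M" unfolding B1_def B2_def by measurable
  have v6: "(v ^ 3) ^ (2 * m) = v ^ (2 * m) * (v ^ (2 * m))\<^sup>2"
    unfolding power_mult[symmetric] power_add[symmetric] by (rule arg_cong[where f="power v"]) simp
  have "near_event a d (v ^ 3) m \<subseteq> B1 \<union> B2"
  proof
    fix \<omega> assume \<omega>: "\<omega> \<in> near_event a d (v ^ 3) m"
    then have sp: "\<omega> \<in> space M" and le: "ennreal ((rs a \<omega>)\<^sup>2) \<le> Vsum a d \<omega> * ennreal ((v ^ 3) ^ (2 * m))"
      by (auto simp: near_event_def)
    show "\<omega> \<in> B1 \<union> B2"
    proof (rule ccontr)
      assume "\<omega> \<notin> B1 \<union> B2"
      then have n1: "v ^ (2 * m) < \<bar>rs a \<omega>\<bar>" and n2: "ennreal (v ^ (2 * m)) * Vsum a d \<omega> \<le> 1"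
        using sp by (auto simp: B1_def B2_def)
      have "ennreal ((rs a \<omega>)\<^sup>2) \<le> (ennreal (v ^ (2 * m)) * Vsum a d \<omega>) * ennreal ((v ^ (2 * m))\<^sup>2)"
        using le[unfolded v6] v by (simp add: ennreal_mult mult_ac)
      also have "\<dots> \<le> 1 * ennreal ((v ^ (2 * m))\<^sup>2)" by (intro mult_right_mono n2) simp
      finally have "(rs a \<omega>)\<^sup>2 \<le> (v ^ (2 * m))\<^sup>2" by simp
      then have "\<bar>rs a \<omega>\<bar> \<le> v ^ (2 * m)" using v by (simp add: abs_le_square_iff[symmetric])
      then show False using n1 by simp
    qed
  qed
  then have sub: "prob (near_event a d (v ^ 3) m) \<le> prob (B1 \<union> B2)"
    by (rule finite_measure_mono) measurable
  have un: "prob (B1 \<union> B2) \<le> prob B1 + prob B2" by (rule measure_Un_le) measurable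
  have p1: "prob B1 \<le> 4 * v ^ (2 * m) + 2 * exp (- J / 4) + 2 / (v ^ (2 * m) * T)\<^sup>2"
    unfolding B1_def
  proof (rule anti_concentration[OF a, where c=c])
    show "0 < v ^ (2 * m)" using v by simp
    show "0 < T" by (rule T)
    show "norm (\<phi> u) \<le> exp (- u\<^sup>2 / 4)" if "\<bar>u\<bar> \<le> c" for u using that by (rule c)
    show "\<exists>F. finite F \<and> (\<forall>k\<in>F. \<bar>t * a k\<bar> \<le> c) \<and> min (t\<^sup>2 / 2) J \<le> (\<Sum>k\<in>F. (t * a k)\<^sup>2)" if "\<bar>t\<bar> \<le> T" for t
      using that by (rule F)
  qed
  have p2: "prob B2 \<le> 4 * C * v ^ (2 * m)"
  proof -
    have "emeasure M B2 \<le> ennreal (v ^ (2 * m)) * (\<integral>\<^sup>+\<omega>. Vsum a d \<omega> * indicator (space M) \<omega> \<partial>M)"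
      unfolding B2_def by (rule nn_integral_Markov_inequality) measurable
    also have "\<dots> = ennreal (v ^ (2 * m)) * (\<integral>\<^sup>+\<omega>. Vsum a d \<omega> \<partial>M)"
      by (intro arg_cong[where f="(*) _"] nn_integral_cong) simp
    also have "\<dots> \<le> ennreal (v ^ (2 * m)) * ennreal (4 * C)"
      by (intro mult_left_mono Vsum_le[OF sm sC]) simp
    also have "\<dots> = ennreal (v ^ (2 * m) * (4 * C))" using v C0 by (intro ennreal_mult[symmetric]) auto
    finally have "ennreal (prob B2) \<le> ennreal (v ^ (2 * m) * (4 * C))" unfolding emeasure_eq_measure .
    then show ?thesis using v C0 by (subst (asm) ennreal_le_iff) (auto simp: mult_ac)
  qed
  show ?thesis using sub un p1 p2 by (simp add: distrib_right)
qed

end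

section \<open>Unimodal weights\<close>

text \<open>All ensembles satisfy such a ratio recursion after normalisation, with the mode near \<open>m\<close> and
  truncation at \<open>N\<close> when \<open>tr\<close> holds.\<close>

locale unimodal_weights =
  fixes p :: "nat \<Rightarrow> real" and A m :: real and L J N :: nat and tr :: bool
  assumes p_nonneg: "\<And>k. p k \<ge> 0" and p_sums: "p sums 1"
    and ratio: "\<And>k. (tr \<Longrightarrow> k < N) \<Longrightarrow> p (Suc k) * real (Suc k) = p k * (real (Suc k) - A * (real k - m))"
    and trunc: "\<And>k. tr \<Longrightarrow> k > N \<Longrightarrow> p k = 0" "tr \<Longrightarrow> m + 3 * real L + 3 \<le> real N"
    and A: "A > 0" and m: "m > 0" and J: "1 \<le> J" "J \<le> L" "real J * (A * (3 * real L + 2)) \<le> m / 2"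
begin

text \<open>By \<open>ratio\<close> the quotient of successive weights is
  \<open>1 - A * (k - m) / (k + 1)\<close>: the weights rise below \<open>m\<close> and fall from
  \<open>m\<close> on, so the first integer at or above \<open>m\<close> is a mode.\<close>

definition "k0 = nat \<lceil>m\<rceil>"

lemma k0: "m \<le> real k0" "real k0 < m + 1"
  using m unfolding k0_def by linarith+

lemma k0_less: "j < 3 * L \<Longrightarrow> tr \<Longrightarrow> k0 + j < N"
  using trunc(2) k0 by linarith

lemma decreasing: assumes "k0 \<le> k" shows "p (Suc k) \<le> p k"
proof (cases "tr \<and> k \<ge> N")
  case True
  then show ?thesis using trunc(1)[of "Suc k"] p_nonneg[of k] by simp
next
  case False
  have "p (Suc k) * real (Suc k) = p k * (real (Suc k) - A * (real k - m))"
    using False by (intro ratio) auto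
  also have "\<dots> \<le> p k * real (Suc k)"
    using assms k0 A by (intro mult_left_mono p_nonneg) (simp add: mult_nonneg_nonneg)
  finally show ?thesis by simp
qed

lemma increasing: assumes "k < k0" shows "p k \<le> p (Suc k)"
proof -
  have km: "real k < m" using assms m unfolding k0_def by linarith
  have "tr \<Longrightarrow> k < N" using assms k0_less[of 0] J by simp
  then have "p (Suc k) * real (Suc k) = p k * (real (Suc k) - A * (real k - m))" by (rule ratio)
  also have "\<dots> \<ge> p k * real (Suc k)"
    using km A by (intro mult_left_mono p_nonneg) (simp add: mult_le_0_iff)
  finally show ?thesis by simp
qed

lemma antitone:
  assumes "k0 \<le> k" "k \<le> k'"
  shows "p k' \<le> p k"
  using assms(2)
proof (induction rule: dec_induct)
  case (step n)
  then show ?case using decreasing[of n] assms(1) by simp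
qed simp

lemma mode: "p k \<le> p k0"
proof (cases "k \<le> k0")
  case True
  then show ?thesis
    by (induction rule: inc_induct) (auto intro: order_trans[OF increasing])
qed (use antitone[of k0 k] in auto)

lemma slow_step:
  assumes "k0 \<le> k" "k < k0 + 3 * L"
  shows "p k * (1 - A * (3 * real L + 2) / m) \<le> p (Suc k)"
proof -
  have "tr \<Longrightarrow> k < N" using assms k0_less[of "k - k0"] by simp
  then have "p (Suc k) * real (Suc k) = p k * (real (Suc k) - A * (real k - m))" by (rule ratio)
  then have eq: "p (Suc k) = p k * (1 - A * (real k - m) / real (Suc k))"
    by (simp add: field_simps)
  have km: "0 \<le> real k - m" "real k - m \<le> 3 * real L + 2" "m \<le> real (Suc k)" using assms k0 by linarith+
  have "A * (real k - m) / real (Suc k) \<le> A * (3 * real L + 2) / m"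
    using km A m by (intro frac_le mult_left_mono) auto
  then show ?thesis unfolding eq by (intro mult_left_mono p_nonneg) simp
qed

text \<open>In the window of length \<open>3 * L\<close> each step loses at most the fraction
  \<open>A * (3 * L + 2) / m\<close>, and by the last assumption on \<open>J\<close> the losses of
  \<open>J\<close> steps add up to at most one half (Bernoulli's inequality).\<close>

lemma half_run:
  assumes "k0 \<le> k" "k + J \<le> k0 + 3 * L" "j \<le> J"
  shows "p k / 2 \<le> p (k + j)"
proof -
  define r where "r = A * (3 * real L + 2) / m"
  have r0: "r \<ge> 0" using A m by (simp add: r_def)
  have "real J * r = real J * (A * (3 * real L + 2)) / m" by (simp add: r_def)
  also have "\<dots> \<le> (m / 2) / m" using J m by (intro divide_right_mono) auto
  finally have Jr: "real J * r \<le> 1 / 2" using m by simp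
  have jr: "real i * r \<le> 1 / 2" if "i \<le> J" for i
    using mult_right_mono[of "real i" "real J" r] that r0 Jr by simp
  have r1: "r \<le> 1" using jr[of 1] J by simp
  have "p k * (1 - real j * r) \<le> p (k + j)" using assms(3)
  proof (induction j)
    case (Suc j)
    have "p k * (1 - real (Suc j) * r) \<le> p k * ((1 - real j * r) * (1 - r))"
      using r0 by (intro mult_left_mono p_nonneg) (simp add: algebra_simps)
    also have "\<dots> = p k * (1 - real j * r) * (1 - r)" by simp
    also have "\<dots> \<le> p (k + j) * (1 - r)"
      using Suc r1 by (intro mult_right_mono) auto
    also have "\<dots> \<le> p (Suc (k + j))"
      unfolding r_def using assms Suc.prems by (intro slow_step) auto
    finally show ?case by simp
  qed simp
  moreover have "p k * (1 / 2) \<le> p k * (1 - real j * r)"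
    using jr[OF assms(3)] by (intro mult_left_mono p_nonneg) auto
  ultimately show ?thesis by simp
qed

lemma run_mass:
  assumes "k0 \<le> k" "k + J \<le> k0 + 3 * L"
  shows "real J * (p k / 2) \<le> (\<Sum>i\<in>{Suc k..k + J}. p i)"
proof -
  have "(\<Sum>i\<in>{Suc k..k + J}. p k / 2) \<le> (\<Sum>i\<in>{Suc k..k + J}. p i)"
  proof (rule sum_mono)
    fix i assume "i \<in> {Suc k..k + J}"
    then have i: "i - k \<le> J" "k + (i - k) = i" by auto
    show "p k / 2 \<le> p i" using half_run[OF assms i(1)] unfolding i(2) .
  qed
  then show ?thesis by simp
qed

lemma finite_mass_le: "finite F \<Longrightarrow> (\<Sum>k\<in>F. p k) \<le> 1"
  using sum_le_suminf[OF sums_summable[OF p_sums], of F] p_nonneg sums_unique[OF p_sums] by simp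

text \<open>The \<open>J\<close> weights after the mode are at least half the maximal one, and
  together at most 1.\<close>

lemma p_le: "p k \<le> 2 / real J"
proof -
  have "real J * (p k0 / 2) \<le> 1"
    using run_mass[of k0] finite_mass_le[of "{Suc k0..k0 + J}"] J by simp
  then have "p k0 \<le> 2 / real J" using J by (simp add: field_simps)
  then show ?thesis using mode[of k] by simp
qed

text \<open>From \<open>k0 + L\<close> on, the index exceeds \<open>m\<close> by at least
  \<open>L\<close>, so each of the next \<open>L\<close> steps contracts by
  \<open>exp (- g)\<close>.\<close>

lemma tail_small: "p (k0 + 2 * L) \<le> exp (- (A * real L ^ 2 / (m + 2 * real L + 2)))"
proof -
  define g where "g = A * real L / (m + 2 * real L + 2)"
  have "p (k0 + L + j) \<le> exp (- g * real j)" if "j \<le> L" for j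
    using that
  proof (induction j)
    case 0
    have "p (k0 + L) \<le> 1" using finite_mass_le[of "{k0 + L}"] by simp
    then show ?case by simp
  next
    case (Suc j)
    define k where "k = k0 + L + j"
    have "tr \<Longrightarrow> k < N" using Suc.prems k0_less[of "L + j"] by (simp add: k_def)
    then have "p (Suc k) * real (Suc k) = p k * (real (Suc k) - A * (real k - m))" by (rule ratio)
    then have eq: "p (Suc k) = p k * (1 - A * (real k - m) / real (Suc k))"
      by (simp add: field_simps)
    have km: "real L \<le> real k - m" "real (Suc k) \<le> m + 2 * real L + 2"
      using Suc.prems k0 by (auto simp: k_def)
    have "g \<le> A * (real k - m) / real (Suc k)"
      unfolding g_def using km A by (intro frac_le mult_left_mono) auto
    then have "1 - A * (real k - m) / real (Suc k) \<le> 1 + (- g)" by simp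
    also have "\<dots> \<le> exp (- g)" by (rule exp_ge_add_one_self)
    finally have s1: "p (Suc k) \<le> p k * exp (- g)" unfolding eq by (intro mult_left_mono p_nonneg)
    have "p k \<le> exp (- g * real j)" using Suc.IH Suc.prems by (simp add: k_def)
    then have "p k * exp (- g) \<le> exp (- g * real j) * exp (- g)" by (rule mult_right_mono) simp
    also have "\<dots> = exp (- g * real (Suc j))"
      unfolding exp_add[symmetric] by (rule arg_cong[where f=exp]) (simp add: algebra_simps)
    finally show ?case using s1 by (simp add: k_def)
  qed
  then have "p (k0 + L + L) \<le> exp (- g * real L)" by blast
  moreover have "k0 + L + L = k0 + 2 * L" by simp
  moreover have "- g * real L = - (A * real L ^ 2 / (m + 2 * real L + 2))"
    by (simp add: g_def power2_eq_square)
  ultimately show ?thesis by simp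
qed

text \<open>Supplies the sets \<open>F\<close> for \<open>anti_concentration\<close>. For moderate
  \<open>t\<close> all terms are small and a long initial segment carries more than half the mass.
  For large \<open>t\<close> the terms near the mode are too big, and \<open>F\<close> is the run of
  \<open>J\<close> terms that begins where they first drop to \<open>c\<^sup>2\<close>.\<close>

lemma flat:
  assumes c: "c > 0" and t: "t\<^sup>2 \<le> c\<^sup>2 * exp (A * real L ^ 2 / (m + 2 * real L + 2))"
  shows "\<exists>F. finite F \<and> (\<forall>k\<in>F. t\<^sup>2 * p k \<le> c\<^sup>2) \<and> min (t\<^sup>2 / 2) (real J * c\<^sup>2 / 2) \<le> (\<Sum>k\<in>F. t\<^sup>2 * p k)"
proof (cases "t\<^sup>2 * p k0 \<le> c\<^sup>2")
  case True
  have "eventually (\<lambda>K. (\<Sum>k<K. p k) > 1 / 2) sequentially"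
    using p_sums unfolding sums_def by (rule order_tendstoD) simp
  then obtain K where K: "(\<Sum>k<K. p k) > 1 / 2" by (auto simp: eventually_sequentially)
  have "t\<^sup>2 * (1 / 2) \<le> t\<^sup>2 * (\<Sum>k<K. p k)" using K by (intro mult_left_mono) auto
  then have "t\<^sup>2 / 2 \<le> (\<Sum>k<K. t\<^sup>2 * p k)" by (simp add: sum_distrib_left)
  moreover have "t\<^sup>2 * p k \<le> c\<^sup>2" for k
    using True mult_left_mono[OF mode[of k], of "t\<^sup>2"] by simp
  ultimately show ?thesis by (intro exI[of _ "{..<K}"]) auto
next
  case False
  define Q where "Q k \<longleftrightarrow> k0 \<le> k \<and> t\<^sup>2 * p k \<le> c\<^sup>2" for k
  have "t\<^sup>2 * p (k0 + 2 * L) \<le> (c\<^sup>2 * exp (A * real L ^ 2 / (m + 2 * real L + 2))) * exp (- (A * real L ^ 2 / (m + 2 * real L + 2)))"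
    using t tail_small p_nonneg by (intro mult_mono) auto
  also have "\<dots> = c\<^sup>2" by (simp add: exp_minus field_simps)
  finally have Q: "Q (k0 + 2 * L)" by (simp add: Q_def)
  \<comment> \<open>The last term before \<open>k1\<close> exceeds \<open>c\<^sup>2\<close>, so by
    slow variation the following \<open>J\<close> terms are at least \<open>c\<^sup>2 / 2\<close>.
    As \<open>k1 \<le> k0 + 2 * L\<close> and \<open>J \<le> L\<close>, the run stays in the window
    of length \<open>3 * L\<close>.\<close>
  define k1 where "k1 = (LEAST k. Q k)"
  have Q1: "Q k1" unfolding k1_def using Q by (rule LeastI)
  have k1: "k1 \<le> k0 + 2 * L" unfolding k1_def using Q by (rule Least_le)
  have "k1 \<noteq> k0" using Q1 False by (auto simp: Q_def)
  then have k1': "k0 < k1" using Q1 by (simp add: Q_def)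
  define k where "k = k1 - 1"
  have "\<not> Q k" unfolding k_def k1_def by (rule not_less_Least) (use k1' k1_def in auto)
  moreover have "k0 \<le> k" using k1' by (simp add: k_def)
  ultimately have big: "t\<^sup>2 * p k > c\<^sup>2" by (simp add: Q_def)
  have k: "k0 \<le> k" "k + J \<le> k0 + 3 * L" "Suc k = k1" using k1 k1' J by (auto simp: k_def)
  show ?thesis
  proof (intro exI[of _ "{Suc k..k + J}"] conjI ballI)
    fix i assume i: "i \<in> {Suc k..k + J}"
    then have "p i \<le> p k1" using k k1' by (intro antitone) auto
    then have "t\<^sup>2 * p i \<le> t\<^sup>2 * p k1" by (rule mult_left_mono) simp
    then show "t\<^sup>2 * p i \<le> c\<^sup>2" using Q1 by (simp add: Q_def)
  next
    have "real J * c\<^sup>2 / 2 \<le> real J * (t\<^sup>2 * p k) / 2" using big by (intro divide_right_mono mult_left_mono) auto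
    also have "\<dots> = t\<^sup>2 * (real J * (p k / 2))" by simp
    also have "\<dots> \<le> t\<^sup>2 * (\<Sum>i\<in>{Suc k..k + J}. p i)" by (intro mult_left_mono run_mass k) auto
    finally show "min (t\<^sup>2 / 2) (real J * c\<^sup>2 / 2) \<le> (\<Sum>k\<in>{Suc k..k + J}. t\<^sup>2 * p k)"
      by (simp add: sum_distrib_left)
  qed simp
qed

end

section \<open>Coefficient profiles\<close>

text \<open>The untruncated squared coefficients: \<open>\<sigma>\<close> is \<open>-1\<close> for SP, \<open>0\<close> for FAF and WP, \<open>1\<close> for HAF.\<close>

definition uc :: "real \<Rightarrow> nat \<Rightarrow> nat \<Rightarrow> real" where
  "uc \<sigma> n k = (\<Prod>j<k. real n + \<sigma> * real j) / fact k"

text \<open>The generating function of \<open>uc \<sigma> n\<close> is \<open>exp (n * Gl \<sigma> z)\<close>.\<close>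

definition Gl :: "real \<Rightarrow> real \<Rightarrow> real" where
  "Gl \<sigma> z = (if \<sigma> = 0 then z else - ln (1 - \<sigma> * z) / \<sigma>)"

lemma uc_Suc: "uc \<sigma> n (Suc k) * real (Suc k) = uc \<sigma> n k * (real n + \<sigma> * real k)"
  unfolding uc_def fact_Suc prod.lessThan_Suc by (simp del: of_nat_Suc)

lemma uc_exp: "uc 0 n k = real n ^ k / fact k"
  by (simp add: uc_def)

lemma uc_binomial: "uc (-1) n k = real (n choose k)"
proof -
  have "real (n choose k) = (real n gchoose k)" by (simp add: binomial_gbinomial)
  also have "\<dots> = (\<Prod>j<k. real n - real j) / fact k" by (simp add: gbinomial_prod_rev lessThan_atLeast0)
  finally show ?thesis by (simp add: uc_def)
qed

lemma uc_pochhammer: "uc 1 n k = pochhammer (real n) k / fact k"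
  by (simp add: uc_def pochhammer_prod lessThan_atLeast0)

lemma uc_negbinomial:
  assumes "n > 0"
  shows "uc 1 n k = real ((n + k - 1) choose k)"
proof -
  have "real ((n + k - 1) choose k) = (real (n + k - 1) gchoose k)" by (simp add: binomial_gbinomial)
  also have "\<dots> = pochhammer (real (n + k - 1) - real k + 1) k / fact k"
    by (rule gbinomial_pochhammer')
  also have "real (n + k - 1) - real k + 1 = real n" using assms by (simp add: of_nat_diff)
  finally show ?thesis by (simp add: uc_pochhammer)
qed

lemma uc_nonneg: "\<sigma> \<in> {-1, 0, 1} \<Longrightarrow> 0 \<le> uc \<sigma> n k"
  by (cases "\<sigma> = -1")
     (simp add: uc_binomial, auto simp: uc_def intro!: divide_nonneg_nonneg prod_nonneg)

text \<open>The sums are \<open>(1 + z) ^ n\<close>, \<open>exp (n * z)\<close> and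
  \<open>(1 - z) powr (- n)\<close>.\<close>

lemma uc_sums:
  assumes \<sigma>: "\<sigma> \<in> {-1, 0, 1}" and z: "0 \<le> z" "\<sigma> * z < 1"
  shows "(\<lambda>k. uc \<sigma> n k * z ^ k) sums exp (real n * Gl \<sigma> z)"
proof -
  consider "\<sigma> = -1" | "\<sigma> = 0" | "\<sigma> = 1" using \<sigma> by auto
  then show ?thesis
  proof cases
    case 1
    have "(\<lambda>k. real (n choose k) * z ^ k) sums (\<Sum>k\<le>n. real (n choose k) * z ^ k)"
      by (rule sums_finite) auto
    also have "(\<Sum>k\<le>n. real (n choose k) * z ^ k) = (1 + z) ^ n"
      using binomial_ring[of z 1 n] by (simp add: add.commute)
    also have "(1 + z) ^ n = exp (real n * Gl \<sigma> z)"
      using 1 z by (simp add: Gl_def exp_of_nat_mult)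
    finally show ?thesis unfolding 1 uc_binomial .
  next
    case 2
    have "(\<lambda>k. (real n * z) ^ k /\<^sub>R fact k) sums exp (real n * z)" by (rule exp_converges)
    then show ?thesis unfolding 2 uc_exp by (simp add: Gl_def power_mult_distrib field_simps)
  next
    case 3
    have "(\<lambda>k. ((- real n) gchoose k) * (- z) ^ k) sums (1 + (- z)) powr (- real n)"
      using z 3 by (intro gen_binomial_real) auto
    moreover have "((- real n) gchoose k) * (- z) ^ k = uc 1 n k * z ^ k" for k
    proof -
      have "((- real n) gchoose k) * (- z) ^ k = ((-1) ^ k * (-1) ^ k) * (pochhammer (real n) k / fact k * z ^ k)"
        by (simp add: gbinomial_pochhammer power_minus[of z])
      also have "(-1 :: real) ^ k * (-1) ^ k = 1" by (simp flip: power_mult_distrib)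
      finally show ?thesis by (simp add: uc_pochhammer)
    qed
    moreover have "(1 + (- z)) powr (- real n) = exp (real n * Gl \<sigma> z)"
      using z 3 by (simp add: powr_def Gl_def)
    ultimately show ?thesis unfolding 3 by simp
  qed
qed

lemma Gl_deriv:
  assumes "\<sigma> * z < 1"
  shows "(Gl \<sigma> has_real_derivative 1 / (1 - \<sigma> * z)) (at z)"
proof (cases "\<sigma> = 0")
  case True
  then show ?thesis by (simp add: Gl_def[abs_def])
next
  case False
  then show ?thesis unfolding Gl_def[abs_def]
    using assms by (auto intro!: derivative_eq_intros simp: field_simps)
qed

text \<open>Second-order expansion of the cumulant generating function along \<open>z e\<^sup>h\<close>; the
  linear term is the mean and the quadratic one the variance of the weights, up to the factor \<open>n\<close>.\<close>

lemma Gl_expansion: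
  assumes "0 < z1" "z1 \<le> z2" and \<sigma>: "\<bar>\<sigma>\<bar> \<le> 1" "\<sigma> * z2 < 1"
  shows "\<exists>h0>0. \<exists>C>0. \<sigma> * (z2 * exp h0) < 1 \<and> (\<forall>z h. z1 \<le> z \<longrightarrow> z \<le> z2 \<longrightarrow> \<bar>h\<bar> \<le> h0 \<longrightarrow> \<sigma> * (z * exp h) < 1 \<and>
     \<bar>Gl \<sigma> (z * exp h) - Gl \<sigma> z - h * (z / (1 - \<sigma> * z)) - h\<^sup>2 / 2 * (z / (1 - \<sigma> * z)\<^sup>2)\<bar> \<le> C * \<bar>h\<bar> ^ 3)"
proof -
  have "((\<lambda>h. \<sigma> * (z2 * exp h)) \<longlongrightarrow> \<sigma> * (z2 * exp 0)) (at 0)" by (intro tendsto_intros)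
  then have "eventually (\<lambda>h. \<sigma> * (z2 * exp h) < 1) (at 0)"
    using \<sigma> by (intro order_tendstoD) auto
  then have "eventually (\<lambda>h. \<sigma> * (z2 * exp h) < 1) (at_right 0)"
    by (rule filter_leD[OF at_le[OF subset_UNIV]])
  then obtain b where b: "b > 0" "\<And>y. 0 < y \<Longrightarrow> y < b \<Longrightarrow> \<sigma> * (z2 * exp y) < 1"
    unfolding eventually_at_right_field by auto
  define h0 where "h0 = b / 2"
  have h0: "h0 > 0" "\<sigma> * (z2 * exp h0) < 1" using b(1) b(2)[of "b / 2"] by (auto simp: h0_def)
  define W where "W = z2 * exp h0"
  \<comment> \<open>A common lower bound for \<open>1 - \<sigma> * w\<close> over the range: the
    expression is smallest at \<open>W\<close> when \<open>\<sigma> \<ge> 0\<close> and at least 1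
    otherwise.\<close>
  define \<delta> where "\<delta> = min 1 (1 - \<sigma> * W)"
  have W: "W > 0" using assms by (simp add: W_def)
  have \<delta>: "\<delta> > 0" using h0 by (simp add: \<delta>_def W_def)
  define C where "C = W * (1 + W) / \<delta> ^ 3"
  have C: "C > 0" using W \<delta> by (simp add: C_def)
  have range: "0 < w \<and> w \<le> W" "1 - \<sigma> * w \<ge> \<delta>" if "z1 \<le> z" "z \<le> z2" "\<bar>h\<bar> \<le> h0" "w = z * exp h" for z h w
  proof -
    have "z * exp h \<le> z2 * exp h0" using that assms by (intro mult_mono) auto
    then show w: "0 < w \<and> w \<le> W" using that assms by (simp add: W_def)
    show "1 - \<sigma> * w \<ge> \<delta>"
    proof (cases "\<sigma> \<ge> 0")
      case True
      then have "\<sigma> * w \<le> \<sigma> * W" using w by (intro mult_left_mono) auto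
      then show ?thesis by (simp add: \<delta>_def)
    next
      case False
      then have "\<sigma> * w \<le> 0" using w by (simp add: mult_nonpos_nonneg)
      then show ?thesis by (simp add: \<delta>_def)
    qed
  qed
  have main: "\<sigma> * (z * exp h) < 1 \<and> \<bar>Gl \<sigma> (z * exp h) - Gl \<sigma> z - h * (z / (1 - \<sigma> * z)) - h\<^sup>2 / 2 * (z / (1 - \<sigma> * z)\<^sup>2)\<bar> \<le> C * \<bar>h\<bar> ^ 3"
    if z: "z1 \<le> z" "z \<le> z2" and h: "\<bar>h\<bar> \<le> h0" for z h
  proof -
    define w where "w t = z * exp t" for t
    \<comment> \<open>Iterates of \<open>w * d/dw\<close> applied to \<open>Gl \<sigma>\<close>,
      that is, the derivatives in \<open>t\<close> along \<open>w = z * exp t\<close>; the third one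
      bounds the remainder.\<close>
    define diff :: "nat \<Rightarrow> real \<Rightarrow> real" where "diff i t = (if i = 0 then Gl \<sigma> (w t) else if i = 1 then w t / (1 - \<sigma> * w t)
       else if i = 2 then w t / (1 - \<sigma> * w t)\<^sup>2 else w t * (1 + \<sigma> * w t) / (1 - \<sigma> * w t) ^ 3)" for i t
    have rt: "0 < w t" "w t \<le> W" "1 - \<sigma> * w t \<ge> \<delta>" if "\<bar>t\<bar> \<le> \<bar>h\<bar>" for t
      using range[OF z, of t "w t"] that h by (auto simp: w_def)
    have dw: "(w has_real_derivative w t) (at t)" for t
      unfolding w_def[abs_def] by (auto intro!: derivative_eq_intros)
    have D: "(diff i has_real_derivative diff (Suc i) t) (at t)" if i: "i < 3" and t: "\<bar>t\<bar> \<le> \<bar>h\<bar>" for i t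
    proof -
      have nz: "1 - \<sigma> * w t > 0" using rt[OF t] \<delta> by linarith
      consider "i = 0" | "i = 1" | "i = 2" using i by linarith
      then show ?thesis
      proof cases
        case 1
        have "((\<lambda>t. Gl \<sigma> (w t)) has_real_derivative 1 / (1 - \<sigma> * w t) * w t) (at t)"
          by (rule DERIV_chain2[OF Gl_deriv dw]) (use nz in simp)
        then show ?thesis unfolding 1 diff_def[abs_def] by simp
      next
        case 2
        have der: "((\<lambda>t. w t / (1 - \<sigma> * w t)) has_real_derivative
            (w t * (1 - \<sigma> * w t) - w t * (0 - (\<sigma> * w t))) / ((1 - \<sigma> * w t) * (1 - \<sigma> * w t))) (at t)"
          by (intro DERIV_divide DERIV_diff DERIV_const DERIV_cmult dw) (use nz in simp)
        have eq: "(w t * (1 - \<sigma> * w t) - w t * (0 - (\<sigma> * w t))) / ((1 - \<sigma> * w t) * (1 - \<sigma> * w t)) = w t / (1 - \<sigma> * w t)\<^sup>2"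
          by (simp add: power2_eq_square algebra_simps)
        show ?thesis using der[unfolded eq] unfolding 2 diff_def[abs_def] by simp
      next
        case 3
        have d1: "((\<lambda>t. 1 - \<sigma> * w t) has_real_derivative (0 - (\<sigma> * w t))) (at t)"
          by (intro DERIV_diff DERIV_const DERIV_cmult dw)
        have der: "((\<lambda>t. w t / (1 - \<sigma> * w t)\<^sup>2) has_real_derivative
            (w t * (1 - \<sigma> * w t)\<^sup>2 - w t * (of_nat 2 * ((0 - (\<sigma> * w t)) * (1 - \<sigma> * w t) ^ (2 - Suc 0)))) / ((1 - \<sigma> * w t)\<^sup>2 * (1 - \<sigma> * w t)\<^sup>2)) (at t)"
          by (rule DERIV_divide[OF dw DERIV_power[OF d1]]) (use nz in simp)
        have eq: "(w t * (1 - \<sigma> * w t)\<^sup>2 - w t * (of_nat 2 * ((0 - (\<sigma> * w t)) * (1 - \<sigma> * w t) ^ (2 - Suc 0)))) / ((1 - \<sigma> * w t)\<^sup>2 * (1 - \<sigma> * w t)\<^sup>2)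
            = w t * (1 + \<sigma> * w t) / (1 - \<sigma> * w t) ^ 3"
        proof -
          define q where "q = 1 - \<sigma> * w t"
          have q: "q \<noteq> 0" "\<sigma> * w t = 1 - q" using nz by (auto simp: q_def)
          have "w t * q\<^sup>2 - w t * (of_nat 2 * ((0 - (1 - q)) * q ^ (2 - Suc 0))) = q * (w t * (1 + (1 - q)))"
            by (simp add: power2_eq_square algebra_simps)
          moreover have "q\<^sup>2 * q\<^sup>2 = q * q ^ 3" by (simp add: power2_eq_square power3_eq_cube)
          ultimately have "(w t * q\<^sup>2 - w t * (of_nat 2 * ((0 - (1 - q)) * q ^ (2 - Suc 0)))) / (q\<^sup>2 * q\<^sup>2) = w t * (1 + (1 - q)) / q ^ 3"
            using q(1) by simp
          moreover have e: "1 - q = \<sigma> * w t" by (simp add: q_def)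
          ultimately show ?thesis unfolding e unfolding q_def by simp
        qed
        show ?thesis using der[unfolded eq] unfolding 3 diff_def[abs_def] by simp
      qed
    qed
    have "\<forall>i t. i < 3 \<and> \<bar>t\<bar> \<le> \<bar>h\<bar> \<longrightarrow> (diff i has_real_derivative diff (Suc i) t) (at t)"
      by (intro allI impI, elim conjE) (rule D)
    from Maclaurin_bi_le[OF refl this] obtain t
      where t: "\<bar>t\<bar> \<le> \<bar>h\<bar>" "diff 0 h = (\<Sum>i<3. diff i 0 / fact i * h ^ i) + diff 3 t / fact 3 * h ^ 3"
      by (elim exE conjE) (rule that)
    have "Gl \<sigma> (z * exp h) - Gl \<sigma> z - h * (z / (1 - \<sigma> * z)) - h\<^sup>2 / 2 * (z / (1 - \<sigma> * z)\<^sup>2) = diff 3 t / 6 * h ^ 3"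
    proof -
      have s3: "(\<Sum>i<3. diff i 0 / fact i * h ^ i) = diff 0 0 + diff 1 0 * h + diff 2 0 / 2 * h\<^sup>2"
      proof -
        have "{..<3::nat} = {0, 1, 2}" by auto
        then show ?thesis by (simp add: fact_numeral)
      qed
      have d: "diff 0 h = Gl \<sigma> (z * exp h)" "diff 0 0 = Gl \<sigma> z" "diff 1 0 = z / (1 - \<sigma> * z)" "diff 2 0 = z / (1 - \<sigma> * z)\<^sup>2"
        by (simp_all add: diff_def w_def)
      have "fact 3 = (6 :: real)" by (simp add: fact_numeral)
      with t(2) have "Gl \<sigma> (z * exp h) = Gl \<sigma> z + z / (1 - \<sigma> * z) * h + z / (1 - \<sigma> * z)\<^sup>2 / 2 * h\<^sup>2 + diff 3 t / 6 * h ^ 3"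
        unfolding s3 d by simp
      moreover have "g = a + b * h + c / 2 * h2 + r \<Longrightarrow> g - a - h * b - h2 / 2 * c = r" for g a b c h2 r :: real
        by (simp add: mult.commute)
      ultimately show ?thesis by blast
    qed
    also have "\<bar>diff 3 t / 6 * h ^ 3\<bar> \<le> C * \<bar>h\<bar> ^ 3"
    proof -
      have num: "\<bar>w t * (1 + \<sigma> * w t)\<bar> \<le> W * (1 + W)"
      proof -
        have "\<bar>\<sigma> * w t\<bar> \<le> 1 * W" unfolding abs_mult using rt[OF t(1)] \<sigma> by (intro mult_mono) auto
        then have "\<bar>1 + \<sigma> * w t\<bar> \<le> 1 + W" by linarith
        then show ?thesis unfolding abs_mult using rt[OF t(1)] W by (intro mult_mono) auto
      qed
      have den: "\<delta> ^ 3 \<le> (1 - \<sigma> * w t) ^ 3" using rt[OF t(1)] \<delta> by (intro power_mono) auto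
      have pos: "0 < \<delta> ^ 3" using \<delta> by simp
      then have ge: "0 \<le> (1 - \<sigma> * w t) ^ 3" using den by linarith
      have "0 \<le> W * (1 + W)" using W by simp
      from frac_le[OF this num pos den] have fr: "\<bar>w t * (1 + \<sigma> * w t)\<bar> / (1 - \<sigma> * w t) ^ 3 \<le> C"
        unfolding C_def .
      have "diff 3 t = w t * (1 + \<sigma> * w t) / (1 - \<sigma> * w t) ^ 3" by (simp add: diff_def)
      then have "\<bar>diff 3 t\<bar> = \<bar>w t * (1 + \<sigma> * w t)\<bar> / (1 - \<sigma> * w t) ^ 3"
        unfolding abs_divide abs_of_nonneg[OF ge] by (simp only: abs_divide abs_of_nonneg[OF ge])
      then have "\<bar>diff 3 t\<bar> \<le> C" using fr by simp
      then have "\<bar>diff 3 t / 6\<bar> \<le> C" by simp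
      then show ?thesis unfolding abs_mult power_abs by (rule mult_right_mono) simp
    qed
    finally show ?thesis using rt[of h] \<delta> by (simp add: w_def)
  qed
  show ?thesis
    by (intro exI[of _ h0] exI[of _ C] conjI allI impI h0 C)
       (use main in \<open>auto simp del: power2_eq_square\<close>)
qed

lemma summable_exp_neg_abs:
  assumes "c > (0::real)"
  shows "summable (\<lambda>k. exp (- c * \<bar>(real k - x)\<bar>))"
proof (rule summable_comparison_test')
  have "summable (\<lambda>k. exp (- c) ^ k)" using assms by (intro summable_geometric) simp
  then show "summable (\<lambda>k. exp (c * x) * exp (- c) ^ k)" by (rule summable_mult)
  fix k
  have "- c * \<bar>real k - x\<bar> \<le> - c * (real k - x)" using assms by (intro mult_left_mono_neg) auto
  then have "exp (- c * \<bar>real k - x\<bar>) \<le> exp (c * x + real k * (- c))" by (simp add: algebra_simps)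
  also have "\<dots> = exp (c * x) * exp (- c) ^ k" by (simp only: exp_add exp_of_nat_mult)
  finally show "norm (exp (- c * \<bar>real k - x\<bar>)) \<le> exp (c * x) * exp (- c) ^ k" by simp
qed

text \<open>The argument is \<open>x = sg * exp \<tau>\<close> with \<open>\<tau>\<close> in \<open>[\<alpha>, \<beta>]\<close>, and \<open>tr\<close> marks the truncated ensemble WP.
  \<open>\<kappa>\<close> is the mean index under the untruncated weights, and the zeros have asymptotic density
  \<open>sqrt n * D / pi\<close> in \<open>\<tau>\<close>.\<close>

locale ensemble_profile =
  fixes \<sigma> :: real and tr :: bool and sg \<alpha> \<beta> :: real
  assumes \<sigma>: "\<sigma> \<in> {-1, 0, 1}" and sg: "sg \<in> {-1, 1}" and \<alpha>\<beta>: "\<alpha> \<le> \<beta>"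
    and dom: "\<sigma> * exp (2 * \<beta>) < 1" and tr: "tr \<Longrightarrow> \<sigma> = 0 \<and> exp (2 * \<beta>) < 1"
begin

abbreviation "z1 \<equiv> exp (2 * \<alpha>)"
abbreviation "z2 \<equiv> exp (2 * \<beta>)"

definition "v n k = (if tr \<and> k > n then 0 else uc \<sigma> n k)"
definition "S n x = (\<Sum>k. v n k * x ^ k)"
text \<open>The sign of the argument is absorbed into the coefficients; it disappears from their
  squares.\<close>

definition "w n k = sg ^ k * sqrt (v n k)"
definition "\<kappa> n \<tau> = real n * (exp (2 * \<tau>) / (1 - \<sigma> * exp (2 * \<tau>)))"
definition "a n \<tau> k = w n k * exp (real k * \<tau>) / sqrt (S n (exp (2 * \<tau>)))"
text \<open>A shift of \<open>\<tau>\<close> by \<open>u / sqrt n\<close> multiplies the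
  coefficients by \<open>exp (d n \<tau> k * u)\<close> up to a factor independent of
  \<open>k\<close>. Centring at \<open>\<kappa>\<close> chooses this factor so that exponential
  moments remain bounded.\<close>

definition "d n \<tau> k = (real k - \<kappa> n \<tau>) / sqrt (real n)"
definition "D \<tau> = exp \<tau> / (1 - \<sigma> * exp (2 * \<tau>))"

lemma sg_sq: "sg ^ k * sg ^ k = 1"
  using sg by (auto simp flip: power_mult_distrib)

lemma v_nonneg: "v n k \<ge> 0" using uc_nonneg[OF \<sigma>] by (simp add: v_def)

lemma v_le: "v n k \<le> uc \<sigma> n k" using uc_nonneg[OF \<sigma>] by (simp add: v_def)

lemma v_0: "v n 0 = 1" by (simp add: v_def uc_def)

lemma z_range:
  assumes "\<tau> \<le> \<beta>"
  shows "0 < exp (2 * \<tau>)" "exp (2 * \<tau>) \<le> z2" "\<sigma> * exp (2 * \<tau>) < 1"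
proof -
  show le: "exp (2 * \<tau>) \<le> z2" using assms by simp
  show "\<sigma> * exp (2 * \<tau>) < 1"
  proof (cases "\<sigma> \<ge> 0")
    case True
    have "\<sigma> * exp (2 * \<tau>) \<le> \<sigma> * z2" using True le by (intro mult_left_mono) auto
    then show ?thesis using dom by simp
  next
    case False
    then have "\<sigma> * exp (2 * \<tau>) \<le> 0" by (simp add: mult_nonpos_nonneg)
    then show ?thesis by simp
  qed
qed simp

lemma v_summable:
  assumes "0 \<le> x" "\<sigma> * x < 1"
  shows "summable (\<lambda>k. v n k * x ^ k)"
proof (rule summable_comparison_test'[OF sums_summable[OF uc_sums[OF \<sigma> assms]]])
  show "norm (v n k * x ^ k) \<le> uc \<sigma> n k * x ^ k" for k
    using v_nonneg[of n k] v_le[of n k] assms(1) by (simp add: abs_mult mult_right_mono)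
qed

lemma S_le:
  assumes "0 \<le> x" "\<sigma> * x < 1"
  shows "S n x \<le> exp (real n * Gl \<sigma> x)"
proof -
  have "S n x \<le> (\<Sum>k. uc \<sigma> n k * x ^ k)"
    unfolding S_def using v_le assms(1)
    by (intro suminf_le v_summable assms sums_summable[OF uc_sums[OF \<sigma> assms]] mult_right_mono) auto
  also have "\<dots> = exp (real n * Gl \<sigma> x)" using uc_sums[OF \<sigma> assms] by (simp add: sums_iff)
  finally show ?thesis .
qed

lemma S_ge_1:
  assumes "0 \<le> x" "\<sigma> * x < 1"
  shows "S n x \<ge> 1"
proof -
  have "(\<Sum>k\<in>{0}. v n k * x ^ k) \<le> S n x"
    unfolding S_def using v_nonneg assms(1) by (intro sum_le_suminf v_summable assms) auto
  then show ?thesis by (simp add: v_0)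
qed

text \<open>Without truncation equality holds between \<open>S\<close> and the exponential. In the
  truncated case the missing tail of the exponential series is exponentially smaller than the sum,
  since the argument stays below 1.\<close>

lemma S_lower:
  assumes \<delta>: "\<delta> > 0"
  shows "eventually (\<lambda>n. \<forall>x. 0 \<le> x \<longrightarrow> x \<le> z2 \<longrightarrow> (1 - \<delta>) * exp (real n * Gl \<sigma> x) \<le> S n x) sequentially"
proof (cases tr)
  case False
  then have v: "v n k = uc \<sigma> n k" for n k unfolding v_def by simp
  show ?thesis
  proof (intro always_eventually allI impI)
    fix n x assume x: "0 \<le> x" "x \<le> z2"
    have sx: "\<sigma> * x < 1"
    proof (cases "\<sigma> \<ge> 0")
      case True
      then have "\<sigma> * x \<le> \<sigma> * z2" using x by (intro mult_left_mono) auto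
      then show ?thesis using dom by simp
    next
      case False
      then have "\<sigma> * x \<le> 0" using x by (simp add: mult_nonpos_nonneg)
      then show ?thesis by simp
    qed
    have "S n x = exp (real n * Gl \<sigma> x)" unfolding S_def v using uc_sums[OF \<sigma> x(1) sx] by (simp add: sums_iff)
    then show "(1 - \<delta>) * exp (real n * Gl \<sigma> x) \<le> S n x" using \<delta> by (simp add: mult_le_cancel_right1)
  qed
next
  case True
  then have \<sigma>0: "\<sigma> = 0" and z2: "z2 < 1" using tr by auto
  \<comment> \<open>\<open>q < 1\<close> is the strict inequality \<open>ln z2 < z2 - 1\<close> for
    \<open>z2 < 1\<close>; it is the rate at which the tail loses against the full sum.\<close>
  define q where "q = exp (1 - z2) * z2"
  have "ln z2 \<noteq> z2 - 1" using ln_eq_minus_one[of z2] z2 by auto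
  moreover have "ln z2 \<le> z2 - 1" by (rule ln_le_minus_one) simp
  ultimately have "1 - z2 + ln z2 < 0" by linarith
  then have "exp (1 - z2 + ln z2) < 1" by simp
  then have q: "0 < q" "q < 1" unfolding exp_add by (simp_all add: q_def)
  have "(\<lambda>n. q ^ n) \<longlonglongrightarrow> 0" using q by (intro LIMSEQ_power_zero) simp
  then have "eventually (\<lambda>n. q ^ n < \<delta>) sequentially" using \<delta> by (rule order_tendstoD)
  then show ?thesis
  proof (eventually_elim, intro allI impI)
    fix n x assume qn: "q ^ n < \<delta>" and x: "0 \<le> x" "x \<le> z2"
    have ts: "(\<lambda>k. real n ^ k / fact k * y ^ k) sums exp (real n * y)" if "y \<ge> 0" for y
      using uc_sums[of 0 y n] that by (simp add: uc_exp Gl_def)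
    define t where "t k = real n ^ k / fact k * x ^ k" for k
    \<comment> \<open>Majorant of the discarded terms: for \<open>k > n\<close> one has
      \<open>z2 ^ k \<le> z2 ^ n\<close>, after which the whole series in \<open>x / z2\<close> can
      be summed.\<close>
    define t' where "t' k = z2 ^ n * (real n ^ k / fact k * (x / z2) ^ k)" for k
    have t'_sums: "t' sums (z2 ^ n * exp (real n * (x / z2)))"
      unfolding t'_def using x by (intro sums_mult ts) auto
    have v: "v n k * x ^ k = (if k > n then 0 else t k)" for k
      unfolding v_def using True by (simp add: \<sigma>0 uc_exp t_def)
    have "t k \<le> v n k * x ^ k + t' k" for k
    proof (cases "k > n")
      case True
      have "t k = real n ^ k / fact k * (x / z2) ^ k * z2 ^ k" by (simp add: t_def power_divide)
      also have "\<dots> \<le> real n ^ k / fact k * (x / z2) ^ k * z2 ^ n"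
        using True z2 x by (intro mult_left_mono power_decreasing) auto
      finally show ?thesis unfolding v using True by (simp add: t'_def mult_ac)
    next
      case False
      then show ?thesis unfolding v using x by (simp add: t'_def)
    qed
    then have "(\<Sum>k. t k) \<le> (\<Sum>k. v n k * x ^ k + t' k)"
      using ts[OF x(1)] t'_sums x \<sigma>0 unfolding t_def
      by (intro suminf_le summable_add v_summable) (auto simp: sums_iff)
    also have "\<dots> = S n x + z2 ^ n * exp (real n * (x / z2))"
      unfolding S_def sums_unique[OF t'_sums] using x \<sigma>0 t'_sums
      by (intro suminf_add[symmetric] v_summable) (auto simp: sums_iff)
    also have "(\<Sum>k. t k) = exp (real n * x)" using ts[OF x(1)] by (simp add: t_def sums_iff)
    finally have 1: "exp (real n * x) - z2 ^ n * exp (real n * (x / z2)) \<le> S n x" by simp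
    have "real n * (x / z2) \<le> real n * (x + (1 - z2))"
    proof (intro mult_left_mono)
      have "x / z2 - x = (x / z2) * (1 - z2)" by (simp add: right_diff_distrib)
      also have "\<dots> \<le> 1 * (1 - z2)" using x z2 by (intro mult_right_mono) (auto simp: divide_le_eq)
      finally show "x / z2 \<le> x + (1 - z2)" by simp
    qed simp
    then have "z2 ^ n * exp (real n * (x / z2)) \<le> z2 ^ n * exp (real n * (x + (1 - z2)))"
      by (intro mult_left_mono) auto
    also have "\<dots> = q ^ n * exp (real n * x)"
      by (simp add: q_def distrib_left exp_add power_mult_distrib exp_of_nat_mult)
    also have "\<dots> \<le> \<delta> * exp (real n * x)" using qn by (intro mult_right_mono) auto
    finally show "(1 - \<delta>) * exp (real n * Gl \<sigma> x) \<le> S n x"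
      using 1 by (simp add: Gl_def \<sigma>0 left_diff_distrib)
  qed
qed

lemma w_sq: "w n k * w n k = v n k"
proof -
  have "w n k * w n k = (sg ^ k * sg ^ k) * (sqrt (v n k) * sqrt (v n k))" by (simp add: w_def)
  then show ?thesis using sg_sq[of k] v_nonneg[of n k] by simp
qed

lemma a_sq:
  assumes "\<tau> \<le> \<beta>"
  shows "(a n \<tau> k)\<^sup>2 = v n k * exp (2 * \<tau>) ^ k / S n (exp (2 * \<tau>))"
proof -
  have "S n (exp (2 * \<tau>)) \<ge> 1" using z_range[OF assms] by (intro S_ge_1) auto
  moreover have "(w n k)\<^sup>2 = v n k"
    using w_sq[of n k] by (simp add: power2_eq_square)
  moreover have "(exp (real k * \<tau>))\<^sup>2 = exp (2 * \<tau>) ^ k"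
    by (simp flip: exp_of_nat_mult exp_double add: mult_ac)
  ultimately show ?thesis by (simp add: a_def power_divide power_mult_distrib)
qed

lemma a_sq_sums:
  assumes "\<tau> \<le> \<beta>"
  shows "(\<lambda>k. (a n \<tau> k)\<^sup>2) sums 1"
proof -
  have "S n (exp (2 * \<tau>)) \<ge> 1" using z_range[OF assms] by (intro S_ge_1) auto
  moreover have "(\<lambda>k. v n k * exp (2 * \<tau>) ^ k / S n (exp (2 * \<tau>))) sums (S n (exp (2 * \<tau>)) / S n (exp (2 * \<tau>)))"
    unfolding S_def using z_range[OF assms] by (intro sums_divide summable_sums v_summable) auto
  ultimately show ?thesis using a_sq[OF assms] by simp
qed

text \<open>The covariance involves the generating function at the geometric mean of the two squared
  arguments.\<close>

lemma a_prod:
  assumes "\<tau> \<le> \<beta>" "\<tau> + h \<le> \<beta>" "\<tau> + h / 2 \<le> \<beta>"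
  shows "(\<Sum>k. a n \<tau> k * a n (\<tau> + h) k) = S n (exp (2 * (\<tau> + h / 2))) / sqrt (S n (exp (2 * \<tau>)) * S n (exp (2 * (\<tau> + h))))"
proof -
  have "a n \<tau> k * a n (\<tau> + h) k = v n k * exp (2 * (\<tau> + h / 2)) ^ k / sqrt (S n (exp (2 * \<tau>)) * S n (exp (2 * (\<tau> + h))))" for k
  proof -
    have "exp (real k * \<tau>) * exp (real k * (\<tau> + h)) = exp (2 * (\<tau> + h / 2)) ^ k"
      unfolding exp_of_nat_mult[symmetric] exp_add[symmetric] by (rule arg_cong[where f=exp]) (simp add: algebra_simps)
    moreover have "a n \<tau> k * a n (\<tau> + h) k = (w n k * w n k) * (exp (real k * \<tau>) * exp (real k * (\<tau> + h))) / sqrt (S n (exp (2 * \<tau>)) * S n (exp (2 * (\<tau> + h))))"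
      by (simp add: a_def real_sqrt_mult)
    ultimately show ?thesis using w_sq[of n k] by simp
  qed
  moreover have "(\<lambda>k. v n k * exp (2 * (\<tau> + h / 2)) ^ k / sqrt (S n (exp (2 * \<tau>)) * S n (exp (2 * (\<tau> + h)))))
      sums (S n (exp (2 * (\<tau> + h / 2))) / sqrt (S n (exp (2 * \<tau>)) * S n (exp (2 * (\<tau> + h)))))"
    unfolding S_def[of n "exp (2 * (\<tau> + h / 2))"] using z_range[OF assms(3)] by (intro sums_divide summable_sums v_summable) auto
  ultimately show ?thesis by (simp add: sums_iff)
qed

lemma a_shift:
  assumes "\<tau> \<le> \<beta>" "\<tau> + s / sqrt (real n) \<le> \<beta>"
  shows "\<exists>c>0. \<forall>k. a n \<tau> k * exp (d n \<tau> k * s) = c * a n (\<tau> + s / sqrt (real n)) k"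
proof -
  define h where "h = s / sqrt (real n)"
  have S1: "S n (exp (2 * \<tau>)) \<ge> 1" "S n (exp (2 * (\<tau> + h))) \<ge> 1"
    using z_range[OF assms(1)] z_range[OF assms(2)] by (auto intro!: S_ge_1 simp: h_def)
  define c where "c = exp (- \<kappa> n \<tau> * h) * sqrt (S n (exp (2 * (\<tau> + h)))) / sqrt (S n (exp (2 * \<tau>)))"
  have "c > 0" using S1 by (simp add: c_def)
  moreover have "a n \<tau> k * exp (d n \<tau> k * s) = c * a n (\<tau> + h) k" for k
  proof -
    have "d n \<tau> k * s = real k * h - \<kappa> n \<tau> * h" by (simp add: d_def h_def diff_divide_distrib left_diff_distrib)
    then have "exp (real k * \<tau>) * exp (d n \<tau> k * s) = exp (- \<kappa> n \<tau> * h) * exp (real k * (\<tau> + h))"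
      unfolding exp_add[symmetric] by (intro arg_cong[where f=exp]) (simp add: distrib_left)
    then have "a n \<tau> k * exp (d n \<tau> k * s) = w n k * (exp (- \<kappa> n \<tau> * h) * exp (real k * (\<tau> + h))) / sqrt (S n (exp (2 * \<tau>)))"
      by (simp add: a_def mult.assoc)
    also have "\<dots> = c * a n (\<tau> + h) k" using S1 by (simp add: a_def c_def)
    finally show ?thesis .
  qed
  ultimately show ?thesis unfolding h_def by blast
qed

end

section \<open>Growth of the scales and expansions uniform over the interval\<close>

lemma run_length_growth:
  assumes "(0::real) < c" "(0::real) < z"
  shows "eventually (\<lambda>n::nat. c * (real n powr (1/4) * (3 * real n powr (2/3) + 2)) + 1 \<le> z * real n) sequentially"
  using assms by real_asymp

lemma window_growth:
  assumes "(0::real) < c"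
  shows "eventually (\<lambda>n::nat. 3 * real n powr (2/3) + 3 \<le> c * real n) sequentially"
  using assms by real_asymp

text \<open>Here \<open>2 * (2/3) = 4/3\<close> exceeds \<open>1 + 3/10\<close>; the corresponding
  comparison in \<open>run_length_growth\<close> is \<open>1/4 + 2/3 < 1\<close>.\<close>

lemma tail_exponent_growth:
  assumes "(0::real) < A" "(0::real) < z"
  shows "eventually (\<lambda>n::nat. 2 * real n powr (3/10) * (z * real n + 2 * real n powr (2/3) + 2) \<le> A * (real n powr (2/3) - 1)\<^sup>2) sequentially"
  using assms by real_asymp

text \<open>The linear term \<open>l\<close> cancels in the second difference, and the errors
  combine to \<open>e + 8 * e / 2\<close>; the factor 8 is the cube of the doubled step.\<close>

lemma second_difference_bound:
  fixes p0 p1 p2 :: real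
  assumes "\<bar>p1 - p0 - l - q / 2\<bar> \<le> e" "\<bar>p2 - p0 - 2 * l - 2 * q\<bar> \<le> 8 * e"
  shows "\<bar>p1 - (p0 + p2) / 2 + q / 2\<bar> \<le> 5 * e"
proof -
  have eq: "p1 - (p0 + p2) / 2 + q / 2 = (p1 - p0 - l - q / 2) - (p2 - p0 - 2 * l - 2 * q) / 2"
    by (simp add: field_simps)
  have gen: "\<bar>x - y / 2\<bar> \<le> 5 * e" if "\<bar>x\<bar> \<le> e" "\<bar>y\<bar> \<le> 8 * e" for x y :: real
    using that by linarith
  show ?thesis unfolding eq by (rule gen[OF assms])
qed

lemma nat_floor_bounds:
  assumes "(0::real) \<le> x"
  shows "real (nat \<lfloor>x\<rfloor>) \<le> x" "x - 1 \<le> real (nat \<lfloor>x\<rfloor>)"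
  using assms by linarith+

context ensemble_profile
begin

definition "Amin = min 1 (1 - \<sigma> * z2)"
definition "Amax = 1 + z2"

lemma Amin_pos: "Amin > 0" using dom by (simp add: Amin_def)
lemma Amax_pos: "Amax > 0" by (simp add: Amax_def add_pos_pos)

lemma abs_\<sigma>: "\<bar>\<sigma>\<bar> \<le> 1" using \<sigma> by auto

lemma A_range:
  assumes "\<tau> \<le> \<beta>"
  shows "Amin \<le> 1 - \<sigma> * exp (2 * \<tau>)" "1 - \<sigma> * exp (2 * \<tau>) \<le> Amax"
proof -
  note z = z_range[OF assms]
  show "Amin \<le> 1 - \<sigma> * exp (2 * \<tau>)"
  proof (cases "\<sigma> \<ge> 0")
    case True
    have "\<sigma> * exp (2 * \<tau>) \<le> \<sigma> * z2" using True z by (intro mult_left_mono) auto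
    then show ?thesis by (simp add: Amin_def)
  next
    case False
    then have "\<sigma> * exp (2 * \<tau>) \<le> 0" by (simp add: mult_nonpos_nonneg)
    then show ?thesis by (simp add: Amin_def)
  qed
  have "\<bar>\<sigma> * exp (2 * \<tau>)\<bar> \<le> 1 * z2" unfolding abs_mult using abs_\<sigma> z by (intro mult_mono) auto
  then show "1 - \<sigma> * exp (2 * \<tau>) \<le> Amax" unfolding Amax_def by linarith
qed

lemma D_sq: "(D \<tau>)\<^sup>2 = exp (2 * \<tau>) / (1 - \<sigma> * exp (2 * \<tau>))\<^sup>2"
  by (simp add: D_def power_divide exp_double)

lemma D_range:
  assumes "\<alpha> \<le> \<tau>" "\<tau> \<le> \<beta>"
  shows "exp \<alpha> / Amax \<le> D \<tau>" "D \<tau> \<le> exp \<beta> / Amin"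
  using A_range[OF assms(2)] Amin_pos Amax_pos assms unfolding D_def by (auto intro!: frac_le)

lemma expansion:
  obtains h0 C where "h0 > 0" "C > 0"
    "\<And>\<tau> h. \<alpha> \<le> \<tau> \<Longrightarrow> \<tau> \<le> \<beta> \<Longrightarrow> \<bar>h\<bar> \<le> h0 \<Longrightarrow> \<sigma> * (exp (2 * \<tau>) * exp h) < 1"
    "\<And>n \<tau> h. \<alpha> \<le> \<tau> \<Longrightarrow> \<tau> \<le> \<beta> \<Longrightarrow> \<bar>h\<bar> \<le> h0 \<Longrightarrow>
      \<bar>real n * Gl \<sigma> (exp (2 * \<tau>) * exp h) - real n * Gl \<sigma> (exp (2 * \<tau>)) - h * \<kappa> n \<tau> - real n * h\<^sup>2 / 2 * (D \<tau>)\<^sup>2\<bar> \<le> real n * C * \<bar>h\<bar> ^ 3"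
proof -
  have zz: "0 < z1" "z1 \<le> z2" using \<alpha>\<beta> by auto
  obtain h0 C where h: "h0 > 0" "C > 0" and e: "\<forall>z h. z1 \<le> z \<longrightarrow> z \<le> z2 \<longrightarrow> \<bar>h\<bar> \<le> h0 \<longrightarrow> \<sigma> * (z * exp h) < 1 \<and>
     \<bar>Gl \<sigma> (z * exp h) - Gl \<sigma> z - h * (z / (1 - \<sigma> * z)) - h\<^sup>2 / 2 * (z / (1 - \<sigma> * z)\<^sup>2)\<bar> \<le> C * \<bar>h\<bar> ^ 3"
    using Gl_expansion[OF zz abs_\<sigma> dom] by (elim exE conjE) (rule that)
  show thesis
  proof (rule that[OF h])
    fix \<tau> h assume t: "\<alpha> \<le> \<tau>" "\<tau> \<le> \<beta>" and hh: "\<bar>h\<bar> \<le> h0"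
    have z: "z1 \<le> exp (2 * \<tau>)" "exp (2 * \<tau>) \<le> z2" using t by auto
    show "\<sigma> * (exp (2 * \<tau>) * exp h) < 1" using e z hh by blast
  next
    fix n \<tau> h assume t: "\<alpha> \<le> \<tau>" "\<tau> \<le> \<beta>" and hh: "\<bar>h\<bar> \<le> h0"
    have z: "z1 \<le> exp (2 * \<tau>)" "exp (2 * \<tau>) \<le> z2" using t by auto
    define X where "X = Gl \<sigma> (exp (2 * \<tau>) * exp h) - Gl \<sigma> (exp (2 * \<tau>)) - h * (exp (2 * \<tau>) / (1 - \<sigma> * exp (2 * \<tau>))) - h\<^sup>2 / 2 * (exp (2 * \<tau>) / (1 - \<sigma> * exp (2 * \<tau>))\<^sup>2)"
    have "\<bar>X\<bar> \<le> C * \<bar>h\<bar> ^ 3" using e z hh unfolding X_def by blast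
    then have "real n * \<bar>X\<bar> \<le> real n * (C * \<bar>h\<bar> ^ 3)" by (rule mult_left_mono) simp
    moreover have "real n * Gl \<sigma> (exp (2 * \<tau>) * exp h) - real n * Gl \<sigma> (exp (2 * \<tau>)) - h * \<kappa> n \<tau> - real n * h\<^sup>2 / 2 * (D \<tau>)\<^sup>2 = real n * X"
      unfolding X_def \<kappa>_def D_sq right_diff_distrib by (simp add: mult_ac)
    ultimately show "\<bar>real n * Gl \<sigma> (exp (2 * \<tau>) * exp h) - real n * Gl \<sigma> (exp (2 * \<tau>)) - h * \<kappa> n \<tau> - real n * h\<^sup>2 / 2 * (D \<tau>)\<^sup>2\<bar> \<le> real n * C * \<bar>h\<bar> ^ 3"
      by (simp add: abs_mult mult.assoc)
  qed
qed

text \<open>Tilting the squared weights by \<open>exp (\<theta> * d n \<tau> k)\<close> only moves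
  the argument of \<open>S\<close> by the factor \<open>exp (\<theta> / sqrt n)\<close>. In the
  expansion of \<open>Gl\<close> the linear term is cancelled by the centring, and the quadratic and
  cubic ones stay bounded because the shift is of order \<open>1 / sqrt n\<close>.\<close>

lemma mgf_bound:
  "\<exists>C. eventually (\<lambda>n. \<forall>\<tau>. \<alpha> \<le> \<tau> \<longrightarrow> \<tau> \<le> \<beta> \<longrightarrow> summable (\<lambda>k. \<bar>a n \<tau> k\<bar> * exp \<bar>d n \<tau> k\<bar>) \<and>
      summable (\<lambda>k. (a n \<tau> k)\<^sup>2 * exp (4 * \<bar>d n \<tau> k\<bar>)) \<and> (\<Sum>k. (a n \<tau> k)\<^sup>2 * exp (4 * \<bar>d n \<tau> k\<bar>)) \<le> C) sequentially"
proof -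
  obtain h0 C where h0: "h0 > 0" and C: "C > 0" and dom': "\<And>\<tau> h. \<alpha> \<le> \<tau> \<Longrightarrow> \<tau> \<le> \<beta> \<Longrightarrow> \<bar>h\<bar> \<le> h0 \<Longrightarrow> \<sigma> * (exp (2 * \<tau>) * exp h) < 1"
    and ex: "\<And>n \<tau> h. \<alpha> \<le> \<tau> \<Longrightarrow> \<tau> \<le> \<beta> \<Longrightarrow> \<bar>h\<bar> \<le> h0 \<Longrightarrow>
      \<bar>real n * Gl \<sigma> (exp (2 * \<tau>) * exp h) - real n * Gl \<sigma> (exp (2 * \<tau>)) - h * \<kappa> n \<tau> - real n * h\<^sup>2 / 2 * (D \<tau>)\<^sup>2\<bar> \<le> real n * C * \<bar>h\<bar> ^ 3"
    by (rule expansion) (rule that)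
  \<comment> \<open>For \<open>\<bar>\<theta>\<bar> = 4\<close> one has
    \<open>n * h\<^sup>2 = 16\<close>, giving \<open>8 * (D \<tau>)\<^sup>2\<close> from the
    quadratic term and at most \<open>64 * C\<close> from the cubic one; the factor 2 comes from
    \<open>S_lower\<close> with loss one half.\<close>
  define K where "K = 2 * exp (8 * (exp \<beta> / Amin)\<^sup>2 + 64 * C)"
  have "eventually (\<lambda>n::nat. 4 / h0 \<le> sqrt (real n) \<and> 1 \<le> n) sequentially"
  proof (rule eventually_conj)
    have "filterlim (\<lambda>n::nat. sqrt (real n)) at_top sequentially"
      by (intro filterlim_compose[OF sqrt_at_top filterlim_real_sequentially])
    then show "eventually (\<lambda>n::nat. 4 / h0 \<le> sqrt (real n)) sequentially" by (simp add: filterlim_at_top)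
  qed (rule eventually_ge_at_top)
  moreover have "eventually (\<lambda>n. \<forall>x. 0 \<le> x \<longrightarrow> x \<le> z2 \<longrightarrow> (1 - 1/2) * exp (real n * Gl \<sigma> x) \<le> S n x) sequentially"
    by (rule S_lower) simp
  ultimately have "eventually (\<lambda>n. \<forall>\<tau>. \<alpha> \<le> \<tau> \<longrightarrow> \<tau> \<le> \<beta> \<longrightarrow> summable (\<lambda>k. \<bar>a n \<tau> k\<bar> * exp \<bar>d n \<tau> k\<bar>) \<and>
      summable (\<lambda>k. (a n \<tau> k)\<^sup>2 * exp (4 * \<bar>d n \<tau> k\<bar>)) \<and> (\<Sum>k. (a n \<tau> k)\<^sup>2 * exp (4 * \<bar>d n \<tau> k\<bar>)) \<le> 2 * K) sequentially"
  proof (eventually_elim, intro allI impI)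
    fix n \<tau> assume n: "4 / h0 \<le> sqrt (real n) \<and> 1 \<le> n" and low: "\<forall>x. 0 \<le> x \<longrightarrow> x \<le> z2 \<longrightarrow> (1 - 1/2) * exp (real n * Gl \<sigma> x) \<le> S n x"
      and t: "\<alpha> \<le> \<tau>" "\<tau> \<le> \<beta>"
    define z where "z = exp (2 * \<tau>)"
    have z: "0 < z" "z \<le> z2" "\<sigma> * z < 1" using z_range[OF t(2)] by (auto simp: z_def)
    have sn: "sqrt (real n) \<ge> 1" using n by simp
    have tilt: "summable (\<lambda>k. (a n \<tau> k)\<^sup>2 * exp (\<theta> * d n \<tau> k)) \<and> (\<Sum>k. (a n \<tau> k)\<^sup>2 * exp (\<theta> * d n \<tau> k)) \<le> K"
      if \<theta>: "\<bar>\<theta>\<bar> = 4" for \<theta>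
    proof -
      define h where "h = \<theta> / sqrt (real n)"
      have habs: "\<bar>h\<bar> = 4 / sqrt (real n)" using \<theta> sn by (simp add: h_def)
      have h: "\<bar>h\<bar> \<le> h0" unfolding habs using n h0 sn by (simp add: field_simps)
      have sz: "\<sigma> * (z * exp h) < 1" using dom'[OF t h] by (simp add: z_def)
      have S1: "S n z \<ge> 1" using z by (intro S_ge_1) auto
      have eq: "(a n \<tau> k)\<^sup>2 * exp (\<theta> * d n \<tau> k) = (exp (- \<kappa> n \<tau> * h) / S n z) * (v n k * (z * exp h) ^ k)" for k
      proof -
        have "\<theta> * d n \<tau> k = real k * h + (- \<kappa> n \<tau> * h)" by (simp add: d_def h_def diff_divide_distrib right_diff_distrib mult.commute)
        then have "exp (\<theta> * d n \<tau> k) = exp h ^ k * exp (- \<kappa> n \<tau> * h)" by (simp only: exp_add exp_of_nat_mult)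
        then show ?thesis unfolding a_sq[OF t(2)] z_def by (simp add: power_mult_distrib)
      qed
      have sm: "summable (\<lambda>k. v n k * (z * exp h) ^ k)" using z sz by (intro v_summable) auto
      have "(\<Sum>k. (a n \<tau> k)\<^sup>2 * exp (\<theta> * d n \<tau> k)) = (exp (- \<kappa> n \<tau> * h) / S n z) * S n (z * exp h)"
        unfolding eq S_def[of n "z * exp h"] by (rule suminf_mult[OF sm])
      also have "\<dots> \<le> (exp (- \<kappa> n \<tau> * h) / S n z) * exp (real n * Gl \<sigma> (z * exp h))"
        using z sz S1 by (intro mult_left_mono S_le) auto
      also have "\<dots> \<le> (exp (- \<kappa> n \<tau> * h) / ((1 - 1/2) * exp (real n * Gl \<sigma> z))) * exp (real n * Gl \<sigma> (z * exp h))"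
        using low z S1 by (intro mult_right_mono divide_left_mono) auto
      also have "\<dots> = 2 * exp (real n * Gl \<sigma> (z * exp h) - real n * Gl \<sigma> z - h * \<kappa> n \<tau>)"
        by (simp add: exp_diff exp_minus exp_add field_simps)
      also have "\<dots> \<le> K"
      proof -
        have sq: "real n * h\<^sup>2 = 16"
        proof -
          have "h\<^sup>2 = 16 / real n" unfolding power2_abs[of h, symmetric] habs by (simp add: power_divide)
          then show ?thesis using n by simp
        qed
        have cu: "real n * C * \<bar>h\<bar> ^ 3 \<le> 64 * C"
        proof -
          have "real n * C * \<bar>h\<bar> ^ 3 = C * (real n * h\<^sup>2) * \<bar>h\<bar>" by (simp add: power3_eq_cube power2_eq_square abs_mult)
          also have "\<dots> = 16 * C * \<bar>h\<bar>" by (simp add: sq)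
          also have "\<dots> \<le> 16 * C * 4" using C sn unfolding habs by (intro mult_left_mono) (auto simp: divide_le_eq)
          finally show ?thesis by simp
        qed
        have D2: "(D \<tau>)\<^sup>2 \<le> (exp \<beta> / Amin)\<^sup>2"
        proof (rule power_mono)
          show "D \<tau> \<le> exp \<beta> / Amin" by (rule D_range[OF t])
          show "0 \<le> D \<tau>" using D_range(1)[OF t] Amax_pos by (smt (verit) divide_pos_pos exp_gt_zero)
        qed
        have qd: "real n * h\<^sup>2 / 2 * (D \<tau>)\<^sup>2 = 8 * (D \<tau>)\<^sup>2" unfolding sq by simp
        have "real n * Gl \<sigma> (z * exp h) - real n * Gl \<sigma> z - h * \<kappa> n \<tau> \<le> 8 * (D \<tau>)\<^sup>2 + 64 * C"
          using ex[OF t h, of n] cu unfolding qd z_def by linarith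
        also have "\<dots> \<le> 8 * (exp \<beta> / Amin)\<^sup>2 + 64 * C" using D2 by simp
        finally show ?thesis by (simp add: K_def)
      qed
      finally show ?thesis unfolding eq using summable_mult[OF sm] by simp
    qed
    have p4: "summable (\<lambda>k. (a n \<tau> k)\<^sup>2 * exp (4 * d n \<tau> k))" "(\<Sum>k. (a n \<tau> k)\<^sup>2 * exp (4 * d n \<tau> k)) \<le> K"
      and m4: "summable (\<lambda>k. (a n \<tau> k)\<^sup>2 * exp ((-4) * d n \<tau> k))" "(\<Sum>k. (a n \<tau> k)\<^sup>2 * exp ((-4) * d n \<tau> k)) \<le> K"
      using tilt[of 4] tilt[of "-4"] by auto
    have le: "(a n \<tau> k)\<^sup>2 * exp (4 * \<bar>d n \<tau> k\<bar>) \<le> (a n \<tau> k)\<^sup>2 * exp (4 * d n \<tau> k) + (a n \<tau> k)\<^sup>2 * exp ((-4) * d n \<tau> k)" for k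
      by (cases "d n \<tau> k \<ge> 0") auto
    have s4: "summable (\<lambda>k. (a n \<tau> k)\<^sup>2 * exp (4 * \<bar>d n \<tau> k\<bar>))"
      by (rule summable_comparison_test'[OF summable_add[OF p4(1) m4(1)]]) (use le in simp)
    have "(\<Sum>k. (a n \<tau> k)\<^sup>2 * exp (4 * \<bar>d n \<tau> k\<bar>)) \<le> (\<Sum>k. (a n \<tau> k)\<^sup>2 * exp (4 * d n \<tau> k) + (a n \<tau> k)\<^sup>2 * exp ((-4) * d n \<tau> k))"
      by (intro suminf_le le s4 summable_add p4 m4)
    also have "\<dots> \<le> 2 * K" using p4 m4 by (simp add: suminf_add[symmetric])
    finally have S4: "(\<Sum>k. (a n \<tau> k)\<^sup>2 * exp (4 * \<bar>d n \<tau> k\<bar>)) \<le> 2 * K" .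
    have "summable (\<lambda>k. \<bar>a n \<tau> k\<bar> * exp \<bar>d n \<tau> k\<bar>)"
    proof (rule summable_comparison_test')
      have "summable (\<lambda>k. exp (- (2 / sqrt (real n)) * \<bar>real k - \<kappa> n \<tau>\<bar>))"
        using sn by (intro summable_exp_neg_abs) auto
      then show "summable (\<lambda>k. (a n \<tau> k)\<^sup>2 * exp (4 * \<bar>d n \<tau> k\<bar>) + exp (- (2 / sqrt (real n)) * \<bar>real k - \<kappa> n \<tau>\<bar>))"
        by (rule summable_add[OF s4])
      fix k
      \<comment> \<open>The inequality \<open>x * y \<le> x\<^sup>2 + y\<^sup>2\<close> reduces the
        first-power sum to the quadratic one just bounded and to a summable exponential.\<close>
      define x y where "x = \<bar>a n \<tau> k\<bar> * exp (2 * \<bar>d n \<tau> k\<bar>)" and "y = exp (- \<bar>d n \<tau> k\<bar>)"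
      have xy: "\<bar>a n \<tau> k\<bar> * exp \<bar>d n \<tau> k\<bar> = x * y" by (simp add: x_def y_def mult_exp_exp)
      have "x\<^sup>2 = (a n \<tau> k)\<^sup>2 * exp (4 * \<bar>d n \<tau> k\<bar>)"
        by (simp add: x_def power_mult_distrib exp_double[symmetric])
      moreover have "y\<^sup>2 = exp (- (2 / sqrt (real n)) * \<bar>real k - \<kappa> n \<tau>\<bar>)"
        by (simp add: y_def exp_double[symmetric] d_def abs_divide)
      moreover have "x * y \<le> x\<^sup>2 + y\<^sup>2"
      proof -
        have "2 * (x * y) \<le> x\<^sup>2 + y\<^sup>2" using zero_le_power2[of "x - y"] by (simp add: power2_diff)
        moreover have "0 \<le> x * y" by (simp add: x_def y_def)
        ultimately show ?thesis by linarith
      qed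
      ultimately show "norm (\<bar>a n \<tau> k\<bar> * exp \<bar>d n \<tau> k\<bar>) \<le> (a n \<tau> k)\<^sup>2 * exp (4 * \<bar>d n \<tau> k\<bar>) + exp (- (2 / sqrt (real n)) * \<bar>real k - \<kappa> n \<tau>\<bar>)"
        by (simp add: xy[symmetric])
    qed
    then show "summable (\<lambda>k. \<bar>a n \<tau> k\<bar> * exp \<bar>d n \<tau> k\<bar>) \<and>
      summable (\<lambda>k. (a n \<tau> k)\<^sup>2 * exp (4 * \<bar>d n \<tau> k\<bar>)) \<and> (\<Sum>k. (a n \<tau> k)\<^sup>2 * exp (4 * \<bar>d n \<tau> k\<bar>)) \<le> 2 * K"
      using s4 S4 by blast
  qed
  then show ?thesis by blast
qed


text \<open>The logarithm of the covariance is a second difference of \<open>n * Gl \<sigma>\<close>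
  with step of order \<open>1 / sqrt n\<close>, hence
  \<open>- s'\<^sup>2 * (D \<tau>)\<^sup>2 / 2\<close> up to a vanishing cubic error. The error is
  uniform for \<open>s' \<le> s\<close>.\<close>

lemma correlation_limit:
  assumes s: "s > 0" and \<epsilon>: "\<epsilon> > 0"
  shows "eventually (\<lambda>n. \<forall>\<tau> s'. \<alpha> \<le> \<tau> \<longrightarrow> \<tau> + s' / sqrt (real n) \<le> \<beta> \<longrightarrow> 0 < s' \<longrightarrow> s' \<le> s \<longrightarrow>
    \<bar>(\<Sum>k. a n \<tau> k * a n (\<tau> + s' / sqrt (real n)) k) - exp (- (s'\<^sup>2 * (D \<tau>)\<^sup>2 / 2))\<bar> \<le> \<epsilon>) sequentially"
proof -
  obtain h0 C where h0: "h0 > 0" and C: "C > 0" and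
    ex: "\<And>n \<tau> h. \<alpha> \<le> \<tau> \<Longrightarrow> \<tau> \<le> \<beta> \<Longrightarrow> \<bar>h\<bar> \<le> h0 \<Longrightarrow>
      \<bar>real n * Gl \<sigma> (exp (2 * \<tau>) * exp h) - real n * Gl \<sigma> (exp (2 * \<tau>)) - h * \<kappa> n \<tau> - real n * h\<^sup>2 / 2 * (D \<tau>)\<^sup>2\<bar> \<le> real n * C * \<bar>h\<bar> ^ 3"
    by (rule expansion) (rule that)
  \<comment> \<open>Prepares \<open>\<delta>\<close> with
    \<open>exp \<delta> / (1 - \<delta>) \<le> 1 + \<epsilon>\<close>: the exponential absorbs the
    expansion error and the denominator the loss in \<open>S_lower\<close>.\<close>
  have "((\<lambda>x. (1 + \<epsilon>) * (1 - x) - exp x) \<longlongrightarrow> (1 + \<epsilon>) * (1 - 0) - exp 0) (at_right (0::real))"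
    by (intro tendsto_intros)
  then have "eventually (\<lambda>x. (1 + \<epsilon>) * (1 - x) - exp x > 0) (at_right (0::real))"
    using \<epsilon> by (intro order_tendstoD) auto
  then obtain b where b: "b > 0" "\<And>y. 0 < y \<Longrightarrow> y < b \<Longrightarrow> (1 + \<epsilon>) * (1 - y) - exp y > 0"
    unfolding eventually_at_right_field by auto
  define \<delta> where "\<delta> = min (b / 2) (1 / 2)"
  have \<delta>: "0 < \<delta>" "\<delta> < 1" using b(1) by (auto simp: \<delta>_def)
  have "\<delta> < b" using b(1) unfolding \<delta>_def by linarith
  then have \<delta>e: "exp \<delta> \<le> (1 + \<epsilon>) * (1 - \<delta>)" using b(2)[OF \<delta>(1)] by simp
  have "(\<lambda>n. 5 * C * s ^ 3 / sqrt (real n)) \<longlonglongrightarrow> 0" "(\<lambda>n. 2 * s / sqrt (real n)) \<longlonglongrightarrow> 0"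
    by (intro tendsto_divide_0[OF tendsto_const] filterlim_at_top_imp_at_infinity filterlim_compose[OF sqrt_at_top filterlim_real_sequentially])+
  then have "eventually (\<lambda>n. 5 * C * s ^ 3 / sqrt (real n) < \<delta>) sequentially" "eventually (\<lambda>n. 2 * s / sqrt (real n) < h0) sequentially"
    using \<delta> h0 by (auto intro: order_tendstoD)
  moreover have "eventually (\<lambda>n. \<forall>x. 0 \<le> x \<longrightarrow> x \<le> z2 \<longrightarrow> (1 - \<delta>) * exp (real n * Gl \<sigma> x) \<le> S n x) sequentially"
    by (rule S_lower[OF \<delta>(1)])
  ultimately show ?thesis using eventually_gt_at_top[of 0]
  proof (eventually_elim, intro allI impI)
    fix n \<tau> s' assume n1: "5 * C * s ^ 3 / sqrt (real n) < \<delta>" and n2: "2 * s / sqrt (real n) < h0"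
      and low: "\<forall>x. 0 \<le> x \<longrightarrow> x \<le> z2 \<longrightarrow> (1 - \<delta>) * exp (real n * Gl \<sigma> x) \<le> S n x" and n0: "0 < n"
      and t: "\<alpha> \<le> \<tau>" "\<tau> + s' / sqrt (real n) \<le> \<beta>" and s': "0 < s'" "s' \<le> s"
    define h where "h = s' / sqrt (real n)"
    have sn: "sqrt (real n) > 0" using n0 by simp
    have h: "h > 0" "2 * h \<le> h0" "h \<le> s / sqrt (real n)"
    proof -
      show "h > 0" using s' sn by (simp add: h_def)
      show le: "h \<le> s / sqrt (real n)" unfolding h_def using s' sn by (intro divide_right_mono) auto
      show "2 * h \<le> h0" using le n2 by simp
    qed
    have t1: "\<tau> \<le> \<beta>" "\<tau> + h \<le> \<beta>" "\<tau> + h / 2 \<le> \<beta>" using t h unfolding h_def[symmetric] by auto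
    define E where "E x = exp (real n * Gl \<sigma> x)" for x
    define x0 x1 x2 where "x0 = exp (2 * \<tau>)" and "x1 = exp (2 * (\<tau> + h / 2))" and "x2 = exp (2 * (\<tau> + h))"
    have x1: "x1 = x0 * exp h" and x2: "x2 = x0 * exp (2 * h)"
      unfolding x0_def x1_def x2_def exp_add[symmetric] by (simp_all add: distrib_left)
    have zr: "0 \<le> x0" "x0 \<le> z2" "\<sigma> * x0 < 1" "0 \<le> x1" "x1 \<le> z2" "\<sigma> * x1 < 1" "0 \<le> x2" "x2 \<le> z2" "\<sigma> * x2 < 1"
      using z_range[OF t1(1)] z_range[OF t1(2)] z_range[OF t1(3)] by (auto simp: x0_def x1_def x2_def)
    have E: "E x > 0" for x by (simp add: E_def)
    have S: "(1 - \<delta>) * E x0 \<le> S n x0" "S n x0 \<le> E x0" "(1 - \<delta>) * E x1 \<le> S n x1" "S n x1 \<le> E x1"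
       "(1 - \<delta>) * E x2 \<le> S n x2" "S n x2 \<le> E x2"
      using low zr S_le unfolding E_def by auto
    have Sp: "S n x0 > 0" "S n x2 > 0" "S n x1 > 0" using S E \<delta> by (smt (verit) mult_pos_pos)+
    define r where "r = (\<Sum>k. a n \<tau> k * a n (\<tau> + h) k)"
    have r: "r = S n x1 / sqrt (S n x0 * S n x2)"
      unfolding r_def x0_def x1_def x2_def by (rule a_prod[OF t1])
    define r0 where "r0 = E x1 / sqrt (E x0 * E x2)"
    define g where "g = exp (- (s'\<^sup>2 * (D \<tau>)\<^sup>2 / 2))"
    have g: "0 < g" "g \<le> 1" by (simp_all add: g_def)
    have upper: "r \<le> r0 / (1 - \<delta>)"
    proof -
      have "(1 - \<delta>) * sqrt (E x0 * E x2) = sqrt (((1 - \<delta>) * E x0) * ((1 - \<delta>) * E x2))"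
        using \<delta> by (simp add: real_sqrt_mult)
      also have "\<dots> \<le> sqrt (S n x0 * S n x2)"
        using S Sp E \<delta> by (intro real_sqrt_le_mono mult_mono) (auto intro: less_imp_le)
      finally have "r \<le> E x1 / ((1 - \<delta>) * sqrt (E x0 * E x2))"
        unfolding r using S Sp E \<delta> by (intro frac_le) (auto intro: less_imp_le)
      then show ?thesis by (simp add: r0_def mult.commute)
    qed
    have lower: "(1 - \<delta>) * r0 \<le> r"
    proof -
      have "(1 - \<delta>) * E x1 / sqrt (E x0 * E x2) \<le> r"
        unfolding r using S Sp E \<delta> by (intro frac_le real_sqrt_le_mono mult_mono) (auto intro: less_imp_le)
      then show ?thesis by (simp add: r0_def)
    qed
    have r0g: "exp (- \<delta>) * g \<le> r0 \<and> r0 \<le> exp \<delta> * g"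
    proof -
      have sq: "sqrt (E x0 * E x2) = exp ((real n * Gl \<sigma> x0 + real n * Gl \<sigma> x2) / 2)"
        by (rule real_sqrt_unique) (simp_all add: E_def exp_add[symmetric] exp_double[symmetric])
      define B where "B = real n * Gl \<sigma> x1 - (real n * Gl \<sigma> x0 + real n * Gl \<sigma> x2) / 2"
      have r0B: "r0 = exp B" unfolding r0_def sq B_def by (simp add: E_def exp_diff)
      define Y where "Y = (D \<tau>)\<^sup>2"
      have sh: "real n * h\<^sup>2 = s'\<^sup>2" using n0 by (simp add: h_def power_divide)
      have e1: "\<bar>real n * Gl \<sigma> x1 - real n * Gl \<sigma> x0 - h * \<kappa> n \<tau> - s'\<^sup>2 / 2 * Y\<bar> \<le> real n * C * h ^ 3"
        using ex[OF t(1) t1(1), of h n] h unfolding sh x1 x0_def Y_def by simp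
      have "real n * (2 * h)\<^sup>2 = 4 * s'\<^sup>2" using sh by (simp add: power_mult_distrib)
      then have e2: "\<bar>real n * Gl \<sigma> x2 - real n * Gl \<sigma> x0 - 2 * h * \<kappa> n \<tau> - 4 * s'\<^sup>2 / 2 * Y\<bar> \<le> real n * C * (8 * h ^ 3)"
        using ex[OF t(1) t1(1), of "2 * h" n] h unfolding x2 x0_def Y_def by (simp add: power_mult_distrib)
      have "\<bar>B + s'\<^sup>2 * Y / 2\<bar> \<le> 5 * (real n * C * h ^ 3)"
      proof -
        define hk sy e where "hk = h * \<kappa> n \<tau>" and "sy = s'\<^sup>2 * Y" and "e = real n * C * h ^ 3"
        have "\<bar>real n * Gl \<sigma> x1 - real n * Gl \<sigma> x0 - hk - sy / 2\<bar> \<le> e"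
          using e1 by (simp add: hk_def sy_def e_def)
        moreover have "\<bar>real n * Gl \<sigma> x2 - real n * Gl \<sigma> x0 - 2 * hk - 2 * sy\<bar> \<le> 8 * e"
          using e2 by (simp add: hk_def sy_def e_def mult_ac)
        ultimately show ?thesis unfolding B_def sy_def[symmetric] e_def[symmetric] by (rule second_difference_bound)
      qed
      also have "\<dots> = 5 * C * ((real n * h\<^sup>2) * h)" by (simp add: power3_eq_cube power2_eq_square)
      also have "\<dots> \<le> 5 * C * (s\<^sup>2 * (s / sqrt (real n)))"
        unfolding sh using C s' h by (intro mult_left_mono mult_mono power_mono) auto
      also have "\<dots> < \<delta>" using n1 by (simp add: power3_eq_cube power2_eq_square mult.assoc)
      finally have Bd: "\<bar>B + s'\<^sup>2 * Y / 2\<bar> < \<delta>" .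
      have "exp (- \<delta>) * g = exp (- \<delta> - s'\<^sup>2 * Y / 2)" "exp \<delta> * g = exp (\<delta> - s'\<^sup>2 * Y / 2)"
        unfolding g_def Y_def exp_add[symmetric] by simp_all
      moreover have "- \<delta> - s'\<^sup>2 * Y / 2 \<le> B" "B \<le> \<delta> - s'\<^sup>2 * Y / 2" using Bd by linarith+
      ultimately show ?thesis unfolding r0B by simp
    qed
    have "r \<le> g + \<epsilon>"
    proof -
      have "r \<le> exp \<delta> * g / (1 - \<delta>)" using upper r0g \<delta> by (smt (verit) divide_right_mono)
      also have "\<dots> \<le> (1 + \<epsilon>) * (1 - \<delta>) * g / (1 - \<delta>)" using \<delta>e g \<delta> by (intro divide_right_mono mult_right_mono) auto
      also have "\<dots> = (1 + \<epsilon>) * g" using \<delta> by simp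
      also have "\<dots> = g + \<epsilon> * g" by (simp add: distrib_right)
      also have "\<dots> \<le> g + \<epsilon>" using g \<epsilon> by (simp add: mult_left_le)
      finally show ?thesis .
    qed
    moreover have "g - \<epsilon> \<le> r"
    proof -
      have "1 \<le> (1 + \<epsilon>) * ((1 - \<delta>) * exp (- \<delta>))"
      proof -
        have "exp \<delta> * exp (- \<delta>) \<le> (1 + \<epsilon>) * (1 - \<delta>) * exp (- \<delta>)" using \<delta>e by (intro mult_right_mono) auto
        then show ?thesis by (simp add: exp_minus mult.assoc)
      qed
      then have "(1 - \<epsilon>) * 1 \<le> (1 - \<delta>) * exp (- \<delta>)"
      proof -
        assume *: "1 \<le> (1 + \<epsilon>) * ((1 - \<delta>) * exp (- \<delta>))"
        define y where "y = (1 - \<delta>) * exp (- \<delta>)"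
        have y: "0 \<le> y" "1 \<le> (1 + \<epsilon>) * y" using * \<delta> by (auto simp: y_def)
        have "y \<le> 1"
        proof -
          have "(1 - \<delta>) * exp (- \<delta>) \<le> 1 * 1" using \<delta> by (intro mult_mono) auto
          then show ?thesis by (simp add: y_def)
        qed
        then have "\<epsilon> * y \<le> \<epsilon> * 1" using \<epsilon> by (intro mult_left_mono) auto
        then show ?thesis using y unfolding y_def[symmetric] by (simp add: distrib_right)
      qed
      then have "(1 - \<epsilon>) * g \<le> (1 - \<delta>) * exp (- \<delta>) * g" using g by (intro mult_right_mono) auto
      also have "\<dots> \<le> (1 - \<delta>) * r0" using r0g \<delta> by (simp add: mult.assoc)
      also have "\<dots> \<le> r" by (rule lower)
      finally have "g - \<epsilon> * g \<le> r" by (simp add: left_diff_distrib)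
      moreover have "\<epsilon> * g \<le> \<epsilon>" using g \<epsilon> by (simp add: mult_left_le)
      ultimately show ?thesis by simp
    qed
    ultimately show "\<bar>(\<Sum>k. a n \<tau> k * a n (\<tau> + s' / sqrt (real n)) k) - exp (- (s'\<^sup>2 * (D \<tau>)\<^sup>2 / 2))\<bar> \<le> \<epsilon>"
      unfolding h_def[symmetric] r_def[symmetric] g_def[symmetric] abs_le_iff by simp
  qed
qed

text \<open>By \<open>uc_Suc\<close> successive squared coefficients have ratio
  \<open>(n + \<sigma> * k) * z / (k + 1)\<close> with \<open>z = exp (2 * \<tau>)\<close>; the
  parameters of the locale are read off from this. The second conjunct says that at distance
  \<open>2 * L\<close> from the mode the weights have fallen below
  \<open>exp (- 2 * n powr (3/10))\<close>.\<close>

lemma eventually_unimodal: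
  "eventually (\<lambda>n. \<forall>\<tau>. \<alpha> \<le> \<tau> \<longrightarrow> \<tau> \<le> \<beta> \<longrightarrow>
     unimodal_weights (\<lambda>k. (a n \<tau> k)\<^sup>2) (1 - \<sigma> * exp (2 * \<tau>)) ((real n * exp (2 * \<tau>) - 1) / (1 - \<sigma> * exp (2 * \<tau>)))
       (nat \<lfloor>real n powr (2/3)\<rfloor>) (nat \<lfloor>real n powr (1/4)\<rfloor>) n tr \<and>
     2 * real n powr (3/10) \<le> (1 - \<sigma> * exp (2 * \<tau>)) * real (nat \<lfloor>real n powr (2/3)\<rfloor>) ^ 2 /
       ((real n * exp (2 * \<tau>) - 1) / (1 - \<sigma> * exp (2 * \<tau>)) + 2 * real (nat \<lfloor>real n powr (2/3)\<rfloor>) + 2)) sequentially"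
proof -
  have "eventually (\<lambda>n::nat. tr \<longrightarrow> 3 * real n powr (2/3) + 3 \<le> (1 - z2) * real n) sequentially"
  proof (cases tr)
    case True
    then show ?thesis using window_growth[of "1 - z2"] tr by simp
  qed simp
  moreover have "eventually (\<lambda>n::nat. 2 * Amax\<^sup>2 * (real n powr (1/4) * (3 * real n powr (2/3) + 2)) + 1 \<le> z1 * real n) sequentially"
    using Amax_pos by (intro run_length_growth) auto
  moreover have "eventually (\<lambda>n::nat. 2 * real n powr (3/10) * ((z2 / Amin) * real n + 2 * real n powr (2/3) + 2) \<le> Amin * (real n powr (2/3) - 1)\<^sup>2) sequentially"
    using Amin_pos by (intro tail_exponent_growth) auto
  ultimately show ?thesis using eventually_gt_at_top[of 0]
  proof (eventually_elim, intro allI impI)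
    fix n \<tau>
    assume g2: "tr \<longrightarrow> 3 * real n powr (2/3) + 3 \<le> (1 - z2) * real n"
      and g1: "2 * Amax\<^sup>2 * (real n powr (1/4) * (3 * real n powr (2/3) + 2)) + 1 \<le> z1 * real n"
      and g3: "2 * real n powr (3/10) * ((z2 / Amin) * real n + 2 * real n powr (2/3) + 2) \<le> Amin * (real n powr (2/3) - 1)\<^sup>2"
      and n0: "0 < n" and t: "\<alpha> \<le> \<tau>" "\<tau> \<le> \<beta>"
    define z where "z = exp (2 * \<tau>)"
    define A where "A = 1 - \<sigma> * z"
    define m where "m = (real n * z - 1) / A"
    define L where "L = nat \<lfloor>real n powr (2/3)\<rfloor>"
    define J where "J = nat \<lfloor>real n powr (1/4)\<rfloor>"
    have z: "z1 \<le> z" "z \<le> z2" "0 < z" using t by (auto simp: z_def)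
    have A: "Amin \<le> A" "A \<le> Amax" "0 < A" using A_range[OF t(2)] Amin_pos by (auto simp: A_def z_def)
    have L: "real L \<le> real n powr (2/3)" "real n powr (2/3) - 1 \<le> real L" unfolding L_def by (rule nat_floor_bounds, simp)+
    have J: "real J \<le> real n powr (1/4)" unfolding J_def by (rule nat_floor_bounds) simp
    have n1: "1 \<le> real n" using n0 by simp
    have p1: "1 \<le> real n powr (1/4)" using n1 by (simp add: ge_one_powr_ge_zero)
    have J1: "1 \<le> J" unfolding J_def using p1 by linarith
    have "real n powr (1/4) \<le> real n powr (2/3)" using n1 by (intro powr_mono) auto
    then have JL: "J \<le> L" unfolding J_def L_def by (intro nat_mono floor_mono)
    have nz: "real n * z1 \<le> real n * z" using z by (intro mult_left_mono) auto
    have g1': "2 * Amax\<^sup>2 * (real J * (3 * real L + 2)) \<le> real n * z - 1"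
    proof -
      have "real J * (3 * real L + 2) \<le> real n powr (1/4) * (3 * real n powr (2/3) + 2)"
        using J L by (intro mult_mono) auto
      then have "2 * Amax\<^sup>2 * (real J * (3 * real L + 2)) \<le> 2 * Amax\<^sup>2 * (real n powr (1/4) * (3 * real n powr (2/3) + 2))"
        by (intro mult_left_mono) auto
      then show ?thesis using g1 nz by (simp add: mult.commute)
    qed
    have "0 < 2 * Amax\<^sup>2 * (real J * (3 * real L + 2))" using Amax_pos J1 by simp
    then have nz1: "0 < real n * z - 1" using g1' by linarith
    have m: "m > 0" using nz1 A by (simp add: m_def)
    have Jm: "real J * (A * (3 * real L + 2)) \<le> m / 2"
    proof -
      have "2 * (A * A) * (real J * (3 * real L + 2)) \<le> 2 * Amax\<^sup>2 * (real J * (3 * real L + 2))"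
        using A unfolding power2_eq_square by (intro mult_right_mono mult_left_mono mult_mono) auto
      then have "2 * (A * A) * (real J * (3 * real L + 2)) \<le> real n * z - 1" using g1' by linarith
      then have "A * (2 * (real J * (A * (3 * real L + 2)))) \<le> A * m" using A by (simp add: m_def mult_ac)
      then have "2 * (real J * (A * (3 * real L + 2))) \<le> m" using A(3) by (simp only: mult_le_cancel_left_pos)
      then show ?thesis by simp
    qed
    have m_le: "m \<le> (z2 / Amin) * real n"
    proof -
      have "m \<le> (real n * z2) / Amin" unfolding m_def using z A Amin_pos nz1 mult_left_mono[OF z(2), of "real n"] by (intro frac_le) auto
      then show ?thesis by (simp add: mult.commute)
    qed
    have uw: "unimodal_weights (\<lambda>k. (a n \<tau> k)\<^sup>2) A m L J n tr"
    proof
      show "(\<lambda>k. (a n \<tau> k)\<^sup>2) sums 1" by (rule a_sq_sums[OF t(2)])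
      fix k
      show "(a n \<tau> k)\<^sup>2 \<ge> 0" by simp
      show "(a n \<tau> (Suc k))\<^sup>2 * real (Suc k) = (a n \<tau> k)\<^sup>2 * (real (Suc k) - A * (real k - m))" if "tr \<Longrightarrow> k < n"
      proof -
        have v: "v n k = uc \<sigma> n k" "v n (Suc k) = uc \<sigma> n (Suc k)" unfolding v_def using that by auto
        have "A * m = real n * z - 1" using A by (simp add: m_def)
        then have "real (Suc k) - A * (real k - m) = real (Suc k) - (1 - \<sigma> * z) * real k + (real n * z - 1)"
          unfolding right_diff_distrib by (simp add: A_def)
        also have "\<dots> = (real n + \<sigma> * real k) * z" by (simp add: algebra_simps)
        finally have e: "real (Suc k) - A * (real k - m) = (real n + \<sigma> * real k) * z" .
        have "(a n \<tau> (Suc k))\<^sup>2 * real (Suc k) = (uc \<sigma> n (Suc k) * real (Suc k)) * (z * z ^ k) / S n z"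
          unfolding a_sq[OF t(2)] v z_def by (simp add: mult_ac)
        also have "\<dots> = (a n \<tau> k)\<^sup>2 * ((real n + \<sigma> * real k) * z)"
          unfolding uc_Suc a_sq[OF t(2)] v z_def by (simp add: mult_ac)
        finally show ?thesis unfolding e .
      qed
      show "(a n \<tau> k)\<^sup>2 = 0" if "tr" "k > n" using that unfolding a_sq[OF t(2)] v_def by simp
      show "m + 3 * real L + 3 \<le> real n" if tr
      proof -
        have "\<sigma> = 0" using tr that by auto
        then have "m \<le> real n * z2" unfolding m_def A_def using mult_left_mono[OF z(2), of "real n"] by simp
        moreover have "3 * real n powr (2/3) + 3 \<le> (1 - z2) * real n" using g2 that by blast
        moreover have "(1 - z2) * real n = real n - z2 * real n" by (simp add: left_diff_distrib)
        moreover have "z2 * real n = real n * z2" by (rule mult.commute)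
        ultimately show ?thesis using L by linarith
      qed
    qed (use A m J1 JL Jm in auto)
    have "2 * real n powr (3/10) * (m + 2 * real L + 2) \<le> 2 * real n powr (3/10) * ((z2 / Amin) * real n + 2 * real n powr (2/3) + 2)"
      using m_le L by (intro mult_left_mono) auto
    also have "\<dots> \<le> Amin * (real n powr (2/3) - 1)\<^sup>2" by (rule g3)
    also have "\<dots> \<le> A * real L ^ 2"
    proof (intro mult_mono power_mono)
      show "0 \<le> real n powr (2/3) - 1" using n1 by (simp add: ge_one_powr_ge_zero)
    qed (use A L Amin_pos in auto)
    finally have "2 * real n powr (3/10) \<le> A * real L ^ 2 / (m + 2 * real L + 2)"
      using m by (simp add: pos_le_divide_eq)
    with uw show "unimodal_weights (\<lambda>k. (a n \<tau> k)\<^sup>2) (1 - \<sigma> * exp (2 * \<tau>)) ((real n * exp (2 * \<tau>) - 1) / (1 - \<sigma> * exp (2 * \<tau>)))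
       (nat \<lfloor>real n powr (2/3)\<rfloor>) (nat \<lfloor>real n powr (1/4)\<rfloor>) n tr \<and>
     2 * real n powr (3/10) \<le> (1 - \<sigma> * exp (2 * \<tau>)) * real (nat \<lfloor>real n powr (2/3)\<rfloor>) ^ 2 /
       ((real n * exp (2 * \<tau>) - 1) / (1 - \<sigma> * exp (2 * \<tau>)) + 2 * real (nat \<lfloor>real n powr (2/3)\<rfloor>) + 2)"
      unfolding A_def m_def L_def J_def z_def by blast
  qed
qed

lemma eventually_small_coeffs:
  assumes \<eta>: "\<eta> > 0"
  shows "eventually (\<lambda>n. \<forall>\<tau> k. \<alpha> \<le> \<tau> \<longrightarrow> \<tau> \<le> \<beta> \<longrightarrow> \<bar>a n \<tau> k\<bar> \<le> \<eta>) sequentially"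
proof -
  have "filterlim (\<lambda>n::nat. real n powr (1/4)) at_top sequentially" by real_asymp
  then have "eventually (\<lambda>n::nat. 2 / \<eta>\<^sup>2 + 1 \<le> real n powr (1/4)) sequentially" by (simp add: filterlim_at_top)
  with eventually_unimodal show ?thesis
  proof (eventually_elim, intro allI impI)
    fix n \<tau> k
    assume u: "\<forall>\<tau>. \<alpha> \<le> \<tau> \<longrightarrow> \<tau> \<le> \<beta> \<longrightarrow>
     unimodal_weights (\<lambda>k. (a n \<tau> k)\<^sup>2) (1 - \<sigma> * exp (2 * \<tau>)) ((real n * exp (2 * \<tau>) - 1) / (1 - \<sigma> * exp (2 * \<tau>)))
       (nat \<lfloor>real n powr (2/3)\<rfloor>) (nat \<lfloor>real n powr (1/4)\<rfloor>) n tr \<and>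
     2 * real n powr (3/10) \<le> (1 - \<sigma> * exp (2 * \<tau>)) * real (nat \<lfloor>real n powr (2/3)\<rfloor>) ^ 2 /
       ((real n * exp (2 * \<tau>) - 1) / (1 - \<sigma> * exp (2 * \<tau>)) + 2 * real (nat \<lfloor>real n powr (2/3)\<rfloor>) + 2)"
      and n: "2 / \<eta>\<^sup>2 + 1 \<le> real n powr (1/4)" and t: "\<alpha> \<le> \<tau>" "\<tau> \<le> \<beta>"
    define J where "J = nat \<lfloor>real n powr (1/4)\<rfloor>"
    have J: "2 / \<eta>\<^sup>2 \<le> real J" unfolding J_def using n by linarith
    have J0: "real J > 0" using J \<eta> by (smt (verit) divide_pos_pos zero_less_power)
    have uw: "unimodal_weights (\<lambda>k. (a n \<tau> k)\<^sup>2) (1 - \<sigma> * exp (2 * \<tau>)) ((real n * exp (2 * \<tau>) - 1) / (1 - \<sigma> * exp (2 * \<tau>)))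
       (nat \<lfloor>real n powr (2/3)\<rfloor>) J n tr" using u t unfolding J_def by blast
    have "(a n \<tau> k)\<^sup>2 \<le> 2 / real J" by (rule unimodal_weights.p_le[OF uw])
    also have "\<dots> \<le> \<eta>\<^sup>2" using J J0 \<eta> by (simp add: field_simps)
    finally show "\<bar>a n \<tau> k\<bar> \<le> \<eta>" using \<eta> by (simp add: abs_le_square_iff[symmetric])
  qed
qed

text \<open>Frequencies enter squared, which is why \<open>eventually_unimodal\<close> provides
  twice the exponent \<open>n powr (3/10)\<close>.\<close>

lemma eventually_flat:
  assumes c: "c > 0"
  shows "eventually (\<lambda>n. \<forall>\<tau> t. \<alpha> \<le> \<tau> \<longrightarrow> \<tau> \<le> \<beta> \<longrightarrow> \<bar>t\<bar> \<le> c * exp (real n powr (3/10)) \<longrightarrow>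
    (\<exists>F. finite F \<and> (\<forall>k\<in>F. \<bar>t * a n \<tau> k\<bar> \<le> c) \<and>
      min (t\<^sup>2 / 2) (real (nat \<lfloor>real n powr (1/4)\<rfloor>) * c\<^sup>2 / 2) \<le> (\<Sum>k\<in>F. (t * a n \<tau> k)\<^sup>2))) sequentially"
  using eventually_unimodal
proof (eventually_elim, intro allI impI)
  fix n \<tau> t
  assume u: "\<forall>\<tau>. \<alpha> \<le> \<tau> \<longrightarrow> \<tau> \<le> \<beta> \<longrightarrow>
     unimodal_weights (\<lambda>k. (a n \<tau> k)\<^sup>2) (1 - \<sigma> * exp (2 * \<tau>)) ((real n * exp (2 * \<tau>) - 1) / (1 - \<sigma> * exp (2 * \<tau>)))
       (nat \<lfloor>real n powr (2/3)\<rfloor>) (nat \<lfloor>real n powr (1/4)\<rfloor>) n tr \<and>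
     2 * real n powr (3/10) \<le> (1 - \<sigma> * exp (2 * \<tau>)) * real (nat \<lfloor>real n powr (2/3)\<rfloor>) ^ 2 /
       ((real n * exp (2 * \<tau>) - 1) / (1 - \<sigma> * exp (2 * \<tau>)) + 2 * real (nat \<lfloor>real n powr (2/3)\<rfloor>) + 2)"
    and t: "\<alpha> \<le> \<tau>" "\<tau> \<le> \<beta>" and tt: "\<bar>t\<bar> \<le> c * exp (real n powr (3/10))"
  define m where "m = (real n * exp (2 * \<tau>) - 1) / (1 - \<sigma> * exp (2 * \<tau>))"
  define L where "L = nat \<lfloor>real n powr (2/3)\<rfloor>"
  define J where "J = nat \<lfloor>real n powr (1/4)\<rfloor>"
  have uw: "unimodal_weights (\<lambda>k. (a n \<tau> k)\<^sup>2) (1 - \<sigma> * exp (2 * \<tau>)) m L J n tr"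
    and big: "2 * real n powr (3/10) \<le> (1 - \<sigma> * exp (2 * \<tau>)) * real L ^ 2 / (m + 2 * real L + 2)"
    using u t unfolding m_def L_def J_def by blast+
  have "t\<^sup>2 \<le> (c * exp (real n powr (3/10)))\<^sup>2" using tt c by (simp add: abs_le_square_iff[symmetric])
  also have "\<dots> = c\<^sup>2 * exp (2 * real n powr (3/10))" by (simp add: power_mult_distrib exp_double)
  also have "\<dots> \<le> c\<^sup>2 * exp ((1 - \<sigma> * exp (2 * \<tau>)) * real L ^ 2 / (m + 2 * real L + 2))"
    using big by (intro mult_left_mono) auto
  finally obtain F where F: "finite F" "\<forall>k\<in>F. t\<^sup>2 * (a n \<tau> k)\<^sup>2 \<le> c\<^sup>2" "min (t\<^sup>2 / 2) (real J * c\<^sup>2 / 2) \<le> (\<Sum>k\<in>F. t\<^sup>2 * (a n \<tau> k)\<^sup>2)"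
    using unimodal_weights.flat[OF uw c, of t] by blast
  have "\<bar>t * a n \<tau> k\<bar> \<le> c" if "k \<in> F" for k
  proof -
    have "(t * a n \<tau> k)\<^sup>2 \<le> c\<^sup>2" using F(2) that by (simp add: power_mult_distrib)
    then show ?thesis using c by (simp add: abs_le_square_iff[symmetric])
  qed
  then show "\<exists>F. finite F \<and> (\<forall>k\<in>F. \<bar>t * a n \<tau> k\<bar> \<le> c) \<and>
      min (t\<^sup>2 / 2) (real (nat \<lfloor>real n powr (1/4)\<rfloor>) * c\<^sup>2 / 2) \<le> (\<Sum>k\<in>F. (t * a n \<tau> k)\<^sup>2)"
    using F(1,3) by (intro exI[of _ F]) (simp add: J_def power_mult_distrib)
qed

end

section \<open>Sign changes between neighbouring grid points\<close>

text \<open>The probability that two standard Gaussians with correlation \<open>r\<close> have opposite signs.\<close>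

definition theta :: "real \<Rightarrow> real" where
  "theta r = 1 / 2 - arctan (r / sqrt (1 - r\<^sup>2)) / pi"

lemma theta_gauss_limit:
  "((\<lambda>u. theta (exp (- (u\<^sup>2 / 2))) / u) \<longlongrightarrow> 1 / pi) (at_right 0)"
proof -
  have "((\<lambda>u. theta (exp (- (u\<^sup>2 / 2))) / u) \<longlongrightarrow> inverse pi) (at_right 0)"
    unfolding theta_def by real_asymp
  then show ?thesis by (simp add: inverse_eq_divide)
qed

lemma abs_triangle3:
  fixes x y z w e :: real
  assumes "\<bar>x - y\<bar> \<le> e" "\<bar>y - z\<bar> \<le> e" "\<bar>z - w\<bar> \<le> e"
  shows "\<bar>x - w\<bar> \<le> 3 * e"
  using assms by linarith

lemma theta_gauss:
  assumes "\<epsilon> > 0"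
  shows "\<exists>b>0. \<forall>u. 0 < u \<longrightarrow> u < b \<longrightarrow> \<bar>theta (exp (- (u\<^sup>2 / 2))) - u / pi\<bar> \<le> \<epsilon> * u"
proof -
  have "eventually (\<lambda>u. dist (theta (exp (- (u\<^sup>2 / 2))) / u) (1 / pi) < \<epsilon>) (at_right 0)"
    using theta_gauss_limit assms by (rule tendstoD)
  then obtain b where b: "b > 0" "\<And>u. 0 < u \<Longrightarrow> u < b \<Longrightarrow> dist (theta (exp (- (u\<^sup>2 / 2))) / u) (1 / pi) < \<epsilon>"
    unfolding eventually_at_right_field by auto
  have "\<bar>theta (exp (- (u\<^sup>2 / 2))) - u / pi\<bar> \<le> \<epsilon> * u" if u: "0 < u" "u < b" for u
  proof -
    have "theta (exp (- (u\<^sup>2 / 2))) - u / pi = u * (theta (exp (- (u\<^sup>2 / 2))) / u - 1 / pi)"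
      using u by (simp add: right_diff_distrib)
    then have "\<bar>theta (exp (- (u\<^sup>2 / 2))) - u / pi\<bar> = u * \<bar>theta (exp (- (u\<^sup>2 / 2))) / u - 1 / pi\<bar>"
      using u by (simp add: abs_mult)
    also have "\<dots> \<le> u * \<epsilon>" using b(2)[OF u] u by (intro mult_left_mono) (auto simp: dist_real_def)
    finally show ?thesis by (simp add: mult.commute)
  qed
  then show ?thesis using b(1) by blast
qed

text \<open>\<open>theta\<close> has unbounded slope near 1, so uniform continuity is available only
  at a fixed distance from perfect correlation. The interval up to the midpoint of \<open>g2\<close>
  and 1 leaves room for the perturbation.\<close>

lemma theta_uniform:
  assumes g: "0 \<le> g2" "g2 < 1" and \<epsilon>: "\<epsilon> > 0"
  shows "\<exists>\<delta>>0. \<forall>r g. 0 \<le> g \<longrightarrow> g \<le> g2 \<longrightarrow> \<bar>r - g\<bar> \<le> \<delta> \<longrightarrow> \<bar>r\<bar> \<le> (1 + g2) / 2 \<and> \<bar>theta r - theta g\<bar> \<le> \<epsilon>"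
proof -
  define K where "K = {- ((1 + g2) / 2)..(1 + g2) / 2}"
  have "continuous_on K theta"
    unfolding theta_def[abs_def]
  proof (intro continuous_intros)
    show "\<forall>r\<in>K. sqrt (1 - r\<^sup>2) \<noteq> 0"
    proof
      fix r assume "r \<in> K"
      then have "\<bar>r\<bar> \<le> (1 + g2) / 2" unfolding K_def atLeastAtMost_iff abs_le_iff by linarith
      moreover have "(1 + g2) / 2 < 1" using g by simp
      ultimately have "\<bar>r\<bar> < 1" by (rule le_less_trans)
      then have "r\<^sup>2 < 1" by (simp add: abs_square_less_1)
      then show "sqrt (1 - r\<^sup>2) \<noteq> 0" by simp
    qed
  qed simp
  then have "uniformly_continuous_on K theta" by (rule compact_uniformly_continuous) (simp add: K_def)
  then obtain \<delta> where \<delta>: "\<delta> > 0" "\<And>x y. x \<in> K \<Longrightarrow> y \<in> K \<Longrightarrow> dist y x < \<delta> \<Longrightarrow> dist (theta y) (theta x) < \<epsilon>"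
    unfolding uniformly_continuous_on_def using \<epsilon> by blast
  define \<delta>' where "\<delta>' = min (\<delta> / 2) ((1 - g2) / 2)"
  have \<delta>': "\<delta>' > 0" "\<delta>' < \<delta>" "\<delta>' \<le> (1 - g2) / 2" using \<delta>(1) g unfolding \<delta>'_def by (auto simp: min_def)
  show ?thesis
  proof (intro exI[of _ \<delta>'] conjI \<delta>'(1) allI impI)
    fix r x assume x: "0 \<le> x" "x \<le> g2" and r: "\<bar>r - x\<bar> \<le> \<delta>'"
    show r1: "\<bar>r\<bar> \<le> (1 + g2) / 2" using x r \<delta>'(3) by (simp add: field_simps)
    have "r \<in> K" using r1 unfolding K_def atLeastAtMost_iff abs_le_iff by linarith
    moreover have "x \<in> K" using x g unfolding K_def atLeastAtMost_iff by (simp add: field_simps)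
    ultimately have "dist (theta r) (theta x) < \<epsilon>" using r \<delta>' by (intro \<delta>(2)) (auto simp: dist_real_def)
    then show "\<bar>theta r - theta x\<bar> \<le> \<epsilon>" by (simp add: dist_real_def)
  qed
qed

locale random_ensemble = iid_std M \<xi> + ensemble_profile \<sigma> tr sg \<alpha> \<beta>
  for M :: "'w measure" and \<xi> \<sigma> tr sg \<alpha> \<beta>
begin

lemma a_summable:
  "eventually (\<lambda>n. \<forall>\<tau>. \<alpha> \<le> \<tau> \<longrightarrow> \<tau> \<le> \<beta> \<longrightarrow> summable (\<lambda>k. \<bar>a n \<tau> k\<bar>)) sequentially"
proof -
  obtain C where "eventually (\<lambda>n. \<forall>\<tau>. \<alpha> \<le> \<tau> \<longrightarrow> \<tau> \<le> \<beta> \<longrightarrow> summable (\<lambda>k. \<bar>a n \<tau> k\<bar> * exp \<bar>d n \<tau> k\<bar>) \<and>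
      summable (\<lambda>k. (a n \<tau> k)\<^sup>2 * exp (4 * \<bar>d n \<tau> k\<bar>)) \<and> (\<Sum>k. (a n \<tau> k)\<^sup>2 * exp (4 * \<bar>d n \<tau> k\<bar>)) \<le> C) sequentially"
    using mgf_bound by blast
  then show ?thesis
  proof (eventually_elim, intro allI impI)
    fix n \<tau> assume "\<forall>\<tau>. \<alpha> \<le> \<tau> \<longrightarrow> \<tau> \<le> \<beta> \<longrightarrow> summable (\<lambda>k. \<bar>a n \<tau> k\<bar> * exp \<bar>d n \<tau> k\<bar>) \<and>
      summable (\<lambda>k. (a n \<tau> k)\<^sup>2 * exp (4 * \<bar>d n \<tau> k\<bar>)) \<and> (\<Sum>k. (a n \<tau> k)\<^sup>2 * exp (4 * \<bar>d n \<tau> k\<bar>)) \<le> C"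
      and t: "\<alpha> \<le> \<tau>" "\<tau> \<le> \<beta>"
    then have "summable (\<lambda>k. \<bar>a n \<tau> k\<bar> * exp \<bar>d n \<tau> k\<bar>)" by blast
    then show "summable (\<lambda>k. \<bar>a n \<tau> k\<bar>)"
    proof (rule summable_comparison_test')
      show "norm \<bar>a n \<tau> k\<bar> \<le> \<bar>a n \<tau> k\<bar> * exp \<bar>d n \<tau> k\<bar>" for k
        using mult_left_mono[of 1 "exp \<bar>d n \<tau> k\<bar>" "\<bar>a n \<tau> k\<bar>"] by simp
    qed
  qed
qed

text \<open>The mesh parameter \<open>s\<close> is fixed before \<open>n\<close> grows: for fixed
  \<open>s\<close> the correlation stays away from 1 and the central limit theorem applies, while
  the expansion of \<open>theta\<close> for small \<open>s\<close> supplies the density. The three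
  errors are \<open>\<epsilon> * s / 3\<close> each, proportional to the mesh because the number of
  cells is of order \<open>sqrt n / s\<close>.\<close>

lemma sign_change_prob:
  assumes \<epsilon>: "\<epsilon> > 0"
  shows "\<exists>s0>0. \<forall>s. 0 < s \<longrightarrow> s < s0 \<longrightarrow> eventually (\<lambda>n. \<forall>\<tau> s' R. \<alpha> \<le> \<tau> \<longrightarrow> \<tau> + s' / sqrt (real n) \<le> \<beta> \<longrightarrow>
     s / 2 \<le> s' \<longrightarrow> s' \<le> s \<longrightarrow> sgnrel R \<longrightarrow>
     \<bar>prob {\<omega> \<in> space M. R (rs (a n \<tau>) \<omega> * rs (a n (\<tau> + s' / sqrt (real n))) \<omega>)} - s' * D \<tau> / pi\<bar> \<le> \<epsilon> * s) sequentially"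
proof -
  define D1 D2 where "D1 = exp \<alpha> / Amax" and "D2 = exp \<beta> / Amin"
  have D12: "D1 > 0" "D2 > 0" using Amax_pos Amin_pos by (auto simp: D1_def D2_def)
  have D: "D1 \<le> D \<tau>" "D \<tau> \<le> D2" if "\<alpha> \<le> \<tau>" "\<tau> \<le> \<beta>" for \<tau> using D_range[OF that] by (auto simp: D1_def D2_def)
  obtain b where b: "b > 0" "\<And>u. 0 < u \<Longrightarrow> u < b \<Longrightarrow> \<bar>theta (exp (- (u\<^sup>2 / 2))) - u / pi\<bar> \<le> \<epsilon> / (3 * D2) * u"
    using theta_gauss[of "\<epsilon> / (3 * D2)"] \<epsilon> D12 by auto
  show ?thesis
  proof (intro exI[of _ "b / D2"] conjI allI impI)
    show "b / D2 > 0" using b D12 by simp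
    fix s assume s: "0 < s" "s < b / D2"
    define \<epsilon>' where "\<epsilon>' = \<epsilon> * s / 3"
    have \<epsilon>': "\<epsilon>' > 0" using \<epsilon> s by (simp add: \<epsilon>'_def)
    obtain \<eta> where \<eta>: "\<eta> > 0" and clt0: "\<forall>a y R. summable (\<lambda>k. \<bar>a k\<bar>) \<longrightarrow> summable (\<lambda>k. \<bar>y k\<bar>) \<longrightarrow>
     (\<Sum>k. (a k)\<^sup>2) = 1 \<longrightarrow> (\<Sum>k. (y k)\<^sup>2) = 1 \<longrightarrow> \<bar>\<Sum>k. a k * y k\<bar> < 1 \<longrightarrow>
     (\<forall>k. \<bar>a k\<bar> \<le> \<eta> * sqrt (1 - (\<Sum>k. a k * y k)\<^sup>2)) \<longrightarrow> (\<forall>k. \<bar>y k\<bar> \<le> \<eta> * sqrt (1 - (\<Sum>k. a k * y k)\<^sup>2)) \<longrightarrow> sgnrel R \<longrightarrow>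
     \<bar>prob {\<omega> \<in> space M. R (rs a \<omega> * rs y \<omega>)} - (1 / 2 - arctan ((\<Sum>k. a k * y k) / sqrt (1 - (\<Sum>k. a k * y k)\<^sup>2)) / pi)\<bar> \<le> \<epsilon>'"
      using sign_change_clt[OF \<epsilon>'] by (elim exE conjE) (rule that)
    note clt = clt0[rule_format, folded theta_def]
    \<comment> \<open>Upper bound for the limiting correlation, from the shortest step
      \<open>s / 2\<close> and the lower bound \<open>D1\<close> of the density.\<close>
    define g2 where "g2 = exp (- ((s / 2 * D1)\<^sup>2 / 2))"
    have g2: "0 \<le> g2" "g2 < 1" using s D12 by (auto simp: g2_def)
    obtain \<delta> where \<delta>: "\<delta> > 0" and th: "\<And>r g. 0 \<le> g \<Longrightarrow> g \<le> g2 \<Longrightarrow> \<bar>r - g\<bar> \<le> \<delta> \<Longrightarrow> \<bar>r\<bar> \<le> (1 + g2) / 2 \<and> \<bar>theta r - theta g\<bar> \<le> \<epsilon>'"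
      using theta_uniform[OF g2 \<epsilon>'] by auto
    \<comment> \<open>Lower bound for \<open>sqrt (1 - r\<^sup>2)\<close>, so that absolute
      smallness of the coefficients implies the relative smallness required by
      \<open>sign_change_clt\<close>.\<close>
    define c0 where "c0 = sqrt (1 - ((1 + g2) / 2)\<^sup>2)"
    have "((1 + g2) / 2)\<^sup>2 < 1" using g2 by (simp add: abs_square_less_1)
    then have c0: "c0 > 0" by (simp add: c0_def)
    have "eventually (\<lambda>n. \<forall>\<tau> k. \<alpha> \<le> \<tau> \<longrightarrow> \<tau> \<le> \<beta> \<longrightarrow> \<bar>a n \<tau> k\<bar> \<le> \<eta> * c0) sequentially"
      using \<eta> c0 by (intro eventually_small_coeffs) simp
    moreover have "eventually (\<lambda>n. \<forall>\<tau> s'. \<alpha> \<le> \<tau> \<longrightarrow> \<tau> + s' / sqrt (real n) \<le> \<beta> \<longrightarrow> 0 < s' \<longrightarrow> s' \<le> s \<longrightarrow>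
      \<bar>(\<Sum>k. a n \<tau> k * a n (\<tau> + s' / sqrt (real n)) k) - exp (- (s'\<^sup>2 * (D \<tau>)\<^sup>2 / 2))\<bar> \<le> \<delta>) sequentially"
      by (rule correlation_limit[OF s(1) \<delta>])
    ultimately show "eventually (\<lambda>n. \<forall>\<tau> s' R. \<alpha> \<le> \<tau> \<longrightarrow> \<tau> + s' / sqrt (real n) \<le> \<beta> \<longrightarrow>
     s / 2 \<le> s' \<longrightarrow> s' \<le> s \<longrightarrow> sgnrel R \<longrightarrow>
     \<bar>prob {\<omega> \<in> space M. R (rs (a n \<tau>) \<omega> * rs (a n (\<tau> + s' / sqrt (real n))) \<omega>)} - s' * D \<tau> / pi\<bar> \<le> \<epsilon> * s) sequentially"
      using a_summable
    proof (eventually_elim, intro allI impI)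
      fix n \<tau> s' R
      assume small: "\<forall>\<tau> k. \<alpha> \<le> \<tau> \<longrightarrow> \<tau> \<le> \<beta> \<longrightarrow> \<bar>a n \<tau> k\<bar> \<le> \<eta> * c0"
        and cor: "\<forall>\<tau> s'. \<alpha> \<le> \<tau> \<longrightarrow> \<tau> + s' / sqrt (real n) \<le> \<beta> \<longrightarrow> 0 < s' \<longrightarrow> s' \<le> s \<longrightarrow>
          \<bar>(\<Sum>k. a n \<tau> k * a n (\<tau> + s' / sqrt (real n)) k) - exp (- (s'\<^sup>2 * (D \<tau>)\<^sup>2 / 2))\<bar> \<le> \<delta>"
        and sm: "\<forall>\<tau>. \<alpha> \<le> \<tau> \<longrightarrow> \<tau> \<le> \<beta> \<longrightarrow> summable (\<lambda>k. \<bar>a n \<tau> k\<bar>)"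
        and t: "\<alpha> \<le> \<tau>" "\<tau> + s' / sqrt (real n) \<le> \<beta>" and s': "s / 2 \<le> s'" "s' \<le> s" and R: "sgnrel R"
      define \<tau>' where "\<tau>' = \<tau> + s' / sqrt (real n)"
      define r where "r = (\<Sum>k. a n \<tau> k * a n \<tau>' k)"
      define g where "g = exp (- ((s' * D \<tau>)\<^sup>2 / 2))"
      have s0: "0 < s'" using s s' by simp
      have "0 \<le> s' / sqrt (real n)" using s0 by simp
      then have t': "\<tau> \<le> \<beta>" "\<alpha> \<le> \<tau>'" "\<tau>' \<le> \<beta>" using t by (auto simp: \<tau>'_def)
      have rg: "\<bar>r - g\<bar> \<le> \<delta>" using cor t s0 s'(2) unfolding r_def g_def \<tau>'_def power_mult_distrib by blast
      have Dt: "D1 \<le> D \<tau>" "D \<tau> \<le> D2" using D[OF t(1) t'(1)] .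
      have "s / 2 * D1 \<le> s' * D \<tau>" using s s' Dt D12 by (intro mult_mono) auto
      then have "(s / 2 * D1)\<^sup>2 \<le> (s' * D \<tau>)\<^sup>2" using s D12 by (intro power_mono) auto
      then have gg: "0 \<le> g" "g \<le> g2" by (auto simp: g_def g2_def)
      have r1: "\<bar>r\<bar> \<le> (1 + g2) / 2" and th1: "\<bar>theta r - theta g\<bar> \<le> \<epsilon>'" using th[OF gg rg] by auto
      have c0r: "c0 \<le> sqrt (1 - r\<^sup>2)"
      proof -
        have "r\<^sup>2 \<le> ((1 + g2) / 2)\<^sup>2" using r1 g2 by (simp add: abs_le_square_iff[symmetric])
        then show ?thesis unfolding c0_def by (intro real_sqrt_le_mono) simp
      qed
      have "\<eta> * c0 \<le> \<eta> * sqrt (1 - r\<^sup>2)" using \<eta> c0r by (intro mult_left_mono) auto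
      then have sa: "\<bar>a n \<tau> k\<bar> \<le> \<eta> * sqrt (1 - r\<^sup>2)" "\<bar>a n \<tau>' k\<bar> \<le> \<eta> * sqrt (1 - r\<^sup>2)" for k
        using small t(1) t' by (meson order_trans)+
      have "\<bar>prob {\<omega> \<in> space M. R (rs (a n \<tau>) \<omega> * rs (a n \<tau>') \<omega>)} - theta r\<bar> \<le> \<epsilon>'"
        unfolding r_def
      proof (rule clt)
        show "summable (\<lambda>k. \<bar>a n \<tau> k\<bar>)" "summable (\<lambda>k. \<bar>a n \<tau>' k\<bar>)" using sm t(1) t' by blast+
        show "(\<Sum>k. (a n \<tau> k)\<^sup>2) = 1" "(\<Sum>k. (a n \<tau>' k)\<^sup>2) = 1"
          using a_sq_sums[OF t'(1)] a_sq_sums[OF t'(3)] by (auto simp: sums_iff)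
        show "\<bar>\<Sum>k. a n \<tau> k * a n \<tau>' k\<bar> < 1" using r1 g2 unfolding r_def[symmetric] by simp
        show "\<bar>a n \<tau> k\<bar> \<le> \<eta> * sqrt (1 - (\<Sum>k. a n \<tau> k * a n \<tau>' k)\<^sup>2)" for k using sa(1) unfolding r_def .
        show "\<bar>a n \<tau>' k\<bar> \<le> \<eta> * sqrt (1 - (\<Sum>k. a n \<tau> k * a n \<tau>' k)\<^sup>2)" for k using sa(2) unfolding r_def .
      qed (rule R)
      moreover have "\<bar>theta g - s' * D \<tau> / pi\<bar> \<le> \<epsilon>'"
      proof -
        have u: "0 < s' * D \<tau>" "s' * D \<tau> \<le> s * D2" using s s' s0 Dt D12 by (auto intro!: mult_mono)
        have "s * D2 < b" using s D12 by (simp add: field_simps)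
        then have "\<bar>theta g - s' * D \<tau> / pi\<bar> \<le> \<epsilon> / (3 * D2) * (s' * D \<tau>)" unfolding g_def using u by (intro b(2)) auto
        also have "\<dots> \<le> \<epsilon> / (3 * D2) * (s * D2)" using u \<epsilon> D12 by (intro mult_left_mono) auto
        also have "\<dots> = \<epsilon>'" using D12 by (simp add: \<epsilon>'_def)
        finally show ?thesis .
      qed
      ultimately have "\<bar>prob {\<omega> \<in> space M. R (rs (a n \<tau>) \<omega> * rs (a n \<tau>') \<omega>)} - s' * D \<tau> / pi\<bar> \<le> 3 * \<epsilon>'"
        by (rule abs_triangle3[OF _ th1])
      then show "\<bar>prob {\<omega> \<in> space M. R (rs (a n \<tau>) \<omega> * rs (a n (\<tau> + s' / sqrt (real n))) \<omega>)} - s' * D \<tau> / pi\<bar> \<le> \<epsilon> * s"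
        unfolding \<tau>'_def \<epsilon>'_def by simp
    qed
  qed
qed

text \<open>The error terms are made independent of \<open>m\<close> by bounding
  \<open>v ^ (2 * m)\<close> from below at the largest admissible \<open>m\<close>; the constants
  depend neither on \<open>v\<close> nor on \<open>n\<close>. The range ends one step beyond the
  integer part of \<open>n powr (1/4)\<close> because that last event carries the crude
  bound.\<close>

lemma near_event_uniform:
  "\<exists>C c. C > 0 \<and> c > 0 \<and> (\<forall>v. 0 < v \<longrightarrow> v < 1 \<longrightarrow> eventually (\<lambda>n. \<forall>\<tau> m. \<alpha> \<le> \<tau> \<longrightarrow> \<tau> \<le> \<beta> \<longrightarrow>
     m \<le> Suc (nat \<lfloor>real n powr (1/4)\<rfloor>) \<longrightarrow>
     prob (near_event (a n \<tau>) (d n \<tau>) (v ^ 3) m) \<le> C * v ^ (2 * m) +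
       (2 * exp (- c * (real n powr (1/4) - 1)) + 2 / (v powr (2 * real n powr (1/4) + 2) * c * exp (real n powr (3/10)))\<^sup>2)) sequentially)"
proof -
  obtain c where c: "c > 0" and ph: "\<And>u. \<bar>u\<bar> \<le> c \<Longrightarrow> norm (\<phi> u) \<le> exp (- u\<^sup>2 / 4)"
    using phi_decay by auto
  obtain C where mg: "eventually (\<lambda>n. \<forall>\<tau>. \<alpha> \<le> \<tau> \<longrightarrow> \<tau> \<le> \<beta> \<longrightarrow> summable (\<lambda>k. \<bar>a n \<tau> k\<bar> * exp \<bar>d n \<tau> k\<bar>) \<and>
      summable (\<lambda>k. (a n \<tau> k)\<^sup>2 * exp (4 * \<bar>d n \<tau> k\<bar>)) \<and> (\<Sum>k. (a n \<tau> k)\<^sup>2 * exp (4 * \<bar>d n \<tau> k\<bar>)) \<le> C) sequentially"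
    using mgf_bound by blast
  \<comment> \<open>One constant for two purposes: the rate \<open>c\<^sup>2 / 8\<close> of the run
    term and the prefactor of the frequency range.\<close>
  define c' where "c' = min (c\<^sup>2 / 8) c"
  have c': "c' > 0" "c' \<le> c\<^sup>2 / 8" "c' \<le> c" using c by (auto simp: c'_def)
  show ?thesis
  proof (rule exI[of _ "max 1 (4 + 4 * C)"], rule exI[of _ c'], intro conjI allI impI)
    fix v :: real assume v: "0 < v" "v < 1"
    show "eventually (\<lambda>n. \<forall>\<tau> m. \<alpha> \<le> \<tau> \<longrightarrow> \<tau> \<le> \<beta> \<longrightarrow>
     m \<le> Suc (nat \<lfloor>real n powr (1/4)\<rfloor>) \<longrightarrow>
     prob (near_event (a n \<tau>) (d n \<tau>) (v ^ 3) m) \<le> max 1 (4 + 4 * C) * v ^ (2 * m) +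
       (2 * exp (- c' * (real n powr (1/4) - 1)) + 2 / (v powr (2 * real n powr (1/4) + 2) * c' * exp (real n powr (3/10)))\<^sup>2)) sequentially"
      using mg eventually_flat[OF c]
    proof (eventually_elim, intro allI impI)
      fix n \<tau> m
      assume mgn: "\<forall>\<tau>. \<alpha> \<le> \<tau> \<longrightarrow> \<tau> \<le> \<beta> \<longrightarrow> summable (\<lambda>k. \<bar>a n \<tau> k\<bar> * exp \<bar>d n \<tau> k\<bar>) \<and>
          summable (\<lambda>k. (a n \<tau> k)\<^sup>2 * exp (4 * \<bar>d n \<tau> k\<bar>)) \<and> (\<Sum>k. (a n \<tau> k)\<^sup>2 * exp (4 * \<bar>d n \<tau> k\<bar>)) \<le> C"
        and fl: "\<forall>\<tau> t. \<alpha> \<le> \<tau> \<longrightarrow> \<tau> \<le> \<beta> \<longrightarrow> \<bar>t\<bar> \<le> c * exp (real n powr (3/10)) \<longrightarrow>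
          (\<exists>F. finite F \<and> (\<forall>k\<in>F. \<bar>t * a n \<tau> k\<bar> \<le> c) \<and>
          min (t\<^sup>2 / 2) (real (nat \<lfloor>real n powr (1/4)\<rfloor>) * c\<^sup>2 / 2) \<le> (\<Sum>k\<in>F. (t * a n \<tau> k)\<^sup>2))"
        and t: "\<alpha> \<le> \<tau>" "\<tau> \<le> \<beta>" and m: "m \<le> Suc (nat \<lfloor>real n powr (1/4)\<rfloor>)"
      define J where "J = nat \<lfloor>real n powr (1/4)\<rfloor>"
      define T where "T = c * exp (real n powr (3/10))"
      have J: "real J \<le> real n powr (1/4)" "real n powr (1/4) - 1 \<le> real J" unfolding J_def by (rule nat_floor_bounds, simp)+
      have T: "T > 0" using c by (simp add: T_def)
      have "prob (near_event (a n \<tau>) (d n \<tau>) (v ^ 3) m) \<le> (4 + 4 * C) * v ^ (2 * m) + 2 * exp (- (real J * c\<^sup>2 / 2) / 4) + 2 / (v ^ (2 * m) * T)\<^sup>2"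
      proof (rule near_event_prob[where c = c])
        show "summable (\<lambda>k. \<bar>a n \<tau> k\<bar> * exp \<bar>d n \<tau> k\<bar>)" "summable (\<lambda>k. (a n \<tau> k)\<^sup>2 * exp (4 * \<bar>d n \<tau> k\<bar>))"
          "(\<Sum>k. (a n \<tau> k)\<^sup>2 * exp (4 * \<bar>d n \<tau> k\<bar>)) \<le> C" using mgn t by blast+
        show "norm (\<phi> u) \<le> exp (- u\<^sup>2 / 4)" if "\<bar>u\<bar> \<le> c" for u using that by (rule ph)
        show "\<exists>F. finite F \<and> (\<forall>k\<in>F. \<bar>t * a n \<tau> k\<bar> \<le> c) \<and> min (t\<^sup>2 / 2) (real J * c\<^sup>2 / 2) \<le> (\<Sum>k\<in>F. (t * a n \<tau> k)\<^sup>2)"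
          if "\<bar>t\<bar> \<le> T" for t
          using fl \<open>\<alpha> \<le> \<tau>\<close> \<open>\<tau> \<le> \<beta>\<close> that unfolding J_def T_def by blast
      qed (use v T in auto)
      moreover have "(4 + 4 * C) * v ^ (2 * m) \<le> max 1 (4 + 4 * C) * v ^ (2 * m)"
        using v by (intro mult_right_mono) auto
      moreover have "exp (- (real J * c\<^sup>2 / 2) / 4) \<le> exp (- c' * (real n powr (1/4) - 1))"
      proof -
        have "c' * (real n powr (1/4) - 1) \<le> c' * real J" using c' J by (intro mult_left_mono) auto
        also have "\<dots> \<le> c\<^sup>2 / 8 * real J" using c' by (intro mult_right_mono) auto
        finally show ?thesis by (simp add: mult.commute)
      qed
      moreover have "2 / (v ^ (2 * m) * T)\<^sup>2 \<le> 2 / (v powr (2 * real n powr (1/4) + 2) * c' * exp (real n powr (3/10)))\<^sup>2"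
      proof (intro divide_left_mono power_mono)
        have "real m \<le> real (Suc J)" using m unfolding J_def of_nat_le_iff .
        then have "real (2 * m) \<le> 2 * real n powr (1/4) + 2" using J by simp
        then have "v powr (2 * real n powr (1/4) + 2) \<le> v powr real (2 * m)" using v by (intro powr_mono') auto
        also have "\<dots> = v ^ (2 * m)" using v by (rule_tac powr_realpow) auto
        finally have "v powr (2 * real n powr (1/4) + 2) * c' \<le> v ^ (2 * m) * c" using c' v by (intro mult_mono) auto
        then show "v powr (2 * real n powr (1/4) + 2) * c' * exp (real n powr (3/10)) \<le> v ^ (2 * m) * T"
          unfolding T_def mult.assoc[symmetric] by (rule mult_right_mono) simp
      qed (use v c' T in auto)
      ultimately show "prob (near_event (a n \<tau>) (d n \<tau>) (v ^ 3) m) \<le> max 1 (4 + 4 * C) * v ^ (2 * m) +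
       (2 * exp (- c' * (real n powr (1/4) - 1)) + 2 / (v powr (2 * real n powr (1/4) + 2) * c' * exp (real n powr (3/10)))\<^sup>2)"
        by linarith
    qed
  qed (use c' in auto)
qed

end

section \<open>Zero counts\<close>

text \<open>The expression is the error per cell in \<open>zero_count_limit\<close>. Its three basic
  terms vanish even after multiplication by \<open>n ^ 2\<close>; the critical one is
  \<open>exp (q * (4 * y + 4) - 2 * n powr (3/10))\<close> with \<open>y = n powr (1/4)\<close>,
  where \<open>3/10 > 1/4\<close> decides.\<close>

lemma near_event_error_tendsto_0:
  assumes "(0::real) < C" "(0::real) < c" "(0::real) < K" "(0::real) < q"
  shows "((\<lambda>n::nat. (real n powr (1/4) + 2) * (2 * exp (- c * (real n powr (1/4) - 1)) + 2 / (exp (- q * (2 * real n powr (1/4) + 2)) * c * exp (real n powr (3/10)))\<^sup>2)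
     + K * (real n * (C * exp (- q * (2 * real n powr (1/4))) + (2 * exp (- c * (real n powr (1/4) - 1)) + 2 / (exp (- q * (2 * real n powr (1/4) + 2)) * c * exp (real n powr (3/10)))\<^sup>2))
     + sqrt (C * exp (- q * (2 * real n powr (1/4))) + (2 * exp (- c * (real n powr (1/4) - 1)) + 2 / (exp (- q * (2 * real n powr (1/4) + 2)) * c * exp (real n powr (3/10)))\<^sup>2))
     + exp (- real n))) \<longlongrightarrow> 0) sequentially"
proof -
  define y where "y n = real n powr (1/4)" for n :: nat
  define e where "e n = C * exp (- q * (2 * y n))" for n
  define g where "g n = 2 * exp (- c * (y n - 1))" for n
  define r where "r n = 2 / (exp (- q * (2 * y n + 2)) * c * exp (real n powr (3/10)))\<^sup>2" for n
  have r_eq: "r n = 2 / c\<^sup>2 * exp (q * (4 * y n + 4) - 2 * real n powr (3/10))" for n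
  proof -
    have "(exp (- q * (2 * y n + 2)) * c * exp (real n powr (3/10)))\<^sup>2
        = c\<^sup>2 * (exp (- q * (2 * y n + 2)) * exp (- q * (2 * y n + 2)) * exp (real n powr (3/10)) * exp (real n powr (3/10)))"
      by (simp add: power2_eq_square)
    also have "\<dots> = c\<^sup>2 * exp (- (q * (4 * y n + 4) - 2 * real n powr (3/10)))"
      unfolding mult_exp_exp by (simp add: algebra_simps)
    also have "\<dots> = c\<^sup>2 / exp (q * (4 * y n + 4) - 2 * real n powr (3/10))" by (simp only: exp_minus divide_inverse)
    finally show ?thesis by (simp add: r_def)
  qed
  have "(\<lambda>n. real n ^ 2 * exp (- q * (2 * y n))) \<longlonglongrightarrow> 0" unfolding y_def using assms by real_asymp
  from tendsto_mult_left[OF this, of C] have e: "(\<lambda>n. real n ^ 2 * e n) \<longlonglongrightarrow> 0" by (simp add: e_def mult_ac)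
  have "(\<lambda>n. real n ^ 2 * exp (- c * (y n - 1))) \<longlonglongrightarrow> 0" unfolding y_def using assms by real_asymp
  from tendsto_mult_left[OF this, of 2] have g: "(\<lambda>n. real n ^ 2 * g n) \<longlonglongrightarrow> 0" by (simp add: g_def mult_ac)
  have "(\<lambda>n. real n ^ 2 * exp (q * (4 * y n + 4) - 2 * real n powr (3/10))) \<longlonglongrightarrow> 0" unfolding y_def using assms by real_asymp
  from tendsto_mult_left[OF this, of "2 / c\<^sup>2"] have r: "(\<lambda>n. real n ^ 2 * r n) \<longlonglongrightarrow> 0" by (simp add: r_eq mult_ac)
  have d: "(\<lambda>n. real n ^ 2 * (g n + r n)) \<longlonglongrightarrow> 0" using tendsto_add[OF g r] by (simp add: distrib_left)
  have p: "(\<lambda>n. real n ^ 2 * (e n + (g n + r n))) \<longlonglongrightarrow> 0" using tendsto_add[OF e d] by (simp add: distrib_left)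
  have "(\<lambda>n. (y n + 2) / real n ^ 2) \<longlonglongrightarrow> 0" unfolding y_def by real_asymp
  from tendsto_mult[OF this d] have 1: "(\<lambda>n. (y n + 2) / real n ^ 2 * (real n ^ 2 * (g n + r n))) \<longlonglongrightarrow> 0" by simp
  have 0: "(\<lambda>n. 1 / real n) \<longlonglongrightarrow> 0" by real_asymp
  from tendsto_mult[OF 0 p] have 2: "(\<lambda>n. 1 / real n * (real n ^ 2 * (e n + (g n + r n)))) \<longlonglongrightarrow> 0" by simp
  from tendsto_mult[OF 0 tendsto_real_sqrt[OF p]] have 3: "(\<lambda>n. 1 / real n * sqrt (real n ^ 2 * (e n + (g n + r n)))) \<longlonglongrightarrow> 0" by simp
  have 4: "(\<lambda>n. exp (- real n)) \<longlonglongrightarrow> 0" by real_asymp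
  have "(\<lambda>n. (y n + 2) / real n ^ 2 * (real n ^ 2 * (g n + r n)) + K * (1 / real n * (real n ^ 2 * (e n + (g n + r n)))
      + 1 / real n * sqrt (real n ^ 2 * (e n + (g n + r n))) + exp (- real n))) \<longlonglongrightarrow> 0 + K * (0 + 0 + 0)"
    by (intro tendsto_add tendsto_mult tendsto_const 1 2 3 4)
  moreover have "eventually (\<lambda>n. (y n + 2) / real n ^ 2 * (real n ^ 2 * (g n + r n)) + K * (1 / real n * (real n ^ 2 * (e n + (g n + r n)))
      + 1 / real n * sqrt (real n ^ 2 * (e n + (g n + r n))) + exp (- real n))
      = (y n + 2) * (g n + r n) + K * (real n * (e n + (g n + r n)) + sqrt (e n + (g n + r n)) + exp (- real n))) sequentially"
    using eventually_gt_at_top[of 0]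
  proof eventually_elim
    case (elim n)
    then show ?case by (simp add: real_sqrt_mult power2_eq_square)
  qed
  ultimately have "(\<lambda>n. (y n + 2) * (g n + r n) + K * (real n * (e n + (g n + r n)) + sqrt (e n + (g n + r n)) + exp (- real n))) \<longlonglongrightarrow> 0"
    by (simp cong: filterlim_cong)
  then show ?thesis by (simp add: y_def e_def g_def r_def)
qed

lemma mult_pos_scale:
  fixes c x y :: real
  assumes "c > 0"
  shows "0 < x * (c * y) \<longleftrightarrow> 0 < x * y" "x * (c * y) < 0 \<longleftrightarrow> x * y < 0"
  unfolding mult.left_commute[of x c] using assms by (auto simp: zero_less_mult_iff[of c] mult_less_0_iff[of c])

lemma tendsto_ennreal_sandwich:
  fixes x :: "nat \<Rightarrow> ennreal"
  assumes L: "L \<ge> 0" and b: "\<And>\<epsilon>. \<epsilon> > 0 \<Longrightarrow> eventually (\<lambda>n. ennreal (L - \<epsilon>) \<le> x n \<and> x n \<le> ennreal (L + \<epsilon>)) sequentially"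
  shows "x \<longlonglongrightarrow> ennreal L"
proof (rule order_tendstoI)
  fix a assume a: "a < ennreal L"
  then obtain a' where a': "a = ennreal a'" "0 \<le> a'" by (cases a) auto
  then have "a' < L" using a by (simp add: ennreal_less_iff)
  then have "eventually (\<lambda>n. ennreal (L - (L - a') / 2) \<le> x n \<and> x n \<le> ennreal (L + (L - a') / 2)) sequentially"
    by (intro b) simp
  then show "eventually (\<lambda>n. a < x n) sequentially"
  proof eventually_elim
    case (elim n)
    have "a < ennreal (L - (L - a') / 2)" unfolding a'(1) using \<open>a' < L\<close> a'(2) by (simp add: ennreal_less_iff field_simps)
    then show ?case using elim by (auto intro: less_le_trans)
  qed
next
  fix a assume a: "ennreal L < a"
  show "eventually (\<lambda>n. x n < a) sequentially"
  proof (cases a)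
    case top
    have "eventually (\<lambda>n. ennreal (L - 1) \<le> x n \<and> x n \<le> ennreal (L + 1)) sequentially" by (rule b) simp
    then show ?thesis by eventually_elim (auto simp: top intro: le_less_trans)
  next
    case (real a')
    then have "L < a'" using a L by (simp add: ennreal_less_iff)
    then have "eventually (\<lambda>n. ennreal (L - (a' - L) / 2) \<le> x n \<and> x n \<le> ennreal (L + (a' - L) / 2)) sequentially"
      by (intro b) simp
    then show ?thesis
    proof eventually_elim
      case (elim n)
      have "ennreal (L + (a' - L) / 2) < a" unfolding real using \<open>L < a'\<close> L by (simp add: ennreal_less_iff field_simps)
      then show ?case using elim by (auto intro: le_less_trans)
    qed
  qed
qed

lemma Riemann_sum_bound:
  fixes \<Phi> D :: "real \<Rightarrow> real"
  assumes ab: "\<alpha> < \<beta>" and der: "\<And>\<tau>. \<alpha> \<le> \<tau> \<Longrightarrow> \<tau> \<le> \<beta> \<Longrightarrow> (\<Phi> has_real_derivative D \<tau>) (at \<tau>)"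
    and cont: "continuous_on {\<alpha>..\<beta>} D" and \<epsilon>: "\<epsilon> > 0"
  shows "\<exists>h0>0. \<forall>I::nat. I > 0 \<longrightarrow> (\<beta> - \<alpha>) / real I \<le> h0 \<longrightarrow>
    \<bar>(\<Sum>i<I. (\<beta> - \<alpha>) / real I * D (\<alpha> + real i * ((\<beta> - \<alpha>) / real I))) - (\<Phi> \<beta> - \<Phi> \<alpha>)\<bar> \<le> \<epsilon> * (\<beta> - \<alpha>)"
proof -
  have "uniformly_continuous_on {\<alpha>..\<beta>} D" using cont by (rule compact_uniformly_continuous) simp
  then obtain \<delta> where \<delta>: "\<delta> > 0" "\<And>x y. x \<in> {\<alpha>..\<beta>} \<Longrightarrow> y \<in> {\<alpha>..\<beta>} \<Longrightarrow> dist y x < \<delta> \<Longrightarrow> dist (D y) (D x) < \<epsilon>"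
    unfolding uniformly_continuous_on_def using \<epsilon> by blast
  show ?thesis
  proof (intro exI[of _ "\<delta> / 2"] conjI allI impI)
    show "\<delta> / 2 > 0" using \<delta> by simp
    fix I :: nat assume I: "I > 0" and hI: "(\<beta> - \<alpha>) / real I \<le> \<delta> / 2"
    define h where "h = (\<beta> - \<alpha>) / real I"
    define t where "t i = \<alpha> + real i * h" for i
    have "h > 0" using ab I by (simp add: h_def)
    moreover have "h < \<delta>" using hI \<delta>(1) unfolding h_def by linarith
    ultimately have h: "h > 0" "h < \<delta>" by auto
    have Ih: "real I * h = \<beta> - \<alpha>" using I by (simp add: h_def)
    have t_range: "\<alpha> \<le> t i" "t i \<le> \<beta>" if "i \<le> I" for i
    proof -
      have "real i * h \<le> real I * h" using that h by (intro mult_right_mono) auto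
      then show "t i \<le> \<beta>" using Ih by (simp add: t_def)
      show "\<alpha> \<le> t i" using h by (simp add: t_def)
    qed
    have step: "\<bar>h * D (t i) - (\<Phi> (t (Suc i)) - \<Phi> (t i))\<bar> \<le> h * \<epsilon>" if i: "i < I" for i
    proof -
      have ti: "t (Suc i) = t i + h" by (simp add: t_def algebra_simps)
      have rng: "\<alpha> \<le> t i" "t i + h \<le> \<beta>" using t_range[of i] t_range[of "Suc i"] i ti by auto
      have "\<exists>\<xi>. t i < \<xi> \<and> \<xi> < t i + h \<and> \<Phi> (t i + h) - \<Phi> (t i) = (t i + h - t i) * D \<xi>"
        using h rng by (intro MVT2 der) auto
      then obtain \<xi> where \<xi>: "t i < \<xi>" "\<xi> < t i + h" "\<Phi> (t i + h) - \<Phi> (t i) = h * D \<xi>" by auto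
      have "dist (D (t i)) (D \<xi>) < \<epsilon>"
        using \<xi> rng h by (intro \<delta>(2)) (auto simp: dist_real_def)
      then have "\<bar>D (t i) - D \<xi>\<bar> \<le> \<epsilon>" by (simp add: dist_real_def)
      then have "h * \<bar>D (t i) - D \<xi>\<bar> \<le> h * \<epsilon>" using h by (intro mult_left_mono) auto
      moreover have "\<bar>h * D (t i) - h * D \<xi>\<bar> = h * \<bar>D (t i) - D \<xi>\<bar>"
        unfolding right_diff_distrib[symmetric] using h by (simp add: abs_mult)
      ultimately show ?thesis unfolding ti \<xi>(3) by simp
    qed
    have "(\<Sum>i<I. \<Phi> (t (Suc i)) - \<Phi> (t i)) = \<Phi> (t I) - \<Phi> (t 0)" by (rule sum_lessThan_telescope)
    also have "t I = \<beta>" using Ih by (simp add: t_def)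
    also have "t 0 = \<alpha>" by (simp add: t_def)
    finally have "(\<Sum>i<I. h * D (t i)) - (\<Phi> \<beta> - \<Phi> \<alpha>) = (\<Sum>i<I. h * D (t i) - (\<Phi> (t (Suc i)) - \<Phi> (t i)))"
      by (simp add: sum_subtractf)
    then have "\<bar>(\<Sum>i<I. h * D (t i)) - (\<Phi> \<beta> - \<Phi> \<alpha>)\<bar> \<le> (\<Sum>i<I. \<bar>h * D (t i) - (\<Phi> (t (Suc i)) - \<Phi> (t i))\<bar>)"
      using sum_abs by simp
    also have "\<dots> \<le> (\<Sum>i<I. h * \<epsilon>)" using step by (intro sum_mono) auto
    also have "\<dots> = \<epsilon> * (\<beta> - \<alpha>)" using Ih by simp
    finally show "\<bar>(\<Sum>i<I. (\<beta> - \<alpha>) / real I * D (\<alpha> + real i * ((\<beta> - \<alpha>) / real I))) - (\<Phi> \<beta> - \<Phi> \<alpha>)\<bar> \<le> \<epsilon> * (\<beta> - \<alpha>)"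
      by (simp add: h_def t_def)
  qed
qed

section \<open>Local and global events for the process on the logarithmic scale\<close>

context random_ensemble
begin

text \<open>No normalisation: \<open>rs (a n \<tau>)\<close> and the locally shifted sums are
  positive multiples of values of \<open>Fz\<close>, so zeros and signs can be compared across
  different base points.\<close>

definition "Fz n \<omega> \<tau> = rs (\<lambda>k. w n k * exp (real k * \<tau>)) \<omega>"

definition good :: "nat \<Rightarrow> 'w \<Rightarrow> bool" where
  "good n \<omega> \<longleftrightarrow> (\<forall>\<tau>\<le>\<beta>. summable (\<lambda>k. w n k * exp (real k * \<tau>) * \<xi> k \<omega>))"

text \<open>The terms are dominated by those at the right endpoint, so absolute convergence at
  \<open>\<beta>\<close> gives convergence for all \<open>\<tau> \<le> \<beta>\<close> at
  once.\<close>

lemma eventually_good: "eventually (\<lambda>n. AE \<omega> in M. good n \<omega>) sequentially"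
  using a_summable
proof eventually_elim
  case (elim n)
  then have "summable (\<lambda>k. \<bar>a n \<beta> k\<bar>)" using \<alpha>\<beta> by blast
  then have "AE \<omega> in M. summable (\<lambda>k. \<bar>a n \<beta> k * \<xi> k \<omega>\<bar>)" by (rule AE_summable)
  then show ?case
  proof eventually_elim
    case (elim \<omega>)
    have S1: "S n z2 \<ge> 1" using z_range[of \<beta>] by (intro S_ge_1) auto
    have "summable (\<lambda>k. sqrt (S n z2) * \<bar>a n \<beta> k * \<xi> k \<omega>\<bar>)" using elim by (rule summable_mult)
    moreover have "sqrt (S n z2) * \<bar>a n \<beta> k * \<xi> k \<omega>\<bar> = \<bar>w n k * exp (real k * \<beta>) * \<xi> k \<omega>\<bar>" for k
      using S1 by (simp add: a_def abs_mult)
    ultimately have s: "summable (\<lambda>k. \<bar>w n k * exp (real k * \<beta>) * \<xi> k \<omega>\<bar>)" by simp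
    show "good n \<omega>"
      unfolding good_def
    proof (intro allI impI)
      fix \<tau> assume "\<tau> \<le> \<beta>"
      show "summable (\<lambda>k. w n k * exp (real k * \<tau>) * \<xi> k \<omega>)"
      proof (rule summable_comparison_test'[OF s])
        fix k
        have "exp (real k * \<tau>) \<le> exp (real k * \<beta>)" using \<open>\<tau> \<le> \<beta>\<close> by (simp add: mult_left_mono)
        then show "norm (w n k * exp (real k * \<tau>) * \<xi> k \<omega>) \<le> \<bar>w n k * exp (real k * \<beta>) * \<xi> k \<omega>\<bar>"
          by (simp add: abs_mult mult_left_mono mult_right_mono)
      qed
    qed
  qed
qed

lemma rs_scale:
  assumes "good n \<omega>" "\<tau> \<le> \<beta>" "\<And>k. b k = c * (w n k * exp (real k * \<tau>))"
  shows "rs b \<omega> = c * Fz n \<omega> \<tau>"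
proof -
  have "summable (\<lambda>k. w n k * exp (real k * \<tau>) * \<xi> k \<omega>)" using assms unfolding good_def by blast
  then have "(\<Sum>k. c * (w n k * exp (real k * \<tau>) * \<xi> k \<omega>)) = c * (\<Sum>k. w n k * exp (real k * \<tau>) * \<xi> k \<omega>)"
    by (rule suminf_mult)
  then show ?thesis unfolding Fz_def rs_def assms(3) by (simp add: mult.assoc)
qed

lemma rs_a_pos:
  assumes "good n \<omega>" "\<tau> \<le> \<beta>"
  obtains c where "c > 0" "rs (a n \<tau>) \<omega> = c * Fz n \<omega> \<tau>"
proof -
  have "S n (exp (2 * \<tau>)) \<ge> 1" using z_range[OF assms(2)] by (intro S_ge_1) auto
  then show thesis
    by (intro that[of "1 / sqrt (S n (exp (2 * \<tau>)))"] rs_scale assms) (auto simp: a_def)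
qed

lemma rs_shift_pos:
  assumes "good n \<omega>" "\<tau> \<le> \<beta>" "\<tau> + u / sqrt (real n) \<le> \<beta>"
  obtains c where "c > 0" "rs (\<lambda>k. a n \<tau> k * exp (d n \<tau> k * u)) \<omega> = c * Fz n \<omega> (\<tau> + u / sqrt (real n))"
proof -
  obtain c where c: "c > 0" "\<And>k. a n \<tau> k * exp (d n \<tau> k * u) = c * a n (\<tau> + u / sqrt (real n)) k"
    using a_shift[OF assms(2,3)] by blast
  have S1: "S n (exp (2 * (\<tau> + u / sqrt (real n)))) \<ge> 1" using z_range[OF assms(3)] by (intro S_ge_1) auto
  show thesis
  proof (rule that)
    show "c / sqrt (S n (exp (2 * (\<tau> + u / sqrt (real n))))) > 0" using c(1) S1 by simp
    show "rs (\<lambda>k. a n \<tau> k * exp (d n \<tau> k * u)) \<omega> = c / sqrt (S n (exp (2 * (\<tau> + u / sqrt (real n))))) * Fz n \<omega> (\<tau> + u / sqrt (real n))"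
      by (rule rs_scale[OF assms(1,3)]) (unfold c(2), simp add: a_def)
  qed
qed

definition local_good :: "nat \<Rightarrow> real \<Rightarrow> 'w \<Rightarrow> bool" where
  "local_good n \<tau> \<omega> \<longleftrightarrow> continuous_on {-1<..<1} (\<lambda>u. rs (\<lambda>k. a n \<tau> k * exp (d n \<tau> k * u)) \<omega>) \<and>
    (\<forall>s T. 0 < s \<longrightarrow> s < 1 \<longrightarrow> finite T \<longrightarrow> T \<subseteq> {t\<in>{0..s}. rs (\<lambda>k. a n \<tau> k * exp (d n \<tau> k * t)) \<omega> = 0} \<longrightarrow>
       ennreal ((rs (a n \<tau>) \<omega>)\<^sup>2) \<le> Vsum (a n \<tau>) (d n \<tau>) \<omega> * ennreal (s ^ (2 * card T))) \<and>
    (\<forall>s t. 0 < s \<longrightarrow> s < 1 \<longrightarrow> t \<in> {0..s} \<longrightarrow> rs (\<lambda>k. a n \<tau> k * exp (d n \<tau> k * t)) \<omega> = 0 \<longrightarrow>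
       rs (a n \<tau>) \<omega> * rs (\<lambda>k. a n \<tau> k * exp (d n \<tau> k * s)) \<omega> > 0 \<longrightarrow>
       ennreal ((rs (a n \<tau>) \<omega>)\<^sup>2) \<le> Vsum (a n \<tau>) (d n \<tau>) \<omega> * ennreal (s ^ 4))"

lemma eventually_local_good:
  "eventually (\<lambda>n. \<forall>\<tau>. \<alpha> \<le> \<tau> \<longrightarrow> \<tau> \<le> \<beta> \<longrightarrow> (AE \<omega> in M. local_good n \<tau> \<omega>)) sequentially"
proof -
  obtain C where "eventually (\<lambda>n. \<forall>\<tau>. \<alpha> \<le> \<tau> \<longrightarrow> \<tau> \<le> \<beta> \<longrightarrow> summable (\<lambda>k. \<bar>a n \<tau> k\<bar> * exp \<bar>d n \<tau> k\<bar>) \<and>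
      summable (\<lambda>k. (a n \<tau> k)\<^sup>2 * exp (4 * \<bar>d n \<tau> k\<bar>)) \<and> (\<Sum>k. (a n \<tau> k)\<^sup>2 * exp (4 * \<bar>d n \<tau> k\<bar>)) \<le> C) sequentially"
    using mgf_bound by blast
  then show ?thesis
    unfolding local_good_def by eventually_elim (intro allI impI local_zeros_bound, blast)
qed

text \<open>Two or more zeros, or one zero without a sign change, make the value at the left endpoint
  atypically small; more than \<open>m0\<close> zeros do so with a probability that can afford the crude
  global bound \<open>B\<close>.\<close>

lemma interval_count:
  assumes g: "good n \<omega>" and lg: "local_good n \<tau> \<omega>" and \<omega>: "\<omega> \<in> space M"
    and n: "n > 0" and t: "\<tau> \<le> \<beta>" "\<tau> + s' / sqrt (real n) \<le> \<beta>" and s: "0 < s'" "s' \<le> s" "s < 1" and m0: "2 \<le> m0"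
    and B: "emeasure (count_space UNIV) {t \<in> {\<tau>..\<tau> + s' / sqrt (real n)}. Fz n \<omega> t = 0} \<le> B"
  shows "emeasure (count_space UNIV) {t \<in> {\<tau>..\<tau> + s' / sqrt (real n)}. Fz n \<omega> t = 0} \<le>
     indicator {\<omega> \<in> space M. rs (a n \<tau>) \<omega> * rs (a n (\<tau> + s' / sqrt (real n))) \<omega> \<le> 0} \<omega>
     + 2 * indicator (near_event (a n \<tau>) (d n \<tau>) s 2) \<omega>
     + (\<Sum>m\<in>{3..m0}. indicator (near_event (a n \<tau>) (d n \<tau>) s m) \<omega>)
     + B * indicator (near_event (a n \<tau>) (d n \<tau>) s (Suc m0)) \<omega>" (is "?N \<le> ?R")
proof -
  define h where "h u = rs (\<lambda>k. a n \<tau> k * exp (d n \<tau> k * u)) \<omega>" for u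
  define Z where "Z = {u \<in> {0..s'}. h u = 0}"
  define p where "p u = \<tau> + u / sqrt (real n)" for u
  have sn: "sqrt (real n) > 0" using n by simp
  have le\<beta>: "p u \<le> \<beta>" if "u \<le> s'" for u
  proof -
    have "u / sqrt (real n) \<le> s' / sqrt (real n)" using that sn by (intro divide_right_mono) auto
    then show ?thesis using t(2) by (simp add: p_def)
  qed
  have h_iff: "h u = 0 \<longleftrightarrow> Fz n \<omega> (p u) = 0" if "u \<le> s'" for u
    using rs_shift_pos[OF g t(1) le\<beta>[OF that, unfolded p_def]] by (metis h_def p_def mult_eq_0_iff less_irrefl)
  have Zimg: "{t \<in> {\<tau>..\<tau> + s' / sqrt (real n)}. Fz n \<omega> t = 0} = p ` Z"
  proof (intro equalityI subsetI)
    fix t' assume t': "t' \<in> {t \<in> {\<tau>..\<tau> + s' / sqrt (real n)}. Fz n \<omega> t = 0}"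
    define u where "u = (t' - \<tau>) * sqrt (real n)"
    have pu: "p u = t'" using sn by (simp add: p_def u_def)
    have "u \<ge> 0" using t' sn by (simp add: u_def)
    moreover have "u \<le> s'" using t' sn by (simp add: u_def field_simps)
    ultimately have "u \<in> Z" using h_iff[of u] t' pu by (simp add: Z_def)
    then show "t' \<in> p ` Z" using pu by blast
  next
    fix t' assume "t' \<in> p ` Z"
    then obtain u where u: "u \<in> {0..s'}" "h u = 0" "t' = p u" by (auto simp: Z_def)
    have "u / sqrt (real n) \<le> s' / sqrt (real n)" "0 \<le> u / sqrt (real n)" using u sn by (auto intro: divide_right_mono)
    then show "t' \<in> {t \<in> {\<tau>..\<tau> + s' / sqrt (real n)}. Fz n \<omega> t = 0}" using u h_iff[of u] by (auto simp: p_def)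
  qed
  have inj: "inj_on p Z" using sn by (auto simp: inj_on_def p_def)
  have Zs: "Z \<subseteq> {0..s}" using s by (auto simp: Z_def)
  have s0: "0 < s" using s by simp
  have near: "\<omega> \<in> near_event (a n \<tau>) (d n \<tau>) s m" if T: "finite T" "T \<subseteq> Z" "m \<le> card T" for T m
  proof -
    have TT: "T \<subseteq> {t\<in>{0..s}. rs (\<lambda>k. a n \<tau> k * exp (d n \<tau> k * t)) \<omega> = 0}" using T Zs by (auto simp: Z_def h_def)
    have "ennreal ((rs (a n \<tau>) \<omega>)\<^sup>2) \<le> Vsum (a n \<tau>) (d n \<tau>) \<omega> * ennreal (s ^ (2 * card T))"
      using lg s0 s(3) T(1) TT unfolding local_good_def by blast
    also have "\<dots> \<le> Vsum (a n \<tau>) (d n \<tau>) \<omega> * ennreal (s ^ (2 * m))"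
      using T(3) s0 s(3) by (intro mult_left_mono ennreal_leI power_decreasing) auto
    finally show ?thesis using \<omega> by (simp add: near_event_def)
  qed
  \<comment> \<open>Beyond \<open>m0\<close> zeros the last term of the bound alone suffices; this
    includes infinitely many zeros.\<close>
  have big: "?N \<le> ?R" if "\<omega> \<in> near_event (a n \<tau>) (d n \<tau>) s (Suc m0)"
  proof -
    have "?N \<le> B * indicator (near_event (a n \<tau>) (d n \<tau>) s (Suc m0)) \<omega>" using B that by simp
    also have "\<dots> \<le> ?R" by (rule add_increasing) (auto simp: sum_nonneg)
    finally show ?thesis .
  qed
  show ?thesis
  proof (cases "finite Z")
    case False
    then obtain T where "finite T" "T \<subseteq> Z" "card T = Suc m0" using infinite_arbitrarily_large by blast
    then show ?thesis using near[of T "Suc m0"] big by simp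
  next
    case True
    have N: "?N = of_nat (card Z)"
      unfolding Zimg using True card_image[OF inj] by (simp add: emeasure_count_space)
    consider "card Z = 0" | "card Z = 1" | "2 \<le> card Z" "card Z \<le> m0" | "Suc m0 \<le> card Z" by linarith
    then show ?thesis
    proof cases
      case 1
      then show ?thesis unfolding N by simp
    next
      case 2
      show ?thesis
      proof (cases "rs (a n \<tau>) \<omega> * rs (a n (\<tau> + s' / sqrt (real n))) \<omega> \<le> 0")
        case True
        then have "(1::ennreal) \<le> indicator {\<omega> \<in> space M. rs (a n \<tau>) \<omega> * rs (a n (\<tau> + s' / sqrt (real n))) \<omega> \<le> 0} \<omega>"
          using \<omega> by simp
        also have "\<dots> \<le> ?R" by (simp add: add.assoc add_increasing2)
        finally show ?thesis unfolding N 2 by simp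
      next
        \<comment> \<open>A single zero without a sign change is a touching zero and implies the
          event for \<open>m = 2\<close>.\<close>
        case False
        obtain u where u: "u \<in> Z" using 2 by (metis card.empty ex_in_conv zero_neq_one)
        obtain c1 where c1: "c1 > 0" "h s' = c1 * Fz n \<omega> (\<tau> + s' / sqrt (real n))"
          using rs_shift_pos[OF g t] unfolding h_def by blast
        obtain c2 where c2: "c2 > 0" "rs (a n (\<tau> + s' / sqrt (real n))) \<omega> = c2 * Fz n \<omega> (\<tau> + s' / sqrt (real n))"
          using rs_a_pos[OF g t(2)] by blast
        have "rs (a n \<tau>) \<omega> * h s' > 0"
        proof -
          have "rs (a n \<tau>) \<omega> * (c2 * Fz n \<omega> (\<tau> + s' / sqrt (real n))) > 0" using False unfolding c2(2) by simp
          then have "rs (a n \<tau>) \<omega> * Fz n \<omega> (\<tau> + s' / sqrt (real n)) > 0" using mult_pos_scale(1)[OF c2(1)] by simp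
          then show ?thesis unfolding c1(2) using mult_pos_scale(1)[OF c1(1)] by simp
        qed
        then have "ennreal ((rs (a n \<tau>) \<omega>)\<^sup>2) \<le> Vsum (a n \<tau>) (d n \<tau>) \<omega> * ennreal (s' ^ 4)"
          using lg s u unfolding local_good_def h_def Z_def by auto
        also have "\<dots> \<le> Vsum (a n \<tau>) (d n \<tau>) \<omega> * ennreal (s ^ (2 * 2))"
          using s by (intro mult_left_mono ennreal_leI) (auto intro: power_mono)
        finally have "\<omega> \<in> near_event (a n \<tau>) (d n \<tau>) s 2" using \<omega> by (simp add: near_event_def)
        then have "(1::ennreal) \<le> 2 * indicator (near_event (a n \<tau>) (d n \<tau>) s 2) \<omega>" by simp
        also have "\<dots> \<le> ?R" by (simp add: add.assoc add_increasing add_increasing2)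
        finally show ?thesis unfolding N 2 by simp
      qed
    next
      \<comment> \<open>All events up to \<open>m = card Z\<close> occur: the event for 2 accounts
        for two zeros and each further event for one more.\<close>
      case 3
      have A: "\<omega> \<in> near_event (a n \<tau>) (d n \<tau>) s m" if "m \<le> card Z" for m using near[OF True subset_refl that] .
      have "of_nat (card Z - 2) = (\<Sum>m\<in>{3..card Z}. (1::ennreal))" by simp
      also have "\<dots> = (\<Sum>m\<in>{3..card Z}. indicator (near_event (a n \<tau>) (d n \<tau>) s m) \<omega>)"
        using A by (intro sum.cong) auto
      also have "\<dots> \<le> (\<Sum>m\<in>{3..m0}. indicator (near_event (a n \<tau>) (d n \<tau>) s m) \<omega>)"
        using 3 by (intro sum_mono2) auto
      finally have S3: "of_nat (card Z - 2) \<le> (\<Sum>m\<in>{3..m0}. indicator (near_event (a n \<tau>) (d n \<tau>) s m) \<omega> :: ennreal)" .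
      have "card Z = 2 + (card Z - 2)" using 3 by simp
      from arg_cong[OF this, of "of_nat :: nat \<Rightarrow> ennreal"] have "?N = of_nat (2 + (card Z - 2))" unfolding N .
      also have "\<dots> = 2 * indicator (near_event (a n \<tau>) (d n \<tau>) s 2) \<omega> + of_nat (card Z - 2)"
        using A[OF 3(1)] by (simp only: of_nat_add) simp
      also have "\<dots> \<le> 2 * indicator (near_event (a n \<tau>) (d n \<tau>) s 2) \<omega> + (\<Sum>m\<in>{3..m0}. indicator (near_event (a n \<tau>) (d n \<tau>) s m) \<omega>)"
        by (intro add_left_mono S3)
      also have "\<dots> \<le> ?R" by (simp add: add.assoc add_increasing add_increasing2)
      finally show ?thesis .
    next
      case 4
      then show ?thesis using near[OF True subset_refl, of "Suc m0"] big by simp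
    qed
  qed
qed

text \<open>The zero is strictly inside the cell, so zeros found in neighbouring cells are
  distinct.\<close>

lemma sign_change_zero:
  assumes g: "good n \<omega>" and lg: "local_good n \<tau> \<omega>"
    and n: "n > 0" and t: "\<tau> \<le> \<beta>" "\<tau> + s' / sqrt (real n) \<le> \<beta>" and s: "0 < s'" "s' < 1"
    and neg: "rs (a n \<tau>) \<omega> * rs (a n (\<tau> + s' / sqrt (real n))) \<omega> < 0"
  shows "\<exists>t. \<tau> < t \<and> t < \<tau> + s' / sqrt (real n) \<and> Fz n \<omega> t = 0"
proof -
  define h where "h u = rs (\<lambda>k. a n \<tau> k * exp (d n \<tau> k * u)) \<omega>" for u
  have sn: "sqrt (real n) > 0" using n by simp
  obtain c1 where c1: "c1 > 0" "h s' = c1 * Fz n \<omega> (\<tau> + s' / sqrt (real n))"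
    using rs_shift_pos[OF g t] unfolding h_def by blast
  obtain c2 where c2: "c2 > 0" "rs (a n (\<tau> + s' / sqrt (real n))) \<omega> = c2 * Fz n \<omega> (\<tau> + s' / sqrt (real n))"
    using rs_a_pos[OF g t(2)] by blast
  have h0: "h 0 = rs (a n \<tau>) \<omega>" by (simp add: h_def)
  have "h 0 * Fz n \<omega> (\<tau> + s' / sqrt (real n)) < 0" using neg unfolding h0 c2(2) mult_pos_scale(2)[OF c2(1)] .
  then have hn: "h 0 * h s' < 0" unfolding c1(2) mult_pos_scale(2)[OF c1(1)] .
  have "continuous_on {-1<..<1} h" using lg unfolding local_good_def h_def[abs_def] by blast
  then have cont: "continuous_on {0..s'} h" by (rule continuous_on_subset) (use s in auto)
  have "\<exists>u\<ge>0. u \<le> s' \<and> h u = 0"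
  proof (cases "h 0 < 0")
    case True
    then show ?thesis using hn s cont by (intro IVT') (auto simp: mult_less_0_iff)
  next
    case False
    then show ?thesis using hn s cont by (intro IVT2') (auto simp: mult_less_0_iff)
  qed
  then obtain u where u: "0 \<le> u" "u \<le> s'" "h u = 0" by auto
  have "u \<noteq> 0" "u \<noteq> s'" using u(3) hn by auto
  then have u': "0 < u" "u < s'" using u by auto
  have lt: "0 < u / sqrt (real n)" "u / sqrt (real n) < s' / sqrt (real n)" using u' sn by (auto intro: divide_strict_right_mono)
  have tu: "\<tau> + u / sqrt (real n) \<le> \<beta>" using lt t(2) by simp
  obtain c3 where c3: "c3 > 0" "h u = c3 * Fz n \<omega> (\<tau> + u / sqrt (real n))"
    using rs_shift_pos[OF g t(1) tu] unfolding h_def by blast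
  then have "Fz n \<omega> (\<tau> + u / sqrt (real n)) = 0" using u(3) by simp
  then show ?thesis using lt by (intro exI[of _ "\<tau> + u / sqrt (real n)"]) auto
qed

end

section \<open>Counting over a grid and the limit of the mean\<close>

lemma count_grid_le:
  fixes h :: real
  assumes "h \<ge> 0" "I > 0"
  shows "emeasure (count_space UNIV) {t \<in> {x..x + real I * h}. P t}
    \<le> (\<Sum>i<I. emeasure (count_space UNIV) {t \<in> {x + real i * h..x + real i * h + h}. P t})"
  using assms(2)
proof (induction I rule: nat_induct_non_zero)
  case 1
  then show ?case by simp
next
  case (Suc n)
  have "emeasure (count_space UNIV) {t \<in> {x..x + real (Suc n) * h}. P t} \<le>
     emeasure (count_space UNIV) ({t \<in> {x..x + real n * h}. P t} \<union> {t \<in> {x + real n * h..x + real n * h + h}. P t})"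
    by (rule emeasure_mono) (auto simp: algebra_simps)
  also have "\<dots> \<le> emeasure (count_space UNIV) {t \<in> {x..x + real n * h}. P t} + emeasure (count_space UNIV) {t \<in> {x + real n * h..x + real n * h + h}. P t}"
    by (rule emeasure_subadditive) auto
  also have "\<dots> \<le> (\<Sum>i<Suc n. emeasure (count_space UNIV) {t \<in> {x + real i * h..x + real i * h + h}. P t})"
    using Suc by (simp add: add_right_mono)
  finally show ?case .
qed

lemma count_grid_ge:
  fixes h :: real
  assumes h: "h \<ge> 0" and P: "\<And>i. i < I \<Longrightarrow> Q i \<Longrightarrow> \<exists>t. x + real i * h < t \<and> t < x + real i * h + h \<and> P t"
  shows "(\<Sum>i<I. if Q i then 1 else 0) \<le> emeasure (count_space UNIV) {t \<in> {x<..<x + real I * h}. P t}"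
  using P
proof (induction I)
  case 0
  then show ?case by simp
next
  case (Suc n)
  let ?A = "{t \<in> {x<..<x + real n * h}. P t}" and ?B = "{t \<in> {x + real n * h<..<x + real n * h + h}. P t}"
  have "(if Q n then 1 else 0) \<le> emeasure (count_space UNIV) ?B"
  proof (cases "Q n")
    case True
    then obtain t where "t \<in> ?B" using Suc.prems[of n] by auto
    then have "emeasure (count_space UNIV) {t} \<le> emeasure (count_space UNIV) ?B" by (intro emeasure_mono) auto
    then show ?thesis using True by simp
  qed simp
  moreover have "(\<Sum>i<n. if Q i then 1 else 0) \<le> emeasure (count_space UNIV) ?A"
    using Suc.prems by (intro Suc.IH) auto
  ultimately have "(\<Sum>i<Suc n. if Q i then 1 else 0) \<le> emeasure (count_space UNIV) ?A + emeasure (count_space UNIV) ?B"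
    by (simp add: add_mono)
  also have "\<dots> = emeasure (count_space UNIV) (?A \<union> ?B)" by (rule plus_emeasure) auto
  also have "\<dots> \<le> emeasure (count_space UNIV) {t \<in> {x<..<x + real (Suc n) * h}. P t}"
    by (rule emeasure_mono) (use h in \<open>auto simp: algebra_simps intro: le_less_trans[of _ "x + real n * h"] add_increasing2\<close>)
  finally show ?case .
qed

lemma geometric_tail:
  fixes x :: real
  assumes "0 \<le> x" "x \<le> 1/2"
  shows "(\<Sum>m\<in>{3..J}. x ^ m) \<le> x\<^sup>2"
proof -
  have x: "x < 1" using assms by simp
  have "(\<Sum>m\<in>{3..J}. x ^ m) \<le> (\<Sum>m. x ^ (m + 3))"
  proof -
    have s: "summable (\<lambda>m. x ^ (m + 3))" using assms x by (intro summable_ignore_initial_segment summable_geometric) auto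
    have "(\<Sum>m\<in>{3..J}. x ^ m) = (\<Sum>m<J + 1 - 3. x ^ (m + 3))"
      by (rule sum.reindex_bij_witness[of _ "\<lambda>m. m + 3" "\<lambda>m. m - 3"]) auto
    also have "\<dots> \<le> (\<Sum>m. x ^ (m + 3))" using s assms by (intro sum_le_suminf) auto
    finally show ?thesis .
  qed
  also have "\<dots> = x ^ 3 / (1 - x)"
    using suminf_mult2[OF summable_geometric[of x], of "x ^ 3"] assms x by (simp add: power_add suminf_geometric)
  also have "\<dots> \<le> x\<^sup>2"
  proof -
    have "x ^ 3 \<le> x\<^sup>2 * (1 - x)" using assms by (simp add: power3_eq_cube power2_eq_square mult_left_mono)
    then show ?thesis using x by (simp add: field_simps)
  qed
  finally show ?thesis .
qed

context random_ensemble
begin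

lemma D_pos: "\<tau> \<le> \<beta> \<Longrightarrow> D \<tau> > 0"
  using z_range[of \<tau>] by (simp add: D_def)

lemma D_continuous: "continuous_on {\<alpha>..\<beta>} D"
  unfolding D_def
proof (intro continuous_intros ballI)
  fix x assume "x \<in> {\<alpha>..\<beta>}"
  then show "1 - \<sigma> * exp (2 * x) \<noteq> 0" using z_range[of x] by auto
qed

lemma count_integral_bound:
  assumes A: "A \<in> sets M" and E: "\<And>m. E m \<in> sets M" and B[measurable]: "B \<in> borel_measurable M"
  shows "(\<integral>\<^sup>+\<omega>. indicator A \<omega> + 2 * indicator (E 2) \<omega> + (\<Sum>m\<in>{3..J}. indicator (E m) \<omega>) + B \<omega> * indicator (E (Suc J)) \<omega> \<partial>M)
    = ennreal (prob A + 2 * prob (E 2) + (\<Sum>m\<in>{3..J}. prob (E m))) + (\<integral>\<^sup>+\<omega>. B \<omega> * indicator (E (Suc J)) \<omega> \<partial>M)"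
proof -
  note [measurable] = A E
  have "(\<integral>\<^sup>+\<omega>. indicator A \<omega> + 2 * indicator (E 2) \<omega> + (\<Sum>m\<in>{3..J}. indicator (E m) \<omega>) + B \<omega> * indicator (E (Suc J)) \<omega> \<partial>M)
    = emeasure M A + 2 * emeasure M (E 2) + (\<Sum>m\<in>{3..J}. emeasure M (E m)) + (\<integral>\<^sup>+\<omega>. B \<omega> * indicator (E (Suc J)) \<omega> \<partial>M)"
    by (simp add: nn_integral_add nn_integral_sum nn_integral_cmult)
  also have "emeasure M A + 2 * emeasure M (E 2) + (\<Sum>m\<in>{3..J}. emeasure M (E m)) = ennreal (prob A + 2 * prob (E 2) + (\<Sum>m\<in>{3..J}. prob (E m)))"
    by (simp add: emeasure_eq_measure ennreal_plus ennreal_mult sum_nonneg sum_ennreal flip: ennreal_numeral)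
  finally show ?thesis .
qed

text \<open>\<open>N\<close> is either the number of zeros, or 0 on an event where the process
  vanishes on the whole interval; there no strict sign change occurs, so the lower bound survives.
  The crude bound \<open>B\<close> is integrated only over the events that belong to more than
  \<open>n powr (1/4)\<close> zeros in one cell.\<close>

lemma zero_count_limit:
  fixes N B :: "nat \<Rightarrow> 'w \<Rightarrow> ennreal"
  assumes ab: "\<alpha> < \<beta>"
    and der: "\<And>\<tau>. \<alpha> \<le> \<tau> \<Longrightarrow> \<tau> \<le> \<beta> \<Longrightarrow> (\<Phi> has_real_derivative D \<tau>) (at \<tau>)"
    and NB: "eventually (\<lambda>n. AE \<omega> in M. (N n \<omega> = emeasure (count_space UNIV) {\<tau> \<in> {\<alpha>..\<beta>}. Fz n \<omega> \<tau> = 0} \<or>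
        (N n \<omega> = 0 \<and> (\<forall>\<tau>\<in>{\<alpha>..\<beta>}. Fz n \<omega> \<tau> = 0))) \<and> N n \<omega> \<le> B n \<omega>) sequentially"
    and B[measurable]: "\<And>n. B n \<in> borel_measurable M"
    and K: "K > 0" and tail: "eventually (\<lambda>n. \<forall>A\<in>sets M. (\<integral>\<^sup>+\<omega>. B n \<omega> * indicator A \<omega> \<partial>M)
        \<le> ennreal (K * (real n * prob A + sqrt (prob A) + exp (- real n)))) sequentially"
  shows "(\<lambda>n. (\<integral>\<^sup>+\<omega>. N n \<omega> \<partial>M) / ennreal (sqrt (real n))) \<longlonglongrightarrow> ennreal ((\<Phi> \<beta> - \<Phi> \<alpha>) / pi)"
proof (rule tendsto_ennreal_sandwich)
  define l where "l = \<beta> - \<alpha>"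
  have l: "l > 0" using ab by (simp add: l_def)
  have "\<Phi> \<alpha> \<le> \<Phi> \<beta>"
  proof (rule DERIV_nonneg_imp_nondecreasing[of \<alpha> \<beta> \<Phi>])
    fix x assume "\<alpha> \<le> x" "x \<le> \<beta>"
    then show "\<exists>y. DERIV \<Phi> x :> y \<and> 0 \<le> y" using der[of x] D_pos[of x] by (intro exI[of _ "D x"]) auto
  qed (use ab in simp)
  then show "0 \<le> (\<Phi> \<beta> - \<Phi> \<alpha>) / pi" by simp
  fix \<eta> :: real assume \<eta>: "\<eta> > 0"
  \<comment> \<open>Each cell contributes an error of \<open>3 * \<epsilon> * s\<close>, there are
    at most \<open>2 * l * sqrt n / s\<close> cells, and the Riemann sum adds
    \<open>\<epsilon> * l\<close>: after division by \<open>sqrt n\<close> this is 7 of the 8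
    parts.\<close>
  define \<epsilon> where "\<epsilon> = \<eta> / (8 * l)"
  have \<epsilon>: "\<epsilon> > 0" using \<eta> l by (simp add: \<epsilon>_def)
  have \<epsilon>l: "\<epsilon> * l * 8 = \<eta>" using l by (simp add: \<epsilon>_def)
  obtain C c where C: "C > 0" "c > 0" and ne: "\<And>v. 0 < v \<Longrightarrow> v < 1 \<Longrightarrow> eventually (\<lambda>n. \<forall>\<tau> m. \<alpha> \<le> \<tau> \<longrightarrow> \<tau> \<le> \<beta> \<longrightarrow>
     m \<le> Suc (nat \<lfloor>real n powr (1/4)\<rfloor>) \<longrightarrow>
     prob (near_event (a n \<tau>) (d n \<tau>) (v ^ 3) m) \<le> C * v ^ (2 * m) +
       (2 * exp (- c * (real n powr (1/4) - 1)) + 2 / (v powr (2 * real n powr (1/4) + 2) * c * exp (real n powr (3/10)))\<^sup>2)) sequentially"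
    using near_event_uniform by blast
  obtain s0 where s0: "s0 > 0" and sc: "\<And>s. 0 < s \<Longrightarrow> s < s0 \<Longrightarrow> eventually (\<lambda>n. \<forall>\<tau> s' R. \<alpha> \<le> \<tau> \<longrightarrow> \<tau> + s' / sqrt (real n) \<le> \<beta> \<longrightarrow>
     s / 2 \<le> s' \<longrightarrow> s' \<le> s \<longrightarrow> sgnrel R \<longrightarrow>
     \<bar>prob {\<omega> \<in> space M. R (rs (a n \<tau>) \<omega> * rs (a n (\<tau> + s' / sqrt (real n))) \<omega>)} - s' * D \<tau> / pi\<bar> \<le> \<epsilon> * s) sequentially"
    using sign_change_prob[OF \<epsilon>] by blast
  obtain h0 where h0: "h0 > 0" and Rie: "\<And>I::nat. I > 0 \<Longrightarrow> (\<beta> - \<alpha>) / real I \<le> h0 \<Longrightarrow>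
    \<bar>(\<Sum>i<I. (\<beta> - \<alpha>) / real I * D (\<alpha> + real i * ((\<beta> - \<alpha>) / real I))) - (\<Phi> \<beta> - \<Phi> \<alpha>)\<bar> \<le> \<epsilon> * (\<beta> - \<alpha>)"
    using Riemann_sum_bound[OF ab der D_continuous \<epsilon>] by blast
  \<comment> \<open>The last entry gives \<open>3 * C * v ^ 4 \<le> \<epsilon> * s\<close> for
    \<open>s = v ^ 3\<close>, so two or more zeros in a cell are negligible; \<open>1/2\<close>
    serves the geometric series in \<open>v\<^sup>2\<close>.\<close>
  define v where "v = Min {1/2, s0 / 2, \<epsilon> / (4 * C)}"
  have v: "v > 0" "v \<le> 1/2" "v \<le> s0 / 2" "v \<le> \<epsilon> / (4 * C)" using s0 \<epsilon> C(1) by (auto simp: v_def)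
  have v1: "v < 1" using v by simp
  have "v * v \<le> 1/2 * 1" using v by (intro mult_mono) auto
  then have v2: "v\<^sup>2 \<le> 1/2" by (simp add: power2_eq_square)
  have Cv: "C * v * 4 \<le> \<epsilon>" using v(4) C(1) by (simp add: pos_le_divide_eq mult_ac)
  define q where "q = - ln v"
  have q: "q > 0" using v by (simp add: q_def)
  define s where "s = v ^ 3"
  have s: "0 < s" "s \<le> v" "s < s0" "s < 1"
  proof -
    show "0 < s" using v by (simp add: s_def)
    show sv: "s \<le> v" unfolding s_def using v power_decreasing[of 1 3 v] by simp
    show "s < s0" "s < 1" using sv v s0 by auto
  qed
  define \<delta> where "\<delta> n = 2 * exp (- c * (real n powr (1/4) - 1)) + 2 / (exp (- q * (2 * real n powr (1/4) + 2)) * c * exp (real n powr (3/10)))\<^sup>2" for n :: nat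
  define p where "p n = C * exp (- q * (2 * real n powr (1/4))) + \<delta> n" for n :: nat
  define J where "J n = nat \<lfloor>real n powr (1/4)\<rfloor>" for n :: nat
  have \<delta>0: "\<delta> n \<ge> 0" for n by (simp add: \<delta>_def)
  have vpow: "v powr x = exp (- q * x)" for x using v by (simp add: powr_def q_def)
  \<comment> \<open>Rounding the number of cells up shortens the step from \<open>s\<close> to
    \<open>s'\<close>. Once \<open>l * sqrt n / s \<ge> 1\<close>, rounding at most doubles the
    number, so \<open>s' \<ge> s / 2\<close>.\<close>
  define I where "I n = nat \<lceil>l * sqrt (real n) / s\<rceil>" for n :: nat
  define h where "h n = l / real (I n)" for n
  have err: "eventually (\<lambda>n. (real n powr (1/4) + 2) * \<delta> n + K * (real n * p n + sqrt (p n) + exp (- real n)) < \<epsilon> * s) sequentially"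
    using order_tendstoD(2)[OF near_event_error_tendsto_0[OF C K q], of "\<epsilon> * s"] \<epsilon> s unfolding p_def \<delta>_def by simp
  have ev1: "eventually (\<lambda>n. l * sqrt (real n) / s \<ge> 1) sequentially" using l s by real_asymp
  have ev2: "eventually (\<lambda>n. s / sqrt (real n) \<le> h0) sequentially" using h0 s by real_asymp
  have ev3: "eventually (\<lambda>n. real n powr (1/4) \<ge> 2) sequentially" by real_asymp
  show "eventually (\<lambda>n. ennreal ((\<Phi> \<beta> - \<Phi> \<alpha>) / pi - \<eta>) \<le> (\<integral>\<^sup>+\<omega>. N n \<omega> \<partial>M) / ennreal (sqrt (real n)) \<and>
     (\<integral>\<^sup>+\<omega>. N n \<omega> \<partial>M) / ennreal (sqrt (real n)) \<le> ennreal ((\<Phi> \<beta> - \<Phi> \<alpha>) / pi + \<eta>)) sequentially"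
    using eventually_gt_at_top[of 0] err ev1 ev2 ev3 ne[OF v(1) v1] sc[OF s(1,3)] NB tail eventually_good eventually_local_good
  proof eventually_elim
    case (elim n)
    note el = elim
    define x where "x = sqrt (real n)"
    have x: "x > 0" using el(1) by (simp add: x_def)
    have "real (I n) \<ge> l * x / s" "real (I n) \<le> l * x / s + 1"
    proof -
      have "l * x / s \<ge> 0" using l x s by simp
      then have "real (I n) = of_int \<lceil>l * x / s\<rceil>" unfolding I_def x_def by (intro of_nat_nat) simp
      then show "real (I n) \<ge> l * x / s" "real (I n) \<le> l * x / s + 1" by linarith+
    qed
    then have I2: "l * x \<le> real (I n) * s" "real (I n) * s \<le> 2 * l * x"
      using el(3) s unfolding x_def[symmetric] by (auto simp: field_simps)
    have I0: "I n > 0" using I2(1) mult_pos_pos[OF l x] by (cases "I n") auto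
    have h_pos: "h n > 0" using l I0 by (simp add: h_def)
    have Ih: "real (I n) * h n = l" using I0 by (simp add: h_def)
    define s' where "s' = h n * x"
    have s'x: "s' / x = h n" using x by (simp add: s'_def)
    have Is': "real (I n) * s' = l * x" using Ih by (simp add: s'_def flip: mult.assoc)
    have s's: "s' \<le> s" using I2(1) I0 unfolding Is'[symmetric] by simp
    have s'2: "s / 2 \<le> s'"
    proof -
      have "real (I n) * (s / 2) \<le> real (I n) * s'" using I2(2) unfolding Is' by simp
      then show ?thesis using I0 by simp
    qed
    have s'0: "0 < s'" using s'2 s by simp
    have hh0: "h n \<le> h0"
    proof -
      have "h n \<le> s / x" using s's x by (simp add: s'_def pos_le_divide_eq)
      then show ?thesis using el(4) by (simp add: x_def)
    qed
    define t where "t i = \<alpha> + real i * h n" for i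
    have t_r: "\<alpha> \<le> t i" "t i + h n \<le> \<beta>" "t i \<le> \<beta>" if "i < I n" for i
    proof -
      have "real (Suc i) * h n \<le> real (I n) * h n" using that h_pos by (intro mult_right_mono) auto
      then show "t i + h n \<le> \<beta>" unfolding Ih by (simp add: t_def l_def algebra_simps)
      then show "t i \<le> \<beta>" using h_pos by simp
      show "\<alpha> \<le> t i" using h_pos by (simp add: t_def)
    qed
    have tI: "\<alpha> + real (I n) * h n = \<beta>" using Ih by (simp add: l_def)
    define E where "E i m = near_event (a n (t i)) (d n (t i)) s m" for i m
    define Ale where "Ale i = {\<omega> \<in> space M. rs (a n (t i)) \<omega> * rs (a n (t i + s' / sqrt (real n))) \<omega> \<le> 0}" for i
    define Alt where "Alt i = {\<omega> \<in> space M. rs (a n (t i)) \<omega> * rs (a n (t i + s' / sqrt (real n))) \<omega> < 0}" for i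
    have [measurable]: "Ale i \<in> sets M" "Alt i \<in> sets M" "E i m \<in> sets M" for i m
      unfolding Ale_def Alt_def E_def by measurable
    have tn: "t i + s' / sqrt (real n) = t i + h n" for i using s'x by (simp add: x_def)
    have P_le: "prob (Ale i) \<le> s' * D (t i) / pi + \<epsilon> * s" and P_lt: "prob (Alt i) \<ge> s' * D (t i) / pi - \<epsilon> * s"
      if i: "i < I n" for i
    proof -
      have r: "\<alpha> \<le> t i" "t i + s' / sqrt (real n) \<le> \<beta>" unfolding tn using t_r[OF i] by auto
      have R1: "sgnrel (\<lambda>x. x \<le> 0)" and R2: "sgnrel (\<lambda>x. x < 0)" by (auto simp: sgnrel_def)
      have "\<bar>prob (Ale i) - s' * D (t i) / pi\<bar> \<le> \<epsilon> * s"
        using el(7) r s'2 s's R1 unfolding Ale_def by blast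
      moreover have "\<bar>prob (Alt i) - s' * D (t i) / pi\<bar> \<le> \<epsilon> * s"
        using el(7) r s'2 s's R2 unfolding Alt_def by blast
      ultimately show "prob (Ale i) \<le> s' * D (t i) / pi + \<epsilon> * s" "prob (Alt i) \<ge> s' * D (t i) / pi - \<epsilon> * s" by linarith+
    qed
    have P_E: "prob (E i m) \<le> C * v ^ (2 * m) + \<delta> n" if "i < I n" "m \<le> Suc (J n)" for i m
      using el(6) t_r[OF that(1)] that(2) unfolding E_def J_def s_def \<delta>_def vpow by blast
    have J: "real (J n) \<le> real n powr (1/4)" "real n powr (1/4) \<le> real (Suc (J n))" unfolding J_def
      using nat_floor_bounds[of "real n powr (1/4)"] by (simp_all, linarith)
    have J2: "J n \<ge> 2" using el(5) unfolding J_def by (simp add: le_nat_floor)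
    have AE1: "AE \<omega> in M. \<forall>i\<in>{..<I n}. local_good n (t i) \<omega>"
      using t_r el(11) by (intro AE_finite_allI) auto
    have sum_D: "\<bar>(\<Sum>i<I n. s' * D (t i) / pi) - x * ((\<Phi> \<beta> - \<Phi> \<alpha>) / pi)\<bar> \<le> x * (\<epsilon> * l)"
    proof -
      have "(\<Sum>i<I n. s' * D (t i) / pi) - x * ((\<Phi> \<beta> - \<Phi> \<alpha>) / pi) = x / pi * ((\<Sum>i<I n. h n * D (t i)) - (\<Phi> \<beta> - \<Phi> \<alpha>))"
        unfolding s'_def by (simp add: algebra_simps sum_distrib_left diff_divide_distrib)
      then have "\<bar>(\<Sum>i<I n. s' * D (t i) / pi) - x * ((\<Phi> \<beta> - \<Phi> \<alpha>) / pi)\<bar> = x / pi * \<bar>(\<Sum>i<I n. h n * D (t i)) - (\<Phi> \<beta> - \<Phi> \<alpha>)\<bar>"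
        using x by (simp add: abs_mult)
      also have "\<dots> \<le> x / pi * (\<epsilon> * l)"
        using Rie[OF I0] hh0 x unfolding h_def t_def l_def by (intro mult_left_mono) auto
      also have "\<dots> \<le> x * (\<epsilon> * l)"
      proof (rule mult_right_mono)
        show "x / pi \<le> x" using x pi_gt3 by (simp add: divide_le_eq)
      qed (use \<epsilon> l in simp)
      finally show ?thesis .
    qed
    have Is\<epsilon>: "real (I n) * (\<epsilon> * s) \<le> x * (2 * \<epsilon> * l)"
      using mult_left_mono[OF I2(2), of \<epsilon>] \<epsilon> by (simp add: mult_ac)
    have up: "(\<integral>\<^sup>+\<omega>. N n \<omega> \<partial>M) \<le> ennreal (x * ((\<Phi> \<beta> - \<Phi> \<alpha>) / pi + \<eta>))"
    proof -
      define G where "G i \<omega> = indicator (Ale i) \<omega> + 2 * indicator (E i 2) \<omega> + (\<Sum>m\<in>{3..J n}. indicator (E i m) \<omega>) + B n \<omega> * indicator (E i (Suc (J n))) \<omega>" for i \<omega>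
      have [measurable]: "G i \<in> borel_measurable M" for i unfolding G_def by measurable
      have "AE \<omega> in M. N n \<omega> \<le> (\<Sum>i<I n. G i \<omega>)"
        using AE1 el(8,10) AE_space
      proof eventually_elim
        case (elim \<omega>)
        show ?case
        proof (cases "N n \<omega> = 0")
          case False
          then have Neq: "N n \<omega> = emeasure (count_space UNIV) {\<tau> \<in> {\<alpha>..\<beta>}. Fz n \<omega> \<tau> = 0}" and NBn: "N n \<omega> \<le> B n \<omega>"
            using elim by auto
          have "N n \<omega> \<le> (\<Sum>i<I n. emeasure (count_space UNIV) {\<tau> \<in> {t i..t i + h n}. Fz n \<omega> \<tau> = 0})"
            unfolding Neq using count_grid_le[of "h n" "I n" \<alpha> "\<lambda>\<tau>. Fz n \<omega> \<tau> = 0"] h_pos I0 unfolding t_def tI by simp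
          also have "\<dots> \<le> (\<Sum>i<I n. G i \<omega>)"
          proof (rule sum_mono)
            fix i assume i: "i \<in> {..<I n}"
            have i': "i < I n" using i by simp
            have lg: "local_good n (t i) \<omega>" using elim i by blast
            have "emeasure (count_space UNIV) {\<tau> \<in> {t i..t i + s' / sqrt (real n)}. Fz n \<omega> \<tau> = 0} \<le> N n \<omega>"
              unfolding tn Neq using t_r[OF i'] by (intro emeasure_mono) auto
            then have le: "emeasure (count_space UNIV) {\<tau> \<in> {t i..t i + s' / sqrt (real n)}. Fz n \<omega> \<tau> = 0} \<le> B n \<omega>" using NBn by simp
            have "t i + s' / sqrt (real n) \<le> \<beta>" unfolding tn using t_r[OF i'] by simp
            from interval_count[OF _ lg _ el(1) t_r(3)[OF i'] this s'0 s's s(4) J2 le] elim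
            show "emeasure (count_space UNIV) {\<tau> \<in> {t i..t i + h n}. Fz n \<omega> \<tau> = 0} \<le> G i \<omega>"
              unfolding G_def Ale_def E_def tn by simp
          qed
          finally show ?thesis .
        qed simp
      qed
      then have "(\<integral>\<^sup>+\<omega>. N n \<omega> \<partial>M) \<le> (\<integral>\<^sup>+\<omega>. (\<Sum>i<I n. G i \<omega>) \<partial>M)" by (rule nn_integral_mono_AE)
      also have "\<dots> = (\<Sum>i<I n. \<integral>\<^sup>+\<omega>. G i \<omega> \<partial>M)" by (rule nn_integral_sum) simp
      also have "\<dots> \<le> (\<Sum>i<I n. ennreal (s' * D (t i) / pi + 3 * (\<epsilon> * s)))"
      proof (rule sum_mono)
        fix i assume "i \<in> {..<I n}"
        then have i: "i < I n" by simp
        have eq: "(\<integral>\<^sup>+\<omega>. G i \<omega> \<partial>M) = ennreal (prob (Ale i) + 2 * prob (E i 2) + (\<Sum>m\<in>{3..J n}. prob (E i m))) + (\<integral>\<^sup>+\<omega>. B n \<omega> * indicator (E i (Suc (J n))) \<omega> \<partial>M)"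
          unfolding G_def by (rule count_integral_bound) auto
        have pE: "prob (E i (Suc (J n))) \<le> p n"
        proof -
          have "v ^ (2 * Suc (J n)) = v powr real (2 * Suc (J n))" using v(1) by (simp only: powr_realpow)
          also have "\<dots> = exp (- q * real (2 * Suc (J n)))" by (rule vpow)
          also have "\<dots> \<le> exp (- q * (2 * real n powr (1/4)))" using J(2) q by simp
          finally have "C * v ^ (2 * Suc (J n)) \<le> C * exp (- q * (2 * real n powr (1/4)))" using C(1) by simp
          then show ?thesis using P_E[OF i order_refl] unfolding p_def by linarith
        qed
        have "(\<integral>\<^sup>+\<omega>. B n \<omega> * indicator (E i (Suc (J n))) \<omega> \<partial>M) \<le> ennreal (K * (real n * prob (E i (Suc (J n))) + sqrt (prob (E i (Suc (J n)))) + exp (- real n)))"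
          using el(9) by simp
        also have "\<dots> \<le> ennreal (K * (real n * p n + sqrt (p n) + exp (- real n)))"
          using pE K by (intro ennreal_leI mult_left_mono add_mono) auto
        finally have b1: "(\<integral>\<^sup>+\<omega>. B n \<omega> * indicator (E i (Suc (J n))) \<omega> \<partial>M) \<le> ennreal (K * (real n * p n + sqrt (p n) + exp (- real n)))" .
        have p0: "p n \<ge> 0" using C(1) \<delta>0[of n] by (simp add: p_def)
        have "(\<Sum>m\<in>{3..J n}. prob (E i m)) \<le> (\<Sum>m\<in>{3..J n}. C * v ^ (2 * m) + \<delta> n)" using P_E[OF i] by (intro sum_mono) auto
        also have "\<dots> = C * (\<Sum>m\<in>{3..J n}. (v\<^sup>2) ^ m) + real (J n + 1 - 3) * \<delta> n"
          by (simp add: sum.distrib sum_distrib_left power_mult)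
        also have "\<dots> \<le> C * (v\<^sup>2)\<^sup>2 + real (J n) * \<delta> n"
          using geometric_tail[OF _ v2, of "J n"] C(1) \<delta>0[of n] by (intro add_mono mult_left_mono mult_right_mono) auto
        finally have b2: "(\<Sum>m\<in>{3..J n}. prob (E i m)) \<le> C * (v\<^sup>2)\<^sup>2 + real (J n) * \<delta> n" .
        have b3: "prob (E i 2) \<le> C * (v\<^sup>2)\<^sup>2 + \<delta> n" using P_E[OF i, of 2] J2 by (simp flip: power_mult)
        have "real (J n) * \<delta> n \<le> real n powr (1/4) * \<delta> n" using J(1) \<delta>0[of n] by (intro mult_right_mono) auto
        then have b4: "real (J n) * \<delta> n + 2 * \<delta> n + K * (real n * p n + sqrt (p n) + exp (- real n)) \<le> \<epsilon> * s"
          using el(2) by (simp add: algebra_simps)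
        have b5: "3 * (C * (v\<^sup>2)\<^sup>2) \<le> \<epsilon> * s"
        proof -
          have "3 * (C * (v\<^sup>2)\<^sup>2) = 3 * (C * v) * s" by (simp add: s_def power2_eq_square power3_eq_cube)
          also have "\<dots> \<le> \<epsilon> * s" using Cv s C(1) v(1) by (intro mult_right_mono) (auto simp: zero_le_mult_iff intro: order_trans[rotated])
          finally show ?thesis .
        qed
        have "(\<integral>\<^sup>+\<omega>. G i \<omega> \<partial>M) \<le> ennreal (prob (Ale i) + 2 * prob (E i 2) + (\<Sum>m\<in>{3..J n}. prob (E i m))) + ennreal (K * (real n * p n + sqrt (p n) + exp (- real n)))"
          unfolding eq using b1 by (intro add_left_mono)
        also have "\<dots> = ennreal (prob (Ale i) + 2 * prob (E i 2) + (\<Sum>m\<in>{3..J n}. prob (E i m)) + K * (real n * p n + sqrt (p n) + exp (- real n)))"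
          using K p0 by (intro ennreal_plus[symmetric]) (auto intro!: add_nonneg_nonneg sum_nonneg mult_nonneg_nonneg)
        also have "\<dots> \<le> ennreal (s' * D (t i) / pi + 3 * (\<epsilon> * s))"
          using b2 b3 b4 b5 P_le[OF i] by (intro ennreal_leI) linarith
        finally show "(\<integral>\<^sup>+\<omega>. G i \<omega> \<partial>M) \<le> ennreal (s' * D (t i) / pi + 3 * (\<epsilon> * s))" .
      qed
      also have "\<dots> = ennreal (\<Sum>i<I n. s' * D (t i) / pi + 3 * (\<epsilon> * s))"
      proof (rule sum_ennreal)
        fix i assume "i \<in> {..<I n}"
        then show "0 \<le> s' * D (t i) / pi + 3 * (\<epsilon> * s)" using D_pos[OF t_r(3), of i] s'0 \<epsilon> s by simp
      qed
      also have "\<dots> \<le> ennreal (x * ((\<Phi> \<beta> - \<Phi> \<alpha>) / pi + \<eta>))"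
      proof (rule ennreal_leI)
        have "(\<Sum>i<I n. s' * D (t i) / pi + 3 * (\<epsilon> * s)) = (\<Sum>i<I n. s' * D (t i) / pi) + 3 * (real (I n) * (\<epsilon> * s))"
          by (simp add: sum.distrib)
        also have "\<dots> \<le> x * ((\<Phi> \<beta> - \<Phi> \<alpha>) / pi) + x * (\<epsilon> * l) + 3 * (x * (2 * \<epsilon> * l))" using sum_D Is\<epsilon> by linarith
        also have "\<dots> = x * ((\<Phi> \<beta> - \<Phi> \<alpha>) / pi + 7 * (\<epsilon> * l))" by (simp add: algebra_simps)
        also have "\<dots> \<le> x * ((\<Phi> \<beta> - \<Phi> \<alpha>) / pi + \<eta>)"
          using x \<epsilon>l \<eta> by (intro mult_left_mono add_left_mono) auto
        finally show "(\<Sum>i<I n. s' * D (t i) / pi + 3 * (\<epsilon> * s)) \<le> x * ((\<Phi> \<beta> - \<Phi> \<alpha>) / pi + \<eta>)" .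
      qed
      finally show ?thesis .
    qed
    have lo: "ennreal (x * ((\<Phi> \<beta> - \<Phi> \<alpha>) / pi - \<eta>)) \<le> (\<integral>\<^sup>+\<omega>. N n \<omega> \<partial>M)"
    proof -
      have "x * ((\<Phi> \<beta> - \<Phi> \<alpha>) / pi - \<eta>) \<le> (\<Sum>i<I n. prob (Alt i))"
      proof -
        have "x * ((\<Phi> \<beta> - \<Phi> \<alpha>) / pi - \<eta>) \<le> x * ((\<Phi> \<beta> - \<Phi> \<alpha>) / pi - 3 * (\<epsilon> * l))"
          using x \<epsilon>l \<eta> by (intro mult_left_mono diff_left_mono) auto
        also have "\<dots> = x * ((\<Phi> \<beta> - \<Phi> \<alpha>) / pi) - x * (\<epsilon> * l) - x * (2 * \<epsilon> * l)" by (simp add: algebra_simps)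
        also have "\<dots> \<le> (\<Sum>i<I n. s' * D (t i) / pi) - real (I n) * (\<epsilon> * s)" using sum_D Is\<epsilon> by linarith
        also have "\<dots> = (\<Sum>i<I n. s' * D (t i) / pi - \<epsilon> * s)" by (simp add: sum_subtractf)
        also have "\<dots> \<le> (\<Sum>i<I n. prob (Alt i))" using P_lt by (intro sum_mono) auto
        finally show ?thesis .
      qed
      then have "ennreal (x * ((\<Phi> \<beta> - \<Phi> \<alpha>) / pi - \<eta>)) \<le> ennreal (\<Sum>i<I n. prob (Alt i))" by (rule ennreal_leI)
      also have "\<dots> = (\<Sum>i<I n. emeasure M (Alt i))" by (simp add: emeasure_eq_measure sum_ennreal)
      also have "\<dots> = (\<integral>\<^sup>+\<omega>. (\<Sum>i<I n. indicator (Alt i) \<omega>) \<partial>M)" by (simp add: nn_integral_sum)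
      also have "\<dots> \<le> (\<integral>\<^sup>+\<omega>. N n \<omega> \<partial>M)"
      proof (rule nn_integral_mono_AE)
        show "AE \<omega> in M. (\<Sum>i<I n. indicator (Alt i) \<omega>) \<le> N n \<omega>"
          using AE1 el(8,10) AE_space
        proof eventually_elim
          case (elim \<omega>)
          have ex: "\<exists>\<tau>. t i < \<tau> \<and> \<tau> < t i + h n \<and> Fz n \<omega> \<tau> = 0" if i: "i < I n" "\<omega> \<in> Alt i" for i
          proof -
            have lg: "local_good n (t i) \<omega>" using elim i by blast
            have r: "t i + s' / sqrt (real n) \<le> \<beta>" unfolding tn using t_r[OF i(1)] by simp
            have neg: "rs (a n (t i)) \<omega> * rs (a n (t i + s' / sqrt (real n))) \<omega> < 0" using i(2) by (simp add: Alt_def)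
            have "s' < 1" using s's s(4) by simp
            from sign_change_zero[OF _ lg el(1) t_r(3)[OF i(1)] r s'0 this neg] elim show ?thesis unfolding tn by blast
          qed
          have sumeq: "(\<Sum>i<I n. indicator (Alt i) \<omega>) = (\<Sum>i<I n. if \<omega> \<in> Alt i then 1 else (0::ennreal))"
            by (intro sum.cong) auto
          from elim(2) have "N n \<omega> = emeasure (count_space UNIV) {\<tau> \<in> {\<alpha>..\<beta>}. Fz n \<omega> \<tau> = 0} \<or> (\<forall>\<tau>\<in>{\<alpha>..\<beta>}. Fz n \<omega> \<tau> = 0)" by blast
          then show ?case
          proof
            assume Neq: "N n \<omega> = emeasure (count_space UNIV) {\<tau> \<in> {\<alpha>..\<beta>}. Fz n \<omega> \<tau> = 0}"
            have "(\<Sum>i<I n. if \<omega> \<in> Alt i then 1 else 0) \<le> emeasure (count_space UNIV) {\<tau> \<in> {\<alpha><..<\<beta>}. Fz n \<omega> \<tau> = 0}"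
              using count_grid_ge[of "h n" "I n" "\<lambda>i. \<omega> \<in> Alt i" \<alpha> "\<lambda>\<tau>. Fz n \<omega> \<tau> = 0"] h_pos ex unfolding t_def tI by auto
            also have "\<dots> \<le> N n \<omega>" unfolding Neq by (intro emeasure_mono) auto
            finally show ?thesis unfolding sumeq .
          next
            assume z: "\<forall>\<tau>\<in>{\<alpha>..\<beta>}. Fz n \<omega> \<tau> = 0"
            have "\<omega> \<notin> Alt i" if i: "i < I n" for i
            proof -
              have g: "good n \<omega>" using elim by simp
              obtain c where "rs (a n (t i)) \<omega> = c * Fz n \<omega> (t i)" using rs_a_pos[OF g t_r(3)[OF i]] by blast
              then have "rs (a n (t i)) \<omega> = 0" using z t_r[OF i] by simp
              then show ?thesis by (simp add: Alt_def)
            qed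
            then show ?thesis unfolding sumeq by simp
          qed
        qed
      qed
      finally show ?thesis .
    qed
    have div: "ennreal (x * u) / ennreal x = ennreal u" for u
    proof (cases "u \<ge> 0")
      case True
      then show ?thesis using x by (simp add: divide_ennreal)
    next
      case False
      then show ?thesis using x by (simp add: ennreal_neg mult_nonneg_nonpos)
    qed
    from divide_right_mono_ennreal[OF lo, of "ennreal x"] divide_right_mono_ennreal[OF up, of "ennreal x"]
    show ?case unfolding div by (simp add: x_def)
  qed
qed

end

section \<open>Tails of the number of zeros\<close>

text \<open>The squared modulus of the factor differs from 1 by \<open>(1 - t\<^sup>2) * (1 - (norm
  z)\<^sup>2) / (norm (1 - t * z))\<^sup>2\<close>. On the circle of radius \<open>1/2\<close> the
  second factor is \<open>3/4\<close> and the denominator at most \<open>9/4\<close>, whence the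
  \<open>1/3\<close>.\<close>

lemma Moebius_real_half_bound:
  assumes t: "\<bar>t\<bar> \<le> a0" "a0 < 1" and z: "norm z = 1/2"
  shows "norm (Moebius_function 0 (of_real t) z) \<le> sqrt (1 - (1 - a0\<^sup>2) / 3)"
proof -
  have a0: "t\<^sup>2 \<le> a0\<^sup>2" using t by (simp add: abs_le_square_iff[symmetric])
  have "a0\<^sup>2 < 1" using t by (simp add: abs_square_less_1)
  have zz: "(Re z)\<^sup>2 + (Im z)\<^sup>2 = 1/4" unfolding cmod_power2[symmetric] z by (simp add: power2_eq_square)
  define P where "P = (norm (z - of_real t))\<^sup>2"
  define Q where "Q = (norm (1 - of_real t * z))\<^sup>2"
  have P: "P = 1/4 - 2 * (t * Re z) + t\<^sup>2" using zz by (simp add: P_def cmod_power2 power2_diff algebra_simps)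
  have "(1 - t * Re z)\<^sup>2 + (t * Im z)\<^sup>2 = 1 - 2 * (t * Re z) + t\<^sup>2 * ((Re z)\<^sup>2 + (Im z)\<^sup>2)"
    by (simp add: power2_eq_square algebra_simps)
  then have Q: "Q = 1 - 2 * (t * Re z) + t\<^sup>2 / 4" unfolding zz by (simp add: Q_def cmod_power2)
  have "norm (1 - of_real t * z) \<le> norm (1::complex) + norm (of_real t * z)" by (rule norm_triangle_ineq4)
  also have "\<dots> \<le> 3/2" using t by (simp add: norm_mult z)
  finally have "Q \<le> (3/2)\<^sup>2" unfolding Q_def by (intro power_mono) auto
  then have Q94: "Q \<le> 9/4" by (simp add: power2_eq_square)
  have "norm (of_real t * z) < 1" using t by (simp add: norm_mult z)
  then have "1 - of_real t * z \<noteq> 0" by auto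
  then have Q0: "Q > 0" by (simp add: Q_def)
  have "Q * (1 - a0\<^sup>2) \<le> 9/4 * (1 - a0\<^sup>2)" using Q94 \<open>a0\<^sup>2 < 1\<close> by (intro mult_right_mono) auto
  moreover have "P \<le> Q - X / 3" if "X \<le> 9/4 * (1 - a0\<^sup>2)" for X
  proof -
    have "P \<le> Q - X / 3" if "X \<le> 9/4 * (1 - b)" "P = 1/4 - 2 * u + y" "Q = 1 - 2 * u + y / 4" "y \<le> b" for b u y
      using that by simp
    from this[OF \<open>X \<le> _\<close> P Q a0] show ?thesis .
  qed
  ultimately have "P \<le> Q - Q * (1 - a0\<^sup>2) / 3" by blast
  then have "P \<le> Q * (1 - (1 - a0\<^sup>2) / 3)" by (simp add: right_diff_distrib)
  then have "P / Q \<le> 1 - (1 - a0\<^sup>2) / 3" using Q0 by (simp add: divide_le_eq mult.commute)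
  moreover have "norm (Moebius_function 0 (of_real t) z) = sqrt (P / Q)"
    by (simp add: Moebius_function_def norm_divide P_def Q_def real_sqrt_divide)
  ultimately show ?thesis by simp
qed

text \<open>Blaschke factors bound \<open>G\<close> on the circle of radius \<open>1/2\<close>, and
  Cauchy's estimate transfers this to the \<open>k\<close>-th coefficient. An arbitrary
  \<open>k\<close> matters since the constant term may vanish with positive probability.\<close>

lemma (in real_power_series) coeff_bound:
  assumes T: "finite T" "\<And>t. t \<in> T \<Longrightarrow> \<bar>t\<bar> \<le> a0" "\<And>t. t \<in> T \<Longrightarrow> g t = 0" and a0: "a0 < 1"
  shows "\<bar>c k\<bar> \<le> 2 ^ k * ((\<Sum>i. \<bar>c i\<bar>) * sqrt (1 - (1 - a0\<^sup>2) / 3) ^ card T)"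
proof -
  define q where "q = sqrt (1 - (1 - a0\<^sup>2) / 3)"
  have s0: "(\<Sum>i. \<bar>c i\<bar>) \<ge> 0" by (intro suminf_nonneg c) auto
  have bd: "norm (G z) \<le> (\<Sum>i. \<bar>c i\<bar>) * q ^ card T" if z: "norm z = 1/2" for z
  proof -
    have "norm (G z) \<le> (\<Sum>i. \<bar>c i\<bar>) * (\<Prod>t\<in>complex_of_real ` T. norm (Moebius_function 0 t z))"
    proof (rule Moebius_zeros_bound)
      show "complex_of_real ` T \<subseteq> ball 0 1" using T(2) a0 by force
      show "norm (G z) \<le> (\<Sum>i. \<bar>c i\<bar>)" if "norm z < 1" for z using G_bound that by simp
      show "G t = 0" if tT: "t \<in> complex_of_real ` T" for t
      proof -
        obtain x where x: "x \<in> T" "t = of_real x" using tT by blast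
        have "\<bar>x\<bar> \<le> 1" using T(2)[OF x(1)] a0 by simp
        then show ?thesis using T(3)[OF x(1)] by (simp add: x(2) G_of_real)
      qed
    qed (use T(1) z G_holomorphic in auto)
    also have "(\<Prod>t\<in>complex_of_real ` T. norm (Moebius_function 0 t z)) = (\<Prod>t\<in>T. norm (Moebius_function 0 (of_real t) z))"
      by (subst prod.reindex) (auto simp: inj_on_def)
    also have "\<dots> \<le> (\<Prod>t\<in>T. q)"
      using Moebius_real_half_bound[OF T(2) a0 z] by (intro prod_mono) (auto simp: q_def)
    finally show ?thesis using s0 by (simp add: mult_left_mono)
  qed
  define F where "F = Abs_fps (\<lambda>i. complex_of_real (c i))"
  have GF: "eval_fps F = G" by (auto simp: eval_fps_def F_def G_def)
  have "ereal (norm (1::complex)) \<le> fps_conv_radius F"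
    unfolding fps_conv_radius_def
    by (rule conv_radius_geI) (use summable_norm_cancel[OF G_summable[of 1]] in \<open>simp add: F_def\<close>)
  then have "fps_conv_radius F > 0" by (auto intro: less_le_trans[rotated])
  from fps_nth_conv_deriv[OF this, of k] have cd: "of_real (c k) = (deriv ^^ k) G 0 / fact k" unfolding GF by (simp add: F_def)
  have "norm ((deriv ^^ k) G 0) \<le> fact k * ((\<Sum>i. \<bar>c i\<bar>) * q ^ card T) / (1/2) ^ k"
  proof (rule Cauchy_inequality)
    show "G holomorphic_on ball 0 (1/2)" by (rule holomorphic_on_subset[OF G_holomorphic]) auto
    show "continuous_on (cball 0 (1/2)) G"
      by (rule holomorphic_on_imp_continuous_on, rule holomorphic_on_subset[OF G_holomorphic]) auto
  qed (use bd in auto)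
  moreover have "\<bar>c k\<bar> = norm ((deriv ^^ k) G 0) / fact k"
    using arg_cong[OF cd, of norm] by (simp add: norm_divide)
  moreover have "fact k * ((\<Sum>i. \<bar>c i\<bar>) * q ^ card T) / (1/2) ^ k = fact k * (2 ^ k * ((\<Sum>i. \<bar>c i\<bar>) * q ^ card T))"
    by (simp add: power_divide)
  ultimately have "\<bar>c k\<bar> \<le> fact k * (2 ^ k * ((\<Sum>i. \<bar>c i\<bar>) * q ^ card T)) / fact k"
    by (metis divide_right_mono fact_ge_zero)
  then show ?thesis by (simp add: q_def)
qed

lemma count_space_le_finite_subsets:
  assumes "\<And>T. finite T \<Longrightarrow> T \<subseteq> Z \<Longrightarrow> of_nat (card T) \<le> (B::ennreal)"
  shows "emeasure (count_space UNIV) Z \<le> B"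
proof (cases "finite Z")
  case True
  then show ?thesis using assms[of Z] by (simp add: emeasure_count_space)
next
  case False
  have "of_nat m \<le> B" for m
  proof -
    obtain T where "finite T" "T \<subseteq> Z" "card T = m" using infinite_arbitrarily_large[OF False] by blast
    then show ?thesis using assms[of T] by simp
  qed
  then have "B = \<top>" using ennreal_Ex_less_of_nat[of B] by (metis leD less_top)
  then show ?thesis by simp
qed

lemma summable_sq_geometric:
  assumes "0 \<le> r" "r < (1::real)"
  shows "summable (\<lambda>k. (real k + 1)\<^sup>2 * r ^ k)"
proof -
  \<comment> \<open>The maximum with \<open>1/2\<close> keeps \<open>t\<close> positive when
    \<open>r = 0\<close>, where \<open>ln\<close> takes a default value.\<close>
  define t where "t = - ln (max r (1/2)) / 2"
  have t: "t > 0" using assms by (simp add: t_def)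
  have et: "r \<le> exp (- (2 * t))" by (simp add: t_def)
  show ?thesis
  proof (rule summable_comparison_test')
    show "summable (\<lambda>k. 2 / t\<^sup>2 * exp t * exp (- t) ^ k)" using t by (intro summable_mult summable_geometric) auto
    fix k
    have "1 + t * (real k + 1) + (t * (real k + 1))\<^sup>2 / 2 \<le> exp (t * (real k + 1))"
      using t by (intro exp_lower_Taylor_quadratic) auto
    then have "(t * (real k + 1))\<^sup>2 / 2 \<le> exp (t * (real k + 1))"
      using t by (smt (verit) mult_nonneg_nonneg of_nat_0_le_iff)
    then have "t\<^sup>2 * (real k + 1)\<^sup>2 \<le> 2 * exp (t * (real k + 1))" unfolding power_mult_distrib by simp
    then have "(real k + 1)\<^sup>2 \<le> 2 * exp (t * (real k + 1)) / t\<^sup>2" using t by (subst pos_le_divide_eq) (auto simp: mult.commute)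
    then have "(real k + 1)\<^sup>2 \<le> 2 / t\<^sup>2 * exp (t * (real k + 1))" by simp
    moreover have "r ^ k \<le> exp (- (2 * t)) ^ k" using et assms by (intro power_mono) auto
    ultimately have "(real k + 1)\<^sup>2 * r ^ k \<le> 2 / t\<^sup>2 * exp (t * (real k + 1)) * exp (- (2 * t)) ^ k"
      using assms by (intro mult_mono) auto
    also have "\<dots> = 2 / t\<^sup>2 * exp t * exp (- t) ^ k"
      by (simp add: exp_of_nat_mult[symmetric] algebra_simps flip: exp_add)
    finally show "norm ((real k + 1)\<^sup>2 * r ^ k) \<le> 2 / t\<^sup>2 * exp t * exp (- t) ^ k" using assms by (simp add: abs_mult)
  qed
qed

section \<open>The first variable of size at least one half\<close>

context iid_std
begin

lemma prob_xi_small_eq: "prob {\<omega>\<in>space M. \<bar>\<xi> j \<omega>\<bar> < 1/2} = prob {\<omega>\<in>space M. \<bar>\<xi> 0 \<omega>\<bar> < 1/2}"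
proof -
  have "prob {\<omega>\<in>space M. \<bar>\<xi> k \<omega>\<bar> < 1/2} = measure (distr M borel (\<xi> k)) {x. \<bar>x\<bar> < 1/2}" for k
    by (subst measure_distr) (auto intro!: arg_cong[of _ _ prob])
  then show ?thesis using distr_eq[of j] by simp
qed

text \<open>Otherwise the second moment would be at most \<open>1/4\<close>.\<close>

lemma prob_xi_small: "prob {\<omega>\<in>space M. \<bar>\<xi> 0 \<omega>\<bar> < 1/2} < 1"
proof (rule ccontr)
  assume "\<not> ?thesis"
  then have "prob {\<omega>\<in>space M. \<bar>\<xi> 0 \<omega>\<bar> < 1/2} = 1" using prob_le_1[of "{\<omega>\<in>space M. \<bar>\<xi> 0 \<omega>\<bar> < 1/2}"] by linarith
  then have "AE \<omega> in M. \<bar>\<xi> 0 \<omega>\<bar> < 1/2" by (subst (asm) prob_Collect_eq_1) auto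
  then have "AE \<omega> in M. (\<xi> 0 \<omega>)\<^sup>2 \<le> 1/4"
  proof eventually_elim
    case (elim \<omega>)
    have "\<bar>\<xi> 0 \<omega>\<bar>\<^sup>2 \<le> (1/2)\<^sup>2" using elim by (intro power_mono) auto
    then show ?case by (simp add: power2_eq_square)
  qed
  then have "expectation (\<lambda>\<omega>. (\<xi> 0 \<omega>)\<^sup>2) \<le> expectation (\<lambda>\<omega>. 1/4)" by (intro integral_mono_AE) auto
  then show False by (simp add: sq_mean prob_space)
qed

lemma prob_first_large:
  "prob {\<omega>\<in>space M. \<forall>j<k. \<bar>\<xi> j \<omega>\<bar> < 1/2} = prob {\<omega>\<in>space M. \<bar>\<xi> 0 \<omega>\<bar> < 1/2} ^ k"
proof (cases "k = 0")
  case True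
  then show ?thesis by (simp add: prob_space)
next
  case False
  have "prob (\<Inter>j\<in>{..<k}. \<xi> j -` {x. \<bar>x\<bar> < 1/2} \<inter> space M) = (\<Prod>j\<in>{..<k}. prob (\<xi> j -` {x. \<bar>x\<bar> < 1/2} \<inter> space M))"
    using False by (intro indep_varsD[OF indep]) auto
  moreover have "(\<Inter>j\<in>{..<k}. \<xi> j -` {x. \<bar>x\<bar> < 1/2} \<inter> space M) = {\<omega>\<in>space M. \<forall>j<k. \<bar>\<xi> j \<omega>\<bar> < 1/2}"
    using False by auto
  moreover have "prob (\<xi> j -` {x. \<bar>x\<bar> < 1/2} \<inter> space M) = prob {\<omega>\<in>space M. \<bar>\<xi> 0 \<omega>\<bar> < 1/2}" for j
  proof -
    have "\<xi> j -` {x. \<bar>x\<bar> < 1/2} \<inter> space M = {\<omega>\<in>space M. \<bar>\<xi> j \<omega>\<bar> < 1/2}" by auto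
    then show ?thesis using prob_xi_small_eq[of j] by simp
  qed
  ultimately show ?thesis by simp
qed

text \<open>A measurable majorant of \<open>(k + 1)\<^sup>2\<close> for the first index \<open>k\<close> with \<open>\<bar>\<xi> k\<bar> \<ge> 1/2\<close>; it is infinite if
  there is no such index.\<close>

definition first_large :: "'w \<Rightarrow> ennreal" where
  "first_large \<omega> = (\<Sum>k. ennreal ((real k + 1)\<^sup>2) * indicator {\<omega>\<in>space M. \<forall>j<k. \<bar>\<xi> j \<omega>\<bar> < 1/2} \<omega>)"

lemma first_large_measurable [measurable]: "first_large \<in> borel_measurable M"
  unfolding first_large_def by measurable

text \<open>The events have geometrically decaying probability, and
  \<open>prob (A \<inter> E k) \<le> sqrt (prob A * prob (E k))\<close> splits the smallness between
  \<open>A\<close> and the series. This is the origin of \<open>sqrt (prob A)\<close> in the tail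
  bounds.\<close>

lemma first_large_integral:
  "\<exists>C\<ge>0. \<forall>A\<in>sets M. (\<integral>\<^sup>+\<omega>. first_large \<omega> * indicator A \<omega> \<partial>M) \<le> ennreal (C * sqrt (prob A))"
proof -
  define r where "r = sqrt (prob {\<omega>\<in>space M. \<bar>\<xi> 0 \<omega>\<bar> < 1/2})"
  have r: "0 \<le> r" "r < 1" using prob_xi_small by (auto simp: r_def)
  define E where "E k = {\<omega>\<in>space M. \<forall>j<k. \<bar>\<xi> j \<omega>\<bar> < 1/2}" for k :: nat
  have [measurable]: "E k \<in> sets M" for k unfolding E_def by measurable
  have sm: "summable (\<lambda>k. (real k + 1)\<^sup>2 * r ^ k)" by (rule summable_sq_geometric[OF r])
  show ?thesis
  proof (intro exI[of _ "\<Sum>k. (real k + 1)\<^sup>2 * r ^ k"] conjI ballI)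
    show "0 \<le> (\<Sum>k. (real k + 1)\<^sup>2 * r ^ k)" using r by (intro suminf_nonneg sm) auto
    fix A assume A[measurable]: "A \<in> sets M"
    have "(\<integral>\<^sup>+\<omega>. first_large \<omega> * indicator A \<omega> \<partial>M) = (\<integral>\<^sup>+\<omega>. (\<Sum>k. ennreal ((real k + 1)\<^sup>2) * indicator (A \<inter> E k) \<omega>) \<partial>M)"
      unfolding first_large_def E_def[symmetric] ennreal_suminf_multc[symmetric]
      by (intro nn_integral_cong suminf_cong) (auto split: split_indicator)
    also have "\<dots> = (\<Sum>k. ennreal ((real k + 1)\<^sup>2) * emeasure M (A \<inter> E k))"
      by (simp add: nn_integral_suminf nn_integral_cmult)
    also have "\<dots> \<le> (\<Sum>k. ennreal ((real k + 1)\<^sup>2 * r ^ k * sqrt (prob A)))"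
    proof (intro suminf_le)
      fix k
      have "prob (A \<inter> E k) \<le> sqrt (prob A) * sqrt (prob (E k))"
      proof -
        have "prob (A \<inter> E k) \<le> prob A" "prob (A \<inter> E k) \<le> prob (E k)" by (auto intro!: finite_measure_mono)
        then have "(prob (A \<inter> E k))\<^sup>2 \<le> prob A * prob (E k)" unfolding power2_eq_square by (intro mult_mono) auto
        then show ?thesis by (simp add: real_le_rsqrt real_sqrt_mult[symmetric])
      qed
      moreover have "sqrt (prob (E k)) = r ^ k" unfolding E_def prob_first_large by (simp add: r_def real_sqrt_power)
      ultimately have "(real k + 1)\<^sup>2 * prob (A \<inter> E k) \<le> (real k + 1)\<^sup>2 * r ^ k * sqrt (prob A)" by (simp add: mult_ac mult_left_mono)
      then show "ennreal ((real k + 1)\<^sup>2) * emeasure M (A \<inter> E k) \<le> ennreal ((real k + 1)\<^sup>2 * r ^ k * sqrt (prob A))"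
        by (simp add: emeasure_eq_measure ennreal_mult[symmetric] ennreal_leI)
    qed auto
    also have "\<dots> = ennreal ((\<Sum>k. (real k + 1)\<^sup>2 * r ^ k) * sqrt (prob A))"
      using r by (subst suminf_ennreal2) (auto simp: suminf_mult2[OF sm] intro: summable_mult2 sm)
    finally show "(\<integral>\<^sup>+\<omega>. first_large \<omega> * indicator A \<omega> \<partial>M) \<le> ennreal ((\<Sum>k. (real k + 1)\<^sup>2 * r ^ k) * sqrt (prob A))" .
  qed
qed

text \<open>If every variable were small, all terms of the series would be at least 1 and the sum
  infinite. At the least index with a large variable the term of that index alone gives the
  bound.\<close>

lemma first_large_ge:
  assumes "first_large \<omega> < \<top>" and \<omega>: "\<omega> \<in> space M"
  obtains k where "\<bar>\<xi> k \<omega>\<bar> \<ge> 1/2" "ennreal ((real k + 1)\<^sup>2) \<le> first_large \<omega>"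
proof -
  have "\<exists>k. \<bar>\<xi> k \<omega>\<bar> \<ge> 1/2"
  proof (rule ccontr)
    assume n: "\<not> ?thesis"
    then have all: "\<bar>\<xi> k \<omega>\<bar> < 1/2" for k by (simp add: not_le)
    have "of_nat m \<le> first_large \<omega>" for m
    proof -
      have "of_nat m = (\<Sum>k<m. (1::ennreal))" by simp
      also have "\<dots> \<le> (\<Sum>k<m. ennreal ((real k + 1)\<^sup>2) * indicator {\<omega>\<in>space M. \<forall>j<k. \<bar>\<xi> j \<omega>\<bar> < 1/2} \<omega>)"
        using all \<omega> by (intro sum_mono) (simp add: one_le_power)
      also have "\<dots> \<le> first_large \<omega>" unfolding first_large_def by (intro sum_le_suminf) auto
      finally show ?thesis .
    qed
    then show False using ennreal_Ex_less_of_nat[OF assms(1)] by (metis leD)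
  qed
  then have L: "\<bar>\<xi> (LEAST k. \<bar>\<xi> k \<omega>\<bar> \<ge> 1/2) \<omega>\<bar> \<ge> 1/2" by (rule LeastI_ex)
  define k where "k = (LEAST k. \<bar>\<xi> k \<omega>\<bar> \<ge> 1/2)"
  have "\<forall>j<k. \<bar>\<xi> j \<omega>\<bar> < 1/2" unfolding k_def using not_less_Least not_le by blast
  then have "ennreal ((real k + 1)\<^sup>2) = (\<Sum>i\<in>{k}. ennreal ((real i + 1)\<^sup>2) * indicator {\<omega>\<in>space M. \<forall>j<i. \<bar>\<xi> j \<omega>\<bar> < 1/2} \<omega>)"
    using \<omega> by simp
  also have "\<dots> \<le> first_large \<omega>" unfolding first_large_def by (intro sum_le_suminf) auto
  finally show thesis using that[of k] L unfolding k_def by blast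
qed

end

section \<open>Global bounds for the number of zeros\<close>

context random_ensemble
begin

text \<open>The zeros in \<open>\<tau>\<close> inject under \<open>exp\<close> into the roots of a
  polynomial of degree at most \<open>n\<close>, which is nonzero unless all random coefficients
  vanish.\<close>

lemma poly_case:
  assumes v: "\<And>k. k > n \<Longrightarrow> v n k = 0"
  shows "(\<forall>k. w n k * \<xi> k \<omega> = 0) \<or> emeasure (count_space UNIV) {\<tau> \<in> {\<alpha>..\<beta>}. Fz n \<omega> \<tau> = 0} \<le> ennreal (real n)"
proof (cases "\<forall>k. w n k * \<xi> k \<omega> = 0")
  case False
  define p where "p = (\<Sum>k\<le>n. monom (w n k * \<xi> k \<omega>) k)"
  have w: "w n k = 0" if "k > n" for k using v[OF that] by (simp add: w_def)
  have co: "coeff p k = w n k * \<xi> k \<omega>" for k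
    using w[of k] by (auto simp: p_def coeff_sum not_le)
  have p0: "p \<noteq> 0" using False co by (metis coeff_0)
  have deg: "degree p \<le> n" by (rule degree_le) (auto simp: co w)
  have F: "Fz n \<omega> \<tau> = poly p (exp \<tau>)" for \<tau>
  proof -
    have "Fz n \<omega> \<tau> = (\<Sum>k\<le>n. w n k * exp (real k * \<tau>) * \<xi> k \<omega>)"
      unfolding Fz_def rs_def by (rule suminf_finite) (auto simp: w)
    also have "\<dots> = (\<Sum>k\<le>n. w n k * \<xi> k \<omega> * exp \<tau> ^ k)"
      by (intro sum.cong refl) (unfold exp_of_nat_mult, simp only: mult_ac)
    finally show ?thesis by (simp add: p_def poly_sum poly_monom)
  qed
  have fin: "finite {x. poly p x = 0}" using p0 by (rule poly_roots_finite)
  let ?Z = "{\<tau> \<in> {\<alpha>..\<beta>}. Fz n \<omega> \<tau> = 0}"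
  have sub: "exp ` ?Z \<subseteq> {x. poly p x = 0}" by (auto simp: F)
  have inj: "inj_on exp ?Z" by (auto simp: inj_on_def)
  have finZ: "finite ?Z" using finite_subset[OF sub fin] finite_imageD[OF _ inj] by blast
  have "card ?Z = card (exp ` ?Z)" using inj by (rule card_image[symmetric])
  also have "\<dots> \<le> card {x. poly p x = 0}" using fin sub by (rule card_mono)
  also have "\<dots> \<le> degree p" using p0 by (rule card_poly_roots_bound)
  finally have "card ?Z \<le> n" using deg by simp
  then have "(of_nat (card ?Z) :: ennreal) \<le> of_nat n" by simp
  then show ?thesis using finZ by (simp add: emeasure_count_space ennreal_of_nat_eq_real_of_nat)
qed simp

text \<open>Bounds the coefficient of the Jensen-type estimate from below in terms of
  \<open>k\<close> alone.\<close>

lemma v_ge: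
  assumes "\<sigma> \<ge> 0" "\<not> tr" "n > 0"
  shows "v n k \<ge> 1 / fact k"
proof -
  have "1 \<le> (\<Prod>j<k. real n + \<sigma> * real j)" using assms(1,3) by (intro prod_ge_1) (simp add: add_increasing2)
  then have "1 / fact k \<le> (\<Prod>j<k. real n + \<sigma> * real j) / fact k" by (rule divide_right_mono) simp
  then show ?thesis unfolding v_def uc_def using assms(2) by simp
qed

text \<open>Crude, but matched to the quadratic growth built into
  \<open>first_large\<close>.\<close>

lemma ln_fact_le: "ln (fact k) \<le> (real k)\<^sup>2"
proof (cases "k = 0")
  case False
  have "fact k \<le> real k ^ k" using fact_le_power[of k, where 'a = real] by simp
  then have "ln (fact k) \<le> ln (real k ^ k)" using False by (subst ln_le_cancel_iff) auto
  also have "\<dots> = real k * ln (real k)" using False by (simp add: ln_realpow)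
  also have "\<dots> \<le> real k * real k" using False ln_bound[of "real k"] by (intro mult_left_mono) auto
  finally show ?thesis by (simp add: power2_eq_square)
qed simp

text \<open>The absolute coefficient sum after the disc of radius \<open>exp \<gamma>\<close> is
  rescaled to the unit disc, hence a bound for the function there.\<close>

definition "Xsum \<gamma> n \<omega> = (\<Sum>k. ennreal (sqrt (v n k) * exp \<gamma> ^ k * \<bar>\<xi> k \<omega>\<bar>))"

lemma Xsum_measurable [measurable]: "Xsum \<gamma> n \<in> borel_measurable M"
  unfolding Xsum_def by measurable

text \<open>The larger radius \<open>exp \<gamma>'\<close> gives room for the arithmetic-geometric
  mean inequality: half comes from the generating function at that radius, which grows at most
  exponentially in \<open>n\<close>, and half from a geometric series.\<close>

lemma Xsum_integral:
  assumes g: "\<gamma> < \<gamma>'" "\<sigma> * exp (2 * \<gamma>') < 1"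
  shows "\<exists>K\<ge>1. \<forall>n>0. (\<integral>\<^sup>+\<omega>. Xsum \<gamma> n \<omega> \<partial>M) \<le> ennreal (exp (K * real n))"
proof -
  define r where "r = exp (2 * (\<gamma> - \<gamma>'))"
  have r: "0 < r" "r < 1" using g by (auto simp: r_def)
  define z where "z = exp (2 * \<gamma>')"
  define K where "K = Max {1, Gl \<sigma> z, 1 / (1 - r)}"
  have K: "K \<ge> 1" "Gl \<sigma> z \<le> K" "1 / (1 - r) \<le> K" by (auto simp: K_def)
  show ?thesis
  proof (intro exI[of _ K] conjI allI impI K(1))
    fix n :: nat assume n: "n > 0"
    have z: "0 \<le> z" "\<sigma> * z < 1" using g(2) by (auto simp: z_def)
    have sm: "(\<lambda>k. (v n k * z ^ k + r ^ k) / 2) sums ((S n z + 1 / (1 - r)) / 2)"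
      unfolding S_def using r by (intro sums_divide sums_add summable_sums v_summable z geometric_sums) auto
    have "(\<integral>\<^sup>+\<omega>. Xsum \<gamma> n \<omega> \<partial>M) = (\<Sum>k. \<integral>\<^sup>+\<omega>. ennreal (sqrt (v n k) * exp \<gamma> ^ k * \<bar>\<xi> k \<omega>\<bar>) \<partial>M)"
      unfolding Xsum_def by (intro nn_integral_suminf) measurable
    also have "\<dots> \<le> (\<Sum>k. ennreal ((v n k * z ^ k + r ^ k) / 2))"
    proof (intro suminf_le)
      fix k
      have "(\<integral>\<^sup>+\<omega>. ennreal (sqrt (v n k) * exp \<gamma> ^ k * \<bar>\<xi> k \<omega>\<bar>) \<partial>M)
          = ennreal (sqrt (v n k) * exp \<gamma> ^ k) * (\<integral>\<^sup>+\<omega>. ennreal \<bar>\<xi> k \<omega>\<bar> \<partial>M)"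
        using v_nonneg[of n k] by (subst nn_integral_cmult[symmetric]) (auto simp: ennreal_mult)
      also have "\<dots> \<le> ennreal (sqrt (v n k) * exp \<gamma> ^ k) * 1"
        by (intro mult_left_mono xi_abs_mean_le) auto
      also have "\<dots> = ennreal (sqrt (v n k) * exp \<gamma> ^ k)" by simp
      also have "\<dots> \<le> ennreal ((v n k * z ^ k + r ^ k) / 2)"
      proof (rule ennreal_leI)
        define A where "A = sqrt (v n k) * exp \<gamma>' ^ k"
        define B where "B = exp (\<gamma> - \<gamma>') ^ k"
        have AB: "sqrt (v n k) * exp \<gamma> ^ k = A * B" by (simp add: A_def B_def exp_diff power_divide)
        have A2: "A\<^sup>2 = v n k * z ^ k" using v_nonneg[of n k]
          unfolding A_def z_def exp_double power_mult_distrib by (simp add: power_mult[symmetric] mult.commute)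
        have B2: "B\<^sup>2 = r ^ k" unfolding B_def r_def exp_double by (simp add: power_mult[symmetric] mult.commute)
        have "0 \<le> (A - B)\<^sup>2" by simp
        then show "sqrt (v n k) * exp \<gamma> ^ k \<le> (v n k * z ^ k + r ^ k) / 2"
          unfolding AB A2[symmetric] B2[symmetric] by (simp add: power2_diff)
      qed
      finally show "(\<integral>\<^sup>+\<omega>. ennreal (sqrt (v n k) * exp \<gamma> ^ k * \<bar>\<xi> k \<omega>\<bar>) \<partial>M) \<le> ennreal ((v n k * z ^ k + r ^ k) / 2)" .
    qed auto
    also have "\<dots> = ennreal (\<Sum>k. (v n k * z ^ k + r ^ k) / 2)"
      using v_nonneg z(1) r by (intro suminf_ennreal2 sums_summable[OF sm]) auto
    also have "(\<Sum>k. (v n k * z ^ k + r ^ k) / 2) = (S n z + 1 / (1 - r)) / 2" by (rule sums_unique[OF sm, symmetric])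
    also have "\<dots> \<le> ennreal (exp (K * real n))"
    proof (rule ennreal_leI)
      have "S n z \<le> exp (real n * Gl \<sigma> z)" by (rule S_le[OF z])
      also have "\<dots> \<le> exp (K * real n)" using K(2) n by (simp add: mult.commute)
      finally have 1: "S n z \<le> exp (K * real n)" .
      have "K * 1 \<le> K * real n" using K(1) n by (intro mult_left_mono) auto
      moreover have "K * real n \<le> exp (K * real n)" using exp_ge_add_one_self[of "K * real n"] by linarith
      ultimately have "1 / (1 - r) \<le> exp (K * real n)" using K(3) by linarith
      then show "(S n z + 1 / (1 - r)) / 2 \<le> exp (K * real n)" using 1 by simp
    qed
    finally show "(\<integral>\<^sup>+\<omega>. Xsum \<gamma> n \<omega> \<partial>M) \<le> ennreal (exp (K * real n))" .
  qed
qed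

text \<open>Logarithm of \<open>coeff_bound\<close>: the number of zeros times
  \<open>L = - ln q\<close> is at most \<open>ln X - ln \<bar>c k\<bar> + k * ln 2\<close>. At the
  index supplied by \<open>first_large_ge\<close> the terms in \<open>k\<close> cost a multiple of
  \<open>(k + 1)\<^sup>2\<close>, which \<open>first_large\<close> dominates.\<close>

lemma analytic_count:
  assumes \<sigma>0: "\<sigma> \<ge> 0" "\<not> tr" and g: "\<beta> < \<gamma>" and K: "K \<ge> 1"
  shows "\<exists>C>0. \<forall>n>0. \<forall>\<omega>\<in>space M. emeasure (count_space UNIV) {\<tau> \<in> {\<alpha>..\<beta>}. Fz n \<omega> \<tau> = 0}
     \<le> ennreal C * (ennreal (real n) + Xsum \<gamma> n \<omega> * ennreal (exp (- 2 * K * real n)) + first_large \<omega>)"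
proof -
  define a0 where "a0 = exp (\<beta> - \<gamma>)"
  have a0: "0 < a0" "a0 < 1" using g by (auto simp: a0_def)
  define q where "q = sqrt (1 - (1 - a0\<^sup>2) / 3)"
  have "a0\<^sup>2 < 1" using a0 by (simp add: abs_square_less_1)
  then have "0 < sqrt (1 - (1 - b) / 3) \<and> sqrt (1 - (1 - b) / 3) < 1" if "0 \<le> b" "b < 1" for b :: real using that by simp
  from this[OF zero_le_power2 \<open>a0\<^sup>2 < 1\<close>] have q: "0 < q" "q < 1" unfolding q_def by auto
  define L where "L = - ln q"
  have L: "L > 0" using q by (simp add: L_def)
  define A where "A = 4 + \<bar>\<gamma>\<bar>"
  define C where "C = (2 * K + 1 + A) / L"
  have C: "C > 0" using K L by (simp add: C_def A_def)
  show ?thesis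
  proof (intro exI[of _ C] conjI allI impI ballI C)
    fix n :: nat and \<omega> assume n: "n > 0" and \<omega>: "\<omega> \<in> space M"
    let ?B = "ennreal C * (ennreal (real n) + Xsum \<gamma> n \<omega> * ennreal (exp (- 2 * K * real n)) + first_large \<omega>)"
    show "emeasure (count_space UNIV) {\<tau> \<in> {\<alpha>..\<beta>}. Fz n \<omega> \<tau> = 0} \<le> ?B"
    proof (cases "Xsum \<gamma> n \<omega> = \<top> \<or> first_large \<omega> = \<top>")
      case True
      then have "?B = \<top>" using C by (auto simp: ennreal_top_mult ennreal_mult_top)
      then show ?thesis by simp
    next
      case False
      obtain k where k: "\<bar>\<xi> k \<omega>\<bar> \<ge> 1/2" "ennreal ((real k + 1)\<^sup>2) \<le> first_large \<omega>"
        using first_large_ge[OF _ \<omega>] False by (auto simp: less_top)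
      define c where "c i = sqrt (v n i) * exp \<gamma> ^ i * \<xi> i \<omega>" for i
      have cabs: "\<bar>c i\<bar> = sqrt (v n i) * exp \<gamma> ^ i * \<bar>\<xi> i \<omega>\<bar>" for i using v_nonneg[of n i] by (simp add: c_def abs_mult)
      have Xc: "Xsum \<gamma> n \<omega> = (\<Sum>i. ennreal \<bar>c i\<bar>)" by (simp add: Xsum_def cabs)
      have sc: "summable (\<lambda>i. \<bar>c i\<bar>)" using False unfolding Xc by (intro summable_suminf_not_top) auto
      define X where "X = (\<Sum>i. \<bar>c i\<bar>)"
      have XX: "Xsum \<gamma> n \<omega> = ennreal X" unfolding Xc X_def using sc by (intro suminf_ennreal2) auto
      interpret real_power_series c "\<lambda>x. \<Sum>i. c i * x ^ i"
      proof
        fix x :: real assume "\<bar>x\<bar> \<le> 1"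
        then have "summable (\<lambda>i. c i * x ^ i)"
          by (intro summable_comparison_test'[OF sc]) (auto simp: abs_mult power_abs intro!: mult_left_le power_le_one)
        then show "(\<lambda>i. c i * x ^ i) sums (\<Sum>i. c i * x ^ i)" by (rule summable_sums)
      qed (rule sc)
      \<comment> \<open>Replaces \<open>ln X\<close> by \<open>2 * K * n + e\<close> via
        \<open>ln e \<le> e\<close>. This bound is linear in \<open>X\<close>, so when
        \<open>X\<close> has mean at most \<open>exp (K * n)\<close> the excess \<open>e\<close> has
        mean at most \<open>exp (- K * n)\<close>.\<close>
      define e where "e = X * exp (- 2 * K * real n)"
      show ?thesis
      proof (rule count_space_le_finite_subsets)
        fix T assume T: "finite T" "T \<subseteq> {\<tau> \<in> {\<alpha>..\<beta>}. Fz n \<omega> \<tau> = 0}"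
        \<comment> \<open>Zeros are moved into the unit disc; since
          \<open>\<tau> \<le> \<beta> < \<gamma>\<close> they lie within radius
          \<open>a0 < 1\<close>.\<close>
        define h where "h \<tau> = sg * exp (\<tau> - \<gamma>)" for \<tau>
        have inj: "inj_on h T" using sg by (auto simp: inj_on_def h_def)
        have hF: "(\<Sum>i. c i * h \<tau> ^ i) = Fz n \<omega> \<tau>" for \<tau>
          unfolding Fz_def rs_def
        proof (rule suminf_cong)
          fix i
          have "exp \<gamma> ^ i * exp (\<tau> - \<gamma>) ^ i = exp (real i * \<tau>)"
            by (simp add: exp_diff exp_of_nat_mult flip: power_mult_distrib)
          then show "c i * h \<tau> ^ i = w n i * exp (real i * \<tau>) * \<xi> i \<omega>"
            by (simp add: c_def h_def w_def power_mult_distrib mult_ac)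
        qed
        have "\<bar>c k\<bar> \<le> 2 ^ k * ((\<Sum>i. \<bar>c i\<bar>) * sqrt (1 - (1 - a0\<^sup>2) / 3) ^ card (h ` T))"
        proof (rule coeff_bound)
          fix t assume "t \<in> h ` T"
          then obtain \<tau> where \<tau>: "\<tau> \<in> T" "t = h \<tau>" by auto
          have "\<tau> \<le> \<beta>" "Fz n \<omega> \<tau> = 0" using \<tau> T by auto
          then show "(\<Sum>i. c i * t ^ i) = 0" by (simp add: \<tau>(2) hF)
          have "\<bar>sg\<bar> = 1" using sg by auto
          then show "\<bar>t\<bar> \<le> a0" using \<open>\<tau> \<le> \<beta>\<close> by (simp add: \<tau>(2) h_def a0_def abs_mult)
        qed (use T a0 in auto)
        then have main: "\<bar>c k\<bar> \<le> 2 ^ k * (X * q ^ card T)" unfolding card_image[OF inj] X_def q_def .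
        have vk: "v n k \<ge> 1 / fact k" by (rule v_ge[OF \<sigma>0 n])
        have vpos: "v n k > 0" using vk by (auto intro: less_le_trans[rotated])
        have cpos: "\<bar>c k\<bar> > 0" unfolding cabs using vpos k(1) by simp
        have "X \<noteq> 0" using main cpos by auto
        moreover have "X \<ge> 0" unfolding X_def by (intro suminf_nonneg sc) auto
        ultimately have Xpos: "X > 0" by simp
        have lnmain: "ln \<bar>c k\<bar> \<le> ln (2 ^ k * (X * q ^ card T))" using main cpos by (subst ln_le_cancel_iff) auto
        have r: "ln (2 ^ k * (X * q ^ card T)) = real k * ln 2 + ln X - real (card T) * L"
          using Xpos q by (simp add: ln_mult ln_realpow L_def)
        have l: "ln \<bar>c k\<bar> = ln (v n k) / 2 + real k * \<gamma> + ln \<bar>\<xi> k \<omega>\<bar>"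
        proof -
          have "\<bar>\<xi> k \<omega>\<bar> > 0" using k(1) by linarith
          then show ?thesis unfolding cabs using vpos by (simp add: ln_mult ln_sqrt ln_realpow)
        qed
        have "ln (1 / fact k) \<le> ln (v n k)" using vk vpos by (subst ln_le_cancel_iff) auto
        then have l1: "- (real k)\<^sup>2 \<le> ln (v n k)" using ln_fact_le[of k] by (simp add: ln_div)
        have "ln (1/2) \<le> ln \<bar>\<xi> k \<omega>\<bar>" using k(1) by (subst ln_le_cancel_iff) auto
        then have l2: "- 1 \<le> ln \<bar>\<xi> k \<omega>\<bar>" using ln_2_less_1 by (simp add: ln_div)
        have l3: "- (real k * \<bar>\<gamma>\<bar>) \<le> real k * \<gamma>"
          using mult_left_mono[of "- \<bar>\<gamma>\<bar>" \<gamma> "real k"] by simp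
        have l4: "real k * ln 2 \<le> real k" using ln_2_less_1 by (simp add: mult_left_le)
        have l5: "ln X \<le> 2 * K * real n + e"
        proof -
          have "ln e \<le> e" using Xpos ln_bound[of e] by (simp add: e_def)
          moreover have "ln e = ln X - 2 * K * real n" using Xpos by (simp add: e_def ln_mult)
          ultimately show ?thesis by linarith
        qed
        define u where "u = (real k + 1)\<^sup>2"
        have u: "(real k)\<^sup>2 \<le> u" "real k \<le> u" "1 \<le> u" by (auto simp: u_def power2_eq_square algebra_simps)
        have "real k * \<bar>\<gamma>\<bar> \<le> u * \<bar>\<gamma>\<bar>" using u(2) by (intro mult_right_mono) auto
        then have Lc: "real (card T) * L \<le> 2 * K * real n + e + u * A"
          using lnmain l1 l2 l3 l4 l5 u unfolding r l A_def distrib_left by linarith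
        have e0: "e \<ge> 0" using Xpos by (simp add: e_def)
        have u0: "u \<ge> 0" using u by linarith
        have "2 * K * real n + e + u * A \<le> (2 * K + 1 + A) * (real n + e + u)"
        proof -
          have "0 \<le> A" by (simp add: A_def)
          then have "0 \<le> 2 * K * (e + u)" "0 \<le> 1 * (real n + u)" "0 \<le> A * (real n + e)"
            using K e0 u0 by (auto intro!: mult_nonneg_nonneg)
          then show ?thesis by (simp add: algebra_simps)
        qed
        then have "real (card T) * L \<le> (2 * K + 1 + A) * (real n + e + u)" using Lc by linarith
        then have cT: "real (card T) \<le> C * (real n + e + u)" using L by (simp add: C_def pos_le_divide_eq)
        have "of_nat (card T) = ennreal (real (card T))" by (simp add: ennreal_of_nat_eq_real_of_nat)
        also have "\<dots> \<le> ennreal (C * (real n + e + u))" using cT by (rule ennreal_leI)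
        also have "\<dots> = ennreal C * (ennreal (real n) + ennreal e + ennreal u)"
          using C e0 u0 by (simp add: ennreal_mult ennreal_plus)
        also have "ennreal e = Xsum \<gamma> n \<omega> * ennreal (exp (- 2 * K * real n))"
          unfolding XX e_def using Xpos by (simp add: ennreal_mult)
        also have "ennreal C * (ennreal (real n) + Xsum \<gamma> n \<omega> * ennreal (exp (- 2 * K * real n)) + ennreal u) \<le> ?B"
          using k(2) unfolding u_def by (intro mult_left_mono add_left_mono) auto
        finally show "of_nat (card T) \<le> ?B" .
      qed
    qed
  qed
qed

lemma analytic_tail:
  assumes \<sigma>0: "\<sigma> \<ge> 0" "\<not> tr"
  shows "\<exists>B K. K > 0 \<and> (\<forall>n. B n \<in> borel_measurable M) \<and>
    (\<forall>n>0. \<forall>\<omega>\<in>space M. emeasure (count_space UNIV) {\<tau> \<in> {\<alpha>..\<beta>}. Fz n \<omega> \<tau> = 0} \<le> B n \<omega>) \<and>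
    (\<forall>n>0. \<forall>A\<in>sets M. (\<integral>\<^sup>+\<omega>. B n \<omega> * indicator A \<omega> \<partial>M) \<le> ennreal (K * (real n * prob A + sqrt (prob A) + exp (- real n))))"
proof -
  \<comment> \<open>Room to the right of \<open>\<beta>\<close>: unlimited for entire functions, and
    up to 0 in the hyperbolic case, where the disc of convergence gives
    \<open>\<beta> < 0\<close>.\<close>
  obtain \<gamma> \<gamma>' where g: "\<beta> < \<gamma>" "\<gamma> < \<gamma>'" "\<sigma> * exp (2 * \<gamma>') < 1"
  proof (cases "\<sigma> = 0")
    case True
    then show ?thesis using that[of "\<beta> + 1" "\<beta> + 2"] by simp
  next
    case False
    then have "\<sigma> = 1" using \<sigma> \<sigma>0 by auto
    then have "\<beta> < 0" using dom by simp
    then show ?thesis using that[of "\<beta> / 2" "\<beta> / 4"] \<open>\<sigma> = 1\<close> by simp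
  qed
  obtain K where K: "K \<ge> 1" "\<And>n. n > 0 \<Longrightarrow> (\<integral>\<^sup>+\<omega>. Xsum \<gamma> n \<omega> \<partial>M) \<le> ennreal (exp (K * real n))"
    using Xsum_integral[OF g(2,3)] by blast
  obtain C where C: "C > 0" and cnt: "\<And>n \<omega>. n > 0 \<Longrightarrow> \<omega> \<in> space M \<Longrightarrow> emeasure (count_space UNIV) {\<tau> \<in> {\<alpha>..\<beta>}. Fz n \<omega> \<tau> = 0}
     \<le> ennreal C * (ennreal (real n) + Xsum \<gamma> n \<omega> * ennreal (exp (- 2 * K * real n)) + first_large \<omega>)"
    using analytic_count[OF \<sigma>0 g(1) K(1)] by blast
  obtain C2 where C2: "C2 \<ge> 0" "\<And>A. A \<in> sets M \<Longrightarrow> (\<integral>\<^sup>+\<omega>. first_large \<omega> * indicator A \<omega> \<partial>M) \<le> ennreal (C2 * sqrt (prob A))"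
    using first_large_integral by blast
  define B where "B n \<omega> = ennreal C * (ennreal (real n) + Xsum \<gamma> n \<omega> * ennreal (exp (- 2 * K * real n)) + first_large \<omega>)" for n \<omega>
  have Bm: "B n \<in> borel_measurable M" for n unfolding B_def by measurable
  have "(\<integral>\<^sup>+\<omega>. B n \<omega> * indicator A \<omega> \<partial>M) \<le> ennreal (C * (1 + C2) * (real n * prob A + sqrt (prob A) + exp (- real n)))"
    if n: "n > 0" and A[measurable]: "A \<in> sets M" for n A
  proof -
    have X: "(\<integral>\<^sup>+\<omega>. Xsum \<gamma> n \<omega> * ennreal (exp (- 2 * K * real n)) * indicator A \<omega> \<partial>M) \<le> ennreal (exp (- real n))"
    proof -
      have "(\<integral>\<^sup>+\<omega>. Xsum \<gamma> n \<omega> * ennreal (exp (- 2 * K * real n)) * indicator A \<omega> \<partial>M) \<le> (\<integral>\<^sup>+\<omega>. Xsum \<gamma> n \<omega> * ennreal (exp (- 2 * K * real n)) \<partial>M)"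
        by (intro nn_integral_mono) (auto split: split_indicator)
      also have "\<dots> = (\<integral>\<^sup>+\<omega>. Xsum \<gamma> n \<omega> \<partial>M) * ennreal (exp (- 2 * K * real n))" by (rule nn_integral_multc) simp
      also have "\<dots> \<le> ennreal (exp (K * real n)) * ennreal (exp (- 2 * K * real n))" by (intro mult_right_mono K n) auto
      also have "\<dots> = ennreal (exp (- K * real n))" by (simp add: ennreal_mult[symmetric] flip: exp_add)
      also have "\<dots> \<le> ennreal (exp (- real n))"
        using K(1) mult_right_mono[of 1 K "real n"] by (intro ennreal_leI) simp
      finally show ?thesis .
    qed
    have e: "(\<integral>\<^sup>+\<omega>. ennreal C * (ennreal (real n) * indicator A \<omega> + f \<omega> + g \<omega>) \<partial>M)
        = ennreal C * (ennreal (real n) * emeasure M A + (\<integral>\<^sup>+\<omega>. f \<omega> \<partial>M) + (\<integral>\<^sup>+\<omega>. g \<omega> \<partial>M))"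
      if [measurable]: "f \<in> borel_measurable M" "g \<in> borel_measurable M" for f g
      by (simp add: nn_integral_cmult nn_integral_add)
    have "(\<integral>\<^sup>+\<omega>. B n \<omega> * indicator A \<omega> \<partial>M) = (\<integral>\<^sup>+\<omega>. ennreal C * (ennreal (real n) * indicator A \<omega> + Xsum \<gamma> n \<omega> * ennreal (exp (- 2 * K * real n)) * indicator A \<omega> + first_large \<omega> * indicator A \<omega>) \<partial>M)"
      unfolding B_def by (intro nn_integral_cong) (simp add: distrib_right mult.assoc)
    also have "\<dots> = ennreal C * (ennreal (real n) * emeasure M A + (\<integral>\<^sup>+\<omega>. Xsum \<gamma> n \<omega> * ennreal (exp (- 2 * K * real n)) * indicator A \<omega> \<partial>M) + (\<integral>\<^sup>+\<omega>. first_large \<omega> * indicator A \<omega> \<partial>M))"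
      by (rule e) measurable
    also have "\<dots> \<le> ennreal C * (ennreal (real n) * ennreal (prob A) + ennreal (exp (- real n)) + ennreal (C2 * sqrt (prob A)))"
      using X C2(2)[OF A] by (intro mult_left_mono add_mono) (auto simp: emeasure_eq_measure)
    also have "\<dots> = ennreal (C * (real n * prob A + exp (- real n) + C2 * sqrt (prob A)))"
      using C C2(1) by (simp add: ennreal_mult ennreal_plus)
    also have "\<dots> \<le> ennreal (C * (1 + C2) * (real n * prob A + sqrt (prob A) + exp (- real n)))"
    proof (rule ennreal_leI)
      have "0 \<le> C2 * (real n * prob A + exp (- real n))" "0 \<le> sqrt (prob A)" using C2(1) by auto
      then have "real n * prob A + exp (- real n) + C2 * sqrt (prob A) \<le> (1 + C2) * (real n * prob A + sqrt (prob A) + exp (- real n))"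
        by (simp add: algebra_simps)
      then show "C * (real n * prob A + exp (- real n) + C2 * sqrt (prob A)) \<le> C * (1 + C2) * (real n * prob A + sqrt (prob A) + exp (- real n))"
        using C unfolding mult.assoc by (intro mult_left_mono) auto
    qed
    finally show ?thesis .
  qed
  moreover have "C * (1 + C2) > 0" using C C2(1) by simp
  ultimately show ?thesis using Bm cnt unfolding B_def[symmetric] by blast
qed

text \<open>Polynomials (\<open>\<sigma> = -1\<close> or \<open>tr\<close>) use the degree, the
  other cases \<open>analytic_tail\<close>. The last hypothesis on \<open>N\<close> covers the event
  that all random coefficients vanish, where the degree bounds nothing.\<close>

lemma zero_count_asymptotics:
  assumes ab: "\<alpha> < \<beta>"
    and der: "\<And>\<tau>. \<alpha> \<le> \<tau> \<Longrightarrow> \<tau> \<le> \<beta> \<Longrightarrow> (\<Phi> has_real_derivative D \<tau>) (at \<tau>)"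
    and N: "eventually (\<lambda>n. AE \<omega> in M. (N n \<omega> = emeasure (count_space UNIV) {\<tau> \<in> {\<alpha>..\<beta>}. Fz n \<omega> \<tau> = 0} \<or>
        (N n \<omega> = 0 \<and> (\<forall>\<tau>\<in>{\<alpha>..\<beta>}. Fz n \<omega> \<tau> = 0))) \<and> ((\<forall>k. w n k * \<xi> k \<omega> = 0) \<longrightarrow> N n \<omega> = 0)) sequentially"
  shows "(\<lambda>n. (\<integral>\<^sup>+\<omega>. N n \<omega> \<partial>M) / ennreal (sqrt (real n))) \<longlonglongrightarrow> ennreal ((\<Phi> \<beta> - \<Phi> \<alpha>) / pi)"
proof (cases "\<sigma> \<ge> 0 \<and> \<not> tr")
  case True
  obtain B K where BK: "K > 0 \<and> (\<forall>n. B n \<in> borel_measurable M) \<and>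
    (\<forall>n>0. \<forall>\<omega>\<in>space M. emeasure (count_space UNIV) {\<tau> \<in> {\<alpha>..\<beta>}. Fz n \<omega> \<tau> = 0} \<le> B n \<omega>) \<and>
    (\<forall>n>0. \<forall>A\<in>sets M. (\<integral>\<^sup>+\<omega>. B n \<omega> * indicator A \<omega> \<partial>M) \<le> ennreal (K * (real n * prob A + sqrt (prob A) + exp (- real n))))"
    using analytic_tail[OF conjunct1[OF True] conjunct2[OF True]] by (elim exE) (rule that)
  have B: "K > 0" "\<And>n. B n \<in> borel_measurable M"
    "\<And>n \<omega>. n > 0 \<Longrightarrow> \<omega> \<in> space M \<Longrightarrow> emeasure (count_space UNIV) {\<tau> \<in> {\<alpha>..\<beta>}. Fz n \<omega> \<tau> = 0} \<le> B n \<omega>"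
    "\<And>n A. n > 0 \<Longrightarrow> A \<in> sets M \<Longrightarrow> (\<integral>\<^sup>+\<omega>. B n \<omega> * indicator A \<omega> \<partial>M) \<le> ennreal (K * (real n * prob A + sqrt (prob A) + exp (- real n)))"
    using BK by simp_all
  show ?thesis
  proof (rule zero_count_limit[OF ab der _ B(2,1)])
    show "eventually (\<lambda>n. \<forall>A\<in>sets M. (\<integral>\<^sup>+\<omega>. B n \<omega> * indicator A \<omega> \<partial>M) \<le> ennreal (K * (real n * prob A + sqrt (prob A) + exp (- real n)))) sequentially"
      using eventually_gt_at_top[of 0] by eventually_elim (use B(4) in blast)
    show "eventually (\<lambda>n. AE \<omega> in M. (N n \<omega> = emeasure (count_space UNIV) {\<tau> \<in> {\<alpha>..\<beta>}. Fz n \<omega> \<tau> = 0} \<or>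
        (N n \<omega> = 0 \<and> (\<forall>\<tau>\<in>{\<alpha>..\<beta>}. Fz n \<omega> \<tau> = 0))) \<and> N n \<omega> \<le> B n \<omega>) sequentially"
      using N eventually_gt_at_top[of 0]
    proof eventually_elim
      case (elim n)
      from elim(1) AE_space show ?case by eventually_elim (use B(3)[OF elim(2)] in auto)
    qed
  qed
next
  case False
  then have "\<sigma> = -1 \<or> tr" using \<sigma> by auto
  then have v0: "v n k = 0" if "k > n" for n k using that by (auto simp: v_def uc_binomial)
  show ?thesis
  proof (rule zero_count_limit[OF ab der, where B = "\<lambda>n \<omega>. ennreal (real n)" and K = 1])
    show "eventually (\<lambda>n. AE \<omega> in M. (N n \<omega> = emeasure (count_space UNIV) {\<tau> \<in> {\<alpha>..\<beta>}. Fz n \<omega> \<tau> = 0} \<or>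
        (N n \<omega> = 0 \<and> (\<forall>\<tau>\<in>{\<alpha>..\<beta>}. Fz n \<omega> \<tau> = 0))) \<and> N n \<omega> \<le> ennreal (real n)) sequentially"
      using N
    proof eventually_elim
      case (elim n)
      then show ?case
      proof eventually_elim
        case (elim \<omega>)
        then show ?case using poly_case[of n \<omega>, OF v0] by auto
      qed
    qed
    have "(\<integral>\<^sup>+\<omega>. ennreal (real n) * indicator A \<omega> \<partial>M) \<le> ennreal (1 * (real n * prob A + sqrt (prob A) + exp (- real n)))"
      if "A \<in> sets M" for n A
    proof -
      have "(\<integral>\<^sup>+\<omega>. ennreal (real n) * indicator A \<omega> \<partial>M) = ennreal (real n * prob A)"
        using that by (simp add: nn_integral_cmult emeasure_eq_measure ennreal_mult)
      also have "\<dots> \<le> ennreal (1 * (real n * prob A + sqrt (prob A) + exp (- real n)))" by (intro ennreal_leI) simp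
      finally show ?thesis .
    qed
    then show "eventually (\<lambda>n. \<forall>A\<in>sets M. (\<integral>\<^sup>+\<omega>. ennreal (real n) * indicator A \<omega> \<partial>M) \<le> ennreal (1 * (real n * prob A + sqrt (prob A) + exp (- real n)))) sequentially"
      by simp
  qed auto
qed

end

section \<open>Zeros of the ensembles\<close>

context random_ensemble
begin

lemma random_fun_eq_Fz:
  assumes g: "good n \<omega>" and \<tau>: "\<tau> \<le> \<beta>" and co: "\<And>k. ens_coeff E n k = sqrt (v n k)"
  shows "random_fun E \<xi> n \<omega> (complex_of_real (sg * exp \<tau>)) = complex_of_real (Fz n \<omega> \<tau>)"
proof -
  have s: "summable (\<lambda>k. w n k * exp (real k * \<tau>) * \<xi> k \<omega>)" using g \<tau> unfolding good_def by blast
  have "complex_of_real (Fz n \<omega> \<tau>) = (\<Sum>k. complex_of_real (w n k * exp (real k * \<tau>) * \<xi> k \<omega>))"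
    unfolding Fz_def rs_def by (rule suminf_of_real[OF s])
  also have "\<dots> = random_fun E \<xi> n \<omega> (complex_of_real (sg * exp \<tau>))"
    unfolding random_fun_def
  proof (rule suminf_cong)
    fix k
    have "w n k * exp (real k * \<tau>) * \<xi> k \<omega> = ens_coeff E n k * \<xi> k \<omega> * (sg * exp \<tau>) ^ k"
      unfolding co w_def exp_of_nat_mult power_mult_distrib by simp
    then show "complex_of_real (w n k * exp (real k * \<tau>) * \<xi> k \<omega>) = complex_of_real (ens_coeff E n k * \<xi> k \<omega>) * complex_of_real (sg * exp \<tau>) ^ k"
      by (simp only: of_real_mult of_real_power)
  qed
  finally show ?thesis by simp
qed

text \<open>\<open>num_real_zeros\<close> is 0 on the event of vanishing on
  \<open>ens_domain E\<close>; by \<open>dm\<close> this forces \<open>Fz\<close> to vanish on the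
  interval, which is the exceptional alternative of \<open>zero_count_asymptotics\<close>. Otherwise
  the substitution is a bijection between the two zero sets.\<close>

lemma expected_real_zeros_limit:
  fixes l r :: real
  assumes ab: "\<alpha> < \<beta>"
    and der: "\<And>\<tau>. \<alpha> \<le> \<tau> \<Longrightarrow> \<tau> \<le> \<beta> \<Longrightarrow> (\<Phi> has_real_derivative D \<tau>) (at \<tau>)"
    and co: "\<And>n k. n > 0 \<Longrightarrow> ens_coeff E n k = sqrt (v n k)"
    and dm: "\<And>\<tau>. \<tau> \<le> \<beta> \<Longrightarrow> complex_of_real (sg * exp \<tau>) \<in> ens_domain E"
    and im: "(\<lambda>\<tau>. sg * exp \<tau>) ` {\<alpha>..\<beta>} = {l..r}"
  shows "(\<lambda>n. expected_real_zeros M E \<xi> n l r / ennreal (sqrt (real n))) \<longlonglongrightarrow> ennreal ((\<Phi> \<beta> - \<Phi> \<alpha>) / pi)"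
  unfolding expected_real_zeros_def
proof (rule zero_count_asymptotics[OF ab der])
  let ?h = "\<lambda>\<tau>. sg * exp \<tau>"
  show "eventually (\<lambda>n. AE \<omega> in M. (num_real_zeros E \<xi> n l r \<omega> = emeasure (count_space UNIV) {\<tau> \<in> {\<alpha>..\<beta>}. Fz n \<omega> \<tau> = 0} \<or>
        (num_real_zeros E \<xi> n l r \<omega> = 0 \<and> (\<forall>\<tau>\<in>{\<alpha>..\<beta>}. Fz n \<omega> \<tau> = 0))) \<and> ((\<forall>k. w n k * \<xi> k \<omega> = 0) \<longrightarrow> num_real_zeros E \<xi> n l r \<omega> = 0)) sequentially"
    using eventually_good eventually_gt_at_top[of 0]
  proof eventually_elim
    case (elim n)
    note co' = co[OF elim(2)]
    from elim(1) show ?case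
    proof eventually_elim
      case (elim \<omega>)
      note rf = random_fun_eq_Fz[OF elim _ co', unfolded of_real_mult]
      have rf: "random_fun E \<xi> n \<omega> (complex_of_real (?h \<tau>)) = complex_of_real (Fz n \<omega> \<tau>)" if "\<tau> \<le> \<beta>" for \<tau>
        by (rule random_fun_eq_Fz[OF elim that co'])
      have zset: "{x \<in> {l..r}. random_fun E \<xi> n \<omega> (complex_of_real x) = 0} = ?h ` {\<tau> \<in> {\<alpha>..\<beta>}. Fz n \<omega> \<tau> = 0}"
      proof (intro equalityI subsetI)
        fix x assume x: "x \<in> {x \<in> {l..r}. random_fun E \<xi> n \<omega> (complex_of_real x) = 0}"
        then obtain \<tau> where \<tau>: "\<tau> \<in> {\<alpha>..\<beta>}" "x = ?h \<tau>" unfolding im[symmetric] by blast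
        then have "Fz n \<omega> \<tau> = 0" using x rf[of \<tau>] by (auto simp del: of_real_mult)
        then show "x \<in> ?h ` {\<tau> \<in> {\<alpha>..\<beta>}. Fz n \<omega> \<tau> = 0}" using \<tau> by blast
      next
        fix x assume "x \<in> ?h ` {\<tau> \<in> {\<alpha>..\<beta>}. Fz n \<omega> \<tau> = 0}"
        then obtain \<tau> where \<tau>: "\<tau> \<in> {\<alpha>..\<beta>}" "Fz n \<omega> \<tau> = 0" "x = ?h \<tau>" by blast
        have "x \<in> {l..r}" unfolding im[symmetric] using \<tau> by blast
        moreover have "random_fun E \<xi> n \<omega> (complex_of_real x) = 0" using rf[of \<tau>] \<tau> by (simp del: of_real_mult)
        ultimately show "x \<in> {x \<in> {l..r}. random_fun E \<xi> n \<omega> (complex_of_real x) = 0}" by blast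
      qed
      have "inj ?h" using sg by (auto simp: inj_def)
      then have inj: "inj_on ?h Z" for Z using inj_on_subset by blast
      have cnt: "emeasure (count_space UNIV) (?h ` Z) = emeasure (count_space UNIV) Z" for Z
        using card_image[OF inj[of Z]] finite_image_iff[OF inj[of Z]] by (simp add: emeasure_count_space)
      have 1: "num_real_zeros E \<xi> n l r \<omega> = emeasure (count_space UNIV) {\<tau> \<in> {\<alpha>..\<beta>}. Fz n \<omega> \<tau> = 0} \<or>
        (num_real_zeros E \<xi> n l r \<omega> = 0 \<and> (\<forall>\<tau>\<in>{\<alpha>..\<beta>}. Fz n \<omega> \<tau> = 0))"
      proof (cases "\<forall>z\<in>ens_domain E. random_fun E \<xi> n \<omega> z = 0")
        case True
        have "Fz n \<omega> \<tau> = 0" if "\<tau> \<in> {\<alpha>..\<beta>}" for \<tau>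
        proof -
          have "\<tau> \<le> \<beta>" using that by simp
          then have "complex_of_real (Fz n \<omega> \<tau>) = 0" using True dm[of \<tau>] rf[of \<tau>] by metis
          then show ?thesis by simp
        qed
        then show ?thesis using True by (simp add: num_real_zeros_def)
      next
        case False
        then show ?thesis unfolding num_real_zeros_def zset cnt if_not_P[OF False] by (intro disjI1 refl)
      qed
      have 2: "num_real_zeros E \<xi> n l r \<omega> = 0" if z: "\<forall>k. w n k * \<xi> k \<omega> = 0"
      proof -
        have "ens_coeff E n k * \<xi> k \<omega> = 0" for k using z[rule_format, of k] sg by (auto simp: w_def co')
        then have "random_fun E \<xi> n \<omega> z = 0" for z by (simp only: random_fun_def of_real_0 mult_zero_left suminf_zero)
        then show ?thesis by (simp add: num_real_zeros_def)
      qed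
      show ?case using 1 2 by blast
    qed
  qed
qed

end

text \<open>Primitive of \<open>1 / (1 - \<sigma> * x\<^sup>2)\<close>: arc length along the real
  axis in the spherical, flat and hyperbolic metric, up to normalisation.\<close>

definition curvature_primitive :: "real \<Rightarrow> real \<Rightarrow> real" where
  "curvature_primitive \<sigma> = (if \<sigma> = -1 then arctan else if \<sigma> = 0 then (\<lambda>x. x) else artanh)"

lemma curvature_primitive_deriv:
  assumes "\<sigma> \<in> {-1, 0, 1}" "\<sigma> * x\<^sup>2 < 1"
  shows "(curvature_primitive \<sigma> has_real_derivative 1 / (1 - \<sigma> * x\<^sup>2)) (at x)"
proof -
  consider "\<sigma> = -1" | "\<sigma> = 0" | "\<sigma> = 1" using assms by auto
  then show ?thesis
  proof cases
    case 1
    then show ?thesis using DERIV_arctan[of x] by (simp add: curvature_primitive_def inverse_eq_divide)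
  next
    case 2
    then show ?thesis by (simp add: curvature_primitive_def)
  next
    case 3
    then have "\<bar>x\<bar> < 1" using assms(2) by (simp add: abs_square_less_1)
    from artanh_real_has_field_derivative[OF this, of UNIV] 3 show ?thesis by (simp add: curvature_primitive_def)
  qed
qed

context iid_std
begin

lemma num_real_zeros_singleton: "num_real_zeros E \<xi> n a a \<omega> \<le> 1"
proof -
  have "emeasure (count_space UNIV) {x \<in> {a..a}. random_fun E \<xi> n \<omega> (complex_of_real x) = 0} \<le> emeasure (count_space UNIV) {a}"
    by (rule emeasure_mono) auto
  then show ?thesis by (simp add: num_real_zeros_def)
qed

text \<open>The degenerate interval is treated apart, since the grid argument divides an interval of
  positive length into cells.\<close>

lemma expected_real_zeros_singleton:
  "(\<lambda>n. expected_real_zeros M E \<xi> n a a / ennreal (sqrt (real n))) \<longlonglongrightarrow> 0"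
proof (rule tendsto_sandwich[OF _ _ tendsto_const])
  show "(\<lambda>n. ennreal (1 / sqrt (real n))) \<longlonglongrightarrow> 0"
    unfolding ennreal_0[symmetric] by (intro tendsto_ennrealI) real_asymp
  have "expected_real_zeros M E \<xi> n a a \<le> (\<integral>\<^sup>+\<omega>. 1 \<partial>M)" for n
    unfolding expected_real_zeros_def by (intro nn_integral_mono num_real_zeros_singleton)
  then have le: "expected_real_zeros M E \<xi> n a a \<le> ennreal 1" for n by (simp add: emeasure_space_1)
  show "eventually (\<lambda>n. expected_real_zeros M E \<xi> n a a / ennreal (sqrt (real n)) \<le> ennreal (1 / sqrt (real n))) sequentially"
    using eventually_gt_at_top[of 0]
  proof eventually_elim
    case (elim n)
    have "expected_real_zeros M E \<xi> n a a / ennreal (sqrt (real n)) \<le> ennreal 1 / ennreal (sqrt (real n))"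
      by (rule divide_right_mono_ennreal[OF le])
    also have "\<dots> = ennreal (1 / sqrt (real n))" using elim by (intro divide_ennreal) auto
    finally show ?case .
  qed
qed simp

lemma zeros_limit:
  assumes \<sigma>: "\<sigma> \<in> {-1, 0, 1}" and tr: "tr \<Longrightarrow> \<sigma> = 0 \<and> {a..b} \<subseteq> {-1<..<1}"
    and ab: "a \<le> b" and nz: "0 \<notin> {a..b}" and dom: "\<And>x. x \<in> {a..b} \<Longrightarrow> \<sigma> * x\<^sup>2 < 1"
    and co: "\<And>n k. n > 0 \<Longrightarrow> ens_coeff E n k = sqrt (ensemble_profile.v \<sigma> tr n k)"
    and dm: "\<And>x. \<sigma> * x\<^sup>2 < 1 \<Longrightarrow> complex_of_real x \<in> ens_domain E"
  shows "(\<lambda>n. expected_real_zeros M E \<xi> n a b / ennreal (sqrt (real n)))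
     \<longlonglongrightarrow> ennreal (1 / pi * integral {a..b} (\<lambda>t. 1 / (1 - \<sigma> * t\<^sup>2)))"
proof (cases "a = b")
  case True
  then show ?thesis using expected_real_zeros_singleton[of E b] by simp
next
  case False
  then have ab': "a < b" using ab by simp
  let ?P = "curvature_primitive \<sigma>"
  have int: "integral {a..b} (\<lambda>t. 1 / (1 - \<sigma> * t\<^sup>2)) = ?P b - ?P a"
  proof (rule integral_unique, rule fundamental_theorem_of_calculus[OF ab])
    fix x assume "x \<in> {a..b}"
    from has_field_derivative_at_within[OF curvature_primitive_deriv[OF \<sigma> dom[OF this]]]
    show "(?P has_vector_derivative 1 / (1 - \<sigma> * x\<^sup>2)) (at x within {a..b})"
      unfolding has_real_derivative_iff_has_vector_derivative .
  qed
  \<comment> \<open>As 0 is excluded, the interval lies on one half-line. On the negative one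
    \<open>\<tau>\<close> runs against \<open>x\<close>, and the factor \<open>sg\<close> in the
    primitive restores the orientation.\<close>
  obtain sg \<alpha> \<beta> :: real where s: "sg \<in> {-1, 1}" "\<alpha> < \<beta>" and im: "(\<lambda>\<tau>. sg * exp \<tau>) ` {\<alpha>..\<beta>} = {a..b}"
    and ends: "sg * ?P (sg * exp \<beta>) - sg * ?P (sg * exp \<alpha>) = ?P b - ?P a"
  proof (cases "a > 0")
    case True
    have "(\<lambda>\<tau>. 1 * exp \<tau>) ` {ln a..ln b} = {a..b}"
    proof (intro equalityI subsetI)
      fix x assume "x \<in> (\<lambda>\<tau>. 1 * exp \<tau>) ` {ln a..ln b}"
      then obtain \<tau> where \<tau>: "ln a \<le> \<tau>" "\<tau> \<le> ln b" "x = exp \<tau>" by auto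
      have "exp (ln a) \<le> exp \<tau>" "exp \<tau> \<le> exp (ln b)" using \<tau> by simp_all
      then show "x \<in> {a..b}" using \<tau>(3) True ab' by simp
    next
      fix x assume "x \<in> {a..b}"
      then show "x \<in> (\<lambda>\<tau>. 1 * exp \<tau>) ` {ln a..ln b}" using True ab' by (intro image_eqI[of _ _ "ln x"]) auto
    qed
    then show ?thesis using that[of 1 "ln a" "ln b"] True ab' by simp
  next
    case False
    then have neg: "b < 0" using nz ab' by auto
    have "(\<lambda>\<tau>. - 1 * exp \<tau>) ` {ln (-b)..ln (-a)} = {a..b}"
    proof (intro equalityI subsetI)
      fix x assume "x \<in> (\<lambda>\<tau>. - 1 * exp \<tau>) ` {ln (-b)..ln (-a)}"
      then obtain \<tau> where \<tau>: "ln (-b) \<le> \<tau>" "\<tau> \<le> ln (-a)" "x = - exp \<tau>" by auto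
      have "exp (ln (-b)) \<le> exp \<tau>" "exp \<tau> \<le> exp (ln (-a))" using \<tau> by simp_all
      then show "x \<in> {a..b}" using \<tau>(3) neg ab' by simp
    next
      fix x assume "x \<in> {a..b}"
      then show "x \<in> (\<lambda>\<tau>. - 1 * exp \<tau>) ` {ln (-b)..ln (-a)}" using neg ab' by (intro image_eqI[of _ _ "ln (-x)"]) auto
    qed
    then show ?thesis using that[of "-1" "ln (-b)" "ln (-a)"] neg ab' by simp
  qed
  have s2: "(sg * exp \<tau>)\<^sup>2 = exp (2 * \<tau>)" for \<tau> using s(1) by (auto simp: power_mult_distrib exp_double)
  have \<beta>in: "sg * exp \<beta> \<in> {a..b}" unfolding im[symmetric] using s(2) by (intro imageI) simp
  interpret random_ensemble M \<xi> \<sigma> tr sg \<alpha> \<beta>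
  proof
    show "\<sigma> * exp (2 * \<beta>) < 1" using dom[OF \<beta>in] by (simp add: s2)
    show "\<sigma> = 0 \<and> exp (2 * \<beta>) < 1" if "tr"
    proof -
      have "\<bar>sg * exp \<beta>\<bar> < 1" using tr[OF that] \<beta>in by (auto simp: abs_less_iff)
      then have "(sg * exp \<beta>)\<^sup>2 < 1" by (simp only: abs_square_less_1)
      then show ?thesis using tr[OF that] by (simp add: s2)
    qed
  qed (use \<sigma> s in auto)
  have "(\<lambda>n. expected_real_zeros M E \<xi> n a b / ennreal (sqrt (real n)))
     \<longlonglongrightarrow> ennreal ((sg * ?P (sg * exp \<beta>) - sg * ?P (sg * exp \<alpha>)) / pi)"
  proof (rule expected_real_zeros_limit[OF s(2) _ co _ im, where \<Phi> = "\<lambda>\<tau>. sg * ?P (sg * exp \<tau>)"])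
    fix \<tau> assume \<tau>: "\<tau> \<le> \<beta>"
    have z: "\<sigma> * (sg * exp \<tau>)\<^sup>2 < 1" using z_range(3)[OF \<tau>] by (simp add: s2)
    show "complex_of_real (sg * exp \<tau>) \<in> ens_domain E" by (rule dm[OF z])
    have "((\<lambda>\<tau>. sg * exp \<tau>) has_real_derivative sg * exp \<tau>) (at \<tau>)" by (auto intro!: derivative_eq_intros)
    from DERIV_cmult[OF DERIV_chain2[OF curvature_primitive_deriv[OF \<sigma> z] this], of sg]
    have d: "((\<lambda>\<tau>. sg * ?P (sg * exp \<tau>)) has_real_derivative sg * (1 / (1 - \<sigma> * (sg * exp \<tau>)\<^sup>2) * (sg * exp \<tau>))) (at \<tau>)" .
    have "sg * sg = 1" using s(1) by auto
    moreover have "sg * (1 / q * (sg * e)) = sg * sg * (e / q)" for q e :: real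
      by (simp only: times_divide_eq_left times_divide_eq_right mult_1_left mult_ac)
    ultimately have "sg * (1 / (1 - \<sigma> * (sg * exp \<tau>)\<^sup>2) * (sg * exp \<tau>)) = D \<tau>"
      unfolding s2 D_def by (simp only: mult_1_left)
    then show "((\<lambda>\<tau>. sg * ?P (sg * exp \<tau>)) has_real_derivative D \<tau>) (at \<tau>)" using d by simp
  qed
  then show ?thesis unfolding ends int by (simp add: mult.commute)
qed

end

theorem corollary1p2:
  fixes M :: "'w measure" and \<xi> :: "nat \<Rightarrow> 'w \<Rightarrow> real" and a b :: real
  assumes "prob_space M"
    and "prob_space.indep_vars M (\<lambda>_. borel) \<xi> UNIV"
    and "\<And>k. distr M borel (\<xi> k) = distr M borel (\<xi> 0)"
    and "integrable M (\<xi> 0)" and "(\<integral>\<omega>. \<xi> 0 \<omega> \<partial>M) = 0"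
    and "integrable M (\<lambda>\<omega>. (\<xi> 0 \<omega>)\<^sup>2)" and "(\<integral>\<omega>. (\<xi> 0 \<omega>)\<^sup>2 \<partial>M) = 1"
    and "a \<le> b"
  shows "({a..b} \<subseteq> UNIV - {0} \<longrightarrow>
            ((\<lambda>n. expected_real_zeros M SP \<xi> n a b / ennreal (sqrt (real n)))
               \<longlonglongrightarrow> ennreal (1 / pi * integral {a..b} (\<lambda>t. 1 / (1 + t\<^sup>2)))) \<and>
            ((\<lambda>n. expected_real_zeros M FAF \<xi> n a b / ennreal (sqrt (real n)))
               \<longlonglongrightarrow> ennreal ((b - a) / pi))) \<and>
         ({a..b} \<subseteq> {-1<..<1} - {0} \<longrightarrow>
            ((\<lambda>n. expected_real_zeros M HAF \<xi> n a b / ennreal (sqrt (real n)))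
               \<longlonglongrightarrow> ennreal (1 / pi * integral {a..b} (\<lambda>t. 1 / (1 - t\<^sup>2)))) \<and>
            ((\<lambda>n. expected_real_zeros M WP \<xi> n a b / ennreal (sqrt (real n)))
               \<longlonglongrightarrow> ennreal ((b - a) / pi)))"
proof -
  interpret prob_space M by fact
  interpret iid_std M \<xi> using assms by unfold_locales auto
  \<comment> \<open>Unfolding \<open>v\<close> requires an instance of the locale. Its value depends
    on \<open>\<sigma>\<close> and \<open>tr\<close> only among the parameters, so any admissible
    interval serves, here the point \<open>\<tau> = -1\<close>, where
    \<open>exp (- 2) < 1\<close>.\<close>
  have v: "ensemble_profile.v \<sigma> tr n k = (if tr \<and> k > n then 0 else uc \<sigma> n k)" if "\<sigma> \<in> {-1, 0}" "\<not> tr \<or> \<sigma> = 0" for \<sigma> :: real and tr n k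
  proof -
    have "(-1::real) < exp (-2)" by (rule less_trans[of _ 0]) simp_all
    then interpret P: ensemble_profile \<sigma> tr 1 "-1" "-1" by unfold_locales (use that in auto)
    show ?thesis by (rule P.v_def)
  qed
  have v1: "ensemble_profile.v 1 False n k = uc 1 n k" for n k
  proof -
    interpret P: ensemble_profile 1 False 1 "-1" "-1" by unfold_locales auto
    show ?thesis by (simp add: P.v_def)
  qed
  show ?thesis
  proof (intro conjI impI)
    assume nz: "{a..b} \<subseteq> UNIV - {0}"
    then have nz': "0 \<notin> {a..b}" by blast
    have m1: "- 1 * x\<^sup>2 < 1" for x :: real using zero_le_power2[of x] by linarith
    have "(\<lambda>n. expected_real_zeros M SP \<xi> n a b / ennreal (sqrt (real n))) \<longlonglongrightarrow> ennreal (1 / pi * integral {a..b} (\<lambda>t. 1 / (1 - (- 1) * t\<^sup>2)))"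
    proof (rule zeros_limit[where tr = False, OF _ _ assms(8) nz' m1])
      show "ens_coeff SP n k = sqrt (ensemble_profile.v (- 1) False n k)" for n k by (simp add: v uc_binomial)
    qed simp_all
    then show "(\<lambda>n. expected_real_zeros M SP \<xi> n a b / ennreal (sqrt (real n))) \<longlonglongrightarrow> ennreal (1 / pi * integral {a..b} (\<lambda>t. 1 / (1 + t\<^sup>2)))"
      by simp
    have "(\<lambda>n. expected_real_zeros M FAF \<xi> n a b / ennreal (sqrt (real n))) \<longlonglongrightarrow> ennreal (1 / pi * integral {a..b} (\<lambda>t. 1 / (1 - 0 * t\<^sup>2)))"
    proof (rule zeros_limit[where tr = False, OF _ _ assms(8) nz'])
      show "ens_coeff FAF n k = sqrt (ensemble_profile.v 0 False n k)" for n k by (simp add: v uc_exp)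
    qed simp_all
    then show "(\<lambda>n. expected_real_zeros M FAF \<xi> n a b / ennreal (sqrt (real n))) \<longlonglongrightarrow> ennreal ((b - a) / pi)"
      using assms(8) by simp
  next
    assume nz: "{a..b} \<subseteq> {-1<..<1} - {0}"
    then have nz': "0 \<notin> {a..b}" and I: "{a..b} \<subseteq> {-1<..<1}" by blast+
    have sq: "1 * x\<^sup>2 < 1" if "x \<in> {a..b}" for x
    proof -
      have "x \<in> {-1<..<1}" by (rule subsetD[OF I that])
      then have "-1 < x" "x < 1" by simp_all
      then have "\<bar>x\<bar> < 1" by linarith
      then have "x\<^sup>2 < 1" by (simp only: abs_square_less_1)
      then show ?thesis by (simp only: mult_1_left)
    qed
    have "(\<lambda>n. expected_real_zeros M HAF \<xi> n a b / ennreal (sqrt (real n))) \<longlonglongrightarrow> ennreal (1 / pi * integral {a..b} (\<lambda>t. 1 / (1 - 1 * t\<^sup>2)))"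
    proof (rule zeros_limit[where tr = False, OF _ _ assms(8) nz' sq])
      show "ens_coeff HAF n k = sqrt (ensemble_profile.v 1 False n k)" if "n > 0" for n k
        unfolding v1 uc_negbinomial[OF that] by (rule ens_coeff.simps)
      show "complex_of_real x \<in> ens_domain HAF" if "1 * x\<^sup>2 < 1" for x
        using that unfolding mult_1_left abs_square_less_1 by simp
    qed simp_all
    then show "(\<lambda>n. expected_real_zeros M HAF \<xi> n a b / ennreal (sqrt (real n))) \<longlonglongrightarrow> ennreal (1 / pi * integral {a..b} (\<lambda>t. 1 / (1 - t\<^sup>2)))"
      by simp
    have "(\<lambda>n. expected_real_zeros M WP \<xi> n a b / ennreal (sqrt (real n))) \<longlonglongrightarrow> ennreal (1 / pi * integral {a..b} (\<lambda>t. 1 / (1 - 0 * t\<^sup>2)))"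
    proof (rule zeros_limit[where tr = True, OF _ _ assms(8) nz'])
      show "ens_coeff WP n k = sqrt (ensemble_profile.v 0 True n k)" for n k by (simp add: v uc_exp)
      show "(0::real) = 0 \<and> {a..b} \<subseteq> {-1<..<1}" using I by simp
    qed simp_all
    then show "(\<lambda>n. expected_real_zeros M WP \<xi> n a b / ennreal (sqrt (real n))) \<longlonglongrightarrow> ennreal ((b - a) / pi)"
      using assms(8) by simp
  qed
qed

end
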